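(* Let $n\ge1$, let $0<s<1$ with $n>2s$, and let $\Omega\subset\mathbb R^n$ be a bounded domain with Lipschitz boundary. Then $$S_s^N(\Omega)=S_s^D(\mathbb R^n),$$ and $S_s^N(\Omega)$ is not attained on $\widetilde H^s(\Omega)$, i.e. there is no $u\in\widetilde H^s(\Omega)$, $u\neq0$, with $Q_s^N[u]=S_s^N(\Omega)\,\|u\|^2_{L_{2^*_s}(\Omega)}$.
   Context: Fourier transform: $\mathcal F u(\xi)=(2\pi)^{-n/2}\int_{\mathbb R^n}e^{-i\xi\cdot x}u(x)\,dx$. $H^s(\mathbb R^n)$ is the completion of $\mathcal C_0^\infty(\mathbb R^n)$ with respect to the norm $\|u\|_s^2=\int_{\mathbb R^n}(1+|\xi|^2)^s|\mathcal F u(\xi)|^2\,d\xi$, and $\widetilde H^s(\Omega)=\{u\in H^s(\mathbb R^n):\ \mathrm{supp}\,u\subset\overline\Omega\}$. Functions in $L_2(\Omega)$ are identified with their extensions by zero to $\mathbb R^n$. Let $\lambda_j$ and $\varphi_j$ ($j\in\mathbb N$) be the eigenvalues and the corresponding $L_2(\Omega)$-orthonormal eigenfunctions of the Dirichlet Laplacian $-\Delta$ in $\Omega$, and let $(\cdot,\cdot)$ be the scalar product in $L_2(\Omega)$. The quadratic forms of the "Navier" and "Dirichlet" fractional Laplacians are $$Q_s^N[u]=\sum_j\lambda_j^s|(u,\varphi_j)|^2,\qquad Q_s^D[u]=\int_{\mathbb R^n}|\xi|^{2s}|\mathcal F u(\xi)|^2\,d\xi;$$ both are finite on $\widetilde H^s(\Omega)$.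 Put $2^*_s=\dfrac{2n}{n-2s}$; one has the Sobolev embedding $\widetilde H^s(\Omega)\hookrightarrow L_{2^*_s}(\Omega)$. The Sobolev constants are $$S_s^N(\Omega)=\inf_{u\in\widetilde H^s(\Omega),\,u\ne0}\frac{Q_s^N[u]}{\|u\|^2_{L_{2^*_s}(\Omega)}},\qquad S_s^D(\mathbb R^n)=\inf_{u\in H^s(\mathbb R^n),\,u\neq0}\frac{Q_s^D[u]}{\|u\|^2_{L_{2^*_s}(\mathbb R^n)}} .$$ *)

theory Defs
  imports "HOL-Analysis.Analysis"
begin

text \<open>
  The space \<open>\<real>\<^sup>n\<close> is a type \<open>'a :: euclidean_space\<close> with \<open>n = DIM('a)\<close>.  Functions are
  complex-valued and Borel measurable; elements of \<open>L\<^sub>2\<close> and \<open>H\<^sup>s\<close> are represented by functions, so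
  ``\<open>u = 0\<close>'' means that \<open>u\<close> vanishes almost everywhere.
\<close>

subsection \<open>Test functions\<close>

primrec Ck :: "nat \<Rightarrow> ('a::euclidean_space \<Rightarrow> complex) \<Rightarrow> bool" where
  "Ck 0 f \<longleftrightarrow> continuous_on UNIV f"
| "Ck (Suc k) f \<longleftrightarrow> (\<forall>x. f differentiable at x) \<and>
     (\<forall>b\<in>Basis. Ck k (\<lambda>x. frechet_derivative f (at x) b))"

definition test_fun :: "'a::euclidean_space set \<Rightarrow> ('a \<Rightarrow> complex) \<Rightarrow> bool" where
  "test_fun \<Omega> f \<longleftrightarrow> (\<forall>k. Ck k f) \<and> (\<exists>K. compact K \<and> K \<subseteq> \<Omega> \<and> (\<forall>x. x \<notin> K \<longrightarrow> f x = 0))"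

definition laplacian :: "('a::euclidean_space \<Rightarrow> complex) \<Rightarrow> 'a \<Rightarrow> complex" where
  "laplacian f x = (\<Sum>b\<in>Basis. frechet_derivative (\<lambda>y. frechet_derivative f (at y) b) (at x) b)"

subsection \<open>Square-integrable functions and the Fourier transform\<close>

definition L2 :: "('a::euclidean_space \<Rightarrow> complex) \<Rightarrow> bool" where
  "L2 u \<longleftrightarrow> u \<in> borel_measurable lborel \<and> integrable lborel (\<lambda>x. (norm (u x))\<^sup>2)"

definition L2_tendsto :: "(nat \<Rightarrow> 'a::euclidean_space \<Rightarrow> complex) \<Rightarrow> ('a \<Rightarrow> complex) \<Rightarrow> bool" where
  "L2_tendsto f u \<longleftrightarrow>
     (\<lambda>k. \<integral>\<^sup>+ x. ennreal ((norm (f k x - u x))\<^sup>2) \<partial>lborel) \<longlonglongrightarrow> 0"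

definition L2_inner ::
  "'a::euclidean_space set \<Rightarrow> ('a \<Rightarrow> complex) \<Rightarrow> ('a \<Rightarrow> complex) \<Rightarrow> complex" where
  "L2_inner \<Omega> u v = (LINT x:\<Omega>|lborel. u x * cnj (v x))"

definition Lp_norm :: "real \<Rightarrow> 'a::euclidean_space set \<Rightarrow> ('a \<Rightarrow> complex) \<Rightarrow> real" where
  "Lp_norm p \<Omega> u = (LINT x:\<Omega>|lborel. norm (u x) powr p) powr (1 / p)"

definition fourier :: "('a::euclidean_space \<Rightarrow> complex) \<Rightarrow> 'a \<Rightarrow> complex" where
  "fourier u \<xi> = of_real ((2 * pi) powr (- real DIM('a) / 2)) *
     (LINT x|lborel. exp (- \<i> * of_real (\<xi> \<bullet> x)) * u x)"

text \<open>
  The integral above need not exist for \<open>u\<close> in \<open>L\<^sub>2\<close>.  The Fourier--Plancherel transform is the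
  \<open>L\<^sub>2\<close>-limit of the transforms of the truncations of \<open>u\<close> to balls; it is determined up to a null
  set, and agrees almost everywhere with \<open>fourier u\<close> when \<open>u\<close> is also integrable.
\<close>

definition fourier_L2 :: "('a::euclidean_space \<Rightarrow> complex) \<Rightarrow> 'a \<Rightarrow> complex" where
  "fourier_L2 u = (SOME v. L2 v \<and>
     L2_tendsto (\<lambda>k. fourier (\<lambda>x. if norm x \<le> real k then u x else 0)) v)"

subsection \<open>Sobolev spaces\<close>

definition Hs_norm_sq :: "real \<Rightarrow> ('a::euclidean_space \<Rightarrow> complex) \<Rightarrow> ennreal" where
  "Hs_norm_sq s u =
     (\<integral>\<^sup>+ \<xi>. ennreal ((1 + (norm \<xi>)\<^sup>2) powr s * (norm (fourier u \<xi>))\<^sup>2) \<partial>lborel)"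

text \<open>
  For \<open>s \<ge> 0\<close> the norm \<open>\<parallel>\<cdot>\<parallel>\<^sub>s\<close> dominates the \<open>L\<^sub>2\<close> norm and the completion of the test functions
  embeds into \<open>L\<^sub>2\<close>: its elements are the \<open>L\<^sub>2\<close>-limits of \<open>\<parallel>\<cdot>\<parallel>\<^sub>s\<close>-Cauchy sequences.
  For \<open>\<Omega> = UNIV\<close> this is \<open>H\<^sup>s(\<real>\<^sup>n)\<close>; for \<open>s = 1\<close> and open \<open>\<Omega>\<close> it is \<open>H\<^sup>1\<^sub>0(\<Omega>)\<close>, with functions
  extended by zero.
\<close>

definition Hs_completion :: "real \<Rightarrow> 'a::euclidean_space set \<Rightarrow> ('a \<Rightarrow> complex) set" where
  "Hs_completion s \<Omega> = {u. L2 u \<and> (\<exists>f :: nat \<Rightarrow> 'a \<Rightarrow> complex.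
     (\<forall>k. test_fun \<Omega> (f k)) \<and>
     (\<forall>e>0. \<exists>N. \<forall>i\<ge>N. \<forall>j\<ge>N. Hs_norm_sq s (\<lambda>x. f i x - f j x) < e) \<and>
     L2_tendsto f u)}"

definition Hs :: "real \<Rightarrow> ('a::euclidean_space \<Rightarrow> complex) set" where
  "Hs s = Hs_completion s UNIV"

definition H10 :: "'a::euclidean_space set \<Rightarrow> ('a \<Rightarrow> complex) set" where
  "H10 \<Omega> = Hs_completion 1 \<Omega>"

text \<open>The support of a function class: the complement of the largest open set on which it vanishes.\<close>

definition ess_support :: "('a::euclidean_space \<Rightarrow> complex) \<Rightarrow> 'a set" where
  "ess_support u = - \<Union>{U. open U \<and> (AE x in lborel. x \<in> U \<longrightarrow> u x = 0)}"

definition Hs_tilde :: "real \<Rightarrow> 'a::euclidean_space set \<Rightarrow> ('a \<Rightarrow> complex) set" where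
  "Hs_tilde s \<Omega> = {u \<in> Hs s. ess_support u \<subseteq> closure \<Omega>}"

definition ae_zero :: "('a::euclidean_space \<Rightarrow> complex) \<Rightarrow> bool" where
  "ae_zero u \<longleftrightarrow> (AE x in lborel. u x = 0)"

subsection \<open>Bounded Lipschitz domains\<close>

text \<open>
  Near each boundary point \<open>p\<close>, in Cartesian coordinates whose last axis is the unit vector \<open>e\<close>,
  \<open>\<Omega>\<close> is the region above the graph of a Lipschitz function \<open>g\<close> on the hyperplane orthogonal
  to \<open>e\<close>.
\<close>

definition lipschitz_boundary :: "'a::euclidean_space set \<Rightarrow> bool" where
  "lipschitz_boundary \<Omega> \<longleftrightarrow> (\<forall>p\<in>frontier \<Omega>. \<exists>e r L g.
     norm e = 1 \<and> r > 0 \<and> L-lipschitz_on {y. y \<bullet> e = 0} g \<and>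
     (\<forall>x\<in>ball p r. x \<in> \<Omega> \<longleftrightarrow> g (x - (x \<bullet> e) *\<^sub>R e) < x \<bullet> e))"

definition bounded_lipschitz_domain :: "'a::euclidean_space set \<Rightarrow> bool" where
  "bounded_lipschitz_domain \<Omega> \<longleftrightarrow>
     open \<Omega> \<and> connected \<Omega> \<and> \<Omega> \<noteq> {} \<and> bounded \<Omega> \<and> lipschitz_boundary \<Omega>"

subsection \<open>Spectrum of the Dirichlet Laplacian\<close>

text \<open>
  The Dirichlet Laplacian is the distributional \<open>-\<Delta>\<close> with domain
  \<open>{u \<in> H\<^sup>1\<^sub>0(\<Omega>). \<Delta>u \<in> L\<^sub>2(\<Omega>)}\<close>, so \<open>u\<close> is an eigenfunction iff \<open>u \<in> H\<^sup>1\<^sub>0(\<Omega>)\<close> is nonzero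
  and \<open>-\<Delta>u = \<mu> u\<close> holds in the sense of distributions in \<open>\<Omega>\<close>.
\<close>

definition dirichlet_eigenfunction ::
  "'a::euclidean_space set \<Rightarrow> real \<Rightarrow> ('a \<Rightarrow> complex) \<Rightarrow> bool" where
  "dirichlet_eigenfunction \<Omega> \<mu> u \<longleftrightarrow> u \<in> H10 \<Omega> \<and> \<not> ae_zero u \<and>
     (\<forall>v. test_fun \<Omega> v \<longrightarrow>
        - (LINT x:\<Omega>|lborel. u x * laplacian v x) = of_real \<mu> * (LINT x:\<Omega>|lborel. u x * v x))"

text \<open>
  The last condition says that the list of eigenvalues is exhaustive, with multiplicities: no
  eigenfunction is orthogonal to all the listed ones.  The order of the list is immaterial.
\<close>

definition dirichlet_eigensystem ::
  "'a::euclidean_space set \<Rightarrow> (nat \<Rightarrow> real) \<Rightarrow> (nat \<Rightarrow> 'a \<Rightarrow> complex) \<Rightarrow> bool" where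
  "dirichlet_eigensystem \<Omega> \<mu> \<phi> \<longleftrightarrow>
     (\<forall>j. dirichlet_eigenfunction \<Omega> (\<mu> j) (\<phi> j)) \<and>
     (\<forall>i j. L2_inner \<Omega> (\<phi> i) (\<phi> j) = (if i = j then 1 else 0)) \<and>
     (\<forall>\<nu> \<psi>. dirichlet_eigenfunction \<Omega> \<nu> \<psi> \<longrightarrow> (\<exists>j. L2_inner \<Omega> \<psi> (\<phi> j) \<noteq> 0))"

subsection \<open>Quadratic forms and Sobolev constants\<close>

text \<open>
  The forms take values in \<open>[0,\<infinity>]\<close>, so that no convention for divergent sums or integrals is
  involved.  The \<open>L\<^sub>p\<close> norm in the quotients is finite by the Sobolev embedding, and nonzero.
\<close>

definition Q_Navier ::
  "real \<Rightarrow> 'a::euclidean_space set \<Rightarrow> (nat \<Rightarrow> real) \<Rightarrow> (nat \<Rightarrow> 'a \<Rightarrow> complex) \<Rightarrow>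
   ('a \<Rightarrow> complex) \<Rightarrow> ennreal" where
  "Q_Navier s \<Omega> \<mu> \<phi> u = (\<Sum>j. ennreal (\<mu> j powr s * (norm (L2_inner \<Omega> u (\<phi> j)))\<^sup>2))"

definition Q_Dirichlet :: "real \<Rightarrow> ('a::euclidean_space \<Rightarrow> complex) \<Rightarrow> ennreal" where
  "Q_Dirichlet s u =
     (\<integral>\<^sup>+ \<xi>. ennreal (norm \<xi> powr (2 * s) * (norm (fourier_L2 u \<xi>))\<^sup>2) \<partial>lborel)"

definition crit_exp :: "nat \<Rightarrow> real \<Rightarrow> real" where
  "crit_exp n s = 2 * real n / (real n - 2 * s)"

definition S_Navier ::
  "real \<Rightarrow> 'a::euclidean_space set \<Rightarrow> (nat \<Rightarrow> real) \<Rightarrow> (nat \<Rightarrow> 'a \<Rightarrow> complex) \<Rightarrow> ennreal" where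
  "S_Navier s \<Omega> \<mu> \<phi> = (INF u\<in>{u \<in> Hs_tilde s \<Omega>. \<not> ae_zero u}.
     Q_Navier s \<Omega> \<mu> \<phi> u / ennreal ((Lp_norm (crit_exp DIM('a) s) \<Omega> u)\<^sup>2))"

definition S_Dirichlet :: "'a::euclidean_space itself \<Rightarrow> real \<Rightarrow> ennreal" where
  "S_Dirichlet _ s = (INF u\<in>{u :: 'a \<Rightarrow> complex. u \<in> Hs s \<and> \<not> ae_zero u}.
     Q_Dirichlet s u / ennreal ((Lp_norm (crit_exp DIM('a) s) UNIV u)\<^sup>2))"

end

theory Submission
  imports Defs "HOL-Probability.Probability" "HOL-Complex_Analysis.Complex_Analysis"
begin

text \<open>
  For \<open>0 < s < 1\<close> one has \<open>C\<^sub>s \<lambda>\<^sup>s = \<integral>\<^sub>0\<^sup>\<infinity> t\<^sup>s\<^sup>-\<^sup>1 \<lambda> / (\<lambda> + t) dt\<close>, so both forms are integrals over \<open>t\<close> of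
  resolvent forms, and these are minima: each equals the minimum of \<open>\<parallel>u - w\<parallel>\<^sup>2 + \<parallel>\<nabla>w\<parallel>\<^sup>2 / t\<close>, over
  \<open>w \<in> H\<^sup>1\<^sub>0(\<Omega>)\<close> for the Navier form and over \<open>w \<in> H\<^sup>1(\<real>\<^sup>n)\<close> for the Dirichlet form.  Hence
  \<open>Q\<^sup>D \<le> Q\<^sup>N\<close>.  If equality holds for some \<open>u\<close>, then for almost every \<open>t\<close> the minimiser \<open>w\<close> over the whole
  space vanishes outside \<open>\<Omega>\<close>.  Then \<open>(|\<xi>|\<^sup>2 + t) \<F>w = t \<F>u\<close> is an identity between entire functions,
  so \<open>\<F>u\<close> vanishes where \<open>\<xi> \<bullet> \<xi> = - t\<close>, and thus \<open>u = 0\<close>; so the infimum is not attained.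
  Conversely, a test function on \<open>\<real>\<^sup>n\<close> is shrunk to a point of \<open>\<Omega>\<close>: after rescaling, its Navier
  resolvent forms are asymptotically at most the Dirichlet ones, and a reverse Fatou argument in \<open>t\<close>
  gives the same for the fractional forms.  The Sobolev embedding is not needed.
\<close>

section \<open>Square-integrable functions\<close>

text \<open>An eigensystem is only assumed to leave no eigenfunction orthogonal to all
  \<open>\<phi> j\<close>. That the \<open>\<phi> j\<close> span the square-integrable functions on
  \<Omega>, on which the Navier form depends, has to be derived: a Rayleigh quotient is minimised,
  with compactness from Rellich's theorem. Energies are handled on the frequency side, where the
  gradient acts by multiplication and \<open>H10 \<Omega>\<close> becomes a closed subspace of a
  weighted mean-square space. The Lipschitz boundary enters through one fact: it is locally a
  Lipschitz graph, hence a null set, so a function supported in the closure of \<Omega> vanishes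
  almost everywhere off \<Omega> and can be expanded in the \<open>\<phi> j\<close>. In the equality
  case one value of t yields zeros only at one imaginary height; as t tends to 0 the zeros \<i> sqrt
  t accumulate at the origin of every complex line, and this forces the transform to vanish. In the
  other direction the constant enters as an inequality between a multiple of the squared norm and
  the form, for test functions; Fatou's lemma carries it over to \<open>Hs s\<close>.\<close>

definition sqi :: "'b measure \<Rightarrow> ('b \<Rightarrow> complex) \<Rightarrow> bool" where
  "sqi M f \<longleftrightarrow> f \<in> borel_measurable M \<and> integrable M (\<lambda>x. (norm (f x))\<^sup>2)"

text \<open>The measure is a parameter because the same Hilbert space facts serve Lebesgue measure
  and the weighted measures \<open>wl w\<close> on the frequency side.\<close>

definition ip :: "'b measure \<Rightarrow> ('b \<Rightarrow> complex) \<Rightarrow> ('b \<Rightarrow> complex) \<Rightarrow> complex" where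
  "ip M f g = (LINT x|M. f x * cnj (g x))"

definition nsq :: "'b measure \<Rightarrow> ('b \<Rightarrow> complex) \<Rightarrow> real" where
  "nsq M f = (LINT x|M. (norm (f x))\<^sup>2)"

lemma borel_measurable_cnj [measurable]:
  "f \<in> borel_measurable M \<Longrightarrow> (\<lambda>x. cnj (f x)) \<in> borel_measurable M"
  by (rule measurable_compose[OF _ borel_measurable_continuous_onI]) (auto intro: continuous_intros)

lemma L2_iff_sqi: "L2 u \<longleftrightarrow> sqi lborel u"
  by (simp add: L2_def sqi_def)

lemma sqi_measurable [measurable_dest]: "sqi M f \<Longrightarrow> f \<in> borel_measurable M"
  by (simp add: sqi_def)

lemma sqi_integrable: "sqi M f \<Longrightarrow> integrable M (\<lambda>x. (norm (f x))\<^sup>2)"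
  by (simp add: sqi_def)

lemma sqi_bound:
  assumes "f \<in> borel_measurable M" "integrable M g" "AE x in M. (norm (f x))\<^sup>2 \<le> g x"
  shows "sqi M f"
  unfolding sqi_def
proof (intro conjI Bochner_Integration.integrable_bound[OF assms(2)])
  show "AE x in M. norm ((norm (f x))\<^sup>2) \<le> norm (g x)"
    using assms(3) by eventually_elim (auto intro: order_trans abs_ge_self)
qed (use assms in auto)

lemma norm_add_sq_le: "(norm (a + b :: complex))\<^sup>2 \<le> 2 * (norm a)\<^sup>2 + 2 * (norm b)\<^sup>2"
proof -
  have "(norm (a + b))\<^sup>2 \<le> (norm a + norm b)\<^sup>2"
    by (simp add: norm_triangle_ineq power_mono)
  also have "\<dots> \<le> 2 * (norm a)\<^sup>2 + 2 * (norm b)\<^sup>2"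
    using zero_le_power2[of "norm a - norm b"] by (simp add: power2_eq_square algebra_simps)
  finally show ?thesis .
qed

lemma sqi_scale: "sqi M f \<Longrightarrow> sqi M (\<lambda>x. c * f x)"
  by (auto simp: sqi_def norm_mult power_mult_distrib)

lemma sqi_add: "sqi M f \<Longrightarrow> sqi M g \<Longrightarrow> sqi M (\<lambda>x. f x + g x)"
  by (rule sqi_bound[where g = "\<lambda>x. 2 * (norm (f x))\<^sup>2 + 2 * (norm (g x))\<^sup>2"])
     (auto simp: sqi_def norm_add_sq_le)

lemma sqi_diff: "sqi M f \<Longrightarrow> sqi M g \<Longrightarrow> sqi M (\<lambda>x. f x - g x)"
  using sqi_add[of M f "\<lambda>x. (-1) * g x"] sqi_scale[of M g "-1"] by simp

lemma sqi_zero [simp]: "sqi M (\<lambda>x. 0)"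
  by (simp add: sqi_def)

lemma sqi_sum: "(\<And>i. i \<in> I \<Longrightarrow> sqi M (f i)) \<Longrightarrow> sqi M (\<lambda>x. \<Sum>i\<in>I. f i x)"
  by (induction I rule: infinite_finite_induct) (auto intro: sqi_add)

lemma sqi_cong_AE:
  assumes "sqi M f" "g \<in> borel_measurable M" "AE x in M. f x = g x"
  shows "sqi M g"
  by (rule sqi_bound[where g = "\<lambda>x. (norm (f x))\<^sup>2"]) (use assms in \<open>auto simp: sqi_def\<close>)

lemma integrable_sqi_mult:
  assumes "sqi M f" "sqi M g"
  shows "integrable M (\<lambda>x. f x * cnj (g x))"
proof (rule Bochner_Integration.integrable_bound)
  show "integrable M (\<lambda>x. (norm (f x))\<^sup>2 + (norm (g x))\<^sup>2)"
    using assms by (auto simp: sqi_def)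
  have "norm (f x * cnj (g x)) \<le> (norm (f x))\<^sup>2 + (norm (g x))\<^sup>2" for x
  proof -
    have "2 * (norm (f x) * norm (g x)) \<le> (norm (f x))\<^sup>2 + (norm (g x))\<^sup>2"
      using sum_squares_bound[of "norm (f x)" "norm (g x)"] by (simp add: mult.assoc)
    moreover have "0 \<le> norm (f x) * norm (g x)" by simp
    ultimately show ?thesis by (simp only: norm_mult complex_mod_cnj)
  qed
  then show "AE x in M. norm (f x * cnj (g x)) \<le> norm ((norm (f x))\<^sup>2 + (norm (g x))\<^sup>2)"
    by (intro AE_I2) (simp only: real_norm_def abs_of_nonneg add_nonneg_nonneg zero_le_power2)
qed (use assms in \<open>auto simp: sqi_def\<close>)

lemma ip_add_left: "sqi M f \<Longrightarrow> sqi M g \<Longrightarrow> sqi M h \<Longrightarrow>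
    ip M (\<lambda>x. f x + g x) h = ip M f h + ip M g h"
  unfolding ip_def by (subst Bochner_Integration.integral_add[symmetric])
    (auto simp: integrable_sqi_mult algebra_simps)

lemma ip_diff_left: "sqi M f \<Longrightarrow> sqi M g \<Longrightarrow> sqi M h \<Longrightarrow>
    ip M (\<lambda>x. f x - g x) h = ip M f h - ip M g h"
  unfolding ip_def by (subst Bochner_Integration.integral_diff[symmetric])
    (auto simp: integrable_sqi_mult algebra_simps)

lemma ip_scale_left: "ip M (\<lambda>x. c * f x) h = c * ip M f h"
  unfolding ip_def by (simp add: mult.assoc)

lemma ip_commute: "ip M f g = cnj (ip M g f)"
proof -
  have "ip M f g = (LINT x|M. cnj (g x * cnj (f x)))" by (simp add: ip_def mult.commute)
  also have "\<dots> = cnj (ip M g f)" unfolding ip_def by (rule Bochner_Integration.integral_cnj)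
  finally show ?thesis .
qed

lemma ip_add_right: "sqi M f \<Longrightarrow> sqi M g \<Longrightarrow> sqi M h \<Longrightarrow>
    ip M h (\<lambda>x. f x + g x) = ip M h f + ip M h g"
  by (simp add: ip_add_left ip_commute[of M h])

lemma ip_diff_right: "sqi M f \<Longrightarrow> sqi M g \<Longrightarrow> sqi M h \<Longrightarrow>
    ip M h (\<lambda>x. f x - g x) = ip M h f - ip M h g"
  by (simp add: ip_diff_left ip_commute[of M h])

lemma ip_scale_right: "ip M h (\<lambda>x. c * f x) = cnj c * ip M h f"
  by (simp add: ip_scale_left ip_commute[of M h])

lemma ip_sum_left:
  assumes "\<And>i. i \<in> I \<Longrightarrow> sqi M (f i)" "sqi M h"
  shows "ip M (\<lambda>x. \<Sum>i\<in>I. f i x) h = (\<Sum>i\<in>I. ip M (f i) h)"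
  unfolding ip_def sum_distrib_right
  by (rule Bochner_Integration.integral_sum) (use assms in \<open>auto intro: integrable_sqi_mult\<close>)

lemma ip_sum_right:
  assumes "\<And>i. i \<in> I \<Longrightarrow> sqi M (f i)" "sqi M h"
  shows "ip M h (\<lambda>x. \<Sum>i\<in>I. f i x) = (\<Sum>i\<in>I. ip M h (f i))"
  using assms by (simp add: ip_sum_left ip_commute[of M h])

lemma ip_self: "ip M f f = of_real (nsq M f)"
proof -
  have "ip M f f = (LINT x|M. complex_of_real ((norm (f x))\<^sup>2))"
    unfolding ip_def by (simp only: complex_norm_square)
  then show ?thesis unfolding nsq_def by (simp only: integral_complex_of_real)
qed

lemma nsq_eq_Re: "nsq M f = Re (ip M f f)"
  by (simp add: ip_self)

lemma nsq_nonneg [simp]: "0 \<le> nsq M f"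
  by (simp add: nsq_def)

lemma nsq_zero [simp]: "nsq M (\<lambda>x. 0) = 0"
  by (simp add: nsq_def)

lemma nsq_scale: "nsq M (\<lambda>x. c * f x) = (norm c)\<^sup>2 * nsq M f"
  by (simp add: nsq_def norm_mult power_mult_distrib)

lemma nsq_minus_commute: "nsq M (\<lambda>x. f x - g x) = nsq M (\<lambda>x. g x - f x)"
  by (simp add: nsq_def norm_minus_commute)

lemma nsq_add: "sqi M f \<Longrightarrow> sqi M g \<Longrightarrow>
    nsq M (\<lambda>x. f x + g x) = nsq M f + nsq M g + 2 * Re (ip M f g)"
  unfolding nsq_eq_Re
  by (simp add: ip_add_left ip_add_right sqi_add) (subst (2) ip_commute, simp)

lemma nsq_diff: "sqi M f \<Longrightarrow> sqi M g \<Longrightarrow>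
    nsq M (\<lambda>x. f x - g x) = nsq M f + nsq M g - 2 * Re (ip M f g)"
  unfolding nsq_eq_Re
  by (simp add: ip_diff_left ip_diff_right sqi_diff) (subst (2) ip_commute, simp)

lemma nsq_cong_AE:
  assumes "f \<in> borel_measurable M" "g \<in> borel_measurable M" "AE x in M. f x = g x"
  shows "nsq M f = nsq M g"
  unfolding nsq_def by (rule integral_cong_AE) (use assms in auto)

lemma ip_cong_AE:
  assumes "f \<in> borel_measurable M" "f' \<in> borel_measurable M" "AE x in M. f x = f' x"
    and "g \<in> borel_measurable M" "g' \<in> borel_measurable M" "AE x in M. g x = g' x"
  shows "ip M f g = ip M f' g'"
  unfolding ip_def by (rule integral_cong_AE) (use assms in auto)

lemma nsq_eq_0_iff:
  assumes "sqi M f" shows "nsq M f = 0 \<longleftrightarrow> (AE x in M. f x = 0)"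
  unfolding nsq_def
  by (subst integral_nonneg_eq_0_iff_AE) (use assms in \<open>auto simp: sqi_def\<close>)

lemma nn_integral_norm_sq: "sqi M f \<Longrightarrow> (\<integral>\<^sup>+ x. ennreal ((norm (f x))\<^sup>2) \<partial>M) = ennreal (nsq M f)"
  unfolding nsq_def by (rule nn_integral_eq_integral) (auto simp: sqi_def)

lemma Cauchy_Schwarz_ip:
  assumes f: "sqi M f" and g: "sqi M g"
  shows "norm (ip M f g) \<le> sqrt (nsq M f) * sqrt (nsq M g)"
proof (cases "nsq M g = 0")
  case True
  then have "AE x in M. g x = 0" using g by (simp add: nsq_eq_0_iff)
  then have "ip M f g = ip M f (\<lambda>x. 0)"
    by (intro ip_cong_AE) (use f g in \<open>auto simp: sqi_def\<close>)
  then show ?thesis by (simp add: ip_def True)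
next
  case False
  define G where "G = nsq M g"
  have G: "G > 0" using False nsq_nonneg[of M g] unfolding G_def by linarith
  define c where "c = ip M f g / of_real G"
  have "0 \<le> nsq M (\<lambda>x. f x - c * g x)" by simp
  also have "\<dots> = nsq M f + (norm c)\<^sup>2 * G - 2 * Re (cnj c * ip M f g)"
    using f g by (subst nsq_diff) (auto simp: sqi_scale nsq_scale ip_scale_right G_def)
  also have "Re (cnj c * ip M f g) = (norm (ip M f g))\<^sup>2 / G"
    unfolding c_def by (simp add: cmod_power2) (simp add: power2_eq_square)
  also have "(norm c)\<^sup>2 * G = (norm (ip M f g))\<^sup>2 / G"
    using G unfolding c_def by (simp add: norm_divide power_divide) (simp add: power2_eq_square)
  finally have "(norm (ip M f g))\<^sup>2 \<le> nsq M f * nsq M g"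
    using G unfolding G_def[symmetric] by (simp add: field_simps)
  then show ?thesis
    by (metis abs_norm_cancel real_sqrt_abs real_sqrt_le_mono real_sqrt_mult)
qed

text \<open>The parallelogram law with the square of the difference dropped.\<close>

lemma nsq_add_le:
  assumes "sqi M f" "sqi M g"
  shows "nsq M (\<lambda>x. f x + g x) \<le> 2 * nsq M f + 2 * nsq M g"
proof -
  have "0 \<le> nsq M (\<lambda>x. f x - g x)" by simp
  then show ?thesis using assms by (simp add: nsq_diff nsq_add)
qed

lemma nsq_diff_le:
  assumes "sqi M f" "sqi M g" "sqi M h"
  shows "nsq M (\<lambda>x. f x - h x) \<le> 2 * nsq M (\<lambda>x. f x - g x) + 2 * nsq M (\<lambda>x. g x - h x)"
  using nsq_add_le[of M "\<lambda>x. f x - g x" "\<lambda>x. g x - h x"] assms by (simp add: sqi_diff)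

text \<open>Square-integrability is bundled in because \<open>nsq\<close> of a function that is not
  square-integrable is 0 by the convention for integrals; convergence of the numbers alone would
  then say nothing.\<close>

definition sqlim :: "'b measure \<Rightarrow> (nat \<Rightarrow> 'b \<Rightarrow> complex) \<Rightarrow> ('b \<Rightarrow> complex) \<Rightarrow> bool" where
  "sqlim M f g \<longleftrightarrow> (\<forall>i. sqi M (f i)) \<and> sqi M g \<and> (\<lambda>i. nsq M (\<lambda>x. f i x - g x)) \<longlonglongrightarrow> 0"

definition sqCauchy :: "'b measure \<Rightarrow> (nat \<Rightarrow> 'b \<Rightarrow> complex) \<Rightarrow> bool" where
  "sqCauchy M f \<longleftrightarrow> (\<forall>i. sqi M (f i)) \<and>
     (\<forall>e>0. \<exists>N. \<forall>i\<ge>N. \<forall>j\<ge>N. nsq M (\<lambda>x. f i x - f j x) < e)"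

lemma L2_tendsto_iff:
  assumes "\<And>i. L2 (f i)" "L2 u"
  shows "L2_tendsto f u \<longleftrightarrow> sqlim lborel f u"
proof -
  have *: "sqi lborel (f i)" "sqi lborel u" for i using assms by (auto simp: L2_iff_sqi)
  then have "(\<integral>\<^sup>+ x. ennreal ((norm (f k x - u x))\<^sup>2) \<partial>lborel) = ennreal (nsq lborel (\<lambda>x. f k x - u x))" for k
    using sqi_diff[of lborel "f k" u] nn_integral_norm_sq by blast
  then show ?thesis unfolding L2_tendsto_def sqlim_def
    using * by (simp add: tendsto_ennreal_iff[of _ _ 0, simplified])
qed

lemma sqlimD:
  assumes "sqlim M f g"
  shows "sqi M (f i)" "sqi M g" "(\<lambda>i. nsq M (\<lambda>x. f i x - g x)) \<longlonglongrightarrow> 0"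
  using assms unfolding sqlim_def by blast+

lemma sqlimI:
  assumes "\<And>i. sqi M (f i)" "sqi M g" "(\<lambda>i. nsq M (\<lambda>x. f i x - g x)) \<longlonglongrightarrow> 0"
  shows "sqlim M f g"
  using assms unfolding sqlim_def by blast

lemma sqlim_const: "sqi M f \<Longrightarrow> sqlim M (\<lambda>_. f) f"
  by (simp add: sqlim_def)

lemma sqlim_sqrt: "sqlim M f g \<Longrightarrow> (\<lambda>i. sqrt (nsq M (\<lambda>x. f i x - g x))) \<longlonglongrightarrow> 0"
  using tendsto_real_sqrt[of "\<lambda>i. nsq M (\<lambda>x. f i x - g x)" 0] by (simp add: sqlim_def)

lemma sqlim_ip:
  assumes f: "sqlim M f g" and h: "sqlim M h k"
  shows "(\<lambda>i. ip M (f i) (h i)) \<longlonglongrightarrow> ip M g k"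
proof -
  have s: "sqi M (f i)" "sqi M g" "sqi M (h i)" "sqi M k" for i
    using f h by (simp_all add: sqlim_def)
  have eq: "ip M (f i) (h i) - ip M g k = ip M (\<lambda>x. f i x - g x) (\<lambda>x. h i x - k x)
      + ip M (\<lambda>x. f i x - g x) k + ip M g (\<lambda>x. h i x - k x)" for i
    by (simp add: ip_diff_left ip_diff_right sqi_diff s)
  have "norm (ip M (f i) (h i) - ip M g k) \<le>
      sqrt (nsq M (\<lambda>x. f i x - g x)) * sqrt (nsq M (\<lambda>x. h i x - k x))
      + sqrt (nsq M (\<lambda>x. f i x - g x)) * sqrt (nsq M k)
      + sqrt (nsq M g) * sqrt (nsq M (\<lambda>x. h i x - k x))" for i
  proof -
    have tri: "norm (A + B + C) \<le> a + b + c" if "norm A \<le> a" "norm B \<le> b" "norm C \<le> c"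
      for A B C :: complex and a b c
      using that norm_triangle_ineq[of "A + B" C] norm_triangle_ineq[of A B] by linarith
    show ?thesis
      unfolding eq by (rule tri) (intro Cauchy_Schwarz_ip sqi_diff s)+
  qed
  moreover have "(\<lambda>i. sqrt (nsq M (\<lambda>x. f i x - g x)) * sqrt (nsq M (\<lambda>x. h i x - k x))
      + sqrt (nsq M (\<lambda>x. f i x - g x)) * sqrt (nsq M k)
      + sqrt (nsq M g) * sqrt (nsq M (\<lambda>x. h i x - k x))) \<longlonglongrightarrow> 0"
    using tendsto_add[OF tendsto_add[OF tendsto_mult[OF sqlim_sqrt[OF f] sqlim_sqrt[OF h]]
      tendsto_mult_right[OF sqlim_sqrt[OF f], of "sqrt (nsq M k)"]]
      tendsto_mult_left[OF sqlim_sqrt[OF h], of "sqrt (nsq M g)"]] by simp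
  ultimately have "(\<lambda>i. ip M (f i) (h i) - ip M g k) \<longlonglongrightarrow> 0"
    by (rule Lim_null_comparison[OF always_eventually[OF allI]])
  then show ?thesis by (simp add: LIM_zero_iff)
qed

lemma sqlim_nsq: "sqlim M f g \<Longrightarrow> (\<lambda>i. nsq M (f i)) \<longlonglongrightarrow> nsq M g"
  unfolding nsq_eq_Re by (intro tendsto_Re sqlim_ip)

lemma null_sandwich:
  fixes a b :: "nat \<Rightarrow> real"
  assumes "b \<longlonglongrightarrow> 0" "\<And>i. 0 \<le> a i" "\<And>i. a i \<le> b i"
  shows "a \<longlonglongrightarrow> 0"
  by (rule tendsto_sandwich[OF always_eventually always_eventually tendsto_const assms(1)])
     (use assms in auto)

lemma sqlim_add:
  assumes "sqlim M f g" "sqlim M h k"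
  shows "sqlim M (\<lambda>i x. f i x + h i x) (\<lambda>x. g x + k x)"
proof -
  have s: "sqi M (f i)" "sqi M (h i)" "sqi M g" "sqi M k" for i using assms by (auto simp: sqlim_def)
  have eq: "(\<lambda>x. (f i x + h i x) - (g x + k x)) = (\<lambda>x. (f i x - g x) + (h i x - k x))" for i
    by (rule ext) simp
  have le: "nsq M (\<lambda>x. (f i x + h i x) - (g x + k x)) \<le> 2 * nsq M (\<lambda>x. f i x - g x) + 2 * nsq M (\<lambda>x. h i x - k x)" for i
    unfolding eq by (intro nsq_add_le sqi_diff s)
  have "(\<lambda>i. 2 * nsq M (\<lambda>x. f i x - g x) + 2 * nsq M (\<lambda>x. h i x - k x)) \<longlonglongrightarrow> 2 * 0 + 2 * 0"
    by (intro tendsto_add tendsto_mult_left) (use assms in \<open>simp_all add: sqlim_def\<close>)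
  then have "(\<lambda>i. nsq M (\<lambda>x. (f i x + h i x) - (g x + k x))) \<longlonglongrightarrow> 0"
    by (intro null_sandwich[OF _ _ le]) simp_all
  then show ?thesis using s by (auto simp: sqlim_def sqi_add)
qed

lemma sqlim_scale:
  assumes "sqlim M f g"
  shows "sqlim M (\<lambda>i x. c * f i x) (\<lambda>x. c * g x)"
proof -
  have "(\<lambda>i. (norm c)\<^sup>2 * nsq M (\<lambda>x. f i x - g x)) \<longlonglongrightarrow> 0"
    by (rule tendsto_mult_right_zero[OF sqlimD(3)[OF assms]])
  moreover have "nsq M (\<lambda>x. c * f i x - c * g x) = (norm c)\<^sup>2 * nsq M (\<lambda>x. f i x - g x)" for i
    by (simp add: nsq_scale flip: right_diff_distrib)
  ultimately show ?thesis by (intro sqlimI sqi_scale sqlimD[OF assms]) simp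
qed

lemma sqlim_diff:
  assumes "sqlim M f g" "sqlim M h k"
  shows "sqlim M (\<lambda>i x. f i x - h i x) (\<lambda>x. g x - k x)"
  using sqlim_add[OF assms(1) sqlim_scale[OF assms(2), of "-1"]] by simp

lemma sqlim_unique:
  assumes "sqlim M f g" "sqlim M f h"
  shows "AE x in M. g x = h x"
proof -
  have "sqlim M (\<lambda>i x. f i x - f i x) (\<lambda>x. g x - h x)" by (rule sqlim_diff) fact+
  from sqlim_nsq[OF this] have "nsq M (\<lambda>x. g x - h x) = 0" by (simp add: LIMSEQ_const_iff)
  moreover have "sqi M (\<lambda>x. g x - h x)" by (intro sqi_diff sqlimD[OF assms(1)] sqlimD[OF assms(2)])
  ultimately have "AE x in M. g x - h x = 0" by (simp add: nsq_eq_0_iff)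
  then show ?thesis by auto
qed

lemma sqlim_cong_AE:
  assumes "sqlim M f g" "h \<in> borel_measurable M" "AE x in M. g x = h x"
  shows "sqlim M f h"
proof -
  have "sqi M h" by (rule sqi_cong_AE[OF sqlimD(2)[OF assms(1)] assms(2,3)])
  moreover have "nsq M (\<lambda>x. f i x - h x) = nsq M (\<lambda>x. f i x - g x)" for i
  proof (rule nsq_cong_AE)
    show "AE x in M. f i x - h x = f i x - g x" using assms(3) by eventually_elim simp
  qed (use sqi_measurable[OF sqlimD(1)[OF assms(1)]] sqi_measurable[OF sqlimD(2)[OF assms(1)]] assms(2) in measurable)
  ultimately show ?thesis using sqlimD(3)[OF assms(1)] by (intro sqlimI sqlimD(1)[OF assms(1)]) simp_all
qed

lemma sqlim_imp_Cauchy: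
  assumes "sqlim M f g" shows "sqCauchy M f"
  unfolding sqCauchy_def
proof (intro conjI allI impI)
  show s: "sqi M (f i)" for i using assms by (simp add: sqlim_def)
  fix e :: real assume "e > 0"
  then have "\<forall>\<^sub>F i in sequentially. nsq M (\<lambda>x. f i x - g x) < e / 4"
    by (intro order_tendstoD(2)[OF sqlimD(3)[OF assms]]) simp
  then obtain N where N: "\<And>i. i \<ge> N \<Longrightarrow> nsq M (\<lambda>x. f i x - g x) < e / 4"
    by (auto simp: eventually_sequentially)
  have "nsq M (\<lambda>x. f i x - f j x) < e" if "i \<ge> N" "j \<ge> N" for i j
    using nsq_diff_le[of M "f i" g "f j"] N[OF that(1)] N[OF that(2)] s assms
    by (simp add: sqlim_def nsq_minus_commute[of M g])
  then show "\<exists>N. \<forall>i\<ge>N. \<forall>j\<ge>N. nsq M (\<lambda>x. f i x - f j x) < e" by blast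
qed

text \<open>The squared distances tend to 0 in mean, so along a subsequence they tend to 0 almost
  everywhere.\<close>

lemma sqlim_AE_subseq:
  assumes "sqlim M f g"
  obtains r where "strict_mono r" "AE x in M. (\<lambda>i. f (r i) x) \<longlonglongrightarrow> g x"
proof -
  have s: "sqi M (f i)" "sqi M g" for i using assms by (auto simp: sqlim_def)
  have "\<exists>r. strict_mono r \<and> (AE x in M. (\<lambda>n. (norm (f (r n) x - g x))\<^sup>2) \<longlonglongrightarrow> 0)"
    using tendsto_L1_AE_subseq[of M "\<lambda>i x. (norm (f i x - g x))\<^sup>2"] assms sqi_diff[OF s(1) s(2)]
    by (auto simp: sqlim_def nsq_def sqi_def)
  then obtain r where r: "strict_mono r" "AE x in M. (\<lambda>n. (norm (f (r n) x - g x))\<^sup>2) \<longlonglongrightarrow> 0" by blast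
  have "AE x in M. (\<lambda>i. f (r i) x) \<longlonglongrightarrow> g x"
    using r(2)
  proof eventually_elim
    case (elim x)
    then have "(\<lambda>n. norm (f (r n) x - g x)) \<longlonglongrightarrow> 0"
      using tendsto_real_sqrt[OF elim] by simp
    then show ?case by (simp add: LIM_zero_iff tendsto_norm_zero_iff)
  qed
  with r(1) that show ?thesis by blast
qed

text \<open>Riesz--Fischer: a fast Cauchy subsequence converges almost everywhere, and Fatou's lemma
  identifies its pointwise limit as the limit in mean square.\<close>

lemma sqCauchy_converges:
  assumes "sqCauchy M f"
  obtains g where "sqlim M f g"
proof -
  have s: "sqi M (f i)" for i using assms by (simp add: sqCauchy_def)
  have meas [measurable]: "f i \<in> borel_measurable M" for i using s by (auto simp: sqi_def)
  \<comment> \<open>The rate 1/4 survives the weight \<open>2^k\<close>: the integrals of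
    \<open>2^k * (d k x)\<^sup>2\<close> are at most \<open>(1/2)^k\<close>. Since
    \<open>d k x \<le> (1/2)^k + 2^k * (d k x)\<^sup>2\<close>, summability of the weighted squares
    then makes the increments themselves summable almost everywhere.\<close>
  have ex: "\<exists>N. \<forall>i\<ge>N. \<forall>j\<ge>N. nsq M (\<lambda>x. f i x - f j x) < (1/4)^k" for k :: nat
  proof -
    have "(1/4::real)^k > 0" by simp
    then show ?thesis using assms unfolding sqCauchy_def by blast
  qed
  have "\<exists>N. \<forall>k. \<forall>i\<ge>N k. \<forall>j\<ge>N k. nsq M (\<lambda>x. f i x - f j x) < (1/4)^k"
    by (rule choice) (use ex in blast)
  then obtain N where N: "nsq M (\<lambda>x. f i x - f j x) < (1/4)^k" if "i \<ge> N k" "j \<ge> N k" for i j k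
    by blast
  \<comment> \<open>A sum of the thresholds is monotone and dominates each of them; strict
    monotonicity plays no part in what follows.\<close>
  define r where "r k = (\<Sum>i\<le>k. N i)" for k
  have rN: "N k \<le> r k" for k unfolding r_def by (simp add: member_le_sum)
  have rmono: "r k \<le> r (Suc k)" for k unfolding r_def by simp
  have step: "nsq M (\<lambda>x. f (r (Suc k)) x - f (r k) x) \<le> (1/4)^k" for k
    using N[of k "r (Suc k)" "r k"] rN[of k] rmono[of k] by simp
  define d where "d k x = norm (f (r (Suc k)) x - f (r k) x)" for k x
  have dm [measurable]: "d k \<in> borel_measurable M" for k unfolding d_def by measurable
  have "AE x in M. summable (\<lambda>k. 2^k * (d k x)\<^sup>2)"
  proof -
    have dk: "(\<integral>\<^sup>+ x. ennreal (2^k * (d k x)\<^sup>2) \<partial>M) \<le> ennreal ((1/2)^k)" for k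
    proof -
      have "(\<integral>\<^sup>+ x. ennreal (2^k * (d k x)\<^sup>2) \<partial>M) = ennreal (2^k) * (\<integral>\<^sup>+ x. ennreal ((d k x)\<^sup>2) \<partial>M)"
        by (subst nn_integral_cmult[symmetric]) (auto simp: ennreal_mult)
      also have "(\<integral>\<^sup>+ x. ennreal ((d k x)\<^sup>2) \<partial>M) = ennreal (nsq M (\<lambda>x. f (r (Suc k)) x - f (r k) x))"
        unfolding d_def by (rule nn_integral_norm_sq) (intro sqi_diff s)
      also have "ennreal (2^k) * \<dots> \<le> ennreal (2^k) * ennreal ((1/4)^k)"
        by (intro mult_left_mono ennreal_leI step) auto
      also have "\<dots> = ennreal ((1/2)^k)"
        by (subst ennreal_mult[symmetric]) (auto simp flip: power_mult_distrib)
      finally show ?thesis .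
    qed
    have "(\<integral>\<^sup>+ x. (\<Sum>k. ennreal (2^k * (d k x)\<^sup>2)) \<partial>M) = (\<Sum>k. \<integral>\<^sup>+ x. ennreal (2^k * (d k x)\<^sup>2) \<partial>M)"
      by (rule nn_integral_suminf) measurable
    also have "\<dots> \<le> (\<Sum>k. ennreal ((1/2)^k))"
      by (intro suminf_le dk) auto
    also have "\<dots> = ennreal (\<Sum>k. (1/2)^k)"
      by (rule suminf_ennreal2) (auto intro: summable_geometric)
    also have "\<dots> < \<infinity>" by simp
    finally have "AE x in M. (\<Sum>k. ennreal (2^k * (d k x)\<^sup>2)) \<noteq> \<infinity>"
      by (intro nn_integral_PInf_AE) auto
    then show ?thesis
      by eventually_elim (rule summable_suminf_not_top, auto)
  qed
  then have conv: "AE x in M. convergent (\<lambda>k. f (r k) x)"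
  proof eventually_elim
    case (elim x)
    have "summable (\<lambda>k. (1/2)^k + 2^k * (d k x)\<^sup>2)"
      by (intro summable_add elim) (auto intro: summable_geometric)
    moreover have "norm (d k x) \<le> (1/2)^k + 2^k * (d k x)\<^sup>2" for k
    proof -
      have "0 \<le> 2^k * (d k x - (1/2)^k)\<^sup>2" by simp
      also have "2^k * (d k x - (1/2)^k)\<^sup>2 = 2^k * (d k x)\<^sup>2 + (1/2)^k - 2 * d k x"
        by (simp add: power2_diff algebra_simps power2_eq_square power_one_over)
      finally have "2 * d k x \<le> (1/2)^k + 2^k * (d k x)\<^sup>2" by simp
      moreover have "d k x \<ge> 0" by (simp add: d_def)
      ultimately show ?thesis by simp
    qed
    ultimately have "summable (\<lambda>k. d k x)" by (rule summable_comparison_test')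
    then have "summable (\<lambda>k. f (r (Suc k)) x - f (r k) x)"
      unfolding d_def by (rule summable_norm_cancel)
    then have "convergent (\<lambda>n. \<Sum>k<n. f (r (Suc k)) x - f (r k) x)"
      by (simp add: summable_iff_convergent)
    then have "convergent (\<lambda>n. f (r n) x - f (r 0) x)"
      by (simp only: sum_lessThan_telescope[of "\<lambda>n. f (r n) x"])
    then have "convergent (\<lambda>n. (f (r n) x - f (r 0) x) + f (r 0) x)"
      by (intro convergent_add convergent_const)
    then show ?case by simp
  qed
  define g where "g x = lim (\<lambda>k. f (r k) x)" for x
  have gm [measurable]: "g \<in> borel_measurable M" unfolding g_def by measurable
  have lim: "AE x in M. (\<lambda>k. f (r k) x) \<longlonglongrightarrow> g x"
    using conv by eventually_elim (simp add: g_def convergent_LIMSEQ_iff)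
  have bound: "(\<integral>\<^sup>+ x. ennreal ((norm (f i x - g x))\<^sup>2) \<partial>M) \<le> ennreal ((1/4)^k)" if i: "i \<ge> N k" for i k
  proof -
    have "(\<integral>\<^sup>+ x. ennreal ((norm (f i x - g x))\<^sup>2) \<partial>M)
        = (\<integral>\<^sup>+ x. liminf (\<lambda>j. ennreal ((norm (f i x - f (r j) x))\<^sup>2)) \<partial>M)"
    proof (rule nn_integral_cong_AE)
      show "AE x in M. ennreal ((norm (f i x - g x))\<^sup>2) = liminf (\<lambda>j. ennreal ((norm (f i x - f (r j) x))\<^sup>2))"
        using lim
      proof eventually_elim
        case (elim x)
        have "(\<lambda>j. ennreal ((norm (f i x - f (r j) x))\<^sup>2)) \<longlonglongrightarrow> ennreal ((norm (f i x - g x))\<^sup>2)"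
          by (intro tendsto_ennrealI tendsto_power tendsto_norm tendsto_diff tendsto_const elim)
        then show ?case by (intro lim_imp_Liminf[symmetric]) simp_all
      qed
    qed
    also have "\<dots> \<le> liminf (\<lambda>j. \<integral>\<^sup>+ x. ennreal ((norm (f i x - f (r j) x))\<^sup>2) \<partial>M)"
      by (rule nn_integral_liminf) measurable
    also have "\<dots> \<le> ennreal ((1/4)^k)"
    proof (rule order_trans[OF Liminf_mono[of _ "\<lambda>_. ennreal ((1/4)^k)"]])
      show "\<forall>\<^sub>F j in sequentially. (\<integral>\<^sup>+ x. ennreal ((norm (f i x - f (r j) x))\<^sup>2) \<partial>M) \<le> ennreal ((1/4)^k)"
      proof (rule eventually_sequentiallyI[of k])
        fix j assume "k \<le> j"
        then have "r k \<le> r j" by (rule lift_Suc_mono_le[of r, OF rmono])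
        then have "r j \<ge> N k" using rN[of k] by linarith
        then have "nsq M (\<lambda>x. f i x - f (r j) x) \<le> (1/4)^k" using N[OF i] by (simp add: less_imp_le)
        then show "(\<integral>\<^sup>+ x. ennreal ((norm (f i x - f (r j) x))\<^sup>2) \<partial>M) \<le> ennreal ((1/4)^k)"
          unfolding nn_integral_norm_sq[OF sqi_diff[OF s s]] by (rule ennreal_leI)
      qed
    qed (simp add: Liminf_const)
    finally show ?thesis .
  qed
  have diff: "sqi M (\<lambda>x. f i x - g x)" if "i \<ge> N k" for i k
  proof -
    have "(\<integral>\<^sup>+ x. ennreal ((norm (f i x - g x))\<^sup>2) \<partial>M) < \<infinity>"
      using bound[OF that] by (rule le_less_trans) simp
    then show ?thesis
      unfolding sqi_def by (intro conjI integrableI_bounded) simp_all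
  qed
  have sg: "sqi M g"
  proof -
    have "sqi M (\<lambda>x. f (N 0) x - (f (N 0) x - g x))" by (rule sqi_diff[OF s diff[of 0]]) simp
    then show ?thesis by simp
  qed
  have "(\<lambda>i. nsq M (\<lambda>x. f i x - g x)) \<longlonglongrightarrow> 0"
  proof (rule LIMSEQ_I)
    fix e :: real assume "e > 0"
    then obtain k where k: "(1/4::real)^k < e" using real_arch_pow_inv[of e "1/4"] by auto
    have "norm (nsq M (\<lambda>x. f i x - g x) - 0) < e" if "i \<ge> N k" for i
    proof -
      have "nsq M (\<lambda>x. f i x - g x) \<le> (1/4)^k"
        using bound[OF that] unfolding nn_integral_norm_sq[OF diff[OF that]]
        by (subst (asm) ennreal_le_iff) simp_all
      then show ?thesis using k nsq_nonneg[of M "\<lambda>x. f i x - g x"]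
        unfolding real_norm_def by linarith
    qed
    then show "\<exists>no. \<forall>i\<ge>no. norm (nsq M (\<lambda>x. f i x - g x) - 0) < e" by blast
  qed
  then have "sqlim M f g" by (intro sqlimI s sg)
  then show ?thesis by (rule that)
qed

lemma sqCauchy_limit_AE:
  assumes "sqlim M f g" "\<And>i. AE x in M. P x \<longrightarrow> f i x = 0"
  shows "AE x in M. P x \<longrightarrow> g x = 0"
proof -
  obtain r where r: "strict_mono r" "AE x in M. (\<lambda>i. f (r i) x) \<longlonglongrightarrow> g x"
    using sqlim_AE_subseq[OF assms(1)] by blast
  have "AE x in M. \<forall>i. P x \<longrightarrow> f (r i) x = 0" using assms(2) by (subst AE_all_countable) auto
  then show ?thesis using r(2)
    by eventually_elim (auto intro: LIMSEQ_unique)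
qed

subsection \<open>Orthogonal expansions\<close>

text \<open>The squared lengths \<open>c\<close> stay general because the transformed eigenfunctions
  are orthonormal for Lebesgue measure but have squared length \<open>\<mu> j\<close> for the energy
  and \<open>1 + \<mu> j\<close> for the full norm.\<close>

lemma nsq_orthogonal_sum:
  assumes e: "\<And>j. sqi M (e j)" and orth: "\<And>i j. ip M (e i) (e j) = (if i = j then of_real (c i) else 0)"
    and I: "finite I"
  shows "nsq M (\<lambda>x. \<Sum>j\<in>I. a j * e j x) = (\<Sum>j\<in>I. c j * (norm (a j))\<^sup>2)"
proof -
  have "ip M (\<lambda>x. \<Sum>j\<in>I. a j * e j x) (\<lambda>x. \<Sum>j\<in>I. a j * e j x)
      = (\<Sum>i\<in>I. \<Sum>j\<in>I. a i * (cnj (a j) * ip M (e i) (e j)))"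
    using e by (simp add: ip_sum_left ip_sum_right sqi_sum sqi_scale ip_scale_left ip_scale_right sum_distrib_left)
  also have "\<dots> = (\<Sum>i\<in>I. \<Sum>j\<in>I. if i = j then a i * cnj (a i) * of_real (c i) else 0)"
    by (intro sum.cong refl) (auto simp: orth)
  also have "\<dots> = of_real (\<Sum>i\<in>I. c i * (norm (a i))\<^sup>2)"
    using I by (simp add: complex_norm_square[symmetric] mult.commute) 
  finally show ?thesis by (simp add: nsq_eq_Re)
qed

text \<open>A square is completed in every coefficient. The coefficients \<open>a\<close> are
  normalised by \<open>ip M f (e j) = c j * a j\<close>, which avoids a division when
  \<open>c j = 0\<close>; the free \<open>b\<close> admits damped coefficients such as those of a
  resolvent.\<close>

lemma nsq_diff_orthogonal_sum:
  assumes f: "sqi M f" and e: "\<And>j. sqi M (e j)"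
    and orth: "\<And>i j. ip M (e i) (e j) = (if i = j then of_real (c i) else 0)"
    and a: "\<And>j. ip M f (e j) = of_real (c j) * a j" and I: "finite I"
  shows "nsq M (\<lambda>x. f x - (\<Sum>j\<in>I. b j * e j x))
     = nsq M f - (\<Sum>j\<in>I. c j * (norm (a j))\<^sup>2) + (\<Sum>j\<in>I. c j * (norm (a j - b j))\<^sup>2)"
proof -
  have "Re (ip M f (\<lambda>x. \<Sum>j\<in>I. b j * e j x)) = (\<Sum>j\<in>I. c j * Re (cnj (b j) * a j))"
    using f e by (simp add: ip_sum_right sqi_scale ip_scale_right a algebra_simps)
  then have "nsq M (\<lambda>x. f x - (\<Sum>j\<in>I. b j * e j x))
     = nsq M f + ((\<Sum>j\<in>I. c j * (norm (b j))\<^sup>2) - 2 * (\<Sum>j\<in>I. c j * Re (cnj (b j) * a j)))"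
    by (subst nsq_diff) (use f e I in \<open>auto simp: sqi_sum sqi_scale nsq_orthogonal_sum[OF e orth]\<close>)
  also have "(\<Sum>j\<in>I. c j * (norm (b j))\<^sup>2) - 2 * (\<Sum>j\<in>I. c j * Re (cnj (b j) * a j))
     = (\<Sum>j\<in>I. c j * (norm (a j - b j))\<^sup>2 - c j * (norm (a j))\<^sup>2)"
    unfolding sum_distrib_left sum_subtractf[symmetric]
    by (rule sum.cong) (auto simp: cmod_power2 power2_diff algebra_simps)
  finally show ?thesis by (simp add: sum_subtractf)
qed

lemma Bessel:
  assumes "sqi M f" "\<And>j. sqi M (e j)"
    and "\<And>i j. ip M (e i) (e j) = (if i = j then of_real (c i) else 0)"
    and "\<And>j. ip M f (e j) = of_real (c j) * a j" "finite I"
  shows "(\<Sum>j\<in>I. c j * (norm (a j))\<^sup>2) \<le> nsq M f"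
  using nsq_diff_orthogonal_sum[OF assms, where b = a] nsq_nonneg[of M "\<lambda>x. f x - (\<Sum>j\<in>I. a j * e j x)"]
  by simp

lemma sum_lessThan_diff:
  fixes F :: "nat \<Rightarrow> 'c :: ab_group_add"
  shows "m \<le> n \<Longrightarrow> (\<Sum>j<n. F j) - (\<Sum>j<m. F j) = (\<Sum>j\<in>{m..<n}. F j)"
  by (simp add: lessThan_atLeast0 sum_diff_nat_ivl)

text \<open>Bessel's inequality makes the partial sums Cauchy. The limit has the coefficients of
  \<open>f\<close> but may differ from \<open>f\<close>, since completeness of the
  \<open>e j\<close> is a separate matter.\<close>

lemma orthogonal_expansion_converges:
  assumes f: "sqi M f" and e: "\<And>j :: nat. sqi M (e j)" and c: "\<And>j. c j \<ge> 0"
    and orth: "\<And>i j. ip M (e i) (e j) = (if i = j then of_real (c i) else 0)"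
    and a: "\<And>j. ip M f (e j) = of_real (c j) * a j"
  obtains h where "sqlim M (\<lambda>N x. \<Sum>j<N. a j * e j x) h" "\<And>j. ip M h (e j) = ip M f (e j)"
proof -
  have "summable (\<lambda>j. c j * (norm (a j))\<^sup>2)"
    by (rule summableI_nonneg_bounded[of _ "nsq M f"]) (use c Bessel[OF f e orth a] in auto)
  then have C: "Cauchy (\<lambda>N. \<Sum>j<N. c j * (norm (a j))\<^sup>2)"
    by (simp add: summable_iff_convergent convergent_Cauchy)
  have s: "sqi M (\<lambda>x. \<Sum>j\<in>I. a j * e j x)" for I by (intro sqi_sum sqi_scale e)
  have le: "nsq M (\<lambda>x. (\<Sum>j<n. a j * e j x) - (\<Sum>j<m. a j * e j x))
      = (\<Sum>j<n. c j * (norm (a j))\<^sup>2) - (\<Sum>j<m. c j * (norm (a j))\<^sup>2)" if "m \<le> n" for m n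
  proof -
    show ?thesis
      unfolding sum_lessThan_diff[OF that] by (rule nsq_orthogonal_sum[OF e orth]) simp
  qed
  have "sqCauchy M (\<lambda>N x. \<Sum>j<N. a j * e j x)"
    unfolding sqCauchy_def
  proof (intro conjI allI impI s)
    fix \<epsilon> :: real assume "\<epsilon> > 0"
    then obtain N where N: "\<And>m n. m \<ge> N \<Longrightarrow> n \<ge> N \<Longrightarrow>
        \<bar>(\<Sum>j<n. c j * (norm (a j))\<^sup>2) - (\<Sum>j<m. c j * (norm (a j))\<^sup>2)\<bar> < \<epsilon>"
      using C by (metis (no_types, lifting) Cauchy_iff real_norm_def)
    have "nsq M (\<lambda>x. (\<Sum>j<n. a j * e j x) - (\<Sum>j<m. a j * e j x)) < \<epsilon>" if "n \<ge> N" "m \<ge> N" for m n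
    proof (cases "m \<le> n")
      case True then show ?thesis using le[of m n] N[of m n] that by simp
    next
      case False then show ?thesis using le[of n m] N[of n m] that
        by (subst nsq_minus_commute) simp
    qed
    then show "\<exists>N. \<forall>i\<ge>N. \<forall>j\<ge>N. nsq M (\<lambda>x. (\<Sum>j<i. a j * e j x) - (\<Sum>ja<j. a ja * e ja x)) < \<epsilon>"
      by blast
  qed
  then obtain h where h: "sqlim M (\<lambda>N x. \<Sum>j<N. a j * e j x) h" by (rule sqCauchy_converges)
  have "ip M h (e j) = ip M f (e j)" for j
  proof (rule LIMSEQ_unique)
    show "(\<lambda>N. ip M (\<lambda>x. \<Sum>j<N. a j * e j x) (e j)) \<longlonglongrightarrow> ip M h (e j)"
      by (rule sqlim_ip[OF h sqlim_const[OF e]])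
    have "ip M (\<lambda>x. \<Sum>j<N. a j * e j x) (e j) = ip M f (e j)" if "N > j" for N
    proof -
      have "ip M (\<lambda>x. \<Sum>i<N. a i * e i x) (e j) = (\<Sum>i<N. a i * ip M (e i) (e j))"
        using e by (simp add: ip_sum_left sqi_scale ip_scale_left)
      also have "\<dots> = (\<Sum>i<N. if i = j then a j * of_real (c j) else 0)"
        by (intro sum.cong refl) (auto simp: orth)
      finally show ?thesis using that by (simp add: a mult.commute)
    qed
    then show "(\<lambda>N. ip M (\<lambda>x. \<Sum>j<N. a j * e j x) (e j)) \<longlonglongrightarrow> ip M f (e j)"
      by (intro tendsto_eventually eventually_sequentiallyI[of "Suc j"]) auto
  qed
  with h that show ?thesis by blast
qed

section \<open>Test functions\<close>

lemma frechet_works: "f differentiable at x \<Longrightarrow> (f has_derivative frechet_derivative f (at x)) (at x)"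
  using frechet_derivative_works by blast

text \<open>Uniqueness of the derivative lets an explicit formula replace
  \<open>frechet_derivative\<close>.\<close>

lemma Ck_SucI:
  assumes "\<And>x. (f has_derivative f' x) (at x)" "\<And>b. b \<in> Basis \<Longrightarrow> Ck k (\<lambda>x. f' x b)"
  shows "Ck (Suc k) f"
proof -
  have "f' x = frechet_derivative f (at x)" for x
    by (rule frechet_derivative_at[OF assms(1)])
  then have "f' = (\<lambda>x. frechet_derivative f (at x))" by blast
  then show ?thesis using assms by (auto intro: differentiableI)
qed

lemma Ck_Suc_has_derivative: "Ck (Suc k) f \<Longrightarrow> (f has_derivative frechet_derivative f (at x)) (at x)"
  by (auto intro: frechet_works)

text \<open>Used in the product rule, where the undifferentiated factors reappear one order
  lower.\<close>

lemma Ck_SucD: "Ck (Suc k) f \<Longrightarrow> Ck k f"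
proof (induction k arbitrary: f)
  case 0
  then have "continuous (at x) f" for x
    by (auto intro: differentiable_imp_continuous_within)
  then show ?case by (simp add: continuous_at_imp_continuous_on)
next
  case (Suc k)
  have "f differentiable at x" for x using Suc.prems by simp
  moreover have "Ck k (\<lambda>x. frechet_derivative f (at x) b)" if "b \<in> Basis" for b
    using Suc.prems that by (intro Suc.IH) (simp del: Ck.simps(2) add: Ck.simps(2)[of "Suc k"])
  ultimately show ?case by simp
qed

lemma Ck_zero: "Ck k (\<lambda>x. 0)"
proof (induction k)
  case (Suc k)
  show ?case by (rule Ck_SucI[where f' = "\<lambda>x v. 0"]) (auto intro: Suc)
qed simp

lemma Ck_add: "Ck k f \<Longrightarrow> Ck k g \<Longrightarrow> Ck k (\<lambda>x. f x + g x)"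
proof (induction k arbitrary: f g)
  case (Suc k)
  show ?case
    by (rule Ck_SucI[OF has_derivative_add[OF Suc.prems[THEN Ck_Suc_has_derivative]]], rule Suc.IH)
      (use Suc.prems in auto)
qed (auto intro: continuous_on_add)

lemma Ck_mult: "Ck k f \<Longrightarrow> Ck k g \<Longrightarrow> Ck k (\<lambda>x. f x * g x)"
proof (induction k arbitrary: f g)
  case (Suc k)
  show ?case
    by (rule Ck_SucI[OF has_derivative_mult[OF Suc.prems[THEN Ck_Suc_has_derivative]]],
        rule Ck_add; rule Suc.IH)
      (use Suc.prems Suc.prems[THEN Ck_SucD] in auto)
qed (auto intro: continuous_on_mult)

lemma Ck_const: "Ck k (\<lambda>x. c)"
proof (induction k)
  case (Suc k)
  show ?case by (rule Ck_SucI[where f' = "\<lambda>x v. 0"]) (auto intro: Ck_zero)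
qed simp

lemma Ck_scale: "Ck k f \<Longrightarrow> Ck k (\<lambda>x. c * f x)"
  by (rule Ck_mult[OF Ck_const])

lemma Ck_cnj: "Ck k f \<Longrightarrow> Ck k (\<lambda>x. cnj (f x))"
proof (induction k arbitrary: f)
  case (Suc k)
  show ?case
    by (rule Ck_SucI[OF bounded_linear.has_derivative[OF bounded_linear_cnj Suc.prems[THEN Ck_Suc_has_derivative]]],
        rule Suc.IH) (use Suc.prems in auto)
qed (auto intro: continuous_intros)

lemma Ck_affine: "Ck k f \<Longrightarrow> Ck k (\<lambda>x. f (a + c *\<^sub>R x))"
proof (induction k arbitrary: f)
  case 0
  have "continuous_on UNIV f" using 0 by simp
  moreover have "continuous_on UNIV (\<lambda>x. a + c *\<^sub>R x)" by (intro continuous_intros)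
  ultimately have "continuous_on UNIV (\<lambda>x. f (a + c *\<^sub>R x))"
    by (rule continuous_on_compose2) simp
  then show ?case by simp
next
  case (Suc k)
  let ?T = "\<lambda>x::'a. a + c *\<^sub>R x"
  have T: "(?T has_derivative (\<lambda>v. c *\<^sub>R v)) (at x)" for x
    by (auto intro!: derivative_eq_intros)
  have d: "((\<lambda>x. f (?T x)) has_derivative (\<lambda>v. frechet_derivative f (at (?T x)) (c *\<^sub>R v))) (at x)" for x
    by (rule has_derivative_compose[OF T Ck_Suc_has_derivative[OF Suc.prems]])
  have lin: "frechet_derivative f (at y) (c *\<^sub>R v) = of_real c * frechet_derivative f (at y) v" for y v
    by (simp only: linear_scale[OF has_derivative_linear[OF Ck_Suc_has_derivative[OF Suc.prems]]] scaleR_conv_of_real)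
  show ?case
    by (rule Ck_SucI[OF d], unfold lin, rule Ck_scale, rule Suc.IH) (use Suc.prems in auto)
qed

lemma test_funD:
  assumes "test_fun \<Omega> f"
  obtains K where "compact K" "K \<subseteq> \<Omega>" "\<forall>x. x \<notin> K \<longrightarrow> f x = 0"
  using assms unfolding test_fun_def by blast

lemma test_fun_compactE:
  assumes "test_fun \<Omega> f"
  obtains K where "compact K" "\<forall>x. x \<notin> K \<longrightarrow> f x = 0"
  using assms unfolding test_fun_def by blast

lemma test_funI:
  assumes "\<And>k. Ck k f" "compact K" "K \<subseteq> \<Omega>" "\<And>x. x \<notin> K \<Longrightarrow> f x = 0"
  shows "test_fun \<Omega> f"
  using assms unfolding test_fun_def by blast

lemma test_fun_Ck: "test_fun \<Omega> f \<Longrightarrow> Ck k f"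
  unfolding test_fun_def by blast

lemma test_fun_mono: "test_fun \<Omega> f \<Longrightarrow> \<Omega> \<subseteq> \<Omega>' \<Longrightarrow> test_fun \<Omega>' f"
  unfolding test_fun_def by blast

lemma test_fun_UNIV: "test_fun \<Omega> f \<Longrightarrow> test_fun UNIV f"
  by (rule test_fun_mono) auto

lemma test_fun_outside: "test_fun \<Omega> f \<Longrightarrow> x \<notin> \<Omega> \<Longrightarrow> f x = 0"
  unfolding test_fun_def by blast

lemma test_fun_zero [simp]: "test_fun \<Omega> (\<lambda>x. 0)"
  by (rule test_funI[OF Ck_zero, of "{}"]) auto

lemma test_fun_add:
  assumes "test_fun \<Omega> f" "test_fun \<Omega> g"
  shows "test_fun \<Omega> (\<lambda>x. f x + g x)"
proof -
  obtain K where K: "compact K" "K \<subseteq> \<Omega>" "\<forall>x. x \<notin> K \<longrightarrow> f x = 0" by (rule test_funD[OF assms(1)])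
  note K = K[rule_format]
  obtain L where L: "compact L" "L \<subseteq> \<Omega>" "\<forall>x. x \<notin> L \<longrightarrow> g x = 0" by (rule test_funD[OF assms(2)])
  note L = L[rule_format]
  show ?thesis
    by (rule test_funI[OF Ck_add[OF assms[THEN test_fun_Ck]], of "K \<union> L"]) (use K L in auto)
qed

lemma test_fun_scale:
  assumes "test_fun \<Omega> f" shows "test_fun \<Omega> (\<lambda>x. c * f x)"
  by (rule test_funD[OF assms], rule test_funI[OF Ck_scale[OF test_fun_Ck[OF assms]]]) auto

lemma test_fun_diff: "test_fun \<Omega> f \<Longrightarrow> test_fun \<Omega> g \<Longrightarrow> test_fun \<Omega> (\<lambda>x. f x - g x)"
  using test_fun_add[OF _ test_fun_scale[of \<Omega> g "-1"], of f] by simp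

lemma test_fun_cnj:
  assumes "test_fun \<Omega> f" shows "test_fun \<Omega> (\<lambda>x. cnj (f x))"
  by (rule test_funD[OF assms], rule test_funI[OF Ck_cnj[OF test_fun_Ck[OF assms]]]) auto

lemma test_fun_mult:
  assumes "test_fun \<Omega> f" "test_fun \<Omega> g" shows "test_fun \<Omega> (\<lambda>x. f x * g x)"
  by (rule test_funD[OF assms(1)], rule test_funI[OF Ck_mult[OF assms[THEN test_fun_Ck]]]) auto

lemma test_fun_affine:
  assumes f: "test_fun UNIV f" and c: "c \<noteq> 0"
  shows "test_fun UNIV (\<lambda>x. f (a + c *\<^sub>R x))"
proof -
  obtain K where K: "compact K" "\<forall>x. x \<notin> K \<longrightarrow> f x = 0" by (rule test_fun_compactE[OF f])
  note K = K[rule_format]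
  let ?K = "(\<lambda>y. (1 / c) *\<^sub>R (y - a)) ` K"
  have "compact ?K" by (intro compact_continuous_image continuous_intros K)
  moreover have "f (a + c *\<^sub>R x) = 0" if "x \<notin> ?K" for x
  proof (rule K(2))
    show "a + c *\<^sub>R x \<notin> K"
    proof
      assume "a + c *\<^sub>R x \<in> K"
      moreover have "x = (1 / c) *\<^sub>R ((a + c *\<^sub>R x) - a)" using c by simp
      ultimately have "x \<in> ?K" by (rule image_eqI[rotated])
      with that show False by contradiction
    qed
  qed
  ultimately show ?thesis
    by (intro test_funI[OF Ck_affine[OF test_fun_Ck[OF f]]]) auto
qed

lemma test_fun_has_derivative: "test_fun \<Omega> f \<Longrightarrow> (f has_derivative frechet_derivative f (at x)) (at x)"
  using Ck_Suc_has_derivative[of 0 f] test_fun_Ck[of \<Omega> f "Suc 0"] by blast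

lemma test_fun_deriv:
  assumes f: "test_fun \<Omega> f" and b: "b \<in> Basis"
  shows "test_fun \<Omega> (\<lambda>x. frechet_derivative f (at x) b)"
proof -
  obtain K where K: "compact K" "K \<subseteq> \<Omega>" "\<forall>x. x \<notin> K \<longrightarrow> f x = 0" by (rule test_funD[OF f])
  note K = K[rule_format]
  have "Ck k (\<lambda>x. frechet_derivative f (at x) b)" for k
    using test_fun_Ck[OF f, of "Suc k"] b by simp
  moreover have "frechet_derivative f (at x) b = 0" if "x \<notin> K" for x
  proof -
    have "open (- K)" using K(1) by (simp add: compact_imp_closed open_Compl)
    then have "(f has_derivative (\<lambda>_. 0)) (at x)"
      by (rule has_derivative_transform_within_open[OF has_derivative_const[of 0]])
         (use that K in auto)
    then show ?thesis by (simp add: frechet_derivative_at[symmetric])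
  qed
  ultimately show ?thesis by (rule test_funI[OF _ K(1,2)])
qed

lemma test_fun_continuous: "test_fun \<Omega> f \<Longrightarrow> continuous_on S f"
  using test_fun_Ck[of \<Omega> f 0] by (auto intro: continuous_on_subset)

lemma test_fun_measurable [measurable_dest]: "test_fun \<Omega> f \<Longrightarrow> f \<in> borel_measurable borel"
  by (intro borel_measurable_continuous_onI test_fun_continuous)

lemma test_fun_bounded:
  assumes "test_fun \<Omega> f" obtains B where "B > 0" "\<forall>x. norm (f x) \<le> B"
proof -
  obtain K where K: "compact K" "\<forall>x. x \<notin> K \<longrightarrow> f x = 0" by (rule test_fun_compactE[OF assms])
  note K = K[rule_format]
  have "bounded (f ` K)"
    by (intro compact_imp_bounded compact_continuous_image test_fun_continuous[OF assms] K)
  then obtain B where B: "B > 0" "\<And>x. x \<in> K \<Longrightarrow> norm (f x) \<le> B"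
    by (auto simp: bounded_pos)
  have "norm (f x) \<le> B" for x using B K(2)[of x] by (cases "x \<in> K") auto
  then have "\<forall>x. norm (f x) \<le> B" by blast
  from B(1) this show ?thesis by (rule that)
qed

lemma integrable_compact_support:
  fixes f :: "'a::euclidean_space \<Rightarrow> 'b::{banach, second_countable_topology}"
  assumes K: "compact K" "\<And>x. x \<notin> K \<Longrightarrow> f x = 0" and f: "continuous_on UNIV f"
  shows "integrable lborel f"
proof -
  have "integrable lborel (\<lambda>x. indicator K x *\<^sub>R f x)"
    by (rule borel_integrable_compact[OF K(1) continuous_on_subset[OF f]]) simp
  also have "(\<lambda>x. indicator K x *\<^sub>R f x) = f"
    using K(2) by (auto simp: fun_eq_iff indicator_def)
  finally show ?thesis .
qed

lemma test_fun_integrable: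
  assumes "test_fun \<Omega> f" shows "integrable lborel f"
  by (rule test_funD[OF assms], rule integrable_compact_support[OF _ _ test_fun_continuous[OF assms]]) auto

lemma test_fun_norm_powr_integrable:
  assumes "test_fun \<Omega> f" "p > 0" shows "integrable lborel (\<lambda>x. norm (f x) powr p)"
proof -
  obtain K where K: "compact K" "\<forall>x. x \<notin> K \<longrightarrow> f x = 0" by (rule test_fun_compactE[OF assms(1)])
  note K = K[rule_format]
  show ?thesis
  proof (rule integrable_compact_support[OF K(1)])
    show "continuous_on UNIV (\<lambda>x. norm (f x) powr p)"
      using assms(2) by (intro continuous_on_powr' continuous_on_norm continuous_on_const test_fun_continuous[OF assms(1)]) auto
  qed (simp add: K)
qed

lemma test_fun_sqi:
  assumes "test_fun \<Omega> f" shows "sqi lborel f"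
proof -
  obtain K where K: "compact K" "\<forall>x. x \<notin> K \<longrightarrow> f x = 0" by (rule test_fun_compactE[OF assms])
  note K = K[rule_format]
  have "integrable lborel (\<lambda>x. (norm (f x))\<^sup>2)"
    by (rule integrable_compact_support[OF K(1)])
       (auto intro!: continuous_on_power continuous_on_norm test_fun_continuous[OF assms] simp: K)
  then show ?thesis using test_fun_measurable[OF assms] by (simp add: sqi_def)
qed

lemma test_fun_L2: "test_fun \<Omega> f \<Longrightarrow> L2 f"
  by (simp add: L2_iff_sqi test_fun_sqi)

subsection \<open>Convolution with a test function\<close>

text \<open>The translated factor \<open>f\<close> supplies all the smoothness, so \<open>h\<close>
  may be a mere integrable function: below it is the indicator of a box or a truncated resolvent
  kernel.\<close>

definition conv :: "('a::euclidean_space \<Rightarrow> complex) \<Rightarrow> ('a \<Rightarrow> complex) \<Rightarrow> 'a \<Rightarrow> complex" where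
  "conv h f x = (LINT y|lborel. h y * f (x - y))"

lemma integrable_mult_bounded:
  fixes h g :: "'b \<Rightarrow> complex"
  assumes "integrable M h" "g \<in> borel_measurable M" "\<And>x. norm (g x) \<le> B"
  shows "integrable M (\<lambda>x. h x * g x)"
proof (rule Bochner_Integration.integrable_bound)
  show "integrable M (\<lambda>x. B * norm (h x))" using assms(1) by simp
  show "AE x in M. norm (h x * g x) \<le> norm (B * norm (h x))"
  proof (rule AE_I2)
    fix x
    have "norm (h x * g x) \<le> norm (h x) * B"
      unfolding norm_mult by (rule mult_left_mono[OF assms(3)]) simp
    also have "\<dots> \<le> norm (B * norm (h x))" by (simp add: mult.commute)
    finally show "norm (h x * g x) \<le> norm (B * norm (h x))" .
  qed
  show "(\<lambda>x. h x * g x) \<in> borel_measurable M"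
    by (intro borel_measurable_times borel_measurable_integrable assms)
qed

lemma conv_integrable:
  assumes h: "integrable lborel h" and f: "test_fun UNIV f"
  shows "integrable lborel (\<lambda>y. h y * f (x - y))"
proof -
  obtain B where B: "\<forall>x. norm (f x) \<le> B" by (rule test_fun_bounded[OF f])
  have [measurable]: "f \<in> borel_measurable borel" by (rule test_fun_measurable[OF f])
  have "(\<lambda>y. f (x - y)) \<in> borel_measurable lborel" by measurable
  then show ?thesis by (rule integrable_mult_bounded[OF h _ B[rule_format]])
qed

lemma frechet_Basis_expand:
  assumes "(f has_derivative f') F"
  shows "f' v = (\<Sum>b\<in>Basis. (v \<bullet> b) *\<^sub>R f' b)"
proof -
  interpret linear f' by (rule has_derivative_linear[OF assms])
  have "f' v = f' (\<Sum>b\<in>Basis. (v \<bullet> b) *\<^sub>R b)" by (simp add: euclidean_representation)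
  also have "\<dots> = (\<Sum>b\<in>Basis. (v \<bullet> b) *\<^sub>R f' b)" by (simp only: sum scale)
  finally show ?thesis .
qed

text \<open>Compactness gives the estimate on a ball whose radius exceeds that of the support by 1.
  If one of two points closer than 1 lies outside that ball, both miss the support.\<close>

lemma test_fun_uniformly_continuous:
  assumes t: "test_fun UNIV g" and e: "e > 0"
  obtains d where "d > 0" "\<forall>x y. dist y x < d \<longrightarrow> dist (g y) (g x) < e"
proof -
  obtain K where K: "compact K" "\<forall>x. x \<notin> K \<longrightarrow> g x = 0" by (rule test_fun_compactE[OF t])
  note K = K[rule_format]
  obtain R where R: "\<forall>x\<in>K. norm x \<le> R"
    using compact_imp_bounded[OF K(1)] unfolding bounded_iff by auto
  have uc: "uniformly_continuous_on (cball 0 (R+1)) g"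
    by (intro compact_uniformly_continuous test_fun_continuous[OF t] compact_cball)
  obtain d where d: "d > 0"
    "\<forall>x\<in>cball 0 (R+1). \<forall>y\<in>cball 0 (R+1). dist y x < d \<longrightarrow> dist (g y) (g x) < e"
    using uc[unfolded uniformly_continuous_on_def, rule_format, OF e] by auto
  have "dist (g y) (g x) < e" if "dist y x < min d 1" for x y
  proof (cases "x \<in> cball 0 (R+1) \<and> y \<in> cball 0 (R+1)")
    case True then show ?thesis using d that by auto
  next
    case False
    have "norm x \<le> norm y + dist y x" "norm y \<le> norm x + dist y x"
      using norm_triangle_sub[of x y] norm_triangle_sub[of y x] by (auto simp: dist_norm norm_minus_commute)
    then have "norm x > R" "norm y > R" using False that by auto
    then have "x \<notin> K" "y \<notin> K" using R by auto
    then show ?thesis using K(2) e by simp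
  qed
  then have "\<forall>x y. dist y x < min d 1 \<longrightarrow> dist (g y) (g x) < e" by blast
  moreover have "min d 1 > 0" using d(1) by simp
  ultimately show ?thesis using that by blast
qed

text \<open>The mean value inequality is applied to \<open>f\<close> minus its linear part at
  \<open>y\<close>. The partial derivatives are uniformly continuous, and a tolerance
  \<open>e / n\<close> for each of the \<open>n\<close> coordinates adds up to \<open>e\<close>.
  Independence of \<open>d\<close> from \<open>y\<close> is what allows integration of the remainder
  against an arbitrary integrable function.\<close>

lemma test_fun_uniform_derivative:
  fixes f :: "'a::euclidean_space \<Rightarrow> complex"
  assumes f: "test_fun UNIV f" and e: "e > 0"
  obtains d where "d > 0"
    "\<forall>y z. norm z < d \<longrightarrow> norm (f (y + z) - f y - frechet_derivative f (at y) z) \<le> e * norm z"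
proof -
  let ?D = "\<lambda>b x. frechet_derivative f (at x) b"
  define n where "n = real (card (Basis :: 'a set))"
  have n: "n > 0" unfolding n_def by simp
  have "\<exists>d>0. \<forall>x y. dist y x < d \<longrightarrow> dist (?D b y) (?D b x) < e / n" if b: "b \<in> Basis" for b
  proof -
    have en: "e / n > 0" using e n by simp
    obtain d where "d > 0" "\<forall>x y. dist y x < d \<longrightarrow> dist (?D b y) (?D b x) < e / n"
      by (rule test_fun_uniformly_continuous[OF test_fun_deriv[OF f b] en])
    then show ?thesis by blast
  qed
  then have "\<exists>\<delta>. \<forall>b\<in>Basis. \<delta> b > 0 \<and> (\<forall>x y. dist y x < \<delta> b \<longrightarrow> dist (?D b y) (?D b x) < e / n)"
    by (intro bchoice) blast
  then obtain \<delta> where \<delta>: "\<And>b. b \<in> Basis \<Longrightarrow> \<delta> b > 0"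
    "\<And>b x y. b \<in> Basis \<Longrightarrow> dist y x < \<delta> b \<Longrightarrow> dist (?D b y) (?D b x) < e / n" by blast
  define d where "d = Min (\<delta> ` Basis)"
  have d: "d > 0" "\<And>b. b \<in> Basis \<Longrightarrow> d \<le> \<delta> b"
    unfolding d_def using \<delta>(1) by auto
  have main: "norm (f (y + z) - f y - frechet_derivative f (at y) z) \<le> e * norm z" if z: "norm z < d" for y z
  proof -
    let ?L = "frechet_derivative f (at y)"
    have L: "bounded_linear ?L" by (rule has_derivative_bounded_linear[OF test_fun_has_derivative[OF f]])
    have "norm ((f (y + z) - ?L (y + z)) - (f y - ?L y)) \<le> e * norm ((y + z) - y)"
    proof (rule differentiable_bound[where S = "ball y d" and f' = "\<lambda>w v. frechet_derivative f (at w) v - ?L v"])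
      fix w assume w: "w \<in> ball y d"
      show "((\<lambda>w. f w - ?L w) has_derivative (\<lambda>v. frechet_derivative f (at w) v - ?L v)) (at w within ball y d)"
        by (intro has_derivative_diff has_derivative_at_withinI[OF test_fun_has_derivative[OF f]]
            bounded_linear_imp_has_derivative L)
      show "onorm (\<lambda>v. frechet_derivative f (at w) v - ?L v) \<le> e"
      proof (rule onorm_le)
        fix v
        have "norm (frechet_derivative f (at w) v - ?L v) = norm (\<Sum>b\<in>Basis. (v \<bullet> b) *\<^sub>R (?D b w - ?D b y))"
          unfolding scaleR_diff_right sum_subtractf
          by (simp only: frechet_Basis_expand[OF test_fun_has_derivative[OF f], of _ v, symmetric])
        also have "\<dots> \<le> (\<Sum>b\<in>(Basis::'a set). norm v * (e / n))"
        proof (rule sum_norm_le)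
          fix b :: 'a assume b: "b \<in> Basis"
          have "dist w y < \<delta> b" using w d(2)[OF b] by (simp add: dist_commute)
          then have "norm (?D b w - ?D b y) \<le> e / n" using \<delta>(2)[OF b] by (simp add: dist_norm less_imp_le)
          then show "norm ((v \<bullet> b) *\<^sub>R (?D b w - ?D b y)) \<le> norm v * (e / n)"
            unfolding norm_scaleR real_norm_def by (intro mult_mono Basis_le_norm[OF b]) auto
        qed
        also have "\<dots> = e * norm v" using n by (simp add: n_def)
        finally show "norm (frechet_derivative f (at w) v - ?L v) \<le> e * norm v" .
      qed
    qed (use z d in \<open>simp_all add: dist_norm\<close>)
    moreover have "?L (y + z) = ?L y + ?L z" by (rule linear_add[OF bounded_linear.linear[OF L]])
    ultimately show ?thesis by (simp add: algebra_simps)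
  qed
  from main have "\<forall>y z. norm z < d \<longrightarrow> norm (f (y + z) - f y - frechet_derivative f (at y) z) \<le> e * norm z"
    by blast
  with d(1) show ?thesis by (rule that)
qed

text \<open>The uniform remainder estimate for \<open>f\<close> is integrated against the modulus of
  \<open>h\<close>.\<close>

lemma conv_has_derivative:
  fixes f h :: "'a::euclidean_space \<Rightarrow> complex"
  assumes h: "integrable lborel h" and f: "test_fun UNIV f"
  shows "(conv h f has_derivative
      (\<lambda>v. \<Sum>b\<in>Basis. (v \<bullet> b) *\<^sub>R conv h (\<lambda>x. frechet_derivative f (at x) b) x)) (at x)"
  unfolding has_derivative_at_alt
proof (intro conjI allI impI)
  let ?D = "\<lambda>b x. frechet_derivative f (at x) b"
  let ?L = "\<lambda>v. \<Sum>b\<in>Basis. (v \<bullet> b) *\<^sub>R conv h (?D b) x"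
  show "bounded_linear ?L"
    by (intro bounded_linear_sum bounded_linear_compose[OF bounded_linear_scaleR_left] bounded_linear_inner_left)
  fix e :: real assume e: "e > 0"
  define H where "H = (LINT y|lborel. norm (h y))"
  have H: "H \<ge> 0" unfolding H_def by simp
  \<comment> \<open>Dividing by \<open>H + 1\<close> rather than \<open>H\<close> covers the case
    that \<open>h\<close> vanishes almost everywhere.\<close>
  have eH: "e / (H + 1) > 0" using e H by (simp add: add_nonneg_pos)
  obtain d where d: "d > 0"
    "\<forall>y z. norm z < d \<longrightarrow> norm (f (y + z) - f y - frechet_derivative f (at y) z) \<le> e / (H + 1) * norm z"
    by (rule test_fun_uniform_derivative[OF f eH])
  note d = d[rule_format]
  have "norm (conv h f y - conv h f x - ?L (y - x)) \<le> e * norm (y - x)" if y: "norm (y - x) < d" for y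
  proof -
    let ?z = "y - x"
    let ?r = "\<lambda>w. f (y - w) - f (x - w) - frechet_derivative f (at (x - w)) ?z"
    have intD: "integrable lborel (\<lambda>w. h w * ?D b (x - w))" if "b \<in> Basis" for b
      by (rule conv_integrable[OF h test_fun_deriv[OF f that]])
    have ex: "h w * frechet_derivative f (at (x - w)) ?z = (\<Sum>b\<in>Basis. (?z \<bullet> b) *\<^sub>R (h w * ?D b (x - w)))" for w
      by (subst frechet_Basis_expand[OF test_fun_has_derivative[OF f]]) (simp add: sum_distrib_left)
    have intL: "integrable lborel (\<lambda>w. h w * frechet_derivative f (at (x - w)) ?z)"
      unfolding ex by (intro Bochner_Integration.integrable_sum integrable_scaleR_right intD)
    have L: "?L ?z = (LINT w|lborel. h w * frechet_derivative f (at (x - w)) ?z)"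
      unfolding ex conv_def
      by (subst Bochner_Integration.integral_sum) (intro integrable_scaleR_right intD, simp_all)
    have intr: "integrable lborel (\<lambda>w. h w * ?r w)"
      unfolding right_diff_distrib by (intro Bochner_Integration.integrable_diff conv_integrable[OF h f] intL)
    have "conv h f y - conv h f x - ?L ?z
        = conv h f y - conv h f x - (LINT w|lborel. h w * frechet_derivative f (at (x - w)) ?z)"
      by (simp only: L)
    also have "\<dots> = (LINT w|lborel. h w * ?r w)"
      unfolding conv_def right_diff_distrib
      by (simp only: Bochner_Integration.integral_diff Bochner_Integration.integrable_diff
            conv_integrable[OF h f] intL)
    finally have "norm (conv h f y - conv h f x - ?L ?z) = norm (LINT w|lborel. h w * ?r w)"
      by (rule arg_cong)
    also have "\<dots> \<le> (LINT w|lborel. norm (h w * ?r w))" by (rule integral_norm_bound)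
    also have "\<dots> \<le> (LINT w|lborel. e / (H + 1) * norm ?z * norm (h w))"
    proof (rule integral_mono)
      fix w
      have "norm (?r w) \<le> e / (H + 1) * norm ?z"
        using d(2)[OF y, of "x - w"] by (simp add: algebra_simps)
      then show "norm (h w * ?r w) \<le> e / (H + 1) * norm ?z * norm (h w)"
        unfolding norm_mult by (subst mult.commute) (rule mult_right_mono, simp_all)
    next
      show "integrable lborel (\<lambda>w. norm (h w * ?r w))" by (rule integrable_norm[OF intr])
      show "integrable lborel (\<lambda>w. e / (H + 1) * norm ?z * norm (h w))"
        by (intro integrable_mult_right integrable_norm h)
    qed
    also have "\<dots> = e * (H / (H + 1)) * norm ?z" by (simp add: H_def)
    also have "\<dots> \<le> e * 1 * norm ?z"
      using H e by (intro mult_right_mono mult_left_mono) (auto simp: field_simps)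
    finally show ?thesis by simp
  qed
  then show "\<exists>d>0. \<forall>y. norm (y - x) < d \<longrightarrow> norm (conv h f y - conv h f x - ?L (y - x)) \<le> e * norm (y - x)"
    using d(1) by blast
qed

lemma conv_Ck:
  assumes h: "integrable lborel h" and f: "test_fun UNIV f"
  shows "Ck k (conv h f)"
  using f
proof (induction k arbitrary: f)
  case 0
  have "continuous (at x) (conv h f)" for x
    using conv_has_derivative[OF h 0] by (rule has_derivative_continuous)
  then show ?case by (simp add: continuous_at_imp_continuous_on)
next
  case (Suc k)
  have eq: "(\<lambda>x. \<Sum>b'\<in>Basis. (b \<bullet> b') *\<^sub>R conv h (\<lambda>x. frechet_derivative f (at x) b') x)
      = conv h (\<lambda>x. frechet_derivative f (at x) b)" if "b \<in> Basis" for b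
  proof
    fix x
    have "(\<Sum>b'\<in>Basis. (b \<bullet> b') *\<^sub>R conv h (\<lambda>x. frechet_derivative f (at x) b') x)
      = (\<Sum>b'\<in>Basis. if b' = b then conv h (\<lambda>x. frechet_derivative f (at x) b') x else 0)"
      using that by (intro sum.cong refl) (simp add: inner_Basis)
    then show "(\<Sum>b'\<in>Basis. (b \<bullet> b') *\<^sub>R conv h (\<lambda>x. frechet_derivative f (at x) b') x)
      = conv h (\<lambda>x. frechet_derivative f (at x) b) x" using that by simp
  qed
  show ?case
  proof (rule Ck_SucI[OF conv_has_derivative[OF h Suc.prems]])
    fix b :: 'a assume b: "b \<in> Basis"
    show "Ck k (\<lambda>x. \<Sum>b'\<in>Basis. (b \<bullet> b') *\<^sub>R conv h (\<lambda>x. frechet_derivative f (at x) b') x)"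
      unfolding eq[OF b] by (rule Suc.IH[OF test_fun_deriv[OF Suc.prems b]])
  qed
qed

text \<open>The support of a convolution lies in the sum of the two supports, which is
  compact.\<close>

lemma conv_test_fun:
  assumes h: "integrable lborel h" and f: "test_fun UNIV f"
    and A: "compact A" "\<And>x. x \<notin> A \<Longrightarrow> h x = 0" and K: "compact K" "\<And>x. x \<notin> K \<Longrightarrow> f x = 0"
    and sub: "\<And>a k. a \<in> A \<Longrightarrow> k \<in> K \<Longrightarrow> a + k \<in> \<Omega>"
  shows "test_fun \<Omega> (conv h f)"
proof (rule test_funI[OF conv_Ck[OF h f]])
  let ?S = "{a + k |a k. a \<in> A \<and> k \<in> K}"
  show "compact ?S" by (rule compact_sums[OF A(1) K(1)])
  show "?S \<subseteq> \<Omega>" using sub by blast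
  show "conv h f x = 0" if x: "x \<notin> ?S" for x
  proof -
    have "h y * f (x - y) = 0" for y
    proof (cases "y \<in> A \<and> x - y \<in> K")
      case True
      then have "y + (x - y) \<in> ?S" by blast
      then show ?thesis using x by simp
    next
      case False
      then show ?thesis using A(2)[of y] K(2)[of "x - y"] by auto
    qed
    then show ?thesis unfolding conv_def by (simp only: Bochner_Integration.integral_zero)
  qed
qed

section \<open>The Fourier transform\<close>

lemma norm_ee [simp]: "norm (exp (- (\<i> * complex_of_real r))) = 1" "norm (exp (\<i> * complex_of_real r)) = 1"
  by (simp_all add: norm_exp_eq_Re)

lemma ee_measurable [measurable]:
  "(\<lambda>x. exp (- (\<i> * complex_of_real (\<xi> \<bullet> x)))) \<in> borel_measurable (borel :: 'a::euclidean_space measure)"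
  by (intro borel_measurable_continuous_onI continuous_intros)

lemma integrable_ee_mult:
  fixes u :: "'a::euclidean_space \<Rightarrow> complex"
  assumes "integrable lborel u"
  shows "integrable lborel (\<lambda>x. exp (- (\<i> * complex_of_real (\<xi> \<bullet> x))) * u x)"
proof (rule Bochner_Integration.integrable_bound[OF assms])
  show "(\<lambda>x. exp (- (\<i> * complex_of_real (\<xi> \<bullet> x))) * u x) \<in> borel_measurable lborel"
    using assms by measurable
qed (simp add: norm_mult)

abbreviation fconst :: "'a::euclidean_space itself \<Rightarrow> real" where
  "fconst _ \<equiv> (2 * pi) powr (- real DIM('a) / 2)"

lemma fourier_eq: "fourier (u :: 'a::euclidean_space \<Rightarrow> complex) \<xi> = of_real (fconst TYPE('a)) *
     (LINT x|lborel. exp (- (\<i> * of_real (\<xi> \<bullet> x))) * u x)"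
  by (simp add: fourier_def)

lemma fourier_zero: "fourier (\<lambda>x. 0) = (\<lambda>\<xi>. 0)"
  by (simp add: fourier_eq fun_eq_iff)

lemma fourier_add: "integrable lborel u \<Longrightarrow> integrable lborel v \<Longrightarrow>
    fourier (\<lambda>x. u x + v x) \<xi> = fourier u \<xi> + fourier v \<xi>"
  unfolding fourier_eq distrib_left
  by (simp only: Bochner_Integration.integral_add integrable_ee_mult distrib_left)

lemma fourier_diff: "integrable lborel u \<Longrightarrow> integrable lborel v \<Longrightarrow>
    fourier (\<lambda>x. u x - v x) \<xi> = fourier u \<xi> - fourier v \<xi>"
  unfolding fourier_eq right_diff_distrib
  by (simp only: Bochner_Integration.integral_diff integrable_ee_mult right_diff_distrib)

lemma fourier_scale: "fourier (\<lambda>x. c * u x) \<xi> = c * fourier u \<xi>"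
  unfolding fourier_eq by (simp add: mult.left_commute[of _ c])

lemma norm_fourier_le:
  fixes u :: "'a::euclidean_space \<Rightarrow> complex"
  shows "norm (fourier u \<xi>) \<le> fconst TYPE('a) * (LINT x|lborel. norm (u x))"
proof -
  have "norm (LINT x|lborel. exp (- (\<i> * of_real (\<xi> \<bullet> x))) * u x) \<le> (LINT x|lborel. norm (u x))"
    using integral_norm_bound[of lborel "\<lambda>x. exp (- (\<i> * of_real (\<xi> \<bullet> x))) * u x"]
    by (simp add: norm_mult)
  then show ?thesis
    unfolding fourier_eq by (simp add: norm_mult mult_left_mono)
qed

lemma fourier_measurable [measurable]:
  fixes u :: "'a::euclidean_space \<Rightarrow> complex"
  assumes [measurable]: "u \<in> borel_measurable lborel"
  shows "fourier u \<in> borel_measurable borel"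
proof -
  have "(\<lambda>(\<xi>::'a, x). exp (- (\<i> * complex_of_real (\<xi> \<bullet> x))) * u x) \<in> borel_measurable (borel \<Otimes>\<^sub>M lborel)"
    by measurable
  then have "(\<lambda>\<xi>::'a. LINT x|lborel. exp (- (\<i> * of_real (\<xi> \<bullet> x))) * u x) \<in> borel_measurable borel"
    by (rule lborel.borel_measurable_lebesgue_integral)
  then show ?thesis unfolding fourier_eq[abs_def] by measurable
qed

text \<open>The product of the moduli of \<open>h\<close> and \<open>g\<close> is an integrable
  majorant on the product space. The kernels in question are complex exponentials, so
  \<open>B = 1\<close> in the applications.\<close>

lemma Fubini_bounded_kernel:
  fixes h :: "'a::euclidean_space \<Rightarrow> complex" and g :: "'b::euclidean_space \<Rightarrow> complex"
  assumes h: "integrable lborel h" and g: "integrable lborel g"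
    and k [measurable]: "(\<lambda>(x, y). k x y) \<in> borel_measurable (lborel \<Otimes>\<^sub>M lborel)"
    and B: "\<And>x y. norm (k x y) \<le> B"
  shows "(LINT x|lborel. h x * (LINT y|lborel. k x y * g y)) = (LINT y|lborel. g y * (LINT x|lborel. k x y * h x))"
proof -
  have [measurable]: "h \<in> borel_measurable lborel" "g \<in> borel_measurable lborel"
    using h g by (simp_all add: borel_measurable_integrable)
  have bnd: "norm (h x * (k x y * g y)) \<le> norm (B * (norm (h x) * norm (g y)))" for x y
  proof -
    have "norm (h x * (k x y * g y)) = norm (k x y) * (norm (h x) * norm (g y))" by (simp add: norm_mult)
    also have "\<dots> \<le> B * (norm (h x) * norm (g y))" by (intro mult_right_mono B) simp
    also have "\<dots> \<le> norm \<dots>" by simp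
    finally show ?thesis .
  qed
  have m: "(\<lambda>(x, y). h x * (k x y * g y)) \<in> borel_measurable (lborel \<Otimes>\<^sub>M lborel)" by measurable
  have "integrable (lborel \<Otimes>\<^sub>M lborel) (\<lambda>p. B * (norm (h (fst p)) * norm (g (snd p))))"
  proof (rule lborel_pair.Fubini_integrable)
    have "(\<lambda>x. LINT y|lborel. norm (B * (norm (h (fst (x, y))) * norm (g (snd (x, y))))))
       = (\<lambda>x. (\<bar>B\<bar> * (LINT y|lborel. norm (g y))) * norm (h x))"
      by (rule ext) (simp add: abs_mult)
    then show "integrable lborel (\<lambda>x. LINT y|lborel. norm (B * (norm (h (fst (x, y))) * norm (g (snd (x, y))))))"
      using h by simp
    show "AE x in lborel. integrable lborel (\<lambda>y. B * (norm (h (fst (x, y))) * norm (g (snd (x, y)))))"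
      using g by simp
  qed measurable
  then have "integrable (lborel \<Otimes>\<^sub>M lborel) (\<lambda>(x, y). h x * (k x y * g y))"
    by (rule Bochner_Integration.integrable_bound[OF _ m]) (use bnd in \<open>auto intro!: AE_I2\<close>)
  from lborel_pair.Fubini_integral[OF this]
  have "(LINT y|lborel. LINT x|lborel. h x * (k x y * g y)) = (LINT x|lborel. LINT y|lborel. h x * (k x y * g y))" .
  moreover have "(LINT x|lborel. h x * (k x y * g y)) = g y * (LINT x|lborel. k x y * h x)" for y
  proof -
    have "(LINT x|lborel. h x * (k x y * g y)) = (LINT x|lborel. g y * (k x y * h x))"
      by (simp only: mult_ac)
    then show ?thesis by simp
  qed
  ultimately show ?thesis by simp
qed

subsection \<open>Gaussians\<close>

text \<open>The characteristic function of the standard normal distribution, after the substitution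
  that multiplies the variable by \<open>c = sqrt (2 * \<tau>)\<close>.\<close>

lemma gauss_integral_real:
  fixes \<tau> \<xi> :: real
  assumes \<tau>: "\<tau> > 0"
  shows "integrable lborel (\<lambda>x::real. exp (- (\<i> * complex_of_real (\<xi> * x))) * of_real (exp (- \<tau> * x\<^sup>2)))"
    and "(LINT x|lborel. exp (- (\<i> * complex_of_real (\<xi> * x))) * of_real (exp (- \<tau> * x\<^sup>2)))
       = of_real (sqrt (pi / \<tau>) * exp (- \<xi>\<^sup>2 / (4 * \<tau>)))"
proof -
  define c where "c = sqrt (2 * \<tau>)"
  have c: "c > 0" "c\<^sup>2 = 2 * \<tau>" using \<tau> by (auto simp: c_def)
  let ?F = "\<lambda>x. std_normal_density x *\<^sub>R exp (\<i> * complex_of_real (- \<xi> / c * x))"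
  have iF: "integrable lborel ?F"
  proof (rule Bochner_Integration.integrable_bound[OF integrable_normal_density[of 1 0]])
    show "?F \<in> borel_measurable lborel" by measurable
  qed (auto intro!: AE_I2)
  have FF: "?F (0 + c * x) = of_real (1 / sqrt (2 * pi)) * (exp (- (\<i> * complex_of_real (\<xi> * x))) * of_real (exp (- \<tau> * x\<^sup>2)))" for x
  proof -
    have "(c * x)\<^sup>2 / 2 = \<tau> * x\<^sup>2" using c by (simp add: power_mult_distrib)
    then have "std_normal_density (c * x) = 1 / sqrt (2 * pi) * exp (- \<tau> * x\<^sup>2)"
      by (simp add: std_normal_density_def)
    moreover have "- \<xi> / c * (c * x) = - (\<xi> * x)" using c by simp
    ultimately show ?thesis
      by (simp add: scaleR_conv_of_real mult.commute mult.left_commute)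
  qed
  have "integrable lborel (\<lambda>x. ?F (0 + c * x))"
    by (rule lborel_integrable_real_affine[OF iF]) (use c in simp)
  then have "integrable lborel (\<lambda>x. of_real (1 / sqrt (2 * pi)) * (exp (- (\<i> * complex_of_real (\<xi> * x))) * of_real (exp (- \<tau> * x\<^sup>2))))"
    unfolding FF .
  then have "integrable lborel (\<lambda>x. of_real (sqrt (2 * pi)) * (of_real (1 / sqrt (2 * pi)) * (exp (- (\<i> * complex_of_real (\<xi> * x))) * of_real (exp (- \<tau> * x\<^sup>2)))))"
    by (rule integrable_mult_right)
  moreover have s: "complex_of_real (sqrt (2 * pi)) * (of_real (1 / sqrt (2 * pi)) * z) = z" for z
    unfolding mult.assoc[symmetric] of_real_mult[symmetric] by simp
  ultimately show "integrable lborel (\<lambda>x. exp (- (\<i> * complex_of_real (\<xi> * x))) * of_real (exp (- \<tau> * x\<^sup>2)))"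
    by (simp only: s)
  have "complex_of_real (exp (- (- \<xi> / c)\<^sup>2 / 2)) = char std_normal_distribution (- \<xi> / c)"
    by (simp only: char_std_normal_distribution)
  also have "\<dots> = (LINT x|lborel. ?F x)"
    unfolding char_def by (subst integral_density) (auto simp: mult.commute)
  also have "\<dots> = \<bar>c\<bar> *\<^sub>R (LINT x|lborel. ?F (0 + c * x))"
    by (rule lborel_integral_real_affine) (use c in simp)
  also have "\<dots> = of_real (c / sqrt (2 * pi)) * (LINT x|lborel. exp (- (\<i> * complex_of_real (\<xi> * x))) * of_real (exp (- \<tau> * x\<^sup>2)))"
    unfolding FF using c by (simp add: scaleR_conv_of_real)
  finally have eq: "of_real (c / sqrt (2 * pi)) * (LINT x|lborel. exp (- (\<i> * complex_of_real (\<xi> * x))) * of_real (exp (- \<tau> * x\<^sup>2)))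
     = complex_of_real (exp (- (- \<xi> / c)\<^sup>2 / 2))" ..
  have "(- \<xi> / c)\<^sup>2 / 2 = \<xi>\<^sup>2 / (4 * \<tau>)" using c by (simp add: power_divide)
  moreover have "sqrt (2 * pi) / c = sqrt (pi / \<tau>)"
    using \<tau> unfolding c_def by (simp add: real_sqrt_divide[symmetric])
  moreover have "complex_of_real (sqrt (2 * pi) / c) * (of_real (c / sqrt (2 * pi)) * z) = z" for z
    unfolding mult.assoc[symmetric] of_real_mult[symmetric] using c by simp
  ultimately show "(LINT x|lborel. exp (- (\<i> * complex_of_real (\<xi> * x))) * of_real (exp (- \<tau> * x\<^sup>2)))
       = of_real (sqrt (pi / \<tau>) * exp (- \<xi>\<^sup>2 / (4 * \<tau>)))"
    using arg_cong[OF eq, of "\<lambda>z. complex_of_real (sqrt (2 * pi) / c) * z"]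
    by (metis (no_types, lifting) minus_divide_left of_real_mult)
qed

text \<open>Lebesgue measure on the Euclidean space is the image of a product of one-dimensional
  Lebesgue measures under the coordinate map.\<close>

lemma lborel_integral_prod_Basis:
  fixes h :: "'a::euclidean_space \<Rightarrow> real \<Rightarrow> complex"
  assumes h: "\<And>b. b \<in> Basis \<Longrightarrow> integrable lborel (h b)"
  shows "integrable lborel (\<lambda>x::'a. \<Prod>b\<in>Basis. h b (x \<bullet> b))"
    and "(LINT x|lborel. (\<Prod>b\<in>Basis. h b ((x::'a) \<bullet> b))) = (\<Prod>b\<in>Basis. LINT y|lborel. h b y)"
proof -
  interpret product_sigma_finite "\<lambda>_::'a. lborel :: real measure" ..
  let ?T = "\<lambda>f. (\<Sum>b\<in>Basis. f b *\<^sub>R b) :: 'a"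
  have T: "?T \<in> (\<Pi>\<^sub>M b\<in>Basis. lborel) \<rightarrow>\<^sub>M borel" by measurable
  have [measurable]: "h b \<in> borel_measurable borel" if "b \<in> Basis" for b
    using borel_measurable_integrable[OF h[OF that]] by simp
  have m: "(\<lambda>x::'a. \<Prod>b\<in>Basis. h b (x \<bullet> b)) \<in> borel_measurable borel" by measurable
  have eq: "(\<Prod>b\<in>Basis. h b (?T f \<bullet> b)) = (\<Prod>b\<in>Basis. h b (f b))" for f
    by (intro prod.cong refl) simp
  have "integrable (distr (\<Pi>\<^sub>M b\<in>Basis. lborel) borel ?T) (\<lambda>x. \<Prod>b\<in>Basis. h b (x \<bullet> b))"
    unfolding integrable_distr_eq[OF T m] eq
    by (rule product_integrable_prod) (use h in auto)
  then show "integrable lborel (\<lambda>x::'a. \<Prod>b\<in>Basis. h b (x \<bullet> b))" by (simp only: lborel_eq[symmetric])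
  have "(LINT x|distr (\<Pi>\<^sub>M b\<in>Basis. lborel) borel ?T. (\<Prod>b\<in>Basis. h b (x \<bullet> b)))
     = (\<Prod>b\<in>Basis. LINT y|lborel. h b y)"
    unfolding integral_distr[OF T m] eq
    by (rule product_integral_prod) (use h in auto)
  then show "(LINT x|lborel. (\<Prod>b\<in>Basis. h b ((x::'a) \<bullet> b))) = (\<Prod>b\<in>Basis. LINT y|lborel. h b y)"
    by (simp only: lborel_eq[symmetric])
qed

lemma gauss_integral:
  fixes \<xi> :: "'a::euclidean_space" and \<tau> :: real
  assumes \<tau>: "\<tau> > 0"
  shows "integrable lborel (\<lambda>x. exp (- (\<i> * complex_of_real (\<xi> \<bullet> x))) * of_real (exp (- \<tau> * (norm x)\<^sup>2)))" (is ?A)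
    and "(LINT x|lborel. exp (- (\<i> * complex_of_real (\<xi> \<bullet> x))) * of_real (exp (- \<tau> * (norm x)\<^sup>2)))
       = of_real ((pi / \<tau>) powr (real DIM('a) / 2) * exp (- (norm \<xi>)\<^sup>2 / (4 * \<tau>)))" (is ?B)
proof -
  let ?h = "\<lambda>b y. exp (- (\<i> * complex_of_real ((\<xi> \<bullet> b) * y))) * of_real (exp (- \<tau> * y\<^sup>2))"
  have nrm: "(norm x)\<^sup>2 = (\<Sum>b\<in>Basis. (x \<bullet> b)\<^sup>2)" for x :: 'a
    by (subst power2_norm_eq_inner, subst euclidean_inner) (simp add: power2_eq_square)
  have eq: "exp (- (\<i> * complex_of_real (\<xi> \<bullet> x))) * of_real (exp (- \<tau> * (norm x)\<^sup>2)) = (\<Prod>b\<in>Basis. ?h b (x \<bullet> b))" for x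
  proof -
    have "exp (- (\<i> * complex_of_real (\<xi> \<bullet> x))) = (\<Prod>b\<in>Basis. exp (- (\<i> * complex_of_real ((\<xi> \<bullet> b) * (x \<bullet> b)))))"
      unfolding euclidean_inner[of \<xi> x] of_real_sum sum_distrib_left sum_negf[symmetric] by (rule exp_sum) simp
    moreover have "complex_of_real (exp (- \<tau> * (norm x)\<^sup>2)) = (\<Prod>b\<in>Basis. of_real (exp (- \<tau> * (x \<bullet> b)\<^sup>2)))"
      unfolding nrm sum_distrib_left of_real_prod[symmetric] by (subst exp_sum) simp_all
    ultimately show ?thesis by (simp only: prod.distrib)
  qed
  note P = lborel_integral_prod_Basis[of ?h, OF gauss_integral_real(1)[OF \<tau>]]
  show ?A unfolding eq by (rule P(1))
  have "(\<Prod>b\<in>(Basis::'a set). LINT y|lborel. ?h b y)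
      = of_real (\<Prod>b\<in>(Basis::'a set). sqrt (pi / \<tau>) * exp (- (\<xi> \<bullet> b)\<^sup>2 / (4 * \<tau>)))"
    unfolding gauss_integral_real(2)[OF \<tau>] of_real_prod ..
  also have "(\<Prod>b\<in>(Basis::'a set). sqrt (pi / \<tau>) * exp (- (\<xi> \<bullet> b)\<^sup>2 / (4 * \<tau>)))
      = sqrt (pi / \<tau>) ^ DIM('a) * exp (\<Sum>b\<in>(Basis::'a set). - (\<xi> \<bullet> b)\<^sup>2 / (4 * \<tau>))"
    by (simp add: prod.distrib exp_sum)
  also have "(\<Sum>b\<in>(Basis::'a set). - (\<xi> \<bullet> b)\<^sup>2 / (4 * \<tau>)) = - (norm \<xi>)\<^sup>2 / (4 * \<tau>)"
    unfolding nrm sum_divide_distrib[symmetric] sum_negf ..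
  also have "sqrt (pi / \<tau>) ^ DIM('a) = (pi / \<tau>) powr (real DIM('a) / 2)"
    using \<tau> by (simp add: powr_half_sqrt[symmetric] powr_realpow[symmetric] powr_powr)
  finally show ?B unfolding eq P(2) .
qed

definition heat :: "real \<Rightarrow> 'a::euclidean_space \<Rightarrow> real" where
  "heat \<tau> x = (4 * pi * \<tau>) powr (- real DIM('a) / 2) * exp (- (norm x)\<^sup>2 / (4 * \<tau>))"

lemma heat_nonneg [simp]: "0 \<le> heat \<tau> x"
  by (simp add: heat_def)

lemma heat_measurable [measurable]: "heat \<tau> \<in> borel_measurable borel"
  unfolding heat_def[abs_def] by measurable

lemma heat_fourier:
  fixes \<xi> :: "'a::euclidean_space"
  assumes \<tau>: "\<tau> > 0"
  shows "integrable lborel (\<lambda>x. exp (- (\<i> * complex_of_real (\<xi> \<bullet> x))) * of_real (heat \<tau> x))"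
    and "(LINT x|lborel. exp (- (\<i> * complex_of_real (\<xi> \<bullet> x))) * of_real (heat \<tau> x)) = of_real (exp (- \<tau> * (norm \<xi>)\<^sup>2))"
proof -
  let ?d = "real DIM('a) / 2"
  have t4: "1 / (4 * \<tau>) > 0" using \<tau> by simp
  have eq: "exp (- (\<i> * complex_of_real (\<xi> \<bullet> x))) * of_real (heat \<tau> x) = of_real ((4 * pi * \<tau>) powr - ?d) *
      (exp (- (\<i> * complex_of_real (\<xi> \<bullet> x))) * of_real (exp (- (1 / (4 * \<tau>)) * (norm x)\<^sup>2)))" for x :: 'a
    by (simp add: heat_def mult.commute mult.left_commute)
  show "integrable lborel (\<lambda>x. exp (- (\<i> * complex_of_real (\<xi> \<bullet> x))) * of_real (heat \<tau> x))"
    unfolding eq by (intro integrable_mult_right gauss_integral(1)[OF t4])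
  have "(4 * pi * \<tau>) powr - ?d * (pi / (1 / (4 * \<tau>))) powr ?d = 1"
    using \<tau> by (simp add: powr_minus field_simps)
  then have "of_real ((4 * pi * \<tau>) powr - ?d) * complex_of_real ((pi / (1 / (4 * \<tau>))) powr ?d * exp (- (norm \<xi>)\<^sup>2 / (4 * (1 / (4 * \<tau>)))))
     = of_real (exp (- \<tau> * (norm \<xi>)\<^sup>2))"
    unfolding of_real_mult[symmetric] mult.assoc[symmetric] using \<tau> by (simp add: mult.commute)
  then show "(LINT x|lborel. exp (- (\<i> * complex_of_real (\<xi> \<bullet> x))) * of_real (heat \<tau> x)) = of_real (exp (- \<tau> * (norm \<xi>)\<^sup>2))"
    unfolding eq integral_mult_right_zero gauss_integral(2)[OF t4] .
qed

lemma heat_integral: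
  assumes "\<tau> > 0"
  shows "integrable lborel (heat \<tau> :: 'a::euclidean_space \<Rightarrow> real)" "(LINT x|lborel. heat \<tau> (x::'a)) = 1"
    "(\<integral>\<^sup>+ x. ennreal (heat \<tau> (x::'a)) \<partial>lborel) = 1"
proof -
  have "integrable lborel (\<lambda>x::'a. complex_of_real (heat \<tau> x))"
    using heat_fourier(1)[OF assms, of "0::'a"] by simp
  from integrable_Re[OF this] show i: "integrable lborel (heat \<tau> :: 'a \<Rightarrow> real)" by simp
  have "complex_of_real (LINT x|lborel. heat \<tau> (x::'a)) = 1"
    using heat_fourier(2)[OF assms, of "0::'a"] by simp
  then show I: "(LINT x|lborel. heat \<tau> (x::'a)) = 1" by (simp only: of_real_eq_1_iff)
  have "(\<integral>\<^sup>+ x. ennreal (heat \<tau> (x::'a)) \<partial>lborel) = ennreal (LINT x|lborel. heat \<tau> (x::'a))"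
    by (rule nn_integral_eq_integral[OF i AE_I2[OF heat_nonneg]])
  then show "(\<integral>\<^sup>+ x. ennreal (heat \<tau> (x::'a)) \<partial>lborel) = 1"
    by (simp only: I ennreal_1)
qed

text \<open>Fourier inversion for Gaussians. Two normalising factors
  \<open>(2 * pi) powr (- n/2)\<close> and the factor \<open>(pi / \<tau>) powr (n/2)\<close> of the
  integral multiply to \<open>(4 * pi * \<tau>) powr (- n/2)\<close>.\<close>

lemma gauss_integral_heat:
  fixes z :: "'a::euclidean_space"
  assumes "\<tau> > 0"
  shows "of_real ((fconst TYPE('a))\<^sup>2) * (LINT \<xi>|lborel. exp (- (\<i> * complex_of_real (z \<bullet> \<xi>))) * of_real (exp (- \<tau> * (norm \<xi>)\<^sup>2)))
     = of_real (heat \<tau> z)"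
proof -
  let ?d = "real DIM('a) / 2"
  have "(fconst TYPE('a))\<^sup>2 * (pi / \<tau>) powr ?d = (4 * pi * \<tau>) powr - ?d"
  proof -
    have "(fconst TYPE('a))\<^sup>2 = (2 * pi) powr - ?d * (2 * pi) powr - ?d"
      by (simp add: power2_eq_square)
    also have "\<dots> = (2 * pi * (2 * pi)) powr - ?d"
      by (rule powr_mult[symmetric])
    finally have 1: "(fconst TYPE('a))\<^sup>2 = (2 * pi * (2 * pi)) powr - ?d" .
    have 2: "(pi / \<tau>) powr ?d = (\<tau> / pi) powr - ?d"
      using assms by (simp add: powr_minus powr_divide)
    have "(2 * pi * (2 * pi)) powr - ?d * (\<tau> / pi) powr - ?d = (2 * pi * (2 * pi) * (\<tau> / pi)) powr - ?d"
      by (rule powr_mult[symmetric])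
    also have "2 * pi * (2 * pi) * (\<tau> / pi) = 4 * pi * \<tau>" by simp
    finally have 3: "(2 * pi * (2 * pi)) powr - ?d * (\<tau> / pi) powr - ?d = (4 * pi * \<tau>) powr - ?d" .
    show ?thesis unfolding 1 2 by (rule 3)
  qed
  then show ?thesis
    unfolding gauss_integral(2)[OF assms] heat_def of_real_mult[symmetric] mult.assoc[symmetric]
    by (simp only: minus_divide_left)
qed

subsection \<open>Plancherel's theorem\<close>

lemma lborel_integral_affine:
  fixes f :: "'a::euclidean_space \<Rightarrow> 'b::{banach, second_countable_topology}"
  assumes c: "c \<noteq> 0" and f: "f \<in> borel_measurable borel"
  shows "(LINT x|lborel. f x) = (\<bar>c\<bar> ^ DIM('a)) *\<^sub>R (LINT x|lborel. f (t + c *\<^sub>R x))"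
proof -
  have T: "(\<lambda>x::'a. t + c *\<^sub>R x) \<in> lborel \<rightarrow>\<^sub>M borel" by measurable
  have "(LINT x|lborel. f x) = (LINT x|density (distr lborel borel (\<lambda>x. t + c *\<^sub>R x)) (\<lambda>_. ennreal (\<bar>c\<bar> ^ DIM('a))). f x)"
    by (subst lborel_affine[OF c, of t]) (simp add: ennreal_power)
  also have "\<dots> = (LINT x|distr lborel borel (\<lambda>x. t + c *\<^sub>R x). (\<bar>c\<bar> ^ DIM('a)) *\<^sub>R f x)"
    by (rule integral_density) (use f in \<open>auto intro!: AE_I2\<close>)
  also have "\<dots> = (LINT x|lborel. (\<bar>c\<bar> ^ DIM('a)) *\<^sub>R f (t + c *\<^sub>R x))"
    by (rule integral_distr[OF T]) (use f in measurable)
  finally show ?thesis by simp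
qed

lemma lborel_nn_integral_affine:
  fixes f :: "'a::euclidean_space \<Rightarrow> ennreal"
  assumes c: "c \<noteq> 0" and f: "f \<in> borel_measurable borel"
  shows "(\<integral>\<^sup>+ x. f x \<partial>lborel) = ennreal (\<bar>c\<bar> ^ DIM('a)) * (\<integral>\<^sup>+ x. f (t + c *\<^sub>R x) \<partial>lborel)"
proof -
  have T: "(\<lambda>x::'a. t + c *\<^sub>R x) \<in> lborel \<rightarrow>\<^sub>M borel" by measurable
  have "(\<integral>\<^sup>+ x. f x \<partial>lborel) = (\<integral>\<^sup>+ x. f x \<partial>density (distr lborel borel (\<lambda>x. t + c *\<^sub>R x)) (\<lambda>_. ennreal (\<bar>c\<bar> ^ DIM('a))))"
    by (subst lborel_affine[OF c, of t]) (simp add: ennreal_power)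
  also have "\<dots> = (\<integral>\<^sup>+ x. ennreal (\<bar>c\<bar> ^ DIM('a)) * f x \<partial>distr lborel borel (\<lambda>x. t + c *\<^sub>R x))"
    by (rule nn_integral_density) (use f in auto)
  also have "\<dots> = (\<integral>\<^sup>+ x. ennreal (\<bar>c\<bar> ^ DIM('a)) * f (t + c *\<^sub>R x) \<partial>lborel)"
    by (rule nn_integral_distr[OF T]) (use f in measurable)
  also have "\<dots> = ennreal (\<bar>c\<bar> ^ DIM('a)) * (\<integral>\<^sup>+ x. f (t + c *\<^sub>R x) \<partial>lborel)"
    by (rule nn_integral_cmult) (use f in measurable)
  finally show ?thesis .
qed

lemma lborel_integrable_affine:
  fixes f :: "'a::euclidean_space \<Rightarrow> 'b::{banach, second_countable_topology}"
  assumes c: "c \<noteq> 0" and f: "integrable lborel f"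
  shows "integrable lborel (\<lambda>x. f (t + c *\<^sub>R x))"
proof -
  have m: "f \<in> borel_measurable borel" using borel_measurable_integrable[OF f] by simp
  have "ennreal (\<bar>c\<bar> ^ DIM('a)) * (\<integral>\<^sup>+ x. ennreal (norm (f (t + c *\<^sub>R x))) \<partial>lborel) < \<infinity>"
    using f lborel_nn_integral_affine[OF c, of "\<lambda>x. ennreal (norm (f x))" t] m
    by (simp add: integrable_iff_bounded)
  then have "(\<integral>\<^sup>+ x. ennreal (norm (f (t + c *\<^sub>R x))) \<partial>lborel) < \<infinity>"
    using c by (auto simp: ennreal_mult_less_top)
  moreover have [measurable]: "f \<in> borel_measurable borel" by (rule m)
  have "(\<lambda>x. f (t + c *\<^sub>R x)) \<in> borel_measurable lborel" by measurable
  ultimately show ?thesis by (rule integrableI_bounded[rotated])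
qed

lemma heat_scale:
  fixes w :: "'a::euclidean_space"
  assumes "c > 0" shows "c ^ DIM('a) * heat (c\<^sup>2) (c *\<^sub>R w) = heat 1 w"
proof -
  let ?d = "real DIM('a) / 2"
  have p1: "(4 * pi * c\<^sup>2) powr - ?d = (4 * pi) powr - ?d * (c\<^sup>2) powr - ?d" by (rule powr_mult)
  have p2: "(c\<^sup>2) powr - ?d * c ^ DIM('a) = 1"
  proof -
    have "(c\<^sup>2) powr - ?d = (c powr 2) powr - ?d" using assms by simp
    also have "\<dots> = c powr - real DIM('a)" by (simp add: powr_powr)
    finally show ?thesis using assms by (simp add: powr_minus powr_realpow)
  qed
  have p3: "(norm (c *\<^sub>R w))\<^sup>2 / (4 * c\<^sup>2) = (norm w)\<^sup>2 / 4"
    using assms by (simp add: power_mult_distrib)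
  have "c ^ DIM('a) * ((4 * pi) powr - ?d * (c\<^sup>2) powr - ?d * E) = ((c\<^sup>2) powr - ?d * c ^ DIM('a)) * ((4 * pi) powr - ?d * E)" for E :: real
    by (simp only: mult_ac)
  then have p4: "c ^ DIM('a) * ((4 * pi) powr - ?d * (c\<^sup>2) powr - ?d * E) = (4 * pi) powr - ?d * E" for E :: real
    by (simp only: p2 mult_1_left)
  show ?thesis
    unfolding heat_def minus_divide_left[symmetric] p1 p3 p4 by simp
qed

lemma cnj_ee [simp]: "cnj (exp (- (\<i> * complex_of_real r))) = exp (\<i> * complex_of_real r)"
  by (simp add: exp_cnj)

lemma integral_norm_bound_ennreal':
  fixes f :: "'b \<Rightarrow> 'c::{banach, second_countable_topology}"
  shows "ennreal (norm (integral\<^sup>L M f)) \<le> (\<integral>\<^sup>+ x. ennreal (norm (f x)) \<partial>M)"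
  by (cases "integrable M f") (auto intro: integral_norm_bound_ennreal simp: not_integrable_integral_eq)

text \<open>The Gaussian factor makes the frequency integral absolutely convergent, so the order of
  integration can be exchanged twice. What remains of the frequency integral is a heat kernel in
  \<open>x - y\<close>.\<close>

lemma damped_Plancherel:
  fixes f :: "'a::euclidean_space \<Rightarrow> complex"
  assumes f: "integrable lborel f" and \<tau>: "\<tau> > 0"
  shows "of_real (LINT \<xi>|lborel. (norm (fourier f \<xi>))\<^sup>2 * exp (- \<tau> * (norm \<xi>)\<^sup>2))
     = (LINT x|lborel. f x * (LINT y|lborel. cnj (f y) * of_real (heat \<tau> (x - y))))"
    and "integrable lborel (\<lambda>\<xi>. (norm (fourier f \<xi>))\<^sup>2 * exp (- \<tau> * (norm \<xi>)\<^sup>2))"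
proof -
  let ?\<kappa> = "complex_of_real (fconst TYPE('a))"
  let ?G = "\<lambda>\<xi>::'a. complex_of_real (exp (- \<tau> * (norm \<xi>)\<^sup>2))"
  let ?e = "\<lambda>(\<xi>::'a) x. exp (- (\<i> * complex_of_real (\<xi> \<bullet> x)))"
  have [measurable]: "f \<in> borel_measurable lborel" by (rule borel_measurable_integrable[OF f])
  have G: "integrable lborel ?G" using gauss_integral(1)[OF \<tau>, of "0::'a"] by simp
  define B where "B = fconst TYPE('a) * (LINT x|lborel. norm (f x))"
  have B: "norm (fourier f \<xi>) \<le> B" for \<xi> unfolding B_def by (rule norm_fourier_le)
  have [measurable]: "fourier f \<in> borel_measurable borel" by (rule fourier_measurable) simp
  have H: "integrable lborel (\<lambda>\<xi>. ?G \<xi> * cnj (fourier f \<xi>))"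
    by (rule integrable_mult_bounded[OF G]) (use B in \<open>simp_all\<close>)
  have ker: "(\<lambda>(\<xi>::'a, x). ?e \<xi> x) \<in> borel_measurable (lborel \<Otimes>\<^sub>M lborel)"
    "(\<lambda>(x, \<xi>::'a). ?e \<xi> x) \<in> borel_measurable (lborel \<Otimes>\<^sub>M lborel)"
    "(\<lambda>(\<xi>::'a, x). cnj (?e \<xi> x)) \<in> borel_measurable (lborel \<Otimes>\<^sub>M lborel)"
    by measurable
  have inner: "(LINT \<xi>|lborel. ?e \<xi> x * (?G \<xi> * cnj (fourier f \<xi>)))
      = ?\<kappa> * (LINT y|lborel. cnj (f y) * (LINT \<xi>|lborel. ?e (x - y) \<xi> * ?G \<xi>))" for x
  proof -
    have cf: "integrable lborel (\<lambda>y. cnj (f y))" using f by simp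
    have eG: "integrable lborel (\<lambda>\<xi>. ?e x \<xi> * ?G \<xi>)" by (rule integrable_ee_mult[OF G])
    have c1: "cnj (fourier f \<xi>) = ?\<kappa> * (LINT y|lborel. cnj (?e \<xi> y) * cnj (f y))" for \<xi>
      unfolding fourier_eq complex_cnj_mult Bochner_Integration.integral_cnj[symmetric] by simp
    have "(LINT \<xi>|lborel. ?e \<xi> x * (?G \<xi> * cnj (fourier f \<xi>)))
        = (LINT \<xi>|lborel. ?\<kappa> * ((?e x \<xi> * ?G \<xi>) * (LINT y|lborel. cnj (?e \<xi> y) * cnj (f y))))"
      unfolding c1 inner_commute[of x] by (simp only: mult_ac)
    also have "\<dots> = ?\<kappa> * (LINT \<xi>|lborel. (?e x \<xi> * ?G \<xi>) * (LINT y|lborel. cnj (?e \<xi> y) * cnj (f y)))"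
      by (rule integral_mult_right_zero)
    also have "(LINT \<xi>|lborel. (?e x \<xi> * ?G \<xi>) * (LINT y|lborel. cnj (?e \<xi> y) * cnj (f y)))
        = (LINT y|lborel. cnj (f y) * (LINT \<xi>|lborel. cnj (?e \<xi> y) * (?e x \<xi> * ?G \<xi>)))"
      by (rule Fubini_bounded_kernel[OF eG cf ker(3), where B = 1]) simp
    also have "(\<lambda>y. LINT \<xi>|lborel. cnj (?e \<xi> y) * (?e x \<xi> * ?G \<xi>)) = (\<lambda>y. LINT \<xi>|lborel. ?e (x - y) \<xi> * ?G \<xi>)"
    proof (rule ext, rule Bochner_Integration.integral_cong[OF refl])
      fix y \<xi> :: 'a
      have "cnj (?e \<xi> y) * ?e x \<xi> = ?e (x - y) \<xi>"
        unfolding cnj_ee exp_add[symmetric]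
        by (simp add: inner_diff_left inner_commute[of \<xi>] algebra_simps)
      then show "cnj (?e \<xi> y) * (?e x \<xi> * ?G \<xi>) = ?e (x - y) \<xi> * ?G \<xi>"
        by (simp only: mult.assoc[symmetric])
    qed
    finally show ?thesis .
  qed
  have "complex_of_real (LINT \<xi>|lborel. (norm (fourier f \<xi>))\<^sup>2 * exp (- \<tau> * (norm \<xi>)\<^sup>2))
      = (LINT \<xi>|lborel. complex_of_real ((norm (fourier f \<xi>))\<^sup>2 * exp (- \<tau> * (norm \<xi>)\<^sup>2)))"
    by (rule integral_complex_of_real[symmetric])
  also have "\<dots> = (LINT \<xi>|lborel. ?\<kappa> * ((?G \<xi> * cnj (fourier f \<xi>)) * (LINT x|lborel. ?e \<xi> x * f x)))"
  proof (rule Bochner_Integration.integral_cong[OF refl])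
    fix \<xi> :: 'a
    have "complex_of_real ((norm (fourier f \<xi>))\<^sup>2 * exp (- \<tau> * (norm \<xi>)\<^sup>2)) = fourier f \<xi> * cnj (fourier f \<xi>) * ?G \<xi>"
      by (simp only: of_real_mult complex_norm_square)
    also have "\<dots> = (?G \<xi> * cnj (fourier f \<xi>)) * fourier f \<xi>" by (simp only: mult_ac)
    also have "\<dots> = ?\<kappa> * ((?G \<xi> * cnj (fourier f \<xi>)) * (LINT x|lborel. ?e \<xi> x * f x))"
      by (simp only: fourier_eq[of f \<xi>] mult.left_commute[of "?G \<xi> * cnj _"])
    finally show "complex_of_real ((norm (fourier f \<xi>))\<^sup>2 * exp (- \<tau> * (norm \<xi>)\<^sup>2))
      = ?\<kappa> * ((?G \<xi> * cnj (fourier f \<xi>)) * (LINT x|lborel. ?e \<xi> x * f x))" .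
  qed
  also have "\<dots> = ?\<kappa> * (LINT \<xi>|lborel. (?G \<xi> * cnj (fourier f \<xi>)) * (LINT x|lborel. ?e \<xi> x * f x))"
    by (rule integral_mult_right_zero)
  also have "(LINT \<xi>|lborel. (?G \<xi> * cnj (fourier f \<xi>)) * (LINT x|lborel. ?e \<xi> x * f x))
      = (LINT x|lborel. f x * (LINT \<xi>|lborel. ?e \<xi> x * (?G \<xi> * cnj (fourier f \<xi>))))"
    by (rule Fubini_bounded_kernel[OF H f ker(1), where B = 1]) simp
  also have "?\<kappa> * \<dots> = (LINT x|lborel. ?\<kappa> * (f x * (?\<kappa> * (LINT y|lborel. cnj (f y) * (LINT \<xi>|lborel. ?e (x - y) \<xi> * ?G \<xi>)))))"
    unfolding inner by (rule integral_mult_right_zero[symmetric])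
  also have "\<dots> = (LINT x|lborel. f x * (LINT y|lborel. cnj (f y) * of_real (heat \<tau> (x - y))))"
  proof (rule Bochner_Integration.integral_cong[OF refl])
    fix x :: 'a
    have k2: "?\<kappa> * (f x * (?\<kappa> * z)) = f x * (of_real ((fconst TYPE('a))\<^sup>2) * z)" for z
      by (simp add: power2_eq_square mult.left_commute mult.assoc)
    have k3: "of_real ((fconst TYPE('a))\<^sup>2) * (cnj (f y) * z) = cnj (f y) * (of_real ((fconst TYPE('a))\<^sup>2) * z)" for y z
      by (rule mult.left_commute)
    show "?\<kappa> * (f x * (?\<kappa> * (LINT y|lborel. cnj (f y) * (LINT \<xi>|lborel. ?e (x - y) \<xi> * ?G \<xi>))))
        = f x * (LINT y|lborel. cnj (f y) * of_real (heat \<tau> (x - y)))"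
      unfolding k2 integral_mult_right_zero[symmetric] k3
      unfolding integral_mult_right_zero gauss_integral_heat[OF \<tau>] ..
  qed
  finally show "of_real (LINT \<xi>|lborel. (norm (fourier f \<xi>))\<^sup>2 * exp (- \<tau> * (norm \<xi>)\<^sup>2))
     = (LINT x|lborel. f x * (LINT y|lborel. cnj (f y) * of_real (heat \<tau> (x - y))))" .
  have "integrable lborel (\<lambda>\<xi>. (?G \<xi> * cnj (fourier f \<xi>)) * fourier f \<xi>)"
    by (rule integrable_mult_bounded[OF H _ B]) simp
  moreover have "(?G \<xi> * cnj (fourier f \<xi>)) * fourier f \<xi> = of_real ((norm (fourier f \<xi>))\<^sup>2 * exp (- \<tau> * (norm \<xi>)\<^sup>2))" for \<xi>
    by (simp only: of_real_mult complex_norm_square mult_ac)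
  ultimately have "integrable lborel (\<lambda>\<xi>. complex_of_real ((norm (fourier f \<xi>))\<^sup>2 * exp (- \<tau> * (norm \<xi>)\<^sup>2)))"
    by (simp only:)
  from integrable_Re[OF this] show "integrable lborel (\<lambda>\<xi>. (norm (fourier f \<xi>))\<^sup>2 * exp (- \<tau> * (norm \<xi>)\<^sup>2))"
    by simp
qed

lemma heat_translate_integral:
  fixes x :: "'a::euclidean_space"
  assumes \<tau>: "\<tau> > 0"
  shows "(\<integral>\<^sup>+ y. ennreal (heat \<tau> (x - y)) \<partial>lborel) = 1" "(\<integral>\<^sup>+ y. ennreal (heat \<tau> (y - x)) \<partial>lborel) = 1"
proof -
  show 1: "(\<integral>\<^sup>+ y. ennreal (heat \<tau> (x - y)) \<partial>lborel) = 1"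
    using lborel_nn_integral_affine[of "-1" "\<lambda>y. ennreal (heat \<tau> y)" x] heat_integral(3)[OF \<tau>, where 'a='a] by simp
  have "heat \<tau> (y - x) = heat \<tau> (x - y)" for y by (simp add: heat_def norm_minus_commute)
  then show "(\<integral>\<^sup>+ y. ennreal (heat \<tau> (y - x)) \<partial>lborel) = 1" using 1 by simp
qed

text \<open>Schur's estimate: \<open>norm (f x) * norm (f y)\<close> is at most half the sum of the
  squares, and the heat kernel has mass 1 in either variable.\<close>

lemma damped_Bessel:
  fixes f :: "'a::euclidean_space \<Rightarrow> complex"
  assumes f: "integrable lborel f" "sqi lborel f" and \<tau>: "\<tau> > 0"
  shows "(LINT \<xi>|lborel. (norm (fourier f \<xi>))\<^sup>2 * exp (- \<tau> * (norm \<xi>)\<^sup>2)) \<le> nsq lborel f"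
proof -
  let ?I = "LINT \<xi>|lborel. (norm (fourier f \<xi>))\<^sup>2 * exp (- \<tau> * (norm \<xi>)\<^sup>2)"
  have [measurable]: "f \<in> borel_measurable lborel" by (rule borel_measurable_integrable[OF f(1)])
  have nI: "0 \<le> ?I" by (rule integral_nonneg_AE) simp
  have "ennreal ?I = ennreal (norm (complex_of_real ?I))" using nI by simp
  also have "\<dots> = ennreal (norm (LINT x|lborel. f x * (LINT y|lborel. cnj (f y) * of_real (heat \<tau> (x - y)))))"
    by (simp only: damped_Plancherel(1)[OF f(1) \<tau>])
  also have "\<dots> \<le> (\<integral>\<^sup>+ x. ennreal (norm (f x * (LINT y|lborel. cnj (f y) * of_real (heat \<tau> (x - y))))) \<partial>lborel)"
    by (rule integral_norm_bound_ennreal') 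
  also have "\<dots> \<le> (\<integral>\<^sup>+ x. (\<integral>\<^sup>+ y. ennreal ((norm (f x))\<^sup>2 / 2 * heat \<tau> (x - y)) + ennreal ((norm (f y))\<^sup>2 / 2 * heat \<tau> (x - y)) \<partial>lborel) \<partial>lborel)"
  proof (rule nn_integral_mono)
    fix x :: 'a
    have "ennreal (norm (f x * (LINT y|lborel. cnj (f y) * of_real (heat \<tau> (x - y)))))
       = ennreal (norm (LINT y|lborel. f x * (cnj (f y) * of_real (heat \<tau> (x - y)))))"
      by simp
    also have "\<dots> \<le> (\<integral>\<^sup>+ y. ennreal (norm (f x * (cnj (f y) * of_real (heat \<tau> (x - y))))) \<partial>lborel)"
      by (rule integral_norm_bound_ennreal')
    also have "\<dots> \<le> (\<integral>\<^sup>+ y. ennreal ((norm (f x))\<^sup>2 / 2 * heat \<tau> (x - y)) + ennreal ((norm (f y))\<^sup>2 / 2 * heat \<tau> (x - y)) \<partial>lborel)"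
    proof (rule nn_integral_mono)
      fix y :: 'a
      have "norm (f x) * norm (f y) \<le> (norm (f x))\<^sup>2 / 2 + (norm (f y))\<^sup>2 / 2"
        using sum_squares_bound[of "norm (f x)" "norm (f y)"] by simp
      then have "norm (f x) * norm (f y) * heat \<tau> (x - y) \<le> ((norm (f x))\<^sup>2 / 2 + (norm (f y))\<^sup>2 / 2) * heat \<tau> (x - y)"
        by (rule mult_right_mono) simp
      then show "ennreal (norm (f x * (cnj (f y) * of_real (heat \<tau> (x - y)))))
          \<le> ennreal ((norm (f x))\<^sup>2 / 2 * heat \<tau> (x - y)) + ennreal ((norm (f y))\<^sup>2 / 2 * heat \<tau> (x - y))"
        unfolding ennreal_plus[OF mult_nonneg_nonneg[OF divide_nonneg_pos[OF zero_le_power2] heat_nonneg]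
            mult_nonneg_nonneg[OF divide_nonneg_pos[OF zero_le_power2] heat_nonneg], OF zero_less_numeral zero_less_numeral, symmetric]
        by (intro ennreal_leI) (simp add: norm_mult distrib_right mult.assoc)
    qed
    finally show "ennreal (norm (f x * (LINT y|lborel. cnj (f y) * of_real (heat \<tau> (x - y)))))
      \<le> (\<integral>\<^sup>+ y. ennreal ((norm (f x))\<^sup>2 / 2 * heat \<tau> (x - y)) + ennreal ((norm (f y))\<^sup>2 / 2 * heat \<tau> (x - y)) \<partial>lborel)" .
  qed
  also have "\<dots> = (\<integral>\<^sup>+ x. (\<integral>\<^sup>+ y. ennreal ((norm (f x))\<^sup>2 / 2 * heat \<tau> (x - y)) \<partial>lborel) + (\<integral>\<^sup>+ y. ennreal ((norm (f y))\<^sup>2 / 2 * heat \<tau> (x - y)) \<partial>lborel) \<partial>lborel)"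
    by (intro nn_integral_cong nn_integral_add) measurable
  also have "\<dots> = (\<integral>\<^sup>+ x. (\<integral>\<^sup>+ y. ennreal ((norm (f x))\<^sup>2 / 2 * heat \<tau> (x - y)) \<partial>lborel) \<partial>lborel)
      + (\<integral>\<^sup>+ x. (\<integral>\<^sup>+ y. ennreal ((norm (f y))\<^sup>2 / 2 * heat \<tau> (x - y)) \<partial>lborel) \<partial>lborel)"
    by (rule nn_integral_add) measurable
  also have "(\<integral>\<^sup>+ x. (\<integral>\<^sup>+ y. ennreal ((norm (f y))\<^sup>2 / 2 * heat \<tau> (x - y)) \<partial>lborel) \<partial>lborel)
      = (\<integral>\<^sup>+ y. (\<integral>\<^sup>+ x. ennreal ((norm (f y))\<^sup>2 / 2 * heat \<tau> (x - y)) \<partial>lborel) \<partial>lborel)"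
    by (rule lborel_pair.Fubini') measurable
  also have "\<dots> = (\<integral>\<^sup>+ y. ennreal ((norm (f y))\<^sup>2 / 2) \<partial>lborel)"
  proof (rule nn_integral_cong)
    fix y :: 'a
    have "(\<integral>\<^sup>+ x. ennreal ((norm (f y))\<^sup>2 / 2 * heat \<tau> (x - y)) \<partial>lborel)
        = ennreal ((norm (f y))\<^sup>2 / 2) * (\<integral>\<^sup>+ x. ennreal (heat \<tau> (x - y)) \<partial>lborel)"
      unfolding ennreal_mult[OF divide_nonneg_pos[OF zero_le_power2 zero_less_numeral] heat_nonneg]
      by (rule nn_integral_cmult) measurable
    then show "(\<integral>\<^sup>+ x. ennreal ((norm (f y))\<^sup>2 / 2 * heat \<tau> (x - y)) \<partial>lborel) = ennreal ((norm (f y))\<^sup>2 / 2)"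
      by (simp only: heat_translate_integral[OF \<tau>] mult_1_right)
  qed
  also have "(\<integral>\<^sup>+ x. (\<integral>\<^sup>+ y. ennreal ((norm (f x))\<^sup>2 / 2 * heat \<tau> (x - y)) \<partial>lborel) \<partial>lborel) = (\<integral>\<^sup>+ y. ennreal ((norm (f y))\<^sup>2 / 2) \<partial>lborel)"
  proof (rule nn_integral_cong)
    fix y :: 'a
    have "(\<integral>\<^sup>+ x. ennreal ((norm (f y))\<^sup>2 / 2 * heat \<tau> (y - x)) \<partial>lborel)
        = ennreal ((norm (f y))\<^sup>2 / 2) * (\<integral>\<^sup>+ x. ennreal (heat \<tau> (y - x)) \<partial>lborel)"
      unfolding ennreal_mult[OF divide_nonneg_pos[OF zero_le_power2 zero_less_numeral] heat_nonneg]
      by (rule nn_integral_cmult) measurable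
    then show "(\<integral>\<^sup>+ x. ennreal ((norm (f y))\<^sup>2 / 2 * heat \<tau> (y - x)) \<partial>lborel) = ennreal ((norm (f y))\<^sup>2 / 2)"
      by (simp only: heat_translate_integral[OF \<tau>] mult_1_right)
  qed
  also have "(\<integral>\<^sup>+ y. ennreal ((norm (f y))\<^sup>2 / 2) \<partial>lborel) + (\<integral>\<^sup>+ y. ennreal ((norm (f y))\<^sup>2 / 2) \<partial>lborel)
      = (\<integral>\<^sup>+ y. ennreal ((norm (f y))\<^sup>2) \<partial>lborel)"
    by (subst nn_integral_add[symmetric]) (auto simp: ennreal_plus[symmetric] simp del: ennreal_plus)
  also have "\<dots> = ennreal (nsq lborel f)" by (rule nn_integral_norm_sq[OF f(2)])
  finally show ?thesis by (subst (asm) ennreal_le_iff) simp_all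
qed

text \<open>Fatou's lemma as the damping is removed. The inequality holds for every function that is
  both integrable and square-integrable, which is enough to make the transform continuous in mean
  square.\<close>

lemma Bessel_fourier:
  fixes f :: "'a::euclidean_space \<Rightarrow> complex"
  assumes f: "integrable lborel f" "sqi lborel f"
  shows "sqi lborel (fourier f)" "nsq lborel (fourier f) \<le> nsq lborel f"
proof -
  have fm [measurable]: "fourier f \<in> borel_measurable borel"
    by (rule fourier_measurable) (rule borel_measurable_integrable[OF f(1)])
  let ?t = "\<lambda>k. 1 / real (Suc k)"
  let ?F = "\<lambda>k \<xi>. ennreal ((norm (fourier f \<xi>))\<^sup>2 * exp (- ?t k * (norm \<xi>)\<^sup>2))"
  have lim: "(\<lambda>k. ?F k \<xi>) \<longlonglongrightarrow> ennreal ((norm (fourier f \<xi>))\<^sup>2)" for \<xi>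
  proof -
    have "(\<lambda>k. (norm (fourier f \<xi>))\<^sup>2 * exp (- ?t k * (norm \<xi>)\<^sup>2)) \<longlonglongrightarrow> (norm (fourier f \<xi>))\<^sup>2 * exp (- 0 * (norm \<xi>)\<^sup>2)"
      by (intro tendsto_mult tendsto_const tendsto_exp tendsto_minus LIMSEQ_Suc[OF lim_1_over_n])
    then show ?thesis by (intro tendsto_ennrealI) simp
  qed
  have "(\<integral>\<^sup>+ \<xi>. ennreal ((norm (fourier f \<xi>))\<^sup>2) \<partial>lborel) = (\<integral>\<^sup>+ \<xi>. liminf (\<lambda>k. ?F k \<xi>) \<partial>lborel)"
    by (intro nn_integral_cong lim_imp_Liminf[symmetric] lim) simp
  also have "\<dots> \<le> liminf (\<lambda>k. \<integral>\<^sup>+ \<xi>. ?F k \<xi> \<partial>lborel)" by (rule nn_integral_liminf) measurable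
  also have "\<dots> \<le> liminf (\<lambda>k::nat. ennreal (nsq lborel f))"
  proof (intro Liminf_mono always_eventually allI)
    fix k
    have t: "?t k > 0" by simp
    have "(\<integral>\<^sup>+ \<xi>. ?F k \<xi> \<partial>lborel) = ennreal (LINT \<xi>|lborel. (norm (fourier f \<xi>))\<^sup>2 * exp (- ?t k * (norm \<xi>)\<^sup>2))"
      by (rule nn_integral_eq_integral[OF damped_Plancherel(2)[OF f(1) t]]) (intro AE_I2 mult_nonneg_nonneg, simp_all)
    also have "\<dots> \<le> ennreal (nsq lborel f)" by (intro ennreal_leI damped_Bessel[OF f t])
    finally show "(\<integral>\<^sup>+ \<xi>. ?F k \<xi> \<partial>lborel) \<le> ennreal (nsq lborel f)" .
  qed
  also have "\<dots> = ennreal (nsq lborel f)" by (simp add: Liminf_const)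
  finally have le: "(\<integral>\<^sup>+ \<xi>. ennreal ((norm (fourier f \<xi>))\<^sup>2) \<partial>lborel) \<le> ennreal (nsq lborel f)" .
  have "(\<integral>\<^sup>+ \<xi>. ennreal ((norm (fourier f \<xi>))\<^sup>2) \<partial>lborel) < \<infinity>" by (rule le_less_trans[OF le]) simp
  then show s: "sqi lborel (fourier f)"
    unfolding sqi_def by (intro conjI integrableI_bounded) simp_all
  show "nsq lborel (fourier f) \<le> nsq lborel f"
    using le unfolding nn_integral_norm_sq[OF s] by (subst (asm) ennreal_le_iff) simp_all
qed

text \<open>The damped identity is evaluated as the damping tends to 0. On the left the limit is
  dominated thanks to Bessel's inequality; on the right the heat means of a bounded continuous
  function converge to the function.\<close>

lemma Plancherel_test_fun:
  fixes f :: "'a::euclidean_space \<Rightarrow> complex"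
  assumes t: "test_fun \<Omega> f"
  shows "nsq lborel (fourier f) = nsq lborel f"
proof (rule LIMSEQ_unique)
  note f = test_fun_integrable[OF t] test_fun_sqi[OF t]
  have [measurable]: "f \<in> borel_measurable borel" by (rule test_fun_measurable[OF t])
  have fm [measurable]: "fourier f \<in> borel_measurable borel"
    by (rule fourier_measurable) simp
  \<comment> \<open>The damping parameter is \<open>(c k)\<^sup>2\<close>, so that the substitution
    \<open>y = x - c k *\<^sub>R w\<close> turns the heat kernel into the fixed Gaussian
    \<open>heat 1\<close>.\<close>
  define c where "c k = 1 / real (Suc k)" for k
  have c: "c k > 0" for k by (simp add: c_def)
  have c0: "c \<longlonglongrightarrow> 0" unfolding c_def[abs_def] by (rule LIMSEQ_Suc[OF lim_1_over_n])
  have c2: "(c k)\<^sup>2 > 0" for k using c[of k] by simp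
  define I where "I k = (LINT \<xi>|lborel. (norm (fourier f \<xi>))\<^sup>2 * exp (- (c k)\<^sup>2 * (norm \<xi>)\<^sup>2))" for k
  show "I \<longlonglongrightarrow> nsq lborel (fourier f)"
    unfolding nsq_def I_def
  proof (rule integral_dominated_convergence[where w = "\<lambda>\<xi>. (norm (fourier f \<xi>))\<^sup>2"])
    show "AE \<xi> in lborel. (\<lambda>k. (norm (fourier f \<xi>))\<^sup>2 * exp (- (c k)\<^sup>2 * (norm \<xi>)\<^sup>2)) \<longlonglongrightarrow> (norm (fourier f \<xi>))\<^sup>2"
    proof (rule AE_I2)
      fix \<xi> :: 'a
      have "(\<lambda>k. (norm (fourier f \<xi>))\<^sup>2 * exp (- (c k)\<^sup>2 * (norm \<xi>)\<^sup>2)) \<longlonglongrightarrow> (norm (fourier f \<xi>))\<^sup>2 * exp (- 0\<^sup>2 * (norm \<xi>)\<^sup>2)"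
        by (intro tendsto_mult tendsto_const tendsto_exp tendsto_minus tendsto_power c0)
      then show "(\<lambda>k. (norm (fourier f \<xi>))\<^sup>2 * exp (- (c k)\<^sup>2 * (norm \<xi>)\<^sup>2)) \<longlonglongrightarrow> (norm (fourier f \<xi>))\<^sup>2" by simp
    qed
    show "integrable lborel (\<lambda>\<xi>. (norm (fourier f \<xi>))\<^sup>2)" by (rule sqi_integrable[OF Bessel_fourier(1)[OF f]])
    show "AE \<xi> in lborel. norm ((norm (fourier f \<xi>))\<^sup>2 * exp (- (c k)\<^sup>2 * (norm \<xi>)\<^sup>2)) \<le> (norm (fourier f \<xi>))\<^sup>2" for k
      by (intro AE_I2) (simp add: mult_left_le)
  qed measurable
  obtain B where B: "B > 0" "\<forall>x. norm (f x) \<le> B" by (rule test_fun_bounded[OF t])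
  note B = B(1) B(2)[rule_format]
  have h1: "integrable lborel (\<lambda>w::'a. complex_of_real (heat 1 w))"
    by (intro integrable_of_real heat_integral(1)) simp
  \<comment> \<open>The heat mean of \<open>cnj f\<close> at \<open>x\<close> after this
    substitution. With a fixed Gaussian as weight, dominated convergence in \<open>w\<close>
    applies.\<close>
  define A where "A k x = (LINT w|lborel. complex_of_real (heat 1 w) * cnj (f (x - c k *\<^sub>R w)))" for k x
  have Am [measurable]: "A k \<in> borel_measurable lborel" for k
  proof -
    have "(\<lambda>(x, w). complex_of_real (heat 1 w) * cnj (f (x - c k *\<^sub>R w))) \<in> borel_measurable (lborel \<Otimes>\<^sub>M lborel)"
      by measurable
    then show ?thesis unfolding A_def[abs_def] by (rule lborel.borel_measurable_lebesgue_integral)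
  qed
  have AB: "norm (A k x) \<le> B" for k x
  proof -
    have "norm (A k x) \<le> (LINT w|lborel. norm (complex_of_real (heat 1 w) * cnj (f (x - c k *\<^sub>R w))))"
      unfolding A_def by (rule integral_norm_bound)
    also have "\<dots> \<le> (LINT w|lborel. B * heat 1 (w::'a))"
    proof (rule integral_mono')
      show "norm (complex_of_real (heat 1 w) * cnj (f (x - c k *\<^sub>R w))) \<le> B * heat 1 w" for w
        using mult_right_mono[OF B(2)[of "x - c k *\<^sub>R w"] heat_nonneg[of 1 w]] by (simp add: norm_mult mult.commute)
      show "0 \<le> B * heat 1 w" for w :: 'a using B(1) by simp
    qed (use heat_integral(1)[of 1, where 'a='a] in simp)
    also have "\<dots> = B" using heat_integral(2)[of 1, where 'a='a] by simp
    finally show ?thesis .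
  qed
  have Alim: "(\<lambda>k. A k x) \<longlonglongrightarrow> cnj (f x)" for x
  proof -
    have "(\<lambda>k. A k x) \<longlonglongrightarrow> (LINT w|lborel. complex_of_real (heat 1 (w::'a)) * cnj (f x))"
      unfolding A_def
    proof (rule integral_dominated_convergence[where w = "\<lambda>w. B * heat 1 w"])
      show "integrable lborel (\<lambda>w::'a. B * heat 1 w)" using heat_integral(1)[of 1, where 'a='a] by simp
      show "AE w in lborel. (\<lambda>k. complex_of_real (heat 1 w) * cnj (f (x - c k *\<^sub>R w))) \<longlonglongrightarrow> complex_of_real (heat 1 w) * cnj (f x)"
      proof (rule AE_I2)
        fix w :: 'a
        have "(\<lambda>k. x - c k *\<^sub>R w) \<longlonglongrightarrow> x - 0 *\<^sub>R w" by (intro tendsto_diff tendsto_const tendsto_scaleR c0)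
        then have l: "(\<lambda>k. x - c k *\<^sub>R w) \<longlonglongrightarrow> x" by simp
        have "isCont f x" using test_fun_continuous[OF t, of UNIV] by (simp add: continuous_on_eq_continuous_at)
        then have "(\<lambda>k. f (x - c k *\<^sub>R w)) \<longlonglongrightarrow> f x" by (rule isCont_tendsto_compose[OF _ l])
        then show "(\<lambda>k. complex_of_real (heat 1 w) * cnj (f (x - c k *\<^sub>R w))) \<longlonglongrightarrow> complex_of_real (heat 1 w) * cnj (f x)"
          by (intro tendsto_mult tendsto_const tendsto_cnj)
      qed
      show "AE w in lborel. norm (complex_of_real (heat 1 w) * cnj (f (x - c k *\<^sub>R w))) \<le> B * heat 1 w" for k
      proof (rule AE_I2)
        fix w :: 'a
        show "norm (complex_of_real (heat 1 w) * cnj (f (x - c k *\<^sub>R w))) \<le> B * heat 1 w"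
          unfolding norm_mult norm_of_real complex_mod_cnj abs_of_nonneg[OF heat_nonneg]
          by (subst mult.commute) (rule mult_right_mono[OF B(2) heat_nonneg])
      qed
    qed measurable
    also have "(LINT w|lborel. complex_of_real (heat 1 (w::'a)) * cnj (f x)) = complex_of_real (LINT w|lborel. heat 1 (w::'a)) * cnj (f x)"
      by (simp only: integral_mult_left_zero integral_complex_of_real)
    finally show ?thesis using heat_integral(2)[of 1, where 'a='a] by simp
  qed
  have IA: "complex_of_real (I k) = (LINT x|lborel. f x * A k x)" for k
  proof -
    have "(LINT y|lborel. cnj (f y) * of_real (heat ((c k)\<^sup>2) (x - y))) = A k x" for x
    proof -
      have "(LINT y|lborel. cnj (f y) * of_real (heat ((c k)\<^sup>2) (x - y)))
          = (\<bar>- c k\<bar> ^ DIM('a)) *\<^sub>R (LINT w|lborel. cnj (f (x + (- c k) *\<^sub>R w)) * of_real (heat ((c k)\<^sup>2) (x - (x + (- c k) *\<^sub>R w))))"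
        by (rule lborel_integral_affine) (use c[of k] in \<open>simp, measurable\<close>)
      also have "\<dots> = (LINT w|lborel. (\<bar>- c k\<bar> ^ DIM('a)) *\<^sub>R (cnj (f (x + (- c k) *\<^sub>R w)) * of_real (heat ((c k)\<^sup>2) (x - (x + (- c k) *\<^sub>R w)))))"
        by (rule integral_scaleR_right[symmetric]) 
      also have "\<dots> = A k x"
        unfolding A_def
      proof (rule Bochner_Integration.integral_cong[OF refl])
        fix w :: 'a
        have m1: "x - (x + (- c k) *\<^sub>R w) = c k *\<^sub>R w" by simp
        have m2: "\<bar>- c k\<bar> ^ DIM('a) = c k ^ DIM('a)" using c[of k] by simp
        have hs: "complex_of_real (c k ^ DIM('a)) * of_real (heat ((c k)\<^sup>2) (c k *\<^sub>R w)) = of_real (heat 1 w)"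
          unfolding of_real_mult[symmetric] heat_scale[OF c] ..
        have "complex_of_real (c k ^ DIM('a)) * (z * of_real (heat ((c k)\<^sup>2) (c k *\<^sub>R w))) = of_real (heat 1 w) * z" for z
          unfolding hs[symmetric] by (simp only: mult_ac)
        then show "(\<bar>- c k\<bar> ^ DIM('a)) *\<^sub>R (cnj (f (x + (- c k) *\<^sub>R w)) * of_real (heat ((c k)\<^sup>2) (x - (x + (- c k) *\<^sub>R w))))
          = complex_of_real (heat 1 w) * cnj (f (x - c k *\<^sub>R w))"
          unfolding m1 m2 scaleR_conv_of_real by simp
      qed
      finally show ?thesis .
    qed
    then show ?thesis unfolding I_def damped_Plancherel(1)[OF f(1) c2] by simp
  qed
  have "(\<lambda>k. LINT x|lborel. f x * A k x) \<longlonglongrightarrow> (LINT x|lborel. f x * cnj (f x))"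
  proof (rule integral_dominated_convergence[where w = "\<lambda>x. norm (f x) * B"])
    show "AE x in lborel. (\<lambda>k. f x * A k x) \<longlonglongrightarrow> f x * cnj (f x)"
      by (intro AE_I2 tendsto_mult tendsto_const Alim)
    show "AE x in lborel. norm (f x * A k x) \<le> norm (f x) * B" for k
      by (intro AE_I2) (simp add: norm_mult mult_left_mono AB)
  qed (use f(1) in \<open>simp_all\<close>)
  then have "(\<lambda>k. complex_of_real (I k)) \<longlonglongrightarrow> ip lborel f f" unfolding IA ip_def .
  then have "(\<lambda>k. complex_of_real (I k)) \<longlonglongrightarrow> complex_of_real (nsq lborel f)" by (simp only: ip_self)
  then show "I \<longlonglongrightarrow> nsq lborel f" by (simp only: tendsto_of_real_iff)
qed

subsection \<open>Scaling, differentiation and convolution\<close>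

lemma fourier_affine:
  fixes f :: "'a::euclidean_space \<Rightarrow> complex"
  assumes c: "c > 0" and f: "f \<in> borel_measurable borel"
  shows "fourier (\<lambda>x. f ((1 / c) *\<^sub>R (x - a))) \<xi>
    = of_real (c ^ DIM('a)) * exp (- (\<i> * of_real (\<xi> \<bullet> a))) * fourier f (c *\<^sub>R \<xi>)"
proof -
  let ?e = "\<lambda>(\<xi>::'a) x. exp (- (\<i> * complex_of_real (\<xi> \<bullet> x)))"
  have [measurable]: "f \<in> borel_measurable borel" by (rule f)
  have "(LINT x|lborel. ?e \<xi> x * f ((1 / c) *\<^sub>R (x - a)))
      = (\<bar>c\<bar> ^ DIM('a)) *\<^sub>R (LINT y|lborel. ?e \<xi> (a + c *\<^sub>R y) * f ((1 / c) *\<^sub>R ((a + c *\<^sub>R y) - a)))"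
    by (rule lborel_integral_affine) (use c in \<open>simp, measurable\<close>)
  also have "(\<lambda>y. ?e \<xi> (a + c *\<^sub>R y) * f ((1 / c) *\<^sub>R ((a + c *\<^sub>R y) - a))) = (\<lambda>y. ?e \<xi> a * (?e (c *\<^sub>R \<xi>) y * f y))"
  proof
    fix y :: 'a
    have "?e \<xi> (a + c *\<^sub>R y) = ?e \<xi> a * ?e (c *\<^sub>R \<xi>) y"
      unfolding exp_add[symmetric] by (simp add: inner_add_right algebra_simps)
    moreover have "(1 / c) *\<^sub>R ((a + c *\<^sub>R y) - a) = y" using c by simp
    ultimately show "?e \<xi> (a + c *\<^sub>R y) * f ((1 / c) *\<^sub>R ((a + c *\<^sub>R y) - a)) = ?e \<xi> a * (?e (c *\<^sub>R \<xi>) y * f y)"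
      by (simp only: mult.assoc)
  qed
  also have "(LINT y|lborel. ?e \<xi> a * (?e (c *\<^sub>R \<xi>) y * f y)) = ?e \<xi> a * (LINT y|lborel. ?e (c *\<^sub>R \<xi>) y * f y)"
    by (rule integral_mult_right_zero)
  also have "\<bar>c\<bar> ^ DIM('a) = c ^ DIM('a)" using c by simp
  finally have "(LINT x|lborel. ?e \<xi> x * f ((1 / c) *\<^sub>R (x - a)))
      = of_real (c ^ DIM('a)) * (?e \<xi> a * (LINT y|lborel. ?e (c *\<^sub>R \<xi>) y * f y))"
    by (simp only: scaleR_conv_of_real)
  then show ?thesis unfolding fourier_eq by (simp only: mult_ac)
qed

lemma fourier_translate:
  fixes f :: "'a::euclidean_space \<Rightarrow> complex"
  assumes f: "f \<in> borel_measurable borel"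
  shows "fourier (\<lambda>x. f (x + a)) \<xi> = exp (\<i> * of_real (\<xi> \<bullet> a)) * fourier f \<xi>"
  using fourier_affine[OF zero_less_one f, of "- a" \<xi>] by simp

lemma exp_difference_quotient:
  assumes h: "h \<longlonglongrightarrow> 0" "\<And>k. h k \<noteq> 0"
  shows "(\<lambda>k. (exp (\<i> * complex_of_real (h k * \<theta>)) - 1) / of_real (h k)) \<longlonglongrightarrow> \<i> * of_real \<theta>"
proof -
  have "((\<lambda>z. exp (\<i> * of_real \<theta> * z)) has_field_derivative (\<i> * of_real \<theta>)) (at 0)"
    by (auto intro!: derivative_eq_intros)
  then have d: "((\<lambda>z. (exp (\<i> * of_real \<theta> * z) - exp (\<i> * of_real \<theta> * 0)) / (z - 0)) \<longlongrightarrow> \<i> * of_real \<theta>) (at 0)"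
    by (simp only: has_field_derivative_iff)
  have "(\<lambda>k. complex_of_real (h k)) \<longlonglongrightarrow> complex_of_real 0" by (intro tendsto_of_real h)
  then have "filterlim (\<lambda>k. complex_of_real (h k)) (at 0) sequentially"
    using h(2) by (intro filterlim_atI) simp_all
  from filterlim_compose[OF d this]
  have l: "(\<lambda>k. (exp (\<i> * of_real \<theta> * of_real (h k)) - exp (\<i> * of_real \<theta> * 0)) / (of_real (h k) - 0)) \<longlonglongrightarrow> \<i> * of_real \<theta>" .
  have e: "(exp (\<i> * of_real \<theta> * of_real (h k)) - exp (\<i> * of_real \<theta> * 0)) / (of_real (h k) - 0)
     = (exp (\<i> * complex_of_real (h k * \<theta>)) - 1) / of_real (h k)" for k
    by (simp add: mult.commute mult.left_commute)
  show ?thesis using l unfolding e .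
qed

text \<open>A translation multiplies the transform by an exponential, so the transforms of
  difference quotients are explicit; dominated convergence identifies their limit with the transform
  of the derivative.\<close>

lemma fourier_deriv:
  fixes f :: "'a::euclidean_space \<Rightarrow> complex"
  assumes t: "test_fun \<Omega> f" and b: "b \<in> Basis"
  shows "fourier (\<lambda>x. frechet_derivative f (at x) b) \<xi> = \<i> * of_real (\<xi> \<bullet> b) * fourier f \<xi>"
proof -
  let ?D = "\<lambda>x. frechet_derivative f (at x) b"
  note tU = test_fun_UNIV[OF t]
  note tD = test_fun_deriv[OF t b]
  have [measurable]: "f \<in> borel_measurable borel" "?D \<in> borel_measurable borel"
    by (rule test_fun_measurable[OF t], rule test_fun_measurable[OF tD])
  obtain B where B: "B > 0" "\<forall>x. norm (?D x) \<le> B" by (rule test_fun_bounded[OF tD])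
  obtain K where K: "compact K" "\<forall>x. x \<notin> K \<longrightarrow> f x = 0" by (rule test_fun_compactE[OF t])
  obtain R where R: "\<forall>x\<in>K. norm x \<le> R" using compact_imp_bounded[OF K(1)] unfolding bounded_iff by auto
  obtain d where d: "d > 0" "\<forall>y z. norm z < d \<longrightarrow> norm (f (y + z) - f y - frechet_derivative f (at y) z) \<le> 1 * norm z"
    by (rule test_fun_uniform_derivative[OF tU zero_less_one])
  \<comment> \<open>\<open>m < d\<close> makes all difference quotients bounded by
    \<open>B + 1\<close>, and \<open>m \<le> 1\<close> keeps their supports in the ball of radius
    \<open>R + 1\<close>; together this is the integrable majorant.\<close>
  define m where "m = min d 1 / 2"
  have m: "m > 0" "m < d" "m \<le> 1" using d(1) by (auto simp: m_def)
  define h where "h k = m / real (Suc k)" for k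
  have h: "h k > 0" "h k \<le> m" for k using m by (auto simp: h_def field_simps)
  have h0: "h \<longlonglongrightarrow> 0"
    using tendsto_mult_right_zero[OF LIMSEQ_Suc[OF lim_1_over_n], of m] unfolding h_def[abs_def] by simp
  have lin: "frechet_derivative f (at x) (r *\<^sub>R b) = of_real r * ?D x" for x r
    by (simp only: linear_scale[OF has_derivative_linear[OF test_fun_has_derivative[OF t]]] scaleR_conv_of_real)
  define q where "q k x = (1 / of_real (h k)) * (f (x + h k *\<^sub>R b) - f x)" for k x
  have qD: "norm (q k x - ?D x) \<le> e" if "norm (f (x + h k *\<^sub>R b) - f x - frechet_derivative f (at x) (h k *\<^sub>R b)) \<le> e * norm (h k *\<^sub>R b)" for k x e
  proof -
    have hk: "complex_of_real (h k) \<noteq> 0" using h(1)[of k] by simp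
    have "q k x - ?D x = (1 / of_real (h k)) * (f (x + h k *\<^sub>R b) - f x - frechet_derivative f (at x) (h k *\<^sub>R b))"
      unfolding q_def lin right_diff_distrib using hk by (simp add: mult.assoc[symmetric])
    then have "norm (q k x - ?D x) = (1 / h k) * norm (f (x + h k *\<^sub>R b) - f x - frechet_derivative f (at x) (h k *\<^sub>R b))"
      using h(1)[of k] by (simp add: norm_mult norm_divide)
    also have "\<dots> \<le> (1 / h k) * (e * norm (h k *\<^sub>R b))"
      by (rule mult_left_mono[OF that]) (use h(1)[of k] in simp)
    also have "\<dots> = e" using h(1)[of k] b by simp
    finally show ?thesis .
  qed
  have nh: "norm (h k *\<^sub>R b) = h k" for k using h(1)[of k] b by simp
  have q1: "norm (q k x) \<le> B + 1" for k x
  proof -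
    have "norm (h k *\<^sub>R b) < d" using nh h(2)[of k] m(2) by simp
    then have "norm (q k x - ?D x) \<le> 1" by (intro qD) (use d(2) in blast)
    then show ?thesis using norm_triangle_sub[of "q k x" "?D x"] B(2)[rule_format, of x] by linarith
  qed
  have q0: "q k x = 0" if x: "norm x > R + 1" for k x
  proof -
    have "norm x \<le> norm (x + h k *\<^sub>R b) + norm (h k *\<^sub>R b)"
      using norm_triangle_ineq4[of "x + h k *\<^sub>R b" "h k *\<^sub>R b"] by simp
    then have "norm (x + h k *\<^sub>R b) > R" using x nh[of k] h(2)[of k] m(3) by linarith
    moreover have "norm x > R" using x by simp
    ultimately have "x \<notin> K" "x + h k *\<^sub>R b \<notin> K" using R by (auto simp: not_le)
    then show ?thesis using K(2) by (simp add: q_def)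
  qed
  have qlim: "(\<lambda>k. q k x) \<longlonglongrightarrow> ?D x" for x
  proof (rule LIMSEQ_I)
    fix r :: real assume r: "r > 0"
    then have r2: "r / 2 > 0" by simp
    obtain d' where d': "d' > 0" "\<forall>y z. norm z < d' \<longrightarrow> norm (f (y + z) - f y - frechet_derivative f (at y) z) \<le> r / 2 * norm z"
      by (rule test_fun_uniform_derivative[OF tU r2])
    have "\<forall>\<^sub>F k in sequentially. h k < d'" by (rule order_tendstoD(2)[OF h0 d'(1)])
    then obtain N where N: "\<And>k. k \<ge> N \<Longrightarrow> h k < d'" unfolding eventually_sequentially by blast
    have "norm (q k x - ?D x) < r" if "k \<ge> N" for k
    proof -
      have "norm (h k *\<^sub>R b) < d'" using N[OF that] nh by simp
      then have "norm (q k x - ?D x) \<le> r / 2" by (intro qD) (use d'(2) in blast)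
      then show ?thesis using r by linarith
    qed
    then show "\<exists>no. \<forall>k\<ge>no. norm (q k x - ?D x) < r" by blast
  qed
  have "(\<lambda>k. LINT x|lborel. exp (- (\<i> * complex_of_real (\<xi> \<bullet> x))) * q k x)
      \<longlonglongrightarrow> (LINT x|lborel. exp (- (\<i> * complex_of_real (\<xi> \<bullet> x))) * ?D x)"
  proof (rule integral_dominated_convergence[where w = "\<lambda>x. indicator (cball 0 (R + 1)) x * (B + 1)"])
    show "integrable lborel (\<lambda>x::'a. indicator (cball 0 (R + 1)) x * (B + 1))"
      by (intro integrable_mult_left integrable_real_indicator emeasure_bounded_finite) simp_all
    show "AE x in lborel. (\<lambda>k. exp (- (\<i> * complex_of_real (\<xi> \<bullet> x))) * q k x) \<longlonglongrightarrow> exp (- (\<i> * complex_of_real (\<xi> \<bullet> x))) * ?D x"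
      by (intro AE_I2 tendsto_mult tendsto_const qlim)
    show "AE x in lborel. norm (exp (- (\<i> * complex_of_real (\<xi> \<bullet> x))) * q k x) \<le> indicator (cball 0 (R + 1)) x * (B + 1)" for k
    proof (rule AE_I2)
      fix x :: 'a
      show "norm (exp (- (\<i> * complex_of_real (\<xi> \<bullet> x))) * q k x) \<le> indicator (cball 0 (R + 1)) x * (B + 1)"
      proof (cases "norm x > R + 1")
        case True then show ?thesis using q0[OF True] B(1) by simp
      next
        case False then show ?thesis using q1[of k x] by (simp add: norm_mult)
      qed
    qed
  qed (unfold q_def, measurable)
  then have "(\<lambda>k. fourier (q k) \<xi>) \<longlonglongrightarrow> fourier ?D \<xi>"
    unfolding fourier_eq by (intro tendsto_mult tendsto_const)
  moreover have "fourier (q k) \<xi> = (exp (\<i> * complex_of_real (h k * (\<xi> \<bullet> b))) - 1) / of_real (h k) * fourier f \<xi>" for k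
  proof -
    have i: "integrable lborel (\<lambda>x. f (x + h k *\<^sub>R b))"
      using lborel_integrable_affine[OF one_neq_zero test_fun_integrable[OF t], of "h k *\<^sub>R b"] by (simp add: add.commute)
    have "fourier (q k) \<xi> = (1 / of_real (h k)) * fourier (\<lambda>x. f (x + h k *\<^sub>R b) - f x) \<xi>"
      unfolding q_def[abs_def] by (rule fourier_scale)
    also have "fourier (\<lambda>x. f (x + h k *\<^sub>R b) - f x) \<xi> = exp (\<i> * of_real (\<xi> \<bullet> h k *\<^sub>R b)) * fourier f \<xi> - fourier f \<xi>"
      by (simp only: fourier_diff[OF i test_fun_integrable[OF t]] fourier_translate[OF test_fun_measurable[OF t]])
    finally show ?thesis by (simp add: left_diff_distrib right_diff_distrib diff_divide_distrib)
  qed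
  moreover have "(\<lambda>k. (exp (\<i> * complex_of_real (h k * (\<xi> \<bullet> b))) - 1) / of_real (h k) * fourier f \<xi>) \<longlonglongrightarrow> \<i> * of_real (\<xi> \<bullet> b) * fourier f \<xi>"
    by (intro tendsto_mult tendsto_const exp_difference_quotient h0) (use h(1) in \<open>simp add: less_imp_neq[symmetric]\<close>)
  ultimately show ?thesis by (simp add: LIMSEQ_unique)
qed

lemma fourier_sum:
  assumes "finite I" "\<And>i. i \<in> I \<Longrightarrow> integrable lborel (u i)"
  shows "fourier (\<lambda>x. \<Sum>i\<in>I. u i x) \<xi> = (\<Sum>i\<in>I. fourier (u i) \<xi>)"
  using assms
proof (induction I rule: finite_induct)
  case empty then show ?case by (simp add: fourier_zero)
next
  case (insert i I)
  then show ?case by (simp add: fourier_add)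
qed

lemma test_fun_sum: "finite I \<Longrightarrow> (\<And>i. i \<in> I \<Longrightarrow> test_fun \<Omega> (u i)) \<Longrightarrow> test_fun \<Omega> (\<lambda>x. \<Sum>i\<in>I. u i x)"
  by (induction I rule: finite_induct) (auto intro: test_fun_add)

lemma test_fun_laplacian: "test_fun \<Omega> f \<Longrightarrow> test_fun \<Omega> (laplacian f)"
  unfolding laplacian_def[abs_def] by (intro test_fun_sum test_fun_deriv finite_Basis)

lemma norm_sq_Basis: "(norm x)\<^sup>2 = (\<Sum>b\<in>Basis. (x \<bullet> b)\<^sup>2)" for x :: "'a::euclidean_space"
  by (subst power2_norm_eq_inner, subst euclidean_inner) (simp add: power2_eq_square)

lemma fourier_laplacian:
  fixes f :: "'a::euclidean_space \<Rightarrow> complex"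
  assumes t: "test_fun \<Omega> f"
  shows "fourier (laplacian f) \<xi> = - of_real ((norm \<xi>)\<^sup>2) * fourier f \<xi>"
proof -
  have "fourier (laplacian f) \<xi> = (\<Sum>b\<in>Basis. \<i> * of_real (\<xi> \<bullet> b) * (\<i> * of_real (\<xi> \<bullet> b) * fourier f \<xi>))"
    unfolding laplacian_def[abs_def]
    by (subst fourier_sum) (auto intro!: sum.cong test_fun_integrable test_fun_deriv[OF test_fun_deriv[OF t]]
       simp: fourier_deriv[OF test_fun_deriv[OF t]] fourier_deriv[OF t])
  also have "\<dots> = (\<Sum>b\<in>Basis. - of_real ((\<xi> \<bullet> b)\<^sup>2) * fourier f \<xi>)"
  proof (rule sum.cong[OF refl])
    fix b :: 'a
    have "\<i> * a * (\<i> * a * F) = (\<i> * \<i>) * a\<^sup>2 * F" for a F :: complex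
      by (simp only: power2_eq_square mult_ac)
    then show "\<i> * of_real (\<xi> \<bullet> b) * (\<i> * of_real (\<xi> \<bullet> b) * fourier f \<xi>) = - of_real ((\<xi> \<bullet> b)\<^sup>2) * fourier f \<xi>"
      by simp
  qed
  also have "\<dots> = - of_real ((norm \<xi>)\<^sup>2) * fourier f \<xi>"
    unfolding norm_sq_Basis of_real_sum sum_distrib_right[symmetric] sum_negf ..
  finally show ?thesis .
qed

lemma frechet_cnj:
  assumes "test_fun \<Omega> f"
  shows "frechet_derivative (\<lambda>x. cnj (f x)) (at x) b = cnj (frechet_derivative f (at x) b)"
  using frechet_derivative_at[OF bounded_linear.has_derivative[OF bounded_linear_cnj test_fun_has_derivative[OF assms, of x]]]
  by (simp add: fun_eq_iff)

lemma laplacian_cnj: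
  assumes "test_fun \<Omega> f"
  shows "laplacian (\<lambda>x. cnj (f x)) x = cnj (laplacian f x)"
  unfolding laplacian_def frechet_cnj[OF assms] cnj_sum
  by (intro sum.cong refl frechet_cnj[OF test_fun_deriv[OF assms]])

lemma conv_pair_integrable:
  fixes h f :: "'a::euclidean_space \<Rightarrow> complex"
  assumes h: "integrable lborel h" and f: "integrable lborel f"
    and [measurable]: "(\<lambda>(x, y). k x y) \<in> borel_measurable (lborel \<Otimes>\<^sub>M lborel)" and k: "\<And>x y. norm (k x y) = (1::real)"
  shows "integrable (lborel \<Otimes>\<^sub>M lborel) (\<lambda>(y, x). k y x * (h y * f (x - y)) :: complex)"
proof -
  have [measurable]: "h \<in> borel_measurable borel" "f \<in> borel_measurable borel"
    using borel_measurable_integrable[OF h] borel_measurable_integrable[OF f] by simp_all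
  have m: "(\<lambda>(y, x). k y x * (h y * f (x - y))) \<in> borel_measurable (lborel \<Otimes>\<^sub>M lborel)" by measurable
  have tr: "integrable lborel (\<lambda>x. f (x - y))" "(LINT x|lborel. norm (f (x - y))) = (LINT x|lborel. norm (f x))" for y
    using lborel_integrable_affine[OF one_neq_zero f, of "- y"] lborel_integral_affine[OF one_neq_zero, of "\<lambda>x. norm (f x)" "- y"]
    by simp_all
  show ?thesis
  proof (rule lborel_pair.Fubini_integrable[OF m])
    have "(\<lambda>y. LINT x|lborel. norm (case (y, x) of (y, x) \<Rightarrow> k y x * (h y * f (x - y)))) = (\<lambda>y. norm (h y) * (LINT x|lborel. norm (f x)))"
      by (rule ext) (simp add: norm_mult k tr(2))
    then show "integrable lborel (\<lambda>y. LINT x|lborel. norm (case (y, x) of (y, x) \<Rightarrow> k y x * (h y * f (x - y))))"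
      using h by simp
    have "integrable lborel (\<lambda>x. k y x * (h y * f (x - y)))" for y
    proof (rule Bochner_Integration.integrable_bound[OF integrable_mult_right[OF tr(1), of "h y" y]])
      show "(\<lambda>x. k y x * (h y * f (x - y))) \<in> borel_measurable lborel"
        by measurable
    qed (simp add: norm_mult k)
    then show "AE y in lborel. integrable lborel (\<lambda>x. case (y, x) of (y, x) \<Rightarrow> k y x * (h y * f (x - y)))" by simp
  qed
qed

text \<open>The factor belonging to \<open>h\<close> carries no \<open>fconst\<close>: the single
  normalising constant is absorbed by the transform of \<open>f\<close>. Hence the multiplier is the
  plain exponential integral of the kernel.\<close>

lemma fourier_conv:
  fixes h f :: "'a::euclidean_space \<Rightarrow> complex"
  assumes h: "integrable lborel h" and t: "test_fun UNIV f"
  shows "fourier (conv h f) \<xi> = (LINT y|lborel. exp (- (\<i> * of_real (\<xi> \<bullet> y))) * h y) * fourier f \<xi>"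
proof -
  let ?e = "\<lambda>(\<xi>::'a) x. exp (- (\<i> * complex_of_real (\<xi> \<bullet> x)))"
  have k: "(\<lambda>(y::'a, x). ?e \<xi> x) \<in> borel_measurable (lborel \<Otimes>\<^sub>M lborel)" by measurable
  have i: "integrable (lborel \<Otimes>\<^sub>M lborel) (\<lambda>(y, x). ?e \<xi> x * (h y * f (x - y)))"
    by (rule conv_pair_integrable[OF h test_fun_integrable[OF t] k norm_ee(1)])
  have "(LINT x|lborel. ?e \<xi> x * conv h f x) = (LINT x|lborel. LINT y|lborel. ?e \<xi> x * (h y * f (x - y)))"
    unfolding conv_def integral_mult_right_zero[symmetric] ..
  also have "\<dots> = (LINT y|lborel. LINT x|lborel. ?e \<xi> x * (h y * f (x - y)))"
    using lborel_pair.Fubini_integral[OF i] .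
  also have "\<dots> = (LINT y|lborel. (?e \<xi> y * h y) * (LINT x|lborel. ?e \<xi> x * f x))"
  proof (rule Bochner_Integration.integral_cong[OF refl])
    fix y
    have [measurable]: "f \<in> borel_measurable borel" by (rule test_fun_measurable[OF t])
    have "(LINT x|lborel. ?e \<xi> x * (h y * f (x - y)))
        = (\<bar>1\<bar> ^ DIM('a)) *\<^sub>R (LINT x|lborel. ?e \<xi> (y + 1 *\<^sub>R x) * (h y * f ((y + 1 *\<^sub>R x) - y)))"
      by (rule lborel_integral_affine) (simp, measurable)
    also have "\<dots> = (LINT x|lborel. (?e \<xi> y * h y) * (?e \<xi> x * f x))"
    proof -
      have "?e \<xi> (y + 1 *\<^sub>R x) * (h y * f ((y + 1 *\<^sub>R x) - y)) = (?e \<xi> y * h y) * (?e \<xi> x * f x)" for x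
      proof -
        have "?e \<xi> (y + 1 *\<^sub>R x) = ?e \<xi> y * ?e \<xi> x"
          unfolding exp_add[symmetric] by (simp add: inner_add_right algebra_simps)
        then show ?thesis by (simp add: mult_ac)
      qed
      then show ?thesis by (simp only: abs_one power_one scaleR_one)
    qed
    finally show "(LINT x|lborel. ?e \<xi> x * (h y * f (x - y))) = (?e \<xi> y * h y) * (LINT x|lborel. ?e \<xi> x * f x)"
      by (simp only: integral_mult_right_zero)
  qed
  also have "\<dots> = (LINT y|lborel. ?e \<xi> y * h y) * (LINT x|lborel. ?e \<xi> x * f x)"
    by (rule integral_mult_left_zero)
  finally show ?thesis unfolding fourier_eq by (simp only: mult.left_commute)
qed

subsection \<open>Weighted spaces\<close>

text \<open>With the weight inside the measure, the Hilbert space lemmas apply verbatim to Sobolev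
  norms and energies.\<close>

definition wl :: "('a::euclidean_space \<Rightarrow> real) \<Rightarrow> 'a measure" where
  "wl w = density lborel (\<lambda>\<xi>. ennreal (w \<xi>))"

lemma wl_simps [simp]: "borel_measurable (wl w) = borel_measurable borel" "sets (wl w) = sets borel" "space (wl w) = UNIV"
  by (auto simp: wl_def measurable_def)

lemma sqi_wl:
  assumes "w \<in> borel_measurable borel" "\<And>\<xi>. w \<xi> \<ge> 0"
  shows "sqi (wl w) g \<longleftrightarrow> g \<in> borel_measurable borel \<and> integrable lborel (\<lambda>\<xi>. w \<xi> * (norm (g \<xi>))\<^sup>2)"
proof -
  have "integrable (wl w) (\<lambda>\<xi>. (norm (g \<xi>))\<^sup>2) \<longleftrightarrow> integrable lborel (\<lambda>\<xi>. w \<xi> * (norm (g \<xi>))\<^sup>2)"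
    if [measurable]: "g \<in> borel_measurable borel"
    unfolding wl_def by (subst integrable_density) (use assms in auto)
  then show ?thesis unfolding sqi_def by auto
qed

lemma nsq_wl:
  assumes "w \<in> borel_measurable borel" "\<And>\<xi>. w \<xi> \<ge> 0" "g \<in> borel_measurable borel"
  shows "nsq (wl w) g = (LINT \<xi>|lborel. w \<xi> * (norm (g \<xi>))\<^sup>2)"
proof -
  have [measurable]: "g \<in> borel_measurable borel" by fact
  show ?thesis unfolding nsq_def wl_def by (subst integral_density) (use assms in auto)
qed

lemma ip_wl:
  assumes "w \<in> borel_measurable borel" "\<And>\<xi>. w \<xi> \<ge> 0" "f \<in> borel_measurable borel" "g \<in> borel_measurable borel"
  shows "ip (wl w) f g = (LINT \<xi>|lborel. of_real (w \<xi>) * (f \<xi> * cnj (g \<xi>)))"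
proof -
  have [measurable]: "g \<in> borel_measurable borel" "f \<in> borel_measurable borel" by fact+
  show ?thesis unfolding ip_def wl_def
    by (subst integral_density) (use assms in \<open>auto simp: scaleR_conv_of_real\<close>)
qed

lemma wl_1: "wl (\<lambda>_. 1) = lborel"
  by (simp add: wl_def density_1)

lemma sqi_wl_mono:
  assumes "sqi (wl w) g" "w \<in> borel_measurable borel" "\<And>\<xi>. w \<xi> \<ge> 0"
    and "w' \<in> borel_measurable borel" "\<And>\<xi>. w' \<xi> \<ge> 0" "\<And>\<xi>. w' \<xi> \<le> w \<xi>"
  shows "sqi (wl w') g" "nsq (wl w') g \<le> nsq (wl w) g"
proof -
  have g [measurable]: "g \<in> borel_measurable borel" and i: "integrable lborel (\<lambda>\<xi>. w \<xi> * (norm (g \<xi>))\<^sup>2)"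
    using assms(1) unfolding sqi_wl[OF assms(2,3)] by blast+
  have le: "w' \<xi> * (norm (g \<xi>))\<^sup>2 \<le> w \<xi> * (norm (g \<xi>))\<^sup>2" for \<xi>
    by (intro mult_right_mono assms(6)) simp
  have nn: "0 \<le> w' \<xi> * (norm (g \<xi>))\<^sup>2" for \<xi> using assms(5) by simp
  have i': "integrable lborel (\<lambda>\<xi>. w' \<xi> * (norm (g \<xi>))\<^sup>2)"
  proof (rule Bochner_Integration.integrable_bound[OF i])
    show "(\<lambda>\<xi>. w' \<xi> * (norm (g \<xi>))\<^sup>2) \<in> borel_measurable lborel" using assms(4) by measurable
    show "AE \<xi> in lborel. norm (w' \<xi> * (norm (g \<xi>))\<^sup>2) \<le> norm (w \<xi> * (norm (g \<xi>))\<^sup>2)"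
      by (rule AE_I2) (use le nn in \<open>simp add: abs_of_nonneg order_trans[OF nn le] del: abs_mult\<close>)
  qed
  then show "sqi (wl w') g" unfolding sqi_wl[OF assms(4,5)] using g by blast
  show "nsq (wl w') g \<le> nsq (wl w) g"
    unfolding nsq_wl[OF assms(2,3) g] nsq_wl[OF assms(4,5) g]
    by (rule integral_mono[OF i' i le])
qed

lemma sqlim_wl_mono:
  assumes l: "sqlim (wl w) f g" and w: "w \<in> borel_measurable borel" "\<And>\<xi>. w \<xi> \<ge> 0"
    "w' \<in> borel_measurable borel" "\<And>\<xi>. w' \<xi> \<ge> 0" "\<And>\<xi>. w' \<xi> \<le> w \<xi>"
  shows "sqlim (wl w') f g"
proof (rule sqlimI)
  show "sqi (wl w') (f i)" for i by (rule sqi_wl_mono(1)[OF sqlimD(1)[OF l] w])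
  show "sqi (wl w') g" by (rule sqi_wl_mono(1)[OF sqlimD(2)[OF l] w])
  show "(\<lambda>i. nsq (wl w') (\<lambda>x. f i x - g x)) \<longlonglongrightarrow> 0"
    by (rule null_sandwich[OF sqlimD(3)[OF l] nsq_nonneg])
       (rule sqi_wl_mono(2)[OF sqi_diff[OF sqlimD(1,2)[OF l]] w])
qed

lemma wl_1': "sqi (wl (\<lambda>_. 1)) = sqi lborel" "nsq (wl (\<lambda>_. 1)) = nsq lborel" "sqlim (wl (\<lambda>_. 1)) = sqlim lborel"
  by (simp_all add: wl_1)

text \<open>\<open>wl (sw s)\<close> carries the norm of \<open>Hs s\<close>, and
  \<open>wl hw\<close> the Dirichlet energy. For \<open>s = 1\<close> the weight is
  \<open>1 + hw\<close>, so the norm splits into the mean-square part and the energy.\<close>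

definition sw :: "real \<Rightarrow> 'a::euclidean_space \<Rightarrow> real" where
  "sw s \<xi> = (1 + (norm \<xi>)\<^sup>2) powr s"

definition hw :: "'a::euclidean_space \<Rightarrow> real" where
  "hw \<xi> = (norm \<xi>)\<^sup>2"

lemma sw_measurable [measurable, simp]: "sw s \<in> borel_measurable borel"
  unfolding sw_def[abs_def] by measurable

lemma hw_measurable [measurable, simp]: "hw \<in> borel_measurable borel"
  unfolding hw_def[abs_def] by measurable

lemma hw_nonneg [simp]: "0 \<le> hw \<xi>"
  by (simp add: hw_def)

lemma sw_nonneg [simp]: "0 \<le> sw s \<xi>"
  by (simp add: sw_def)

lemma sw_one: "sw 1 \<xi> = 1 + hw \<xi>"
  by (simp add: sw_def hw_def add_pos_nonneg)

lemma sw_ge_1: "0 \<le> s \<Longrightarrow> 1 \<le> sw s \<xi>"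
  unfolding sw_def by (rule ge_one_powr_ge_zero) simp_all

lemma sw_mono: "s \<le> s' \<Longrightarrow> sw s \<xi> \<le> sw s' \<xi>"
  unfolding sw_def by (rule powr_mono) simp_all

lemma hw_le_sw: "hw \<xi> \<le> sw 1 \<xi>"
  by (simp add: sw_one)

lemma AE_wl_sw: "(AE x in wl (sw s). P x) \<longleftrightarrow> (AE x in lborel. P x)" 
proof -
  have "sw s x \<noteq> 0" for x :: 'a unfolding sw_def by (simp add: add_nonneg_eq_0_iff)
  then have "0 < sw s x" for x :: 'a by (metis less_eq_real_def sw_nonneg)
  then show ?thesis
    unfolding wl_def by (subst AE_density) auto
qed

lemma sqi_sw_lborel:
  assumes "0 \<le> s" "sqi (wl (sw s)) g" shows "sqi lborel g"
proof -
  have "sqi (wl (\<lambda>_. 1)) g"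
    by (rule sqi_wl_mono(1)[OF assms(2)]) (simp_all add: sw_ge_1 assms(1))
  then show ?thesis by (simp only: wl_1')
qed

lemma sqlim_sw_lborel:
  assumes "0 \<le> s" "sqlim (wl (sw s)) f g" shows "sqlim lborel f g"
proof -
  have "sqlim (wl (\<lambda>_. 1)) f g"
    by (rule sqlim_wl_mono[OF assms(2)]) (simp_all add: sw_ge_1 assms(1))
  then show ?thesis by (simp only: wl_1')
qed

lemma sqi_sw1_hw: "sqi (wl (sw 1)) g \<Longrightarrow> sqi (wl hw) g"
  by (rule sqi_wl_mono(1)[where w = "sw 1"]) (auto simp: hw_le_sw)

lemma sqlim_sw1_hw: "sqlim (wl (sw 1)) f g \<Longrightarrow> sqlim (wl hw) f g"
  by (rule sqlim_wl_mono[where w = "sw 1"]) (auto simp: hw_le_sw)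

lemma sqi_sw1I:
  assumes "sqi lborel g" "sqi (wl hw) g" shows "sqi (wl (sw 1)) g"
proof -
  have "integrable lborel (\<lambda>\<xi>. (norm (g \<xi>))\<^sup>2 + hw \<xi> * (norm (g \<xi>))\<^sup>2)"
    using assms by (intro Bochner_Integration.integrable_add) (auto simp: sqi_def[of lborel] sqi_wl)
  then show ?thesis using assms
    by (subst sqi_wl) (auto simp: sqi_def[of lborel] sw_one distrib_right)
qed

lemma ip_sw1:
  assumes "sqi (wl (sw 1)) f" "sqi (wl (sw 1)) g"
  shows "ip (wl (sw 1)) f g = ip lborel f g + ip (wl hw) f g"
proof -
  have m: "f \<in> borel_measurable borel" "g \<in> borel_measurable borel"
    using assms unfolding sqi_def by simp_all
  have i1: "integrable lborel (\<lambda>\<xi>. f \<xi> * cnj (g \<xi>))"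
    by (intro integrable_sqi_mult sqi_sw_lborel[of 1] assms) simp_all
  have "integrable (wl hw) (\<lambda>\<xi>. f \<xi> * cnj (g \<xi>))"
    by (intro integrable_sqi_mult sqi_sw1_hw assms)
  then have i2: "integrable lborel (\<lambda>\<xi>. of_real (hw \<xi>) * (f \<xi> * cnj (g \<xi>)))"
    unfolding wl_def by (subst (asm) integrable_density) (use m in \<open>auto simp: scaleR_conv_of_real\<close>)
  have "ip (wl (sw 1)) f g = (LINT \<xi>|lborel. of_real (sw 1 \<xi>) * (f \<xi> * cnj (g \<xi>)))"
    by (rule ip_wl) (use m in auto)
  also have "\<dots> = (LINT \<xi>|lborel. f \<xi> * cnj (g \<xi>) + of_real (hw \<xi>) * (f \<xi> * cnj (g \<xi>)))"
    unfolding sw_one of_real_add of_real_1 distrib_right mult_1_left ..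
  also have "\<dots> = ip lborel f g + (LINT \<xi>|lborel. of_real (hw \<xi>) * (f \<xi> * cnj (g \<xi>)))"
    unfolding ip_def by (rule Bochner_Integration.integral_add[OF i1 i2])
  also have "(LINT \<xi>|lborel. of_real (hw \<xi>) * (f \<xi> * cnj (g \<xi>))) = ip (wl hw) f g"
    by (rule ip_wl[symmetric]) (use m in auto)
  finally show ?thesis .
qed

lemma nsq_sw1: "sqi (wl (sw 1)) f \<Longrightarrow> nsq (wl (sw 1)) f = nsq lborel f + nsq (wl hw) f"
  by (simp add: nsq_eq_Re ip_sw1)

text \<open>The weighted square is the sum of the squared transforms of the partial derivatives,
  each of which is integrable by Bessel's inequality.\<close>

lemma fourier_test_sqi_hw:
  fixes f :: "'a::euclidean_space \<Rightarrow> complex"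
  assumes t: "test_fun \<Omega> f" shows "sqi (wl hw) (fourier f)"
proof -
  have fm: "fourier f \<in> borel_measurable borel"
    by (rule fourier_measurable) (use test_fun_measurable[OF t] in simp)
  have eq: "hw \<xi> * (norm (fourier f \<xi>))\<^sup>2 = (\<Sum>b\<in>Basis. (norm (fourier (\<lambda>x. frechet_derivative f (at x) b) \<xi>))\<^sup>2)" for \<xi>
  proof -
    have "(norm (fourier (\<lambda>x. frechet_derivative f (at x) b) \<xi>))\<^sup>2 = (\<xi> \<bullet> b)\<^sup>2 * (norm (fourier f \<xi>))\<^sup>2" if "b \<in> Basis" for b
      unfolding fourier_deriv[OF t that] by (simp add: norm_mult power_mult_distrib)
    then show ?thesis unfolding hw_def norm_sq_Basis sum_distrib_right by simp
  qed
  have "integrable lborel (\<lambda>\<xi>. hw \<xi> * (norm (fourier f \<xi>))\<^sup>2)"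
    unfolding eq
    by (intro Bochner_Integration.integrable_sum sqi_integrable[OF Bessel_fourier(1)]
        test_fun_integrable[OF test_fun_deriv[OF t]] test_fun_sqi[OF test_fun_deriv[OF t]])
  then show ?thesis by (subst sqi_wl) (use fm in auto)
qed

lemma fourier_test_sqi:
  assumes t: "test_fun \<Omega> f" shows "sqi lborel (fourier f)"
  by (rule Bessel_fourier(1)[OF test_fun_integrable[OF t] test_fun_sqi[OF t]])

lemma fourier_test_sqi_sw:
  assumes t: "test_fun \<Omega> f" and s: "s \<le> 1" shows "sqi (wl (sw s)) (fourier f)"
  by (rule sqi_wl_mono(1)[OF sqi_sw1I[OF fourier_test_sqi[OF t] fourier_test_sqi_hw[OF t]]])
     (auto intro: sw_mono s)

lemma Hs_norm_sq_test:
  assumes t: "test_fun \<Omega> f" and s: "s \<le> 1"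
  shows "Hs_norm_sq s f = ennreal (nsq (wl (sw s)) (fourier f))"
proof -
  have sf: "sqi (wl (sw s)) (fourier f)" by (rule fourier_test_sqi_sw[OF t s])
  then have fm: "fourier f \<in> borel_measurable borel" and i: "integrable lborel (\<lambda>\<xi>. sw s \<xi> * (norm (fourier f \<xi>))\<^sup>2)"
    by (auto simp: sqi_wl)
  have "nsq (wl (sw s)) (fourier f) = (LINT \<xi>|lborel. sw s \<xi> * (norm (fourier f \<xi>))\<^sup>2)"
    by (rule nsq_wl) (use fm in auto)
  then show ?thesis
    unfolding Hs_norm_sq_def sw_def[symmetric] using nn_integral_eq_integral[OF i] by simp
qed

subsection \<open>The Fourier--Plancherel transform\<close>

abbreviation trunc :: "nat \<Rightarrow> ('a::euclidean_space \<Rightarrow> complex) \<Rightarrow> 'a \<Rightarrow> complex" where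
  "trunc k u \<equiv> (\<lambda>x. if norm x \<le> real k then u x else 0)"

text \<open>Cauchy-Schwarz for the modulus of \<open>u\<close> against the indicator of
  \<open>S\<close>.\<close>

lemma sqi_bounded_support_integrable:
  fixes u :: "'a::euclidean_space \<Rightarrow> complex"
  assumes u: "sqi lborel u" and S: "bounded S" "S \<in> sets borel" and z: "\<And>x. x \<notin> S \<Longrightarrow> u x = 0"
  shows "integrable lborel u" "(LINT x|lborel. norm (u x)) \<le> sqrt (measure lborel S) * sqrt (nsq lborel u)"
proof -
  have um [measurable]: "u \<in> borel_measurable borel" using u by (simp add: sqi_def)
  have fin: "emeasure lborel S < \<infinity>" by (rule emeasure_bounded_finite[OF S(1)])
  define g where "g x = complex_of_real (indicator S x)" for x :: 'a
  have g2: "(norm (g x))\<^sup>2 = indicator S x" for x by (simp add: g_def indicator_def)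
  have iS: "integrable lborel (indicator S :: 'a \<Rightarrow> real)" by (rule integrable_real_indicator) (use S fin in auto)
  have gs: "sqi lborel g"
    unfolding sqi_def g2 using iS S(2) by (auto simp: g_def[abs_def])
  define v where "v x = complex_of_real (norm (u x))" for x
  have vs: "sqi lborel v" using u unfolding sqi_def v_def[abs_def] by simp
  have vg: "v x * cnj (g x) = v x" for x using z[of x] by (cases "x \<in> S") (auto simp: g_def v_def)
  have iv: "integrable lborel v" using integrable_sqi_mult[OF vs gs] unfolding vg .
  have "integrable lborel (\<lambda>x. norm (u x))" using integrable_norm[OF iv] by (simp add: v_def)
  then show "integrable lborel u" by (rule integrable_norm_cancel) simp
  have "nsq lborel g = measure lborel S"
    unfolding nsq_def g2 using S by simp
  moreover have "nsq lborel v = nsq lborel u" by (simp add: nsq_def v_def)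
  moreover have "ip lborel v g = complex_of_real (LINT x|lborel. norm (u x))"
    unfolding ip_def vg unfolding v_def by (rule integral_complex_of_real)
  moreover have "0 \<le> (LINT x|lborel. norm (u x))" by simp
  ultimately show "(LINT x|lborel. norm (u x)) \<le> sqrt (measure lborel S) * sqrt (nsq lborel u)"
    using Cauchy_Schwarz_ip[OF vs gs] by (simp add: mult.commute)
qed

lemma trunc_sqi: "sqi lborel u \<Longrightarrow> sqi lborel (trunc k u)"
  by (rule sqi_bound[of _ _ "\<lambda>x. (norm (u x))\<^sup>2"]) (auto simp: sqi_def)

lemma trunc_integrable: "sqi lborel u \<Longrightarrow> integrable lborel (trunc k u)"
  by (rule sqi_bounded_support_integrable(1)[of _ "cball 0 (real k)"]) (auto intro: trunc_sqi)

lemma trunc_sqlim: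
  assumes u: "sqi lborel u" shows "sqlim lborel (\<lambda>k. trunc k u) u"
proof (rule sqlimI[OF trunc_sqi[OF u] u])
  have [measurable]: "u \<in> borel_measurable borel" using u by (simp add: sqi_def)
  have "(\<lambda>k. LINT x|lborel. (norm (trunc k u x - u x))\<^sup>2) \<longlonglongrightarrow> (LINT x|(lborel :: 'a measure). 0)"
  proof (rule integral_dominated_convergence[where w = "\<lambda>x. (norm (u x))\<^sup>2"])
    show "AE x in lborel. (\<lambda>k. (norm (trunc k u x - u x))\<^sup>2) \<longlonglongrightarrow> 0"
    proof (rule AE_I2)
      fix x :: 'a
      obtain N where N: "norm x \<le> real N" using real_arch_simple by blast
      have "(norm (trunc k u x - u x))\<^sup>2 = 0" if "k \<ge> N" for k
      proof -
        have "norm x \<le> real k" using N that by linarith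
        then show ?thesis by simp
      qed
      then show "(\<lambda>k. (norm (trunc k u x - u x))\<^sup>2) \<longlonglongrightarrow> 0"
        by (rule tendsto_eventually[OF eventually_sequentiallyI])
    qed
    show "AE x in lborel. norm ((norm (trunc k u x - u x))\<^sup>2) \<le> (norm (u x))\<^sup>2" for k
      by (rule AE_I2) simp
  qed (use sqi_integrable[OF u] in \<open>simp_all\<close>)
  then show "(\<lambda>k. nsq lborel (\<lambda>x. trunc k u x - u x)) \<longlonglongrightarrow> 0" by (simp add: nsq_def)
qed

lemma fourier_Cauchy:
  assumes f: "\<And>k. integrable lborel (f k)" and C: "sqCauchy lborel f"
  shows "sqCauchy lborel (\<lambda>k. fourier (f k))"
proof -
  have s: "sqi lborel (f k)" for k using C unfolding sqCauchy_def by blast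
  have le: "nsq lborel (\<lambda>\<xi>. fourier (f i) \<xi> - fourier (f j) \<xi>) \<le> nsq lborel (\<lambda>x. f i x - f j x)" for i j
    using Bessel_fourier(2)[OF Bochner_Integration.integrable_diff[OF f f] sqi_diff[OF s s], of i j]
    unfolding fourier_diff[OF f f, abs_def] .
  show ?thesis
    unfolding sqCauchy_def
  proof (intro conjI allI impI)
    show "sqi lborel (fourier (f i))" for i by (rule Bessel_fourier(1)[OF f s])
    fix e :: real assume "e > 0"
    then obtain N where N: "\<forall>i\<ge>N. \<forall>j\<ge>N. nsq lborel (\<lambda>x. f i x - f j x) < e"
      using C unfolding sqCauchy_def by blast
    show "\<exists>N. \<forall>i\<ge>N. \<forall>j\<ge>N. nsq lborel (\<lambda>x. fourier (f i) x - fourier (f j) x) < e"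
      using N le_less_trans[OF le] by blast
  qed
qed

text \<open>Justifies the choice in \<open>fourier_L2\<close>: the truncations converge in mean
  square, Bessel's inequality makes their transforms Cauchy, and completeness supplies a
  witness.\<close>

lemma fourier_L2_trunc:
  assumes u: "sqi lborel u" shows "sqlim lborel (\<lambda>k. fourier (trunc k u)) (fourier_L2 u)"
proof -
  have C: "sqCauchy lborel (\<lambda>k. fourier (trunc k u))"
    by (rule fourier_Cauchy[OF trunc_integrable[OF u] sqlim_imp_Cauchy[OF trunc_sqlim[OF u]]])
  then obtain v where v: "sqlim lborel (\<lambda>k. fourier (trunc k u)) v" by (rule sqCauchy_converges)
  have L: "L2 (fourier (trunc k u))" for k using sqlimD(1)[OF v] by (simp only: L2_iff_sqi)
  have iff: "L2 v \<and> L2_tendsto (\<lambda>k. fourier (trunc k u)) v \<longleftrightarrow> sqlim lborel (\<lambda>k. fourier (trunc k u)) v" for v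
    using L2_tendsto_iff[OF L, of v] sqlimD(2) by (auto simp only: L2_iff_sqi)
  show ?thesis
    unfolding fourier_L2_def iff by (rule someI[of "sqlim lborel (\<lambda>k. fourier (trunc k u))", OF v])
qed

text \<open>The truncations in the definition can be replaced by any integrable approximation,
  because Bessel's inequality bounds the difference of the transforms by the difference of the
  functions.\<close>

lemma fourier_L2_sqlim:
  assumes f: "\<And>k. integrable lborel (f k)" and l: "sqlim lborel f u"
  shows "sqlim lborel (\<lambda>k. fourier (f k)) (fourier_L2 u)"
proof -
  note s = sqlimD(1)[OF l] and u = sqlimD(2)[OF l]
  note ti = trunc_integrable[OF u] and ts = trunc_sqi[OF u]
  have "sqlim lborel (\<lambda>k x. f k x - trunc k u x) (\<lambda>x. u x - u x)"
    by (rule sqlim_diff[OF l trunc_sqlim[OF u]])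
  from sqlim_nsq[OF this] have z: "(\<lambda>k. nsq lborel (\<lambda>x. f k x - trunc k u x)) \<longlonglongrightarrow> 0" by simp
  have le: "nsq lborel (\<lambda>\<xi>. fourier (f k) \<xi> - fourier (trunc k u) \<xi>) \<le> nsq lborel (\<lambda>x. f k x - trunc k u x)" for k
    using Bessel_fourier(2)[OF Bochner_Integration.integrable_diff[OF f ti] sqi_diff[OF s ts], of k k]
    unfolding fourier_diff[OF f ti, abs_def] .
  have "sqlim lborel (\<lambda>k \<xi>. fourier (f k) \<xi> - fourier (trunc k u) \<xi>) (\<lambda>\<xi>. 0)"
  proof (rule sqlimI)
    show "sqi lborel (\<lambda>\<xi>. fourier (f k) \<xi> - fourier (trunc k u) \<xi>)" for k
      by (intro sqi_diff Bessel_fourier(1) f s ti ts)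
    show "(\<lambda>k. nsq lborel (\<lambda>\<xi>. fourier (f k) \<xi> - fourier (trunc k u) \<xi> - 0)) \<longlonglongrightarrow> 0"
      using null_sandwich[OF z nsq_nonneg le] by simp
  qed simp
  from sqlim_add[OF this fourier_L2_trunc[OF u]] show ?thesis by simp
qed

lemma fourier_L2_sqi: "sqi lborel u \<Longrightarrow> sqi lborel (fourier_L2 u)"
  by (rule sqlimD(2)[OF fourier_L2_trunc])

lemma fourier_L2_integrable:
  assumes "integrable lborel f" "sqi lborel f"
  shows "AE \<xi> in lborel. fourier_L2 f \<xi> = fourier f \<xi>"
  by (rule sqlim_unique[OF fourier_L2_sqlim[OF assms(1) sqlim_const[OF assms(2)]] sqlim_const[OF Bessel_fourier(1)[OF assms]]])

lemma fourier_L2_diff: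
  assumes u: "sqi lborel u" and v: "sqi lborel v"
  shows "AE \<xi> in lborel. fourier_L2 (\<lambda>x. u x - v x) \<xi> = fourier_L2 u \<xi> - fourier_L2 v \<xi>"
proof (rule sqlim_unique)
  show "sqlim lborel (\<lambda>k. fourier (\<lambda>x. trunc k u x - trunc k v x)) (fourier_L2 (\<lambda>x. u x - v x))"
    by (intro fourier_L2_sqlim Bochner_Integration.integrable_diff trunc_integrable u v
        sqlim_diff[OF trunc_sqlim[OF u] trunc_sqlim[OF v]])
  show "sqlim lborel (\<lambda>k. fourier (\<lambda>x. trunc k u x - trunc k v x)) (\<lambda>\<xi>. fourier_L2 u \<xi> - fourier_L2 v \<xi>)"
    unfolding fourier_diff[OF trunc_integrable[OF u] trunc_integrable[OF v], abs_def]
    by (rule sqlim_diff[OF fourier_L2_trunc[OF u] fourier_L2_trunc[OF v]])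
qed

lemma fourier_L2_scale:
  assumes u: "sqi lborel u"
  shows "AE \<xi> in lborel. fourier_L2 (\<lambda>x. c * u x) \<xi> = c * fourier_L2 u \<xi>"
proof (rule sqlim_unique)
  show "sqlim lborel (\<lambda>k. fourier (\<lambda>x. c * trunc k u x)) (fourier_L2 (\<lambda>x. c * u x))"
    by (intro fourier_L2_sqlim integrable_mult_right trunc_integrable u sqlim_scale[OF trunc_sqlim[OF u]])
  show "sqlim lborel (\<lambda>k. fourier (\<lambda>x. c * trunc k u x)) (\<lambda>\<xi>. c * fourier_L2 u \<xi>)"
    unfolding fourier_scale[abs_def] by (rule sqlim_scale[OF fourier_L2_trunc[OF u]])
qed

lemma fourier_L2_add:
  assumes u: "sqi lborel u" and v: "sqi lborel v"
  shows "AE \<xi> in lborel. fourier_L2 (\<lambda>x. u x + v x) \<xi> = fourier_L2 u \<xi> + fourier_L2 v \<xi>"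
proof -
  have "AE \<xi> in lborel. fourier_L2 (\<lambda>x. u x - (-1) * v x) \<xi> = fourier_L2 u \<xi> + fourier_L2 v \<xi>"
    using fourier_L2_diff[OF u sqi_scale[OF v, of "-1"]] fourier_L2_scale[OF v, of "-1"]
    by eventually_elim simp
  then show ?thesis by simp
qed

lemma fourier_L2_sum:
  fixes u :: "'i \<Rightarrow> 'a::euclidean_space \<Rightarrow> complex"
  assumes "finite I" "\<And>i. i \<in> I \<Longrightarrow> sqi lborel (u i)"
  shows "AE \<xi> in lborel. fourier_L2 (\<lambda>x. \<Sum>i\<in>I. c i * u i x) \<xi> = (\<Sum>i\<in>I. c i * fourier_L2 (u i) \<xi>)"
  using assms
proof (induction I rule: finite_induct)
  case empty
  show ?case using fourier_L2_integrable[of "\<lambda>x::'a. 0"] by (simp add: fourier_zero)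
next
  case (insert i I)
  have a: "AE \<xi> in lborel. fourier_L2 (\<lambda>x. c i * u i x + (\<Sum>i\<in>I. c i * u i x)) \<xi>
      = fourier_L2 (\<lambda>x. c i * u i x) \<xi> + fourier_L2 (\<lambda>x. \<Sum>i\<in>I. c i * u i x) \<xi>"
    by (intro fourier_L2_add sqi_scale sqi_sum) (use insert.prems in auto)
  have b: "AE \<xi> in lborel. fourier_L2 (\<lambda>x. c i * u i x) \<xi> = c i * fourier_L2 (u i) \<xi>"
    by (intro fourier_L2_scale) (use insert.prems in auto)
  have IH: "AE \<xi> in lborel. fourier_L2 (\<lambda>x. \<Sum>i\<in>I. c i * u i x) \<xi> = (\<Sum>i\<in>I. c i * fourier_L2 (u i) \<xi>)"
    by (rule insert.IH) (use insert.prems in auto)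
  show ?case using a b IH
    by eventually_elim (simp add: insert.hyps)
qed

text \<open>Plancherel's identity is established for test functions and passes to their limits in
  mean square. This class is linear and contains every \<open>Hs_completion s \<Omega>\<close> with
  \<open>0 \<le> s \<le> 1\<close>.\<close>

definition test_limit :: "('a::euclidean_space \<Rightarrow> complex) \<Rightarrow> bool" where
  "test_limit u \<longleftrightarrow> (\<exists>f. (\<forall>k::nat. test_fun UNIV (f k)) \<and> sqlim lborel f u)"

lemma test_limitE:
  assumes "test_limit u"
  obtains f where "\<forall>k::nat. test_fun UNIV (f k)" "sqlim lborel f u"
  using assms unfolding test_limit_def by blast

lemma test_limit_sqi: "test_limit u \<Longrightarrow> sqi lborel u"
  unfolding test_limit_def using sqlimD(2) by blast

lemma test_limit_diff:
  assumes "test_limit u" "test_limit v" shows "test_limit (\<lambda>x. u x - v x)"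
proof -
  obtain f where f: "\<forall>k::nat. test_fun UNIV (f k)" "sqlim lborel f u" using assms(1) by (rule test_limitE)
  note f = f(1)[rule_format] f(2)
  obtain g where g: "\<forall>k::nat. test_fun UNIV (g k)" "sqlim lborel g v" using assms(2) by (rule test_limitE)
  note g = g(1)[rule_format] g(2)
  show ?thesis
    unfolding test_limit_def
    by (rule exI[of _ "\<lambda>k x. f k x - g k x"]) (use test_fun_diff[OF f(1) g(1)] sqlim_diff[OF f(2) g(2)] in blast)
qed

lemma test_limit_add:
  assumes "test_limit u" "test_limit v" shows "test_limit (\<lambda>x. u x + v x)"
proof -
  obtain f where f: "\<forall>k::nat. test_fun UNIV (f k)" "sqlim lborel f u" using assms(1) by (rule test_limitE)
  note f = f(1)[rule_format] f(2)
  obtain g where g: "\<forall>k::nat. test_fun UNIV (g k)" "sqlim lborel g v" using assms(2) by (rule test_limitE)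
  note g = g(1)[rule_format] g(2)
  show ?thesis
    unfolding test_limit_def
    by (rule exI[of _ "\<lambda>k x. f k x + g k x"]) (use test_fun_add[OF f(1) g(1)] sqlim_add[OF f(2) g(2)] in blast)
qed

lemma test_limit_scale:
  assumes "test_limit u" shows "test_limit (\<lambda>x. c * u x)"
proof -
  obtain f where f: "\<forall>k::nat. test_fun UNIV (f k)" "sqlim lborel f u" using assms(1) by (rule test_limitE)
  note f = f(1)[rule_format] f(2)
  show ?thesis
    unfolding test_limit_def
    by (rule exI[of _ "\<lambda>k x. c * f k x"]) (use test_fun_scale[OF f(1)] sqlim_scale[OF f(2)] in blast)
qed

lemma test_limit_test: "test_fun \<Omega> f \<Longrightarrow> test_limit f"
  unfolding test_limit_def
  by (intro exI[of _ "\<lambda>_. f"] conjI allI sqlim_const[OF test_fun_sqi]) (auto intro: test_fun_UNIV)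

lemma test_limit_sum:
  assumes "finite I" "\<And>i. i \<in> I \<Longrightarrow> test_limit (u i)"
  shows "test_limit (\<lambda>x. \<Sum>i\<in>I. c i * u i x)"
  using assms
proof (induction I rule: finite_induct)
  case empty
  show ?case using test_limit_test[OF test_fun_zero[of UNIV]] by simp
next
  case (insert i I)
  have "test_limit (\<lambda>x. c i * u i x + (\<Sum>i\<in>I. c i * u i x))"
    by (intro test_limit_add test_limit_scale insert.IH) (use insert.prems in auto)
  then show ?case using insert.hyps by simp
qed

lemma Plancherel:
  assumes "test_limit u" shows "nsq lborel (fourier_L2 u) = nsq lborel u"
proof -
  obtain f where f: "\<forall>k::nat. test_fun UNIV (f k)" "sqlim lborel f u" using assms(1) by (rule test_limitE)
  note f = f(1)[rule_format] f(2)
  have "sqlim lborel (\<lambda>k. fourier (f k)) (fourier_L2 u)"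
    by (rule fourier_L2_sqlim[OF test_fun_integrable[OF f(1)] f(2)])
  from sqlim_nsq[OF this] have "(\<lambda>k. nsq lborel (f k)) \<longlonglongrightarrow> nsq lborel (fourier_L2 u)"
    by (simp only: Plancherel_test_fun[OF f(1)])
  then show ?thesis by (rule LIMSEQ_unique[OF _ sqlim_nsq[OF f(2)]])
qed

text \<open>Polarisation: the identity for the norm of \<open>u + v\<close> gives the real part, and
  replacing \<open>v\<close> by \<open>\<i> * v\<close> gives the imaginary part.\<close>

lemma Plancherel_ip:
  assumes u: "test_limit u" and v: "test_limit v"
  shows "ip lborel (fourier_L2 u) (fourier_L2 v) = ip lborel u v"
proof -
  have Re: "Re (ip lborel (fourier_L2 u) (fourier_L2 v)) = Re (ip lborel u v)" if u: "test_limit u" and v: "test_limit v" for u v :: "'a \<Rightarrow> complex"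
  proof -
    note su = test_limit_sqi[OF u] and sv = test_limit_sqi[OF v]
    have m: "fourier_L2 u \<in> borel_measurable lborel" "fourier_L2 v \<in> borel_measurable lborel" "fourier_L2 (\<lambda>x. u x + v x) \<in> borel_measurable lborel"
      using fourier_L2_sqi[OF su] fourier_L2_sqi[OF sv] fourier_L2_sqi[OF sqi_add[OF su sv]] unfolding sqi_def by blast+
    have "nsq lborel (\<lambda>\<xi>. fourier_L2 u \<xi> + fourier_L2 v \<xi>) = nsq lborel (fourier_L2 (\<lambda>x. u x + v x))"
      by (rule nsq_cong_AE) (use m fourier_L2_add[OF su sv] in auto)
    also have "\<dots> = nsq lborel (\<lambda>x. u x + v x)" by (rule Plancherel[OF test_limit_add[OF u v]])
    finally show ?thesis
      unfolding nsq_add[OF su sv] nsq_add[OF fourier_L2_sqi[OF su] fourier_L2_sqi[OF sv]] Plancherel[OF u] Plancherel[OF v]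
      by simp
  qed
  have "Im (ip lborel (fourier_L2 u) (fourier_L2 v)) = Im (ip lborel u v)"
  proof -
    note su = test_limit_sqi[OF u] and sv = test_limit_sqi[OF v]
    have "ip lborel (fourier_L2 u) (fourier_L2 (\<lambda>x. \<i> * v x)) = ip lborel (fourier_L2 u) (\<lambda>\<xi>. \<i> * fourier_L2 v \<xi>)"
      using fourier_L2_sqi[OF su] fourier_L2_sqi[OF sv] fourier_L2_sqi[OF sqi_scale[OF sv, of \<i>]] fourier_L2_scale[OF sv, of \<i>]
      by (intro ip_cong_AE) (auto simp: sqi_def)
    then show ?thesis using Re[OF u test_limit_scale[OF v, of \<i>]] by (simp add: ip_scale_right)
  qed
  with Re[OF u v] show ?thesis by (simp add: complex_eq_iff)
qed

text \<open>The transforms are Cauchy in the weighted space, so they converge there; they also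
  converge to \<open>fourier_L2 u\<close> for Lebesgue measure. The weight is at least 1, hence both
  limits agree almost everywhere.\<close>

lemma Hs_completionE:
  assumes u: "u \<in> Hs_completion s \<Omega>" and s: "0 \<le> s" "s \<le> 1"
  obtains f where "\<forall>k::nat. test_fun \<Omega> (f k)" "sqlim lborel f u" "sqlim (wl (sw s)) (\<lambda>k. fourier (f k)) (fourier_L2 u)"
proof -
  obtain f where L: "L2 u" and f: "\<forall>k::nat. test_fun \<Omega> (f k)" and lim: "L2_tendsto f u"
    and C: "\<forall>e>0. \<exists>N. \<forall>i\<ge>N. \<forall>j\<ge>N. Hs_norm_sq s (\<lambda>x. f i x - f j x) < e"
    using u unfolding Hs_completion_def by auto
  note f = f[rule_format] and C = C[rule_format]
  have l: "sqlim lborel f u" using lim L2_tendsto_iff[of f u, OF test_fun_L2[OF f] L] by blast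
  have d: "fourier (\<lambda>x. f i x - f j x) = (\<lambda>\<xi>. fourier (f i) \<xi> - fourier (f j) \<xi>)" for i j
    by (rule ext) (rule fourier_diff[OF test_fun_integrable[OF f] test_fun_integrable[OF f]])
  have "sqCauchy (wl (sw s)) (\<lambda>k. fourier (f k))"
    unfolding sqCauchy_def
  proof (intro conjI allI impI)
    show "sqi (wl (sw s)) (fourier (f i))" for i by (rule fourier_test_sqi_sw[OF f s(2)])
    fix e :: real assume e: "e > 0"
    then obtain N where N: "\<forall>i\<ge>N. \<forall>j\<ge>N. Hs_norm_sq s (\<lambda>x. f i x - f j x) < ennreal e"
      using C[of "ennreal e"] by auto
    have "nsq (wl (sw s)) (\<lambda>\<xi>. fourier (f i) \<xi> - fourier (f j) \<xi>) < e" if "i \<ge> N" "j \<ge> N" for i j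
    proof -
      have "ennreal (nsq (wl (sw s)) (\<lambda>\<xi>. fourier (f i) \<xi> - fourier (f j) \<xi>)) < ennreal e"
        using N that unfolding Hs_norm_sq_test[OF test_fun_diff[OF f f] s(2)] d by blast
      then show ?thesis by (simp add: ennreal_less_iff)
    qed
    then show "\<exists>N. \<forall>i\<ge>N. \<forall>j\<ge>N. nsq (wl (sw s)) (\<lambda>x. fourier (f i) x - fourier (f j) x) < e" by blast
  qed
  then obtain g where g: "sqlim (wl (sw s)) (\<lambda>k. fourier (f k)) g" by (rule sqCauchy_converges)
  have F: "sqlim lborel (\<lambda>k. fourier (f k)) (fourier_L2 u)"
    by (rule fourier_L2_sqlim[OF test_fun_integrable[OF f] l])
  have "AE \<xi> in lborel. g \<xi> = fourier_L2 u \<xi>" by (rule sqlim_unique[OF sqlim_sw_lborel[OF s(1) g] F])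
  then have "AE \<xi> in wl (sw s). g \<xi> = fourier_L2 u \<xi>" by (simp only: AE_wl_sw)
  moreover have "fourier_L2 u \<in> borel_measurable (wl (sw s))"
    using sqlimD(2)[OF F] by (simp add: sqi_def)
  ultimately have "sqlim (wl (sw s)) (\<lambda>k. fourier (f k)) (fourier_L2 u)"
    by (intro sqlim_cong_AE[OF g])
  moreover have "\<forall>k. test_fun \<Omega> (f k)" using f by blast
  ultimately show ?thesis using l by (intro that)
qed

lemma Hs_completion_test_limit:
  assumes "u \<in> Hs_completion s \<Omega>" "0 \<le> s" "s \<le> 1" shows "test_limit u"
proof -
  obtain f where f: "\<forall>k::nat. test_fun \<Omega> (f k)" "sqlim lborel f u"
      "sqlim (wl (sw s)) (\<lambda>k. fourier (f k)) (fourier_L2 u)"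
    using assms by (rule Hs_completionE)
  show ?thesis unfolding test_limit_def
    by (intro exI[of _ f] conjI allI f(2) test_fun_UNIV[OF f(1)[rule_format]])
qed

text \<open>Conversely a limit of transforms of test functions in the weighted space comes from an
  element of the completion.\<close>

lemma Hs_completionI:
  assumes f: "\<And>k::nat. test_fun \<Omega> (f k)" and g: "sqlim (wl (sw s)) (\<lambda>k. fourier (f k)) g" and s: "0 \<le> s" "s \<le> 1"
  obtains u where "u \<in> Hs_completion s \<Omega>" "sqlim lborel f u" "AE \<xi> in lborel. fourier_L2 u \<xi> = g \<xi>"
proof -
  have d: "fourier (\<lambda>x. f i x - f j x) = (\<lambda>\<xi>. fourier (f i) \<xi> - fourier (f j) \<xi>)" for i j
    by (rule ext) (rule fourier_diff[OF test_fun_integrable[OF f] test_fun_integrable[OF f]])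
  have C: "sqCauchy lborel (\<lambda>k. fourier (f k))" by (rule sqlim_imp_Cauchy[OF sqlim_sw_lborel[OF s(1) g]])
  have "sqCauchy lborel f"
    using C unfolding sqCauchy_def d[symmetric] Plancherel_test_fun[OF test_fun_diff[OF f f]]
    using test_fun_sqi[OF f] by blast
  then obtain u where u: "sqlim lborel f u" by (rule sqCauchy_converges)
  have L: "L2 u" using sqlimD(2)[OF u] by (simp only: L2_iff_sqi)
  have CW: "sqCauchy (wl (sw s)) (\<lambda>k. fourier (f k))" by (rule sqlim_imp_Cauchy[OF g])
  have "u \<in> Hs_completion s \<Omega>"
    unfolding Hs_completion_def mem_Collect_eq
  proof (intro conjI exI[of _ f] L allI impI f)
    show "L2_tendsto f u" using u L2_tendsto_iff[of f u, OF test_fun_L2[OF f] L] by blast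
    fix e :: ennreal assume e: "e > 0"
    \<comment> \<open>The tolerance ranges over extended reals and may be infinite; a real tolerance
      below it suffices.\<close>
    obtain r where r: "r > 0" "ennreal r \<le> e"
    proof (cases e)
      case (real q)
      then have "q > 0" "ennreal q \<le> e" using e by auto
      then show ?thesis by (rule that)
    next
      case top
      then have "(1::real) > 0" "ennreal 1 \<le> e" by auto
      then show ?thesis by (rule that)
    qed
    obtain N where N: "\<forall>i\<ge>N. \<forall>j\<ge>N. nsq (wl (sw s)) (\<lambda>x. fourier (f i) x - fourier (f j) x) < r"
      using CW r(1) unfolding sqCauchy_def by blast
    have "Hs_norm_sq s (\<lambda>x. f i x - f j x) < e" if "i \<ge> N" "j \<ge> N" for i j
    proof -
      have "nsq (wl (sw s)) (fourier (\<lambda>x. f i x - f j x)) < r" unfolding d using N that by blast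
      then have "Hs_norm_sq s (\<lambda>x. f i x - f j x) < ennreal r"
        unfolding Hs_norm_sq_test[OF test_fun_diff[OF f f] s(2)] by (simp add: ennreal_less_iff)
      then show ?thesis using r(2) by (rule less_le_trans)
    qed
    then show "\<exists>N. \<forall>i\<ge>N. \<forall>j\<ge>N. Hs_norm_sq s (\<lambda>x. f i x - f j x) < e" by blast
  qed
  moreover have "AE \<xi> in lborel. fourier_L2 u \<xi> = g \<xi>"
    by (rule sqlim_unique[OF fourier_L2_sqlim[OF test_fun_integrable[OF f] u] sqlim_sw_lborel[OF s(1) g]])
  ultimately show ?thesis using u by (intro that)
qed

section \<open>The form domain on the Fourier side\<close>

abbreviation \<nu> :: "'a::euclidean_space measure" where "\<nu> \<equiv> wl (sw 1)"

text \<open>The frequency-side picture of \<open>H10 \<Omega>\<close>: a closed subspace of the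
  space with measure \<nu>, on which the energy is the \<open>wl hw\<close> part of the
  norm.\<close>

definition Hcl :: "'a::euclidean_space set \<Rightarrow> ('a \<Rightarrow> complex) \<Rightarrow> bool" where
  "Hcl \<Omega> g \<longleftrightarrow> (\<exists>f. (\<forall>k::nat. test_fun \<Omega> (f k)) \<and> sqlim \<nu> (\<lambda>k. fourier (f k)) g)"

lemma HclE:
  assumes "Hcl \<Omega> g"
  obtains f where "\<forall>k::nat. test_fun \<Omega> (f k)" "sqlim \<nu> (\<lambda>k. fourier (f k)) g"
  using assms unfolding Hcl_def by blast

lemma Hcl_sqi: "Hcl \<Omega> g \<Longrightarrow> sqi \<nu> g"
  unfolding Hcl_def using sqlimD(2) by blast

lemma Hcl_sqi0: "Hcl \<Omega> g \<Longrightarrow> sqi lborel g"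
  by (rule sqi_sw_lborel[OF zero_le_one Hcl_sqi])

lemma Hcl_sqihw: "Hcl \<Omega> g \<Longrightarrow> sqi (wl hw) g"
  by (rule sqi_sw1_hw[OF Hcl_sqi])

lemma sqlim_nu0: "sqlim \<nu> f g \<Longrightarrow> sqlim lborel f g"
  by (rule sqlim_sw_lborel[OF zero_le_one])

lemma Hcl_test: "test_fun \<Omega> f \<Longrightarrow> Hcl \<Omega> (fourier f)"
  unfolding Hcl_def
  by (intro exI[of _ "\<lambda>_. f"] conjI allI sqlim_const fourier_test_sqi_sw) auto

lemma Hcl_diff:
  assumes "Hcl \<Omega> g" "Hcl \<Omega> h" shows "Hcl \<Omega> (\<lambda>x. g x - h x)"
proof -
  obtain a where a: "\<forall>k::nat. test_fun \<Omega> (a k)" "sqlim \<nu> (\<lambda>k. fourier (a k)) g" using assms(1) by (rule HclE)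
  obtain b where b: "\<forall>k::nat. test_fun \<Omega> (b k)" "sqlim \<nu> (\<lambda>k. fourier (b k)) h" using assms(2) by (rule HclE)
  note a = a(1)[rule_format] a(2) and b = b(1)[rule_format] b(2)
  have "fourier (\<lambda>x. a k x - b k x) = (\<lambda>\<xi>. fourier (a k) \<xi> - fourier (b k) \<xi>)" for k
    by (rule ext) (rule fourier_diff[OF test_fun_integrable[OF a(1)] test_fun_integrable[OF b(1)]])
  then have "sqlim \<nu> (\<lambda>k. fourier (\<lambda>x. a k x - b k x)) (\<lambda>x. g x - h x)"
    using sqlim_diff[OF a(2) b(2)] by (simp only:)
  then show ?thesis unfolding Hcl_def
    by (intro exI[of _ "\<lambda>k x. a k x - b k x"] conjI allI test_fun_diff a(1) b(1))
qed

lemma Hcl_scale: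
  assumes "Hcl \<Omega> g" shows "Hcl \<Omega> (\<lambda>x. c * g x)"
proof -
  obtain a where a: "\<forall>k::nat. test_fun \<Omega> (a k)" "sqlim \<nu> (\<lambda>k. fourier (a k)) g" using assms(1) by (rule HclE)
  note a = a(1)[rule_format] a(2)
  have "fourier (\<lambda>x. c * a k x) = (\<lambda>\<xi>. c * fourier (a k) \<xi>)" for k
    by (rule ext) (rule fourier_scale)
  then have "sqlim \<nu> (\<lambda>k. fourier (\<lambda>x. c * a k x)) (\<lambda>x. c * g x)"
    using sqlim_scale[OF a(2)] by (simp only:)
  then show ?thesis unfolding Hcl_def
    by (intro exI[of _ "\<lambda>k x. c * a k x"] conjI allI test_fun_scale a(1))
qed

lemma Hcl_add:
  assumes "Hcl \<Omega> g" "Hcl \<Omega> h" shows "Hcl \<Omega> (\<lambda>x. g x + h x)"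
  using Hcl_diff[OF assms(1) Hcl_scale[OF assms(2), of "-1"]] by simp

lemma Hcl_sum:
  assumes "finite I" "\<And>i. i \<in> I \<Longrightarrow> Hcl \<Omega> (u i)"
  shows "Hcl \<Omega> (\<lambda>x. \<Sum>i\<in>I. c i * u i x)"
  using assms
proof (induction I rule: finite_induct)
  case empty
  show ?case using Hcl_test[OF test_fun_zero[of \<Omega>]] by (simp add: fourier_zero)
next
  case (insert i I)
  have "Hcl \<Omega> (\<lambda>x. c i * u i x + (\<Sum>i\<in>I. c i * u i x))"
    by (intro Hcl_add Hcl_scale insert.IH) (use insert.prems in auto)
  then show ?case using insert.hyps by simp
qed

lemma Hcl_approx:
  assumes g: "Hcl \<Omega> g" and e: "e > 0"
  shows "\<exists>f. test_fun \<Omega> f \<and> nsq \<nu> (\<lambda>x. fourier f x - g x) < e"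
proof -
  obtain a where a: "\<forall>k::nat. test_fun \<Omega> (a k)" "sqlim \<nu> (\<lambda>k. fourier (a k)) g" using g by (rule HclE)
  have "\<forall>\<^sub>F k in sequentially. nsq \<nu> (\<lambda>x. fourier (a k) x - g x) < e"
    by (rule order_tendstoD(2)[OF sqlimD(3)[OF a(2)] e])
  then show ?thesis using a(1) unfolding eventually_sequentially by blast
qed

text \<open>Each \<open>g k\<close> is replaced by the transform of a test function at squared
  distance below \<open>1 / (k + 1)\<close>.\<close>

lemma Hcl_closed:
  assumes g: "\<And>k::nat. Hcl \<Omega> (g k)" and l: "sqlim \<nu> g h"
  shows "Hcl \<Omega> h"
proof -
  have ex: "\<forall>k. \<exists>f. test_fun \<Omega> f \<and> nsq \<nu> (\<lambda>x. fourier f x - g k x) < 1 / real (Suc k)"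
    by (intro allI Hcl_approx g) simp
  have "\<exists>f. \<forall>k. test_fun \<Omega> (f k) \<and> nsq \<nu> (\<lambda>x. fourier (f k) x - g k x) < 1 / real (Suc k)"
    by (rule choice[OF ex])
  then obtain f where f: "\<forall>k. test_fun \<Omega> (f k) \<and> nsq \<nu> (\<lambda>x. fourier (f k) x - g k x) < 1 / real (Suc k)"
    by (rule exE)
  have ft: "test_fun \<Omega> (f k)" for k by (rule conjunct1[OF spec[OF f]])
  have fl: "nsq \<nu> (\<lambda>x. fourier (f k) x - g k x) < 1 / real (Suc k)" for k by (rule conjunct2[OF spec[OF f]])
  have fs: "sqi \<nu> (fourier (f k))" for k by (rule Hcl_sqi[OF Hcl_test[OF ft]])
  have "sqlim \<nu> (\<lambda>k. fourier (f k)) h"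
  proof (rule sqlimI[OF fs sqlimD(2)[OF l]])
    have le: "nsq \<nu> (\<lambda>x. fourier (f k) x - h x) \<le> 2 * (1 / real (Suc k)) + 2 * nsq \<nu> (\<lambda>x. g k x - h x)" for k
      using nsq_diff_le[OF fs[of k] sqlimD(1)[OF l, of k] sqlimD(2)[OF l]] fl[of k] by linarith
    have "(\<lambda>k. 2 * (1 / real (Suc k)) + 2 * nsq \<nu> (\<lambda>x. g k x - h x)) \<longlonglongrightarrow> 2 * 0 + 2 * 0"
      by (intro tendsto_add tendsto_mult_left LIMSEQ_Suc[OF lim_1_over_n] sqlimD(3)[OF l])
    then have "(\<lambda>k. 2 * (1 / real (Suc k)) + 2 * nsq \<nu> (\<lambda>x. g k x - h x)) \<longlonglongrightarrow> 0" by simp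
    from null_sandwich[OF this nsq_nonneg le]
    show "(\<lambda>k. nsq \<nu> (\<lambda>x. fourier (f k) x - h x)) \<longlonglongrightarrow> 0" .
  qed
  with ft show ?thesis unfolding Hcl_def by (intro exI[of _ f] conjI allI)
qed

lemma H10_D:
  assumes u: "u \<in> H10 \<Omega>"
  shows "Hcl \<Omega> (fourier_L2 u)" "test_limit u" "sqi lborel u" "AE x in lborel. x \<notin> \<Omega> \<longrightarrow> u x = 0"
proof -
  have u': "u \<in> Hs_completion 1 \<Omega>" using u by (simp add: H10_def)
  obtain f where f: "\<forall>k::nat. test_fun \<Omega> (f k)" "sqlim lborel f u"
      "sqlim \<nu> (\<lambda>k. fourier (f k)) (fourier_L2 u)"
    using u' zero_le_one order_refl by (rule Hs_completionE)
  show "Hcl \<Omega> (fourier_L2 u)" unfolding Hcl_def by (intro exI[of _ f] conjI f)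
  show t: "test_limit u" by (rule Hs_completion_test_limit[OF u' zero_le_one order_refl])
  show "sqi lborel u" by (rule test_limit_sqi[OF t])
  show "AE x in lborel. x \<notin> \<Omega> \<longrightarrow> u x = 0"
    by (rule sqCauchy_limit_AE[OF f(2)]) (use test_fun_outside[OF f(1)[rule_format]] in auto)
qed

lemma L2_inner_eq_ip:
  assumes "\<Omega> \<in> sets borel" "u \<in> borel_measurable lborel" "v \<in> borel_measurable lborel"
    and "AE x in lborel. x \<notin> \<Omega> \<longrightarrow> u x * cnj (v x) = 0"
  shows "L2_inner \<Omega> u v = ip lborel u v"
  unfolding L2_inner_def ip_def set_lebesgue_integral_def
proof (rule integral_cong_AE)
  have [measurable]: "\<Omega> \<in> sets borel" "u \<in> borel_measurable lborel" "v \<in> borel_measurable lborel" by fact+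
  show "(\<lambda>x. indicator \<Omega> x *\<^sub>R (u x * cnj (v x))) \<in> borel_measurable lborel"
    "(\<lambda>x. u x * cnj (v x)) \<in> borel_measurable lborel" by measurable
  show "AE x in lborel. indicator \<Omega> x *\<^sub>R (u x * cnj (v x)) = u x * cnj (v x)"
    using assms(4) by eventually_elim (auto simp: indicator_def)
qed

lemma set_integral_test:
  assumes v: "test_fun \<Omega> v"
  shows "(LINT x:\<Omega>|lborel. u x * v x) = ip lborel u (\<lambda>x. cnj (v x))"
  unfolding ip_def set_lebesgue_integral_def
proof (rule Bochner_Integration.integral_cong[OF refl])
  fix x show "indicator \<Omega> x *\<^sub>R (u x * v x) = u x * cnj (cnj (v x))"
    using test_fun_outside[OF v, of x] by (cases "x \<in> \<Omega>") auto
qed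

lemma ip_fourier_test:
  assumes u: "test_limit u" and v: "test_fun \<Omega> v"
  shows "ip lborel u v = ip lborel (fourier_L2 u) (fourier v)"
proof -
  have "ip lborel u v = ip lborel (fourier_L2 u) (fourier_L2 v)"
    by (rule Plancherel_ip[OF u test_limit_test[OF v], symmetric])
  also have "\<dots> = ip lborel (fourier_L2 u) (fourier v)"
    by (rule ip_cong_AE)
       (use fourier_L2_sqi[OF test_limit_sqi[OF u]] fourier_L2_sqi[OF test_fun_sqi[OF v]] fourier_test_sqi[OF v]
         fourier_L2_integrable[OF test_fun_integrable[OF v] test_fun_sqi[OF v]] in \<open>auto simp: sqi_def\<close>)
  finally show ?thesis .
qed

text \<open>Plancherel together with the symbol of the Laplacian. The weak formulation is bilinear
  in \<open>u\<close> and \<open>v\<close> while \<open>ip\<close> is conjugate-linear in its second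
  argument, which is why \<open>v\<close> is conjugated.\<close>

lemma weak_laplacian:
  assumes u: "u \<in> H10 \<Omega>" and v: "test_fun \<Omega> v"
  shows "- (LINT x:\<Omega>|lborel. u x * laplacian v x) = ip (wl hw) (fourier_L2 u) (fourier (\<lambda>x. cnj (v x)))"
    and "(LINT x:\<Omega>|lborel. u x * v x) = ip lborel (fourier_L2 u) (fourier (\<lambda>x. cnj (v x)))"
proof -
  note tu = H10_D(2)[OF u] and cv = test_fun_cnj[OF v]
  let ?V = "fourier (\<lambda>x. cnj (v x))"
  have m: "fourier_L2 u \<in> borel_measurable borel" "?V \<in> borel_measurable borel"
    using fourier_L2_sqi[OF test_limit_sqi[OF tu]] fourier_test_sqi[OF cv] by (simp_all add: sqi_def)
  show "(LINT x:\<Omega>|lborel. u x * v x) = ip lborel (fourier_L2 u) ?V"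
    unfolding set_integral_test[OF v] by (rule ip_fourier_test[OF tu cv])
  have "(LINT x:\<Omega>|lborel. u x * laplacian v x) = ip lborel u (\<lambda>x. cnj (laplacian v x))"
    by (rule set_integral_test[OF test_fun_laplacian[OF v]])
  also have "(\<lambda>x. cnj (laplacian v x)) = laplacian (\<lambda>x. cnj (v x))"
    by (rule ext) (rule laplacian_cnj[OF v, symmetric])
  also have "ip lborel u (laplacian (\<lambda>x. cnj (v x))) = ip lborel (fourier_L2 u) (fourier (laplacian (\<lambda>x. cnj (v x))))"
    by (rule ip_fourier_test[OF tu test_fun_laplacian[OF cv]])
  also have "fourier (laplacian (\<lambda>x. cnj (v x))) = (\<lambda>\<xi>. - of_real (hw \<xi>) * ?V \<xi>)"
    by (rule ext) (simp add: fourier_laplacian[OF cv] hw_def)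
  also have "ip lborel (fourier_L2 u) (\<lambda>\<xi>. - of_real (hw \<xi>) * ?V \<xi>) = (LINT \<xi>|lborel. - (of_real (hw \<xi>) * (fourier_L2 u \<xi> * cnj (?V \<xi>))))"
    unfolding ip_def by (rule Bochner_Integration.integral_cong[OF refl]) (simp add: mult.left_commute)
  also have "\<dots> = - ip (wl hw) (fourier_L2 u) ?V"
    by (subst ip_wl) (use m in auto)
  finally show "- (LINT x:\<Omega>|lborel. u x * laplacian v x) = ip (wl hw) (fourier_L2 u) ?V" by simp
qed

text \<open>The distributional equation is the form identity tested with transforms of test
  functions; both sides are continuous for \<nu>, so the identity extends to the whole form
  domain.\<close>

lemma eigenfunction_form:
  assumes e: "dirichlet_eigenfunction \<Omega> m u" and g: "Hcl \<Omega> g"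
  shows "ip (wl hw) (fourier_L2 u) g = of_real m * ip lborel (fourier_L2 u) g"
proof -
  have u: "u \<in> H10 \<Omega>" using e by (simp add: dirichlet_eigenfunction_def)
  have t: "ip (wl hw) (fourier_L2 u) (fourier v) = of_real m * ip lborel (fourier_L2 u) (fourier v)" if v: "test_fun \<Omega> v" for v
  proof -
    have "- (LINT x:\<Omega>|lborel. u x * laplacian (\<lambda>x. cnj (v x)) x) = of_real m * (LINT x:\<Omega>|lborel. u x * cnj (v x))"
      using e test_fun_cnj[OF v] unfolding dirichlet_eigenfunction_def by blast
    then show ?thesis unfolding weak_laplacian[OF u test_fun_cnj[OF v]] by simp
  qed
  obtain f where f: "\<forall>k::nat. test_fun \<Omega> (f k)" "sqlim \<nu> (\<lambda>k. fourier (f k)) g" using g by (rule HclE)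
  have s: "sqi lborel (fourier_L2 u)" "sqi (wl hw) (fourier_L2 u)"
    using Hcl_sqi0 Hcl_sqihw H10_D(1)[OF u] by blast+
  have "(\<lambda>k. ip (wl hw) (fourier_L2 u) (fourier (f k))) \<longlonglongrightarrow> ip (wl hw) (fourier_L2 u) g"
    by (rule sqlim_ip[OF sqlim_const[OF s(2)] sqlim_sw1_hw[OF f(2)]])
  moreover have "(\<lambda>k. of_real m * ip lborel (fourier_L2 u) (fourier (f k))) \<longlonglongrightarrow> of_real m * ip lborel (fourier_L2 u) g"
    by (intro tendsto_mult_left sqlim_ip[OF sqlim_const[OF s(1)] sqlim_nu0[OF f(2)]])
  ultimately show ?thesis unfolding t[OF f(1)[rule_format]] by (rule LIMSEQ_unique)
qed

lemma eigenfunctionI: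
  assumes u: "u \<in> H10 \<Omega>" "\<not> ae_zero u"
    and f: "\<And>v. test_fun \<Omega> v \<Longrightarrow> ip (wl hw) (fourier_L2 u) (fourier v) = of_real m * ip lborel (fourier_L2 u) (fourier v)"
  shows "dirichlet_eigenfunction \<Omega> m u"
  unfolding dirichlet_eigenfunction_def
proof (intro conjI allI impI u)
  fix v assume v: "test_fun \<Omega> v"
  show "- (LINT x:\<Omega>|lborel. u x * laplacian v x) = of_real m * (LINT x:\<Omega>|lborel. u x * v x)"
    unfolding weak_laplacian[OF u(1) v] by (rule f[OF test_fun_cnj[OF v]])
qed

subsection \<open>Rellich's theorem\<close>

lemma norm_exp_diff_le: "norm (exp (- (\<i> * complex_of_real a)) - exp (- (\<i> * complex_of_real b))) \<le> \<bar>a - b\<bar>"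
proof -
  have "exp (- (\<i> * complex_of_real a)) - exp (- (\<i> * complex_of_real b))
      = exp (- (\<i> * complex_of_real b)) * (exp (\<i> * complex_of_real (b - a)) - 1)"
    by (simp add: right_diff_distrib exp_add[symmetric] algebra_simps)
  moreover have "norm (exp (\<i> * complex_of_real (b - a)) - 1) \<le> \<bar>b - a\<bar>"
    using iexp_approx1[of "b - a" 0] by simp
  ultimately show ?thesis by (simp add: norm_mult abs_minus_commute)
qed

lemma fourier_Lipschitz:
  fixes u :: "'a::euclidean_space \<Rightarrow> complex"
  assumes u: "integrable lborel u" and R: "\<And>x. norm x > R \<Longrightarrow> u x = 0"
  shows "norm (fourier u \<xi> - fourier u \<eta>) \<le> fconst TYPE('a) * (LINT x|lborel. norm (u x)) * R * norm (\<xi> - \<eta>)"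
proof -
  let ?e = "\<lambda>(\<xi>::'a) x. exp (- (\<i> * complex_of_real (\<xi> \<bullet> x)))"
  have "(LINT x|lborel. ?e \<xi> x * u x) - (LINT x|lborel. ?e \<eta> x * u x) = (LINT x|lborel. ?e \<xi> x * u x - ?e \<eta> x * u x)"
    by (rule Bochner_Integration.integral_diff[symmetric]) (intro integrable_ee_mult u)+
  also have "norm \<dots> \<le> (LINT x|lborel. norm (?e \<xi> x * u x - ?e \<eta> x * u x))" by (rule integral_norm_bound)
  also have "\<dots> \<le> (LINT x|lborel. norm (\<xi> - \<eta>) * R * norm (u x))"
  proof (rule integral_mono)
    show "integrable lborel (\<lambda>x. norm (?e \<xi> x * u x - ?e \<eta> x * u x))"
      by (intro integrable_norm Bochner_Integration.integrable_diff integrable_ee_mult u)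
    show "integrable lborel (\<lambda>x. norm (\<xi> - \<eta>) * R * norm (u x))" using u by simp
    fix x
    show "norm (?e \<xi> x * u x - ?e \<eta> x * u x) \<le> norm (\<xi> - \<eta>) * R * norm (u x)"
    proof (cases "norm x > R")
      case True then show ?thesis using R by simp
    next
      case False
      have "norm (?e \<xi> x * u x - ?e \<eta> x * u x) = norm (?e \<xi> x - ?e \<eta> x) * norm (u x)"
        by (simp add: norm_mult[symmetric] left_diff_distrib)
      also have "\<dots> \<le> \<bar>\<xi> \<bullet> x - \<eta> \<bullet> x\<bar> * norm (u x)" by (intro mult_right_mono norm_exp_diff_le) simp
      also have "\<bar>\<xi> \<bullet> x - \<eta> \<bullet> x\<bar> \<le> norm (\<xi> - \<eta>) * norm x"
        unfolding inner_diff_left[symmetric] by (rule Cauchy_Schwarz_ineq2)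
      also have "\<dots> \<le> norm (\<xi> - \<eta>) * R" using False by (intro mult_left_mono) auto
      finally show ?thesis by (simp add: mult_right_mono)
    qed
  qed
  also have "\<dots> = norm (\<xi> - \<eta>) * R * (LINT x|lborel. norm (u x))" by simp
  finally have "norm ((LINT x|lborel. ?e \<xi> x * u x) - (LINT x|lborel. ?e \<eta> x * u x)) \<le> norm (\<xi> - \<eta>) * R * (LINT x|lborel. norm (u x))" .
  then have "fconst TYPE('a) * norm ((LINT x|lborel. ?e \<xi> x * u x) - (LINT x|lborel. ?e \<eta> x * u x))
      \<le> fconst TYPE('a) * (norm (\<xi> - \<eta>) * R * (LINT x|lborel. norm (u x)))"
    by (rule mult_left_mono) simp
  then show ?thesis
    unfolding fourier_eq right_diff_distrib[symmetric] norm_mult by (simp add: mult_ac)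
qed

text \<open>A diagonal argument gives convergence on a countable dense set, and the common Lipschitz
  constant transfers it to all points.\<close>

lemma pointwise_convergent_subsequence:
  fixes f :: "nat \<Rightarrow> 'a::euclidean_space \<Rightarrow> complex"
  assumes M: "\<And>n x. norm (f n x) \<le> M" and L: "\<And>n x y. norm (f n x - f n y) \<le> L * norm (x - y)"
  obtains r where "strict_mono (r :: nat \<Rightarrow> nat)" "\<forall>x. convergent (\<lambda>n. f (r n) x)"
proof -
  have L0: "L \<ge> 0"
  proof -
    obtain b :: 'a where b: "b \<in> Basis" using nonempty_Basis by blast
    have "0 \<le> norm (f 0 b - f 0 0)" by simp
    also have "\<dots> \<le> L * norm (b - 0)" by (rule L)
    finally show ?thesis using b by simp
  qed
  obtain D :: "'a set" where D: "countable D" "\<forall>X. open X \<longrightarrow> X \<noteq> {} \<longrightarrow> (\<exists>d\<in>D. d \<in> X)"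
    using countable_dense_exists by blast
  obtain r where r: "strict_mono r" "\<And>x. x \<in> D \<Longrightarrow> \<exists>l. (\<lambda>n. f (r n) x) \<longlonglongrightarrow> l"
    using function_convergent_subsequence[OF D(1), of f M] M by blast
  have "convergent (\<lambda>n. f (r n) x)" for x
  proof (rule Cauchy_convergent, rule metric_CauchyI)
    fix e :: real assume e: "e > 0"
    define \<delta> where "\<delta> = e / (3 * (L + 1))"
    have \<delta>: "\<delta> > 0" "L * \<delta> < e / 3" using e L0 by (auto simp: \<delta>_def field_simps)
    have "open (ball x \<delta>)" "ball x \<delta> \<noteq> {}" using \<delta>(1) by auto
    then obtain d where d: "d \<in> D" "d \<in> ball x \<delta>" using D(2) by blast
    have "norm (x - d) \<le> \<delta>" using d(2) by (simp add: dist_norm)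
    then have fd: "norm (f n x - f n d) < e / 3" for n
      using L[of n x d] mult_left_mono[OF _ L0, of "norm (x - d)" \<delta>] \<delta>(2) by linarith
    have "Cauchy (\<lambda>n. f (r n) d)" using r(2)[OF d(1)] by (metis LIMSEQ_imp_Cauchy)
    then obtain N where N: "\<forall>m\<ge>N. \<forall>n\<ge>N. dist (f (r m) d) (f (r n) d) < e / 3"
      using e by (metis metric_CauchyD divide_pos_pos zero_less_numeral)
    have "dist (f (r m) x) (f (r n) x) < e" if "m \<ge> N" "n \<ge> N" for m n
    proof -
      have "dist (f (r m) x) (f (r n) x) \<le> dist (f (r m) x) (f (r m) d) + dist (f (r m) d) (f (r n) d) + dist (f (r n) d) (f (r n) x)"
        using dist_triangle[of "f (r m) x" "f (r n) x" "f (r m) d"] dist_triangle[of "f (r m) d" "f (r n) x" "f (r n) d"] by linarith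
      moreover have "dist (f (r m) x) (f (r m) d) < e / 3" using fd by (simp add: dist_norm)
      moreover have "dist (f (r n) d) (f (r n) x) < e / 3" using fd[of "r n"] by (simp add: dist_norm norm_minus_commute)
      moreover have "dist (f (r m) d) (f (r n) d) < e / 3" using N that by blast
      ultimately show ?thesis by linarith
    qed
    then show "\<exists>N. \<forall>m\<ge>N. \<forall>n\<ge>N. dist (f (r m) x) (f (r n) x) < e" by blast
  qed
  then have "\<forall>x. convergent (\<lambda>n. f (r n) x)" by blast
  with r(1) show ?thesis by (rule that)
qed

text \<open>The transforms of a bounded sequence supported in a fixed ball are equi-Lipschitz, so a subsequence
  converges locally uniformly; the weight controls the tails.\<close>

lemma Rellich:
  fixes f :: "nat \<Rightarrow> 'a::euclidean_space \<Rightarrow> complex"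
  assumes \<Omega>: "bounded \<Omega>" and f: "\<And>k. test_fun \<Omega> (f k)" and C: "\<And>k. nsq \<nu> (fourier (f k)) \<le> C"
  obtains r where "strict_mono (r :: nat \<Rightarrow> nat)" "sqCauchy lborel (\<lambda>k. fourier (f (r k)))"
proof -
  obtain R where R: "\<forall>x\<in>\<Omega>. norm x \<le> R" using \<Omega> unfolding bounded_iff by blast
  have C0: "C \<ge> 0" using order_trans[OF nsq_nonneg C] .
  have R0: "0 \<le> max R 0" by simp
  have z: "f k x = 0" if "norm x > max R 0" for k x
    by (rule test_fun_outside[OF f]) (use that R in force)
  let ?S = "cball 0 (max R 0) :: 'a set"
  have sS: "nsq lborel (f k) \<le> C" for k
    using C[of k] nsq_sw1[OF fourier_test_sqi_sw[OF f order_refl], of k] nsq_nonneg[of "wl hw" "fourier (f k)"]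
    unfolding Plancherel_test_fun[OF f] by linarith
  define A where "A = sqrt (measure lborel ?S) * sqrt C"
  have A0: "A \<ge> 0" using C0 by (simp add: A_def)
  have fA: "(LINT x|lborel. norm (f k x)) \<le> A" for k
  proof -
    have "(LINT x|lborel. norm (f k x)) \<le> sqrt (measure lborel ?S) * sqrt (nsq lborel (f k))"
      by (rule sqi_bounded_support_integrable(2)[OF test_fun_sqi[OF f]]) (use z[of _ k] in \<open>auto simp: not_le\<close>)
    also have "\<dots> \<le> A" unfolding A_def by (intro mult_left_mono real_sqrt_le_mono sS) simp
    finally show ?thesis .
  qed
  define M where "M = fconst TYPE('a) * A"
  define L where "L = fconst TYPE('a) * A * max R 0"
  have M: "norm (fourier (f k) \<xi>) \<le> M" for k \<xi>
    using order_trans[OF norm_fourier_le mult_left_mono[OF fA]] unfolding M_def by simp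
  have L: "norm (fourier (f k) \<xi> - fourier (f k) \<eta>) \<le> L * norm (\<xi> - \<eta>)" for k \<xi> \<eta>
  proof -
    have "norm (fourier (f k) \<xi> - fourier (f k) \<eta>) \<le> fconst TYPE('a) * (LINT x|lborel. norm (f k x)) * max R 0 * norm (\<xi> - \<eta>)"
      by (rule fourier_Lipschitz[OF test_fun_integrable[OF f] z])
    also have "\<dots> \<le> L * norm (\<xi> - \<eta>)"
      unfolding L_def by (intro mult_right_mono mult_left_mono fA) simp_all
    finally show ?thesis .
  qed
  obtain r where r: "strict_mono (r :: nat \<Rightarrow> nat)" "\<forall>\<xi>. convergent (\<lambda>n. fourier (f (r n)) \<xi>)"
    by (rule pointwise_convergent_subsequence[OF M L])
  define F where "F k = fourier (f (r k))" for k
  define l where "l \<xi> = lim (\<lambda>k. F k \<xi>)" for \<xi>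
  have lim: "(\<lambda>k. F k \<xi>) \<longlonglongrightarrow> l \<xi>" for \<xi>
    using r(2) unfolding l_def F_def convergent_LIMSEQ_iff by blast
  have Fs: "sqi \<nu> (F k)" for k unfolding F_def by (rule fourier_test_sqi_sw[OF f order_refl])
  have Fm [measurable]: "F k \<in> borel_measurable borel" for k using Fs[of k] by (simp add: sqi_def)
  have lm [measurable]: "l \<in> borel_measurable borel"
    by (rule borel_measurable_LIMSEQ_metric[OF Fm lim])
  have lM: "norm (l \<xi>) \<le> M" for \<xi>
    by (rule LIMSEQ_le_const2[OF tendsto_norm[OF lim]]) (use M in \<open>auto simp: F_def\<close>)
  have loc: "(\<lambda>k. LINT \<xi>|lborel. indicator (cball 0 P) \<xi> * (norm (F k \<xi> - l \<xi>))\<^sup>2) \<longlonglongrightarrow> 0"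
    and loci: "integrable lborel (\<lambda>\<xi>::'a. indicator (cball 0 P) \<xi> * (norm (F k \<xi> - l \<xi>))\<^sup>2)" for P k
  proof -
    have [measurable]: "cball (0::'a) P \<in> sets borel" by simp
    have mI: "(\<lambda>\<xi>. indicator (cball 0 P) \<xi> * (norm (F k \<xi> - l \<xi>))\<^sup>2) \<in> borel_measurable lborel" for k
      by measurable
    have w: "integrable lborel (\<lambda>\<xi>::'a. indicator (cball 0 P) \<xi> * (2 * M)\<^sup>2)"
      by (intro integrable_mult_left integrable_real_indicator emeasure_bounded_finite) simp_all
    have b: "norm (indicator (cball 0 P) \<xi> * (norm (F k \<xi> - l \<xi>))\<^sup>2) \<le> indicator (cball 0 P) \<xi> * (2 * M)\<^sup>2" for k and \<xi> :: 'a
    proof -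
      have "norm (F k \<xi> - l \<xi>) \<le> 2 * M"
        using norm_triangle_ineq4[of "F k \<xi>" "l \<xi>"] M[of "r k" \<xi>] lM[of \<xi>] unfolding F_def by linarith
      then have "(norm (F k \<xi> - l \<xi>))\<^sup>2 \<le> (2 * M)\<^sup>2" by (intro power_mono) simp_all
      then show ?thesis by (simp add: indicator_def)
    qed
    have "(\<lambda>k. LINT \<xi>|lborel. indicator (cball 0 P) \<xi> * (norm (F k \<xi> - l \<xi>))\<^sup>2) \<longlonglongrightarrow> (LINT \<xi>|(lborel :: 'a measure). 0)"
    proof (rule integral_dominated_convergence[OF _ _ w])
      show "AE \<xi> in lborel. (\<lambda>k. indicator (cball 0 P) \<xi> * (norm (F k \<xi> - l \<xi>))\<^sup>2) \<longlonglongrightarrow> 0"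
      proof (rule AE_I2)
        fix \<xi> :: 'a
        have "(\<lambda>k. indicator (cball 0 P) \<xi> * (norm (F k \<xi> - l \<xi>))\<^sup>2) \<longlonglongrightarrow> indicator (cball 0 P) \<xi> * (norm (l \<xi> - l \<xi>))\<^sup>2"
          by (intro tendsto_mult tendsto_const tendsto_power tendsto_norm tendsto_diff lim)
        then show "(\<lambda>k. indicator (cball 0 P) \<xi> * (norm (F k \<xi> - l \<xi>))\<^sup>2) \<longlonglongrightarrow> 0" by simp
      qed
      show "AE \<xi> in lborel. norm (indicator (cball 0 P) \<xi> * (norm (F k \<xi> - l \<xi>))\<^sup>2) \<le> indicator (cball 0 P) \<xi> * (2 * M)\<^sup>2" for k
        by (rule AE_I2) (rule b)
    qed (rule mI | simp)+
    then show "(\<lambda>k. LINT \<xi>|lborel. indicator (cball 0 P) \<xi> * (norm (F k \<xi> - l \<xi>))\<^sup>2) \<longlonglongrightarrow> 0" by simp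
    show "integrable lborel (\<lambda>\<xi>::'a. indicator (cball 0 P) \<xi> * (norm (F k \<xi> - l \<xi>))\<^sup>2)"
    proof (rule Bochner_Integration.integrable_bound[OF w])
      show "AE \<xi> in lborel. norm (indicator (cball 0 P) \<xi> * (norm (F k \<xi> - l \<xi>))\<^sup>2) \<le> norm (indicator (cball 0 P) \<xi> * (2 * M)\<^sup>2)"
        by (rule AE_I2) (rule order_trans[OF b], simp)
    qed (rule mI)
  qed
  have F0: "sqi lborel (F k)" for k by (rule sqi_sw_lborel[OF zero_le_one Fs])
  have "sqCauchy lborel F"
    unfolding sqCauchy_def
  proof (intro conjI allI impI F0)
    fix e :: real assume e: "e > 0"
    \<comment> \<open>Outside the ball of radius \<open>P\<close> the weight \<open>sw 1\<close> is
      at least \<open>P\<^sup>2\<close>, so the tail of a difference is at most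
      \<open>4 * C / P\<^sup>2\<close>. The choice \<open>8 * C / e + 1\<close> works because
      \<open>P \<ge> 1\<close> gives \<open>P \<le> P\<^sup>2\<close>.\<close>
    obtain P where P: "P > 0" "4 * C / P\<^sup>2 < e / 2"
    proof -
      define P where "P = 8 * C / e + 1"
      have P1: "P \<ge> 1" using C0 e by (simp add: P_def)
      have "8 * C < e * P" using e by (simp add: P_def field_simps)
      also have "\<dots> \<le> e * P\<^sup>2" using P1 e by (simp add: power2_eq_square)
      finally have "4 * C / P\<^sup>2 < e / 2" using P1 by (simp add: field_simps)
      moreover have "P > 0" using P1 by simp
      ultimately show ?thesis by (intro that)
    qed
    let ?I = "\<lambda>k. LINT \<xi>|lborel. indicator (cball 0 P) \<xi> * (norm (F k \<xi> - l \<xi>))\<^sup>2"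
    have "\<forall>\<^sub>F k in sequentially. ?I k < e / 8" by (rule order_tendstoD(2)[OF loc]) (use e in simp)
    then obtain N where N: "\<And>k. k \<ge> N \<Longrightarrow> ?I k < e / 8" unfolding eventually_sequentially by blast
    have "nsq lborel (\<lambda>\<xi>. F i \<xi> - F j \<xi>) < e" if "i \<ge> N" "j \<ge> N" for i j
    proof -
      have sd: "sqi \<nu> (\<lambda>\<xi>. F i \<xi> - F j \<xi>)" by (rule sqi_diff[OF Fs Fs])
      have di: "integrable lborel (\<lambda>\<xi>. sw 1 \<xi> * (norm (F i \<xi> - F j \<xi>))\<^sup>2)"
        using sd by (subst (asm) sqi_wl) auto
      \<comment> \<open>Parallelogram law: the square of the difference is at most twice the sum of
        the two squares, each bounded by \<open>C\<close>.\<close>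
      have "0 \<le> nsq \<nu> (\<lambda>\<xi>. F i \<xi> + F j \<xi>)" by simp
      then have tail: "nsq \<nu> (\<lambda>\<xi>. F i \<xi> - F j \<xi>) \<le> 4 * C"
        using C[of "r i"] C[of "r j"] unfolding F_def[symmetric] nsq_diff[OF Fs Fs] nsq_add[OF Fs Fs] by linarith
      have pw: "(norm (F i \<xi> - F j \<xi>))\<^sup>2 \<le> (2 * (indicator (cball 0 P) \<xi> * (norm (F i \<xi> - l \<xi>))\<^sup>2)
          + 2 * (indicator (cball 0 P) \<xi> * (norm (F j \<xi> - l \<xi>))\<^sup>2)) + 1 / P\<^sup>2 * (sw 1 \<xi> * (norm (F i \<xi> - F j \<xi>))\<^sup>2)" for \<xi>
      proof (cases "\<xi> \<in> cball 0 P")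
        case True
        have "(norm (F i \<xi> - F j \<xi>))\<^sup>2 \<le> 2 * (norm (F i \<xi> - l \<xi>))\<^sup>2 + 2 * (norm (l \<xi> - F j \<xi>))\<^sup>2"
          using norm_add_sq_le[of "F i \<xi> - l \<xi>" "l \<xi> - F j \<xi>"] by simp
        moreover have "0 \<le> 1 / P\<^sup>2 * (sw 1 \<xi> * (norm (F i \<xi> - F j \<xi>))\<^sup>2)" by simp
        ultimately show ?thesis using True by (simp only: indicator_simps norm_minus_commute[of "l \<xi>"])
      next
        case False
        then have "P\<^sup>2 \<le> (norm \<xi>)\<^sup>2" using P(1) by (intro power_mono) auto
        then have "P\<^sup>2 \<le> sw 1 \<xi>" by (simp add: sw_one hw_def)
        then have "1 \<le> 1 / P\<^sup>2 * sw 1 \<xi>" using P(1) by (simp add: field_simps)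
        from mult_right_mono[OF this zero_le_power2, of "norm (F i \<xi> - F j \<xi>)"]
        show ?thesis using False by (simp add: mult.assoc)
      qed
      have "nsq lborel (\<lambda>\<xi>. F i \<xi> - F j \<xi>) \<le> (LINT \<xi>|lborel. (2 * (indicator (cball 0 P) \<xi> * (norm (F i \<xi> - l \<xi>))\<^sup>2)
          + 2 * (indicator (cball 0 P) \<xi> * (norm (F j \<xi> - l \<xi>))\<^sup>2)) + 1 / P\<^sup>2 * (sw 1 \<xi> * (norm (F i \<xi> - F j \<xi>))\<^sup>2))"
        unfolding nsq_def
        by (rule integral_mono[OF sqi_integrable[OF sqi_diff[OF F0 F0]] _ pw])
           (intro Bochner_Integration.integrable_add integrable_mult_right loci di)
      also have "\<dots> = (2 * ?I i + 2 * ?I j) + 1 / P\<^sup>2 * (LINT \<xi>|lborel. sw 1 \<xi> * (norm (F i \<xi> - F j \<xi>))\<^sup>2)"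
        by (simp only: Bochner_Integration.integral_add Bochner_Integration.integrable_add integrable_mult_right loci di integral_mult_right_zero)
      also have "(LINT \<xi>|lborel. sw 1 \<xi> * (norm (F i \<xi> - F j \<xi>))\<^sup>2) = nsq \<nu> (\<lambda>\<xi>. F i \<xi> - F j \<xi>)"
        by (rule nsq_wl[symmetric]) auto
      finally have "nsq lborel (\<lambda>\<xi>. F i \<xi> - F j \<xi>) \<le> (2 * ?I i + 2 * ?I j) + 1 / P\<^sup>2 * nsq \<nu> (\<lambda>\<xi>. F i \<xi> - F j \<xi>)" .
      moreover have "1 / P\<^sup>2 * nsq \<nu> (\<lambda>\<xi>. F i \<xi> - F j \<xi>) \<le> 1 / P\<^sup>2 * (4 * C)" by (rule mult_left_mono[OF tail]) simp
      ultimately show ?thesis using N[OF that(1)] N[OF that(2)] P(2) by simp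
    qed
    then show "\<exists>N. \<forall>i\<ge>N. \<forall>j\<ge>N. nsq lborel (\<lambda>x. F i x - F j x) < e" by blast
  qed
  then show ?thesis using r(1) unfolding F_def[abs_def] by (intro that)
qed

section \<open>Completeness of the Dirichlet eigenfunctions\<close>

text \<open>For \<open>t = - a / (\<bar>b\<bar> + 1)\<close> the quadratic term is at most half as
  large as the negative linear term. This is the step from minimality to a vanishing first
  variation.\<close>

lemma linear_term_zero:
  fixes a b :: real
  assumes "\<And>t :: real. 0 \<le> 2 * t * a + t\<^sup>2 * b" shows "a = 0"
proof (rule ccontr)
  assume a: "a \<noteq> 0"
  define t where "t = - a / (\<bar>b\<bar> + 1)"
  have p: "\<bar>b\<bar> + 1 > 0" by simp
  have "t\<^sup>2 * b \<le> t\<^sup>2 * (\<bar>b\<bar> + 1)" by (intro mult_left_mono) auto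
  also have "\<dots> = a\<^sup>2 / (\<bar>b\<bar> + 1)" using p by (simp add: t_def power2_eq_square)
  finally have "0 \<le> 2 * t * a + a\<^sup>2 / (\<bar>b\<bar> + 1)" using assms[of t] by linarith
  moreover have "2 * t * a = - 2 * (a\<^sup>2 / (\<bar>b\<bar> + 1))"
    by (simp add: t_def power2_eq_square)
  moreover have "a\<^sup>2 / (\<bar>b\<bar> + 1) > 0" using a p by simp
  ultimately show False by linarith
qed

lemma near_minimum_bound:
  fixes a b q m :: real
  assumes "a < q" "b < m + q" "q \<le> 1"
  shows "2 * a + 2 * b \<le> 2 * 1 + 2 * (m + 1)"
proof -
  have "2 * a \<le> 2 * 1" using assms(1,3) by simp
  moreover have "2 * b \<le> 2 * (m + 1)" using assms(2,3) by simp
  ultimately show ?thesis by (rule add_mono)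
qed

section \<open>Orthogonality relations of the transformed eigenfunctions\<close>

locale eigensystem =
  fixes \<Omega> :: "'a::euclidean_space set" and \<mu> :: "nat \<Rightarrow> real" and \<phi> :: "nat \<Rightarrow> 'a \<Rightarrow> complex"
  assumes open_dom: "open \<Omega>" and bounded_dom: "bounded \<Omega>" and sys: "dirichlet_eigensystem \<Omega> \<mu> \<phi>"
begin

abbreviation e :: "nat \<Rightarrow> 'a \<Rightarrow> complex" where "e j \<equiv> fourier_L2 (\<phi> j)"

lemma eigenfunction: "dirichlet_eigenfunction \<Omega> (\<mu> j) (\<phi> j)"
  using sys by (simp add: dirichlet_eigensystem_def)

lemma phi_H10: "\<phi> j \<in> H10 \<Omega>"
  using eigenfunction by (simp add: dirichlet_eigenfunction_def)

lemmas e_Hcl = H10_D(1)[OF phi_H10] and phi_limit = H10_D(2)[OF phi_H10] and phi_sqi = H10_D(3)[OF phi_H10]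
  and phi_outside = H10_D(4)[OF phi_H10]

lemma dom_borel [measurable]: "\<Omega> \<in> sets borel"
  using open_dom by simp

lemma L2_inner_ip:
  assumes "u \<in> borel_measurable lborel"
  shows "L2_inner \<Omega> u (\<phi> j) = ip lborel u (\<phi> j)"
proof (rule L2_inner_eq_ip)
  show "AE x in lborel. x \<notin> \<Omega> \<longrightarrow> u x * cnj (\<phi> j x) = 0"
    using phi_outside[of j] by eventually_elim simp
qed (use assms phi_sqi[of j] in \<open>auto simp: sqi_def\<close>)

lemma phi_orth: "ip lborel (\<phi> i) (\<phi> j) = (if i = j then of_real 1 else 0)"
  using sys L2_inner_ip[OF sqi_measurable[OF phi_sqi]] unfolding dirichlet_eigensystem_def by simp

lemma e_orth: "ip lborel (e i) (e j) = (if i = j then of_real 1 else 0)"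
  by (simp only: Plancherel_ip[OF phi_limit phi_limit] phi_orth)

lemma form_e:
  assumes g: "Hcl \<Omega> g" shows "ip (wl hw) g (e j) = of_real (\<mu> j) * ip lborel g (e j)"
  using eigenfunction_form[OF eigenfunction g, of j] ip_commute[of "wl hw" g "e j"] ip_commute[of lborel g "e j"]
  by simp

lemma form_e1:
  assumes g: "Hcl \<Omega> g" shows "ip \<nu> g (e j) = of_real (1 + \<mu> j) * ip lborel g (e j)"
  unfolding ip_sw1[OF Hcl_sqi[OF g] Hcl_sqi[OF e_Hcl]] form_e[OF g] by (simp add: distrib_right)

lemma mu_nonneg: "0 \<le> \<mu> j"
proof -
  have "complex_of_real (nsq (wl hw) (e j)) = of_real (\<mu> j)"
    using form_e[OF e_Hcl, of j j] by (simp only: ip_self[symmetric] e_orth) simp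
  then have "nsq (wl hw) (e j) = \<mu> j" by (simp only: of_real_eq_iff)
  then show ?thesis using nsq_nonneg[of "wl hw" "e j"] by simp
qed

lemma form_orth: "ip (wl hw) (e i) (e j) = (if i = j then of_real (\<mu> i) else 0)"
  unfolding form_e[OF e_Hcl] e_orth by simp

lemma form_orth1: "ip \<nu> (e i) (e j) = (if i = j then of_real (1 + \<mu> i) else 0)"
  unfolding form_e1[OF e_Hcl] e_orth by simp

text \<open>By \<open>form_e1\<close>, orthogonality to the \<open>e j\<close> for Lebesgue measure
  implies orthogonality for \<nu> as well, so this is a closed complement of the eigenfunctions in
  the form domain.\<close>

definition V :: "('a \<Rightarrow> complex) \<Rightarrow> bool" where
  "V g \<longleftrightarrow> Hcl \<Omega> g \<and> (\<forall>j. ip lborel g (e j) = 0)"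

lemma V_add: "V g \<Longrightarrow> V h \<Longrightarrow> V (\<lambda>x. g x + h x)"
  unfolding V_def by (auto simp: Hcl_add ip_add_left Hcl_sqi0 Hcl_sqi0[OF e_Hcl])

lemma V_scale: "V g \<Longrightarrow> V (\<lambda>x. c * g x)"
  unfolding V_def by (auto simp: Hcl_scale ip_scale_left)

lemma V_closed:
  assumes "\<And>k. V (g k)" "sqlim \<nu> g h" shows "V h"
  unfolding V_def
proof (intro conjI allI)
  show "Hcl \<Omega> h" by (rule Hcl_closed[OF _ assms(2)]) (use assms(1) in \<open>simp add: V_def\<close>)
  fix j
  have "(\<lambda>k. ip lborel (g k) (e j)) \<longlonglongrightarrow> ip lborel h (e j)"
    by (rule sqlim_ip[OF sqlim_nu0[OF assms(2)] sqlim_const[OF Hcl_sqi0[OF e_Hcl]]])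
  moreover have "ip lborel (g k) (e j) = 0" for k using assms(1)[of k] by (simp add: V_def)
  ultimately show "ip lborel h (e j) = 0" by (simp add: LIMSEQ_const_iff)
qed

text \<open>The series is taken in \<nu>, so that its limit and the remainder stay in the form
  domain. Its coefficients are the plain ones because both products with \<open>e j\<close> differ
  by the factor \<open>1 + \<mu> j\<close>, and this factor is positive, so the remainder is
  orthogonal in both senses.\<close>

lemma test_decomposition:
  assumes F: "Hcl \<Omega> F"
  obtains h where "sqlim \<nu> (\<lambda>N x. \<Sum>j<N. ip lborel F (e j) * e j x) h" "V (\<lambda>x. F x - h x)"
proof -
  have s: "sqi \<nu> F" "\<And>j. sqi \<nu> (e j)" "\<And>j. 1 + \<mu> j \<ge> 0"
    using Hcl_sqi[OF F] Hcl_sqi[OF e_Hcl] mu_nonneg by (auto simp: add_nonneg_nonneg)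
  obtain h where h: "sqlim \<nu> (\<lambda>N x. \<Sum>j<N. ip lborel F (e j) * e j x) h" and hj: "\<And>j. ip \<nu> h (e j) = ip \<nu> F (e j)"
    using orthogonal_expansion_converges[OF s(1) s(2) s(3) form_orth1 form_e1[OF F]] by blast
  have hH: "Hcl \<Omega> h" by (rule Hcl_closed[OF _ h]) (intro Hcl_sum e_Hcl finite_lessThan)
  have "ip lborel (\<lambda>x. F x - h x) (e j) = 0" for j
  proof -
    have "of_real (1 + \<mu> j) * ip lborel (\<lambda>x. F x - h x) (e j) = ip \<nu> (\<lambda>x. F x - h x) (e j)"
      by (rule form_e1[OF Hcl_diff[OF F hH], symmetric])
    also have "\<dots> = 0" unfolding ip_diff_left[OF s(1) Hcl_sqi[OF hH] s(2)] hj by simp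
    finally have "of_real (1 + \<mu> j) * ip lborel (\<lambda>x. F x - h x) (e j) = 0" .
    moreover have "complex_of_real (1 + \<mu> j) \<noteq> 0"
      unfolding of_real_eq_0_iff using mu_nonneg[of j] by linarith
    ultimately show ?thesis by (simp only: mult_eq_0_iff) blast
  qed
  then have "V (\<lambda>x. F x - h x)" unfolding V_def using Hcl_diff[OF F hH] by blast
  with h show ?thesis by (rule that)
qed

text \<open>Minimality gives the Euler-Lagrange equation for variations in \<open>V\<close>. A
  general test function differs from an element of \<open>V\<close> by a limit of combinations of
  the \<open>e j\<close>, to which \<open>g\<close> is orthogonal in both products, so the equation
  holds for all test functions. Then \<open>g\<close> is the transform of an eigenfunction
  orthogonal to every listed one.\<close>

lemma V_minimizer_contra:
  assumes g: "V g" "nsq lborel g = 1" and R: "\<And>h. V h \<Longrightarrow> m * nsq lborel h \<le> nsq \<nu> h" and eq: "nsq \<nu> g = m"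
  shows False
proof -
  have gH: "Hcl \<Omega> g" using g(1) by (simp add: V_def)
  have EL: "ip \<nu> g h = of_real m * ip lborel g h" if h: "V h" for h
  proof -
    have Re: "Re (ip \<nu> g h) = m * Re (ip lborel g h)" if h: "V h" for h
    proof -
      have hH: "Hcl \<Omega> h" using h by (simp add: V_def)
      \<comment> \<open>The Rayleigh inequality for \<open>g + t h\<close>; the constant terms
        cancel because \<open>g\<close> attains the minimum.\<close>
      have "0 \<le> 2 * t * (Re (ip \<nu> g h) - m * Re (ip lborel g h)) + t\<^sup>2 * (nsq \<nu> h - m * nsq lborel h)" for t :: real
      proof -
        have "m * nsq lborel (\<lambda>x. g x + of_real t * h x) \<le> nsq \<nu> (\<lambda>x. g x + of_real t * h x)"
          by (rule R[OF V_add[OF g(1) V_scale[OF h]]])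
        then show ?thesis
          unfolding nsq_add[OF Hcl_sqi[OF gH] sqi_scale[OF Hcl_sqi[OF hH]]] nsq_add[OF Hcl_sqi0[OF gH] sqi_scale[OF Hcl_sqi0[OF hH]]]
          by (simp add: nsq_scale ip_scale_right g(2) eq algebra_simps)
      qed
      then have "Re (ip \<nu> g h) - m * Re (ip lborel g h) = 0" by (rule linear_term_zero)
      then show ?thesis by simp
    qed
    have "Im (ip \<nu> g h) = m * Im (ip lborel g h)"
      using Re[OF V_scale[OF h, of \<i>]] by (simp add: ip_scale_right)
    with Re[OF h] show ?thesis by (simp add: complex_eq_iff)
  qed
  have form: "ip (wl hw) g (fourier v) = of_real (m - 1) * ip lborel g (fourier v)" if v: "test_fun \<Omega> v" for v
  proof -
    note F = Hcl_test[OF v]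
    let ?S = "\<lambda>N x. \<Sum>j<N. ip lborel (fourier v) (e j) * e j x"
    obtain h where h: "sqlim \<nu> ?S h" "V (\<lambda>x. fourier v x - h x)" using F by (rule test_decomposition)
    have hs: "sqi \<nu> h" by (rule sqlimD(2)[OF h(1)])
    have "ip lborel g (?S N) = 0" for N
      using g(1) Hcl_sqi0[OF e_Hcl] Hcl_sqi0[OF gH]
      by (simp add: ip_sum_right sqi_scale ip_scale_right V_def)
    then have 0: "ip lborel g h = 0"
      using sqlim_ip[OF sqlim_const[OF Hcl_sqi0[OF gH]] sqlim_nu0[OF h(1)]] by (simp add: LIMSEQ_const_iff)
    have "ip \<nu> g (?S N) = 0" for N
      using g(1) form_e1[OF gH] Hcl_sqi[OF e_Hcl] Hcl_sqi[OF gH]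
      by (simp add: ip_sum_right sqi_scale ip_scale_right V_def)
    then have 1: "ip \<nu> g h = 0"
      using sqlim_ip[OF sqlim_const[OF Hcl_sqi[OF gH]] h(1)] by (simp add: LIMSEQ_const_iff)
    have "ip \<nu> g (fourier v) = of_real m * ip lborel g (fourier v)"
      using EL[OF h(2)]
      unfolding ip_diff_right[OF Hcl_sqi[OF F] hs Hcl_sqi[OF gH]]
        ip_diff_right[OF Hcl_sqi0[OF F] sqi_sw_lborel[OF zero_le_one hs] Hcl_sqi0[OF gH]] 0 1 by simp
    then show ?thesis
      unfolding ip_sw1[OF Hcl_sqi[OF gH] Hcl_sqi[OF F]] by (simp add: algebra_simps)
  qed
  obtain f where f: "\<forall>k::nat. test_fun \<Omega> (f k)" "sqlim \<nu> (\<lambda>k. fourier (f k)) g" using gH by (rule HclE)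
  obtain u where u: "u \<in> Hs_completion 1 \<Omega>" "sqlim lborel f u" "AE \<xi> in lborel. fourier_L2 u \<xi> = g \<xi>"
    by (rule Hs_completionI[OF f(1)[rule_format] f(2) zero_le_one order_refl])
  have uH: "u \<in> H10 \<Omega>" using u(1) by (simp add: H10_def)
  note us = H10_D(3)[OF uH]
  have m: "fourier_L2 u \<in> borel_measurable borel" "g \<in> borel_measurable borel"
    using fourier_L2_sqi[OF us] Hcl_sqi[OF gH] by (simp_all add: sqi_def)
  have ip_u: "ip lborel (fourier_L2 u) k = ip lborel g k" if "k \<in> borel_measurable borel" for k
    by (rule ip_cong_AE) (use m that u(3) in auto)
  have iphw_u: "ip (wl hw) (fourier_L2 u) k = ip (wl hw) g k" if k: "k \<in> borel_measurable borel" for k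
  proof -
    have "AE \<xi> in wl hw. fourier_L2 u \<xi> = g \<xi>"
      unfolding wl_def by (subst AE_density) (use u(3) in auto)
    then show ?thesis by (intro ip_cong_AE) (use m k in auto)
  qed
  have fm: "fourier v \<in> borel_measurable borel" if "test_fun \<Omega> v" for v
    using fourier_test_sqi[OF that] by (simp add: sqi_def)
  have "nsq lborel u = 1"
    using Plancherel[OF H10_D(2)[OF uH]] nsq_cong_AE[of "fourier_L2 u" lborel g] m u(3) g(2) by simp
  then have nz: "\<not> ae_zero u" using nsq_eq_0_iff[OF us] by (simp add: ae_zero_def)
  \<comment> \<open>The product for \<nu> is the energy plus the plain product, hence the shift by
    1.\<close>
  have "dirichlet_eigenfunction \<Omega> (m - 1) u"
    by (rule eigenfunctionI[OF uH nz]) (simp only: ip_u[OF fm] iphw_u[OF fm] form)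
  then obtain j where "L2_inner \<Omega> u (\<phi> j) \<noteq> 0"
    using sys unfolding dirichlet_eigensystem_def by blast
  moreover have "L2_inner \<Omega> u (\<phi> j) = ip lborel g (e j)"
    unfolding L2_inner_ip[OF sqi_measurable[OF us]] Plancherel_ip[OF H10_D(2)[OF uH] phi_limit, symmetric]
    by (rule ip_u) (use Hcl_sqi[OF e_Hcl] in \<open>simp add: sqi_def\<close>)
  ultimately show False using g(1) by (simp add: V_def)
qed

text \<open>The direct method: minimise the Rayleigh quotient over the complement of the listed eigenfunctions.
  A minimiser would be a further eigenfunction.\<close>

lemma V_trivial:
  assumes g0: "V g0" shows "nsq lborel g0 = 0"
proof (rule ccontr)
  assume nz: "nsq lborel g0 \<noteq> 0"
  define S where "S = {nsq \<nu> g |g. V g \<and> nsq lborel g = 1}"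
  have norm1: "\<exists>c. nsq lborel (\<lambda>x. c * h x) = 1 \<and> V (\<lambda>x. c * h x) \<and> (norm c)\<^sup>2 * nsq lborel h = 1"
    if h: "V h" "nsq lborel h \<noteq> 0" for h
  proof -
    have p: "nsq lborel h > 0" using h(2) nsq_nonneg[of lborel h] by linarith
    then have n: "(norm (complex_of_real (1 / sqrt (nsq lborel h))))\<^sup>2 * nsq lborel h = 1"
      by (simp add: norm_divide power_divide)
    show ?thesis
      by (intro exI[of _ "complex_of_real (1 / sqrt (nsq lborel h))"] conjI V_scale[OF h(1)] n)
         (simp only: nsq_scale n)
  qed
  have ne: "S \<noteq> {}" using norm1[OF g0 nz] unfolding S_def by blast
  have bb: "bdd_below S" unfolding S_def by (rule bdd_belowI[of _ 0]) auto
  define m where "m = Inf S"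
  have mle: "m \<le> nsq \<nu> g" if "V g" "nsq lborel g = 1" for g
    unfolding m_def by (rule cInf_lower[OF _ bb]) (use that in \<open>auto simp: S_def\<close>)
  have m0: "m \<ge> 0" unfolding m_def by (rule cInf_greatest[OF ne]) (auto simp: S_def)
  have R: "m * nsq lborel h \<le> nsq \<nu> h" if h: "V h" for h
  proof (cases "nsq lborel h = 0")
    case True then show ?thesis by simp
  next
    case False
    obtain c where c: "nsq lborel (\<lambda>x. c * h x) = 1" "V (\<lambda>x. c * h x)" "(norm c)\<^sup>2 * nsq lborel h = 1"
      using norm1[OF h False] by blast
    have "m \<le> (norm c)\<^sup>2 * nsq \<nu> h" using mle[OF c(2,1)] by (simp only: nsq_scale)
    from mult_right_mono[OF this nsq_nonneg[of lborel h]]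
    have "m * nsq lborel h \<le> ((norm c)\<^sup>2 * nsq lborel h) * nsq \<nu> h" by (simp only: mult_ac)
    then show ?thesis unfolding c(3) by simp
  qed
  have "\<forall>k::nat. \<exists>g. V g \<and> nsq lborel g = 1 \<and> nsq \<nu> g < m + 1 / real (Suc k)"
  proof
    fix k :: nat
    have "Inf S < m + 1 / real (Suc k)" unfolding m_def by simp
    then obtain q where "q \<in> S" "q < m + 1 / real (Suc k)" using cInf_lessD[OF ne] by blast
    then show "\<exists>g. V g \<and> nsq lborel g = 1 \<and> nsq \<nu> g < m + 1 / real (Suc k)" unfolding S_def by blast
  qed
  from choice[OF this] obtain g where g: "\<forall>k. V (g k) \<and> nsq lborel (g k) = 1 \<and> nsq \<nu> (g k) < m + 1 / real (Suc k)" by (rule exE)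
  have gV: "V (g k)" and g1: "nsq lborel (g k) = 1" and gm: "nsq \<nu> (g k) < m + 1 / real (Suc k)" for k
    using g by blast+
  have gH: "Hcl \<Omega> (g k)" for k using gV by (simp add: V_def)
  \<comment> \<open>\<open>Rellich\<close> speaks of test functions, so the minimising sequence is
    shadowed by transforms of test functions at vanishing distance.\<close>
  have "\<forall>k. \<exists>f. test_fun \<Omega> f \<and> nsq \<nu> (\<lambda>x. fourier f x - g k x) < 1 / real (Suc k)"
    by (intro allI Hcl_approx gH) simp
  from choice[OF this] obtain f where f: "\<forall>k. test_fun \<Omega> (f k) \<and> nsq \<nu> (\<lambda>x. fourier (f k) x - g k x) < 1 / real (Suc k)" by (rule exE)
  have ft: "test_fun \<Omega> (f k)" and fl: "nsq \<nu> (\<lambda>x. fourier (f k) x - g k x) < 1 / real (Suc k)" for k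
    using f by blast+
  have fs: "sqi \<nu> (fourier (f k))" for k by (rule fourier_test_sqi_sw[OF ft order_refl])
  have k1: "1 / real (Suc k) \<le> 1" for k by simp
  have "nsq \<nu> (fourier (f k)) \<le> 2 * nsq \<nu> (\<lambda>x. fourier (f k) x - g k x) + 2 * nsq \<nu> (g k)" for k
    using nsq_diff_le[OF fs[of k] Hcl_sqi[OF gH[of k]] sqi_zero] by simp
  moreover have "2 * nsq \<nu> (\<lambda>x. fourier (f k) x - g k x) + 2 * nsq \<nu> (g k) \<le> 2 * 1 + 2 * (m + 1)" for k
    by (rule near_minimum_bound[OF fl gm k1])
  ultimately have "nsq \<nu> (fourier (f k)) \<le> 2 * 1 + 2 * (m + 1)" for k by (rule order_trans)
  then obtain r where r: "strict_mono r" "sqCauchy lborel (\<lambda>k. fourier (f (r k)))"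
    by (rule Rellich[OF bounded_dom ft])
  have rk: "k \<le> r k" for k by (rule seq_suble[OF r(1)])
  have inv: "1 / real (Suc (r k)) \<le> 1 / real (Suc k)" for k using rk[of k] by (simp add: frac_le)
  have e0: "\<exists>N. \<forall>k\<ge>N. 1 / real (Suc k) < \<epsilon>" if "\<epsilon> > 0" for \<epsilon> :: real
    using order_tendstoD(2)[OF LIMSEQ_Suc[OF lim_1_over_n] that] unfolding eventually_sequentially .
  have g0: "sqi lborel (g k)" for k by (rule Hcl_sqi0[OF gH])
  have f0: "sqi lborel (fourier (f k))" for k by (rule fourier_test_sqi[OF ft])
  have fg0: "nsq lborel (\<lambda>x. fourier (f (r k)) x - g (r k) x) \<le> 1 / real (Suc k)" for k
    using fl[of "r k"] inv[of k] nsq_sw1[OF sqi_diff[OF fs Hcl_sqi[OF gH]], of "r k" "r k"]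
      nsq_nonneg[of "wl hw" "\<lambda>x. fourier (f (r k)) x - g (r k) x"] by linarith
  have C0: "\<exists>N. \<forall>i\<ge>N. \<forall>j\<ge>N. nsq lborel (\<lambda>x. g (r i) x - g (r j) x) < \<epsilon>" if "\<epsilon> > 0" for \<epsilon>
  proof -
    have e8: "\<epsilon> / 16 > 0" using that by simp
    obtain N1 where N1: "\<forall>i\<ge>N1. \<forall>j\<ge>N1. nsq lborel (\<lambda>x. fourier (f (r i)) x - fourier (f (r j)) x) < \<epsilon> / 16"
      using r(2) e8 unfolding sqCauchy_def by blast
    obtain N2 where N2: "\<forall>k\<ge>N2. 1 / real (Suc k) < \<epsilon> / 16" using e0[OF e8] by blast
    have "nsq lborel (\<lambda>x. g (r i) x - g (r j) x) < \<epsilon>" if "i \<ge> max N1 N2" "j \<ge> max N1 N2" for i j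
    proof -
      have i: "i \<ge> N1" "i \<ge> N2" "j \<ge> N1" "j \<ge> N2" using that by auto
      have "nsq lborel (\<lambda>x. g (r i) x - g (r j) x)
          \<le> 2 * nsq lborel (\<lambda>x. g (r i) x - fourier (f (r i)) x) + 2 * nsq lborel (\<lambda>x. fourier (f (r i)) x - g (r j) x)"
        by (rule nsq_diff_le[OF g0 f0 g0])
      moreover have "nsq lborel (\<lambda>x. fourier (f (r i)) x - g (r j) x)
          \<le> 2 * nsq lborel (\<lambda>x. fourier (f (r i)) x - fourier (f (r j)) x) + 2 * nsq lborel (\<lambda>x. fourier (f (r j)) x - g (r j) x)"
        by (rule nsq_diff_le[OF f0 f0 g0])
      moreover have "nsq lborel (\<lambda>x. g (r i) x - fourier (f (r i)) x) < \<epsilon> / 16"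
        using fg0[of i] N2[rule_format, OF i(2)] unfolding nsq_minus_commute[of lborel "g (r i)"] by linarith
      moreover have "nsq lborel (\<lambda>x. fourier (f (r j)) x - g (r j) x) < \<epsilon> / 16"
        using fg0[of j] N2[rule_format, OF i(4)] by linarith
      moreover have "nsq lborel (\<lambda>x. fourier (f (r i)) x - fourier (f (r j)) x) < \<epsilon> / 16"
        using N1 i by blast
      ultimately show ?thesis using \<open>\<epsilon> > 0\<close> by linarith
    qed
    then show ?thesis by blast
  qed
  have gs: "sqi \<nu> (g k)" for k by (rule Hcl_sqi[OF gH])
  \<comment> \<open>The sum of two members of the minimising sequence lies in \<open>V\<close>, so
    its norm for \<nu> is bounded below by the Rayleigh inequality. The parallelogram law then
    bounds the norm of the difference by \<open>m\<close> times its plain norm and vanishing terms: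
    Cauchy for Lebesgue measure becomes Cauchy for \<nu>.\<close>
  have par: "nsq \<nu> (\<lambda>x. g (r i) x - g (r j) x) \<le> 2 / real (Suc i) + 2 / real (Suc j) + m * nsq lborel (\<lambda>x. g (r i) x - g (r j) x)" for i j
  proof -
    have "m * nsq lborel (\<lambda>x. g (r i) x + g (r j) x) \<le> nsq \<nu> (\<lambda>x. g (r i) x + g (r j) x)"
      by (rule R[OF V_add[OF gV gV]])
    moreover have "nsq \<nu> (\<lambda>x. g (r i) x - g (r j) x) + nsq \<nu> (\<lambda>x. g (r i) x + g (r j) x) = 2 * nsq \<nu> (g (r i)) + 2 * nsq \<nu> (g (r j))"
      unfolding nsq_diff[OF gs gs] nsq_add[OF gs gs] by simp
    moreover have p0: "nsq lborel (\<lambda>x. g (r i) x + g (r j) x) = 4 - nsq lborel (\<lambda>x. g (r i) x - g (r j) x)"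
      unfolding nsq_diff[OF g0 g0] nsq_add[OF g0 g0] g1 by simp
    moreover have "nsq \<nu> (g (r i)) \<le> m + 1 / real (Suc i)" "nsq \<nu> (g (r j)) \<le> m + 1 / real (Suc j)"
      using gm[of "r i"] gm[of "r j"] inv[of i] inv[of j] by linarith+
    ultimately show ?thesis by (simp add: right_diff_distrib)
  qed
  have "sqCauchy \<nu> (\<lambda>k. g (r k))"
    unfolding sqCauchy_def
  proof (intro conjI allI impI gs)
    fix \<epsilon> :: real assume \<epsilon>: "\<epsilon> > 0"
    \<comment> \<open>The budget is \<open>\<epsilon> / 4\<close> for each of the two terms
      \<open>2 / real (Suc i)\<close>, \<open>2 / real (Suc j)\<close> and
      \<open>\<epsilon> / 4\<close> for the term with \<open>m\<close>; the \<open>m + 1\<close>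
      keeps the divisor positive when \<open>m = 0\<close>.\<close>
    have e1: "\<epsilon> / 8 > 0" "\<epsilon> / (4 * (m + 1)) > 0" using \<epsilon> m0 by (simp_all add: add_nonneg_pos)
    obtain N1 where N1: "\<forall>i\<ge>N1. \<forall>j\<ge>N1. nsq lborel (\<lambda>x. g (r i) x - g (r j) x) < \<epsilon> / (4 * (m + 1))" using C0[OF e1(2)] by blast
    obtain N2 where N2: "\<forall>k\<ge>N2. 1 / real (Suc k) < \<epsilon> / 8" using e0[OF e1(1)] by blast
    have "nsq \<nu> (\<lambda>x. g (r i) x - g (r j) x) < \<epsilon>" if "i \<ge> max N1 N2" "j \<ge> max N1 N2" for i j
    proof -
      have i: "i \<ge> N1" "i \<ge> N2" "j \<ge> N1" "j \<ge> N2" using that by auto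
      have "nsq lborel (\<lambda>x. g (r i) x - g (r j) x) \<le> \<epsilon> / (4 * (m + 1))" using N1 i less_imp_le by blast
      from mult_left_mono[OF this m0]
      have "m * nsq lborel (\<lambda>x. g (r i) x - g (r j) x) \<le> m * (\<epsilon> / (4 * (m + 1)))" .
      also have "\<dots> \<le> \<epsilon> / 4" using m0 \<epsilon> by (simp add: field_simps)
      finally show ?thesis
        using par[of i j] N2[rule_format, OF i(2)] N2[rule_format, OF i(4)] \<epsilon> by simp
    qed
    then show "\<exists>N. \<forall>i\<ge>N. \<forall>j\<ge>N. nsq \<nu> (\<lambda>x. g (r i) x - g (r j) x) < \<epsilon>" by blast
  qed
  then obtain h where h: "sqlim \<nu> (\<lambda>k. g (r k)) h" by (rule sqCauchy_converges)
  have hV: "V h" by (rule V_closed[OF gV h])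
  have h1: "nsq lborel h = 1"
    using sqlim_nsq[OF sqlim_nu0[OF h]] unfolding g1 by (simp add: LIMSEQ_const_iff)
  have "nsq \<nu> h \<le> m + 0"
  proof (rule LIMSEQ_le[OF sqlim_nsq[OF h]])
    show "(\<lambda>k. m + 1 / real (Suc k)) \<longlonglongrightarrow> m + 0" by (intro tendsto_add tendsto_const LIMSEQ_Suc[OF lim_1_over_n])
    show "\<exists>N. \<forall>k\<ge>N. nsq \<nu> (g (r k)) \<le> m + 1 / real (Suc k)"
      using gm[of "r _"] inv by (intro exI[of _ 0] allI impI) (meson add_left_mono less_imp_le order_trans)
  qed
  then have hm: "nsq \<nu> h = m" using mle[OF hV h1] by simp
  show False
  proof (rule V_minimizer_contra[OF hV h1 _ hm])
    fix k assume "V k" then show "m * nsq lborel k \<le> nsq \<nu> k" by (rule R)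
  qed
qed

text \<open>The remainder of the decomposition lies in \<open>V\<close> and vanishes; Plancherel
  carries the convergence from the transforms back to the functions.\<close>

lemma test_expansion:
  assumes v: "test_fun \<Omega> v"
  shows "sqlim lborel (\<lambda>N x. \<Sum>j<N. ip lborel v (\<phi> j) * \<phi> j x) v"
proof -
  note F = Hcl_test[OF v]
  let ?S = "\<lambda>N x. \<Sum>j<N. ip lborel (fourier v) (e j) * e j x"
  obtain h where h: "sqlim \<nu> ?S h" "V (\<lambda>x. fourier v x - h x)" using F by (rule test_decomposition)
  have "Hcl \<Omega> (\<lambda>x. fourier v x - h x)" using h(2) by (simp add: V_def)
  then have "sqi lborel (\<lambda>x. fourier v x - h x)" by (rule Hcl_sqi0)
  then have "AE x in lborel. fourier v x - h x = 0" using V_trivial[OF h(2)] by (simp add: nsq_eq_0_iff)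
  then have "AE x in lborel. h x = fourier v x" by eventually_elim simp
  then have lim: "sqlim lborel ?S (fourier v)"
    by (intro sqlim_cong_AE[OF sqlim_nu0[OF h(1)]]) (use Hcl_sqi0[OF F] in \<open>auto simp: sqi_def\<close>)
  have a: "ip lborel (fourier v) (e j) = ip lborel v (\<phi> j)" for j
    using ip_fourier_test[OF phi_limit v, of j] ip_commute[of lborel "fourier v" "e j"] ip_commute[of lborel v "\<phi> j"] by simp
  let ?T = "\<lambda>N x. \<Sum>j<N. ip lborel v (\<phi> j) * \<phi> j x"
  have Tl: "test_limit (?T N)" for N by (intro test_limit_sum phi_limit finite_lessThan)
  have Ts: "sqi lborel (?T N)" for N by (rule test_limit_sqi[OF Tl])
  show ?thesis
  proof (rule sqlimI[OF Ts test_fun_sqi[OF v]])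
    have "nsq lborel (\<lambda>x. ?T N x - v x) = nsq lborel (\<lambda>x. ?S N x - fourier v x)" for N
    proof -
      have "nsq lborel (\<lambda>x. ?T N x - v x) = nsq lborel (fourier_L2 (\<lambda>x. ?T N x - v x))"
        by (rule Plancherel[OF test_limit_diff[OF Tl test_limit_test[OF v]], symmetric])
      also have "\<dots> = nsq lborel (\<lambda>x. ?S N x - fourier v x)"
      proof (rule nsq_cong_AE)
        show "fourier_L2 (\<lambda>x. ?T N x - v x) \<in> borel_measurable lborel"
          by (rule sqi_measurable[OF fourier_L2_sqi[OF sqi_diff[OF Ts test_fun_sqi[OF v]]]])
        show "(\<lambda>x. ?S N x - fourier v x) \<in> borel_measurable lborel"
          by (rule sqi_measurable[OF sqi_diff[OF sqlimD(1)[OF lim] Hcl_sqi0[OF F]]])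
        have "AE \<xi> in lborel. fourier_L2 (?T N) \<xi> = (\<Sum>j<N. ip lborel v (\<phi> j) * e j \<xi>)"
          by (rule fourier_L2_sum) (simp_all add: phi_sqi)
        then show "AE x in lborel. fourier_L2 (\<lambda>x. ?T N x - v x) x = ?S N x - fourier v x"
          using fourier_L2_diff[OF Ts test_fun_sqi[OF v], of N] fourier_L2_integrable[OF test_fun_integrable[OF v] test_fun_sqi[OF v]]
          unfolding a by eventually_elim simp
      qed
      finally show ?thesis .
    qed
    then show "(\<lambda>N. nsq lborel (\<lambda>x. ?T N x - v x)) \<longlonglongrightarrow> 0" using sqlimD(3)[OF lim] by simp
  qed
qed

end

subsection \<open>Expansion of square-integrable functions\<close>

context eigensystem
begin

text \<open>Since there is an eigenfunction, there is a nonzero test function \<open>f\<close>; the kernel is a multiple of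
  \<open>\<bar>f\<bar>\<^sup>2\<close>.\<close>

lemma mollifier:
  obtains \<rho> :: "'a \<Rightarrow> complex" where "test_fun UNIV \<rho>" "(LINT x|lborel. \<rho> x) = 1"
proof -
  have "\<phi> 0 \<in> Hs_completion 1 \<Omega>" using phi_H10[of 0] by (simp add: H10_def)
  then obtain f where f: "\<forall>k::nat. test_fun \<Omega> (f k)" "sqlim lborel f (\<phi> 0)"
      "sqlim \<nu> (\<lambda>k. fourier (f k)) (fourier_L2 (\<phi> 0))"
    using zero_le_one order_refl by (rule Hs_completionE)
  have "nsq lborel (\<phi> 0) = 1" using phi_orth[of 0 0] by (simp add: nsq_eq_Re)
  then have "\<forall>\<^sub>F k in sequentially. nsq lborel (f k) > 1 / 2"
    using order_tendstoD(1)[OF sqlim_nsq[OF f(2)], of "1 / 2"] by simp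
  then obtain k where k: "nsq lborel (f k) > 1 / 2" unfolding eventually_sequentially by blast
  have fk: "test_fun UNIV (f k)" using f(1) test_fun_UNIV by blast
  let ?\<rho> = "\<lambda>x. complex_of_real (1 / nsq lborel (f k)) * (f k x * cnj (f k x))"
  have "test_fun UNIV ?\<rho>" by (intro test_fun_scale test_fun_mult test_fun_cnj fk)
  moreover have "(LINT x|lborel. ?\<rho> x) = of_real (1 / nsq lborel (f k)) * ip lborel (f k) (f k)"
    unfolding ip_def by (rule integral_mult_right_zero)
  then have "(LINT x|lborel. ?\<rho> x) = 1" using k by (simp add: ip_self)
  ultimately show ?thesis by (rule that)
qed

text \<open>The mollified indicators of the box are test functions in \<Omega>. They are bounded by
  the integral of the modulus of \<rho> and converge to the indicator off the boundary of the box, a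
  null set, so the orthogonality passes to the indicator.\<close>

lemma integral_box_zero:
  assumes w: "sqi lborel w" and orth: "\<And>v. test_fun \<Omega> v \<Longrightarrow> ip lborel w v = 0" and B: "cbox a b \<subseteq> \<Omega>"
  shows "(LINT x|lborel. indicator (cbox a b) x *\<^sub>R w x) = 0"
proof -
  let ?B = "cbox a b"
  let ?i = "\<lambda>y. complex_of_real (indicator ?B y)"
  obtain \<rho> :: "'a \<Rightarrow> complex" where \<rho>: "test_fun UNIV \<rho>" "(LINT x|lborel. \<rho> x) = 1" by (rule mollifier)
  have [measurable]: "\<rho> \<in> borel_measurable borel" by (rule test_fun_measurable[OF \<rho>(1)])
  have wm [measurable]: "w \<in> borel_measurable borel" using w by (simp add: sqi_def)
  have [measurable]: "?B \<in> sets borel" by simp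
  obtain K where K: "compact K" "\<forall>x. x \<notin> K \<longrightarrow> \<rho> x = 0" by (rule test_fun_compactE[OF \<rho>(1)])
  obtain R0 where R0: "\<forall>x\<in>K. norm x \<le> R0" using compact_imp_bounded[OF K(1)] unfolding bounded_iff by blast
  define R where "R = max R0 1"
  have R: "R > 0" by (simp add: R_def)
  have R\<rho>: "\<rho> x = 0" if x: "norm x > R" for x
  proof -
    have "x \<notin> K"
    proof
      assume "x \<in> K"
      then have "norm x \<le> R0" using R0 by blast
      then show False using x by (simp add: R_def)
    qed
    then show ?thesis using K(2) by blast
  qed
  obtain d where d: "d > 0" "(\<Union>x\<in>?B. ball x d) \<subseteq> \<Omega>"
    using compact_subset_open_imp_ball_epsilon_subset[OF compact_cbox open_dom B] by auto
  \<comment> \<open>The factor 2 leaves \<open>h k * R\<close> strictly below \<open>d\<close> even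
    for \<open>k = 0\<close>, so every mollified indicator is supported in \<Omega>.\<close>
  define h where "h k = d / (2 * R) / real (Suc k)" for k
  have h: "h k > 0" for k using d R by (simp add: h_def)
  have hR: "h k * R < d" for k
  proof -
    have "h k * R = (d / 2) * (1 / real (Suc k))" using R by (simp add: h_def)
    also have "\<dots> \<le> (d / 2) * 1" using d by (intro mult_left_mono) auto
    finally show ?thesis using d by simp
  qed
  have h0: "h \<longlonglongrightarrow> 0"
    using tendsto_mult_right_zero[OF LIMSEQ_Suc[OF lim_1_over_n], of "d / (2 * R)"] unfolding h_def[abs_def] by simp
  define \<rho>h where "\<rho>h k x = of_real (1 / h k ^ DIM('a)) * \<rho> (0 + (1 / h k) *\<^sub>R x)" for k x
  have \<rho>t: "test_fun UNIV (\<rho>h k)" for k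
    unfolding \<rho>h_def[abs_def] by (intro test_fun_scale test_fun_affine[OF \<rho>(1)]) (use h[of k] in simp)
  have \<rho>0: "\<rho>h k x = 0" if "x \<notin> cball 0 (h k * R)" for k x
  proof -
    have "norm ((1 / h k) *\<^sub>R x) > R" using that h[of k] by (simp add: field_simps)
    then show ?thesis using R\<rho> by (simp add: \<rho>h_def)
  qed
  have ii: "integrable lborel ?i"
    by (intro integrable_of_real integrable_real_indicator emeasure_bounded_finite) simp_all
  define v where "v k = conv ?i (\<rho>h k)" for k
  have vt: "test_fun \<Omega> (v k)" for k
    unfolding v_def
  proof (rule conv_test_fun[OF ii \<rho>t compact_cbox _ compact_cball \<rho>0])
    fix x y :: 'a assume "x \<in> ?B" "y \<in> cball 0 (h k * R)"
    then have "x + y \<in> ball x d" using hR[of k] by (simp add: dist_norm)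
    then show "x + y \<in> \<Omega>" using d(2) \<open>x \<in> ?B\<close> by blast
  qed (simp add: indicator_def)
  have veq: "v k x = (LINT z|lborel. ?i (x + (- h k) *\<^sub>R z) * \<rho> z)" for k x
  proof -
    have [measurable]: "\<rho>h k \<in> borel_measurable borel" by (rule test_fun_measurable[OF \<rho>t])
    have "v k x = (\<bar>- h k\<bar> ^ DIM('a)) *\<^sub>R (LINT z|lborel. ?i (x + (- h k) *\<^sub>R z) * \<rho>h k (x - (x + (- h k) *\<^sub>R z)))"
      unfolding v_def conv_def by (rule lborel_integral_affine) (use h[of k] in \<open>simp, measurable\<close>)
    also have "\<dots> = (LINT z|lborel. (\<bar>- h k\<bar> ^ DIM('a)) *\<^sub>R (?i (x + (- h k) *\<^sub>R z) * \<rho>h k (x - (x + (- h k) *\<^sub>R z))))"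
      by (rule integral_scaleR_right[symmetric])
    also have "\<dots> = (LINT z|lborel. ?i (x + (- h k) *\<^sub>R z) * \<rho> z)"
    proof (rule Bochner_Integration.integral_cong[OF refl])
      fix z
      have "\<rho>h k (x - (x + (- h k) *\<^sub>R z)) = of_real (1 / h k ^ DIM('a)) * \<rho> z"
        using h[of k] by (simp add: \<rho>h_def)
      moreover have "complex_of_real (\<bar>- h k\<bar> ^ DIM('a)) * (q * (of_real (1 / h k ^ DIM('a)) * r)) = q * r" for q r
        using h[of k] by (simp add: mult.left_commute)
      ultimately show "(\<bar>- h k\<bar> ^ DIM('a)) *\<^sub>R (?i (x + (- h k) *\<^sub>R z) * \<rho>h k (x - (x + (- h k) *\<^sub>R z))) = ?i (x + (- h k) *\<^sub>R z) * \<rho> z"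
        by (simp only: scaleR_conv_of_real)
    qed
    finally show ?thesis .
  qed
  define P where "P = (LINT z|lborel. norm (\<rho> z))"
  have \<rho>i: "integrable lborel \<rho>" by (rule test_fun_integrable[OF \<rho>(1)])
  have vP: "norm (v k x) \<le> P" for k x
  proof -
    have "norm (v k x) \<le> (LINT z|lborel. norm (?i (x + (- h k) *\<^sub>R z) * \<rho> z))"
      unfolding veq by (rule integral_norm_bound)
    also have "\<dots> \<le> P"
      unfolding P_def
      by (rule integral_mono'[OF integrable_norm[OF \<rho>i]]) (auto simp: norm_mult indicator_def)
    finally show ?thesis .
  qed
  have vlim: "(\<lambda>k. v k x) \<longlonglongrightarrow> ?i x" if x: "x \<notin> ?B - box a b" for x
  proof -
    have "(\<lambda>k. v k x) \<longlonglongrightarrow> (LINT z|lborel. ?i x * \<rho> z)"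
      unfolding veq
    proof (rule integral_dominated_convergence[where w = "\<lambda>z. norm (\<rho> z)"])
      show "AE z in lborel. (\<lambda>k. ?i (x + (- h k) *\<^sub>R z) * \<rho> z) \<longlonglongrightarrow> ?i x * \<rho> z"
      proof (rule AE_I2)
        fix z :: 'a
        have "(\<lambda>k. x + (- h k) *\<^sub>R z) \<longlonglongrightarrow> x + (- 0) *\<^sub>R z"
          by (intro tendsto_add tendsto_const tendsto_scaleR tendsto_minus h0)
        then have l: "(\<lambda>k. x + (- h k) *\<^sub>R z) \<longlonglongrightarrow> x" by simp
        have "\<forall>\<^sub>F k in sequentially. (x + (- h k) *\<^sub>R z \<in> ?B) = (x \<in> ?B)"
        proof (cases "x \<in> ?B")
          case True
          then have "x \<in> box a b" using x by blast
          then have "\<forall>\<^sub>F k in sequentially. x + (- h k) *\<^sub>R z \<in> box a b"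
            by (rule topological_tendstoD[OF l open_box])
          then show ?thesis by eventually_elim (use box_subset_cbox[of a b] True in blast)
        next
          case False
          then have "x \<in> - ?B" by simp
          then have "\<forall>\<^sub>F k in sequentially. x + (- h k) *\<^sub>R z \<in> - ?B"
            by (rule topological_tendstoD[OF l, rotated]) (simp add: open_Compl closed_cbox)
          then show ?thesis by eventually_elim (use False in simp)
        qed
        then have "\<forall>\<^sub>F k in sequentially. ?i (x + (- h k) *\<^sub>R z) * \<rho> z = ?i x * \<rho> z"
          by eventually_elim (simp add: indicator_def)
        then show "(\<lambda>k. ?i (x + (- h k) *\<^sub>R z) * \<rho> z) \<longlonglongrightarrow> ?i x * \<rho> z" by (rule tendsto_eventually)
      qed
      show "AE z in lborel. norm (?i (x + (- h k) *\<^sub>R z) * \<rho> z) \<le> norm (\<rho> z)" for k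
        by (rule AE_I2) (simp add: norm_mult indicator_def)
      show "integrable lborel (\<lambda>z. norm (\<rho> z))" by (rule integrable_norm[OF \<rho>i])
    qed measurable
    also have "(LINT z|lborel. ?i x * \<rho> z) = ?i x" unfolding integral_mult_right_zero \<rho>(2) by simp
    finally show ?thesis .
  qed
  \<comment> \<open>Cutting \<open>w\<close> off to the bounded set \<Omega> makes it integrable,
    which yields the majorant; the functions \<open>v k\<close> vanish outside \<Omega>
    anyway.\<close>
  define w' where "w' x = (if x \<in> \<Omega> then w x else 0)" for x
  have w's: "sqi lborel w'"
    by (rule sqi_bound[OF _ sqi_integrable[OF w]]) (auto simp: w'_def[abs_def])
  have w'i: "integrable lborel w'"
    by (rule sqi_bounded_support_integrable(1)[OF w's bounded_dom dom_borel]) (simp add: w'_def)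
  have null: "AE x in lborel. x \<notin> ?B - box a b"
  proof -
    have "?B - box a b \<in> null_sets lebesgue" using negligible_frontier_interval by (simp add: negligible_iff_null_sets)
    moreover have "?B - box a b \<in> sets borel" by simp
    ultimately have "?B - box a b \<in> null_sets lborel" by (simp add: null_sets_completion_iff[symmetric])
    then show ?thesis by (rule AE_not_in)
  qed
  have "(\<lambda>k. ip lborel w (v k)) \<longlonglongrightarrow> (LINT x|lborel. w x * cnj (?i x))"
    unfolding ip_def
  proof (rule integral_dominated_convergence[where w = "\<lambda>x. P * norm (w' x)"])
    show "AE x in lborel. (\<lambda>k. w x * cnj (v k x)) \<longlonglongrightarrow> w x * cnj (?i x)"
      using null by eventually_elim (intro tendsto_mult tendsto_const tendsto_cnj vlim)
    show "AE x in lborel. norm (w x * cnj (v k x)) \<le> P * norm (w' x)" for k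
    proof (rule AE_I2)
      fix x show "norm (w x * cnj (v k x)) \<le> P * norm (w' x)"
      proof (cases "x \<in> \<Omega>")
        case True
        then show ?thesis using mult_left_mono[OF vP[of k x], of "norm (w x)"] by (simp add: norm_mult w'_def mult.commute)
      next
        case False
        then show ?thesis using test_fun_outside[OF vt False, of k] by (simp add: w'_def)
      qed
    qed
    show "integrable lborel (\<lambda>x. P * norm (w' x))" by (intro integrable_mult_right integrable_norm w'i)
    show "(\<lambda>x. w x * cnj (v k x)) \<in> borel_measurable lborel" for k
    proof -
      have [measurable]: "v k \<in> borel_measurable borel" by (rule test_fun_measurable[OF vt])
      show ?thesis by measurable
    qed
  qed measurable
  then have "(LINT x|lborel. w x * cnj (?i x)) = 0" by (simp add: orth[OF vt] LIMSEQ_const_iff)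
  then show ?thesis by (simp add: scaleR_conv_of_real mult.commute)
qed

text \<open>The complex measure with density \<open>w\<close> on the box vanishes on every smaller
  box, and boxes form an intersection-stable generator of the Borel sets.\<close>

lemma AE_zero_on_box:
  assumes w: "sqi lborel w" and orth: "\<And>v. test_fun \<Omega> v \<Longrightarrow> ip lborel w v = 0" and B: "cbox c d \<subseteq> \<Omega>"
  shows "AE x in lborel. x \<in> cbox c d \<longrightarrow> w x = 0"
proof -
  let ?w = "\<lambda>x. indicator (cbox c d) x *\<^sub>R w x"
  have wm [measurable]: "w \<in> borel_measurable borel" using w by (simp add: sqi_def)
  have cm [measurable]: "cbox c d \<in> sets borel" by simp
  have ws: "sqi lborel ?w"
    by (rule sqi_bound[OF _ sqi_integrable[OF w]]) (auto simp: indicator_def)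
  have wi: "integrable lborel ?w"
    by (rule sqi_bounded_support_integrable(1)[OF ws bounded_cbox cm]) simp
  have wiA: "integrable lborel (\<lambda>x. indicator A x *\<^sub>R ?w x)" if "A \<in> sets borel" for A
    using integrable_mult_indicator[OF _ wi, of A] that by simp
  \<comment> \<open>Induction over the generated sigma-algebra. Open boxes and closed boxes differ
    by null sets, and the intersection of two closed boxes is again a closed box.\<close>
  have gen: "(LINT x|lborel. indicator A x *\<^sub>R ?w x) = 0" if "A \<in> sigma_sets UNIV (range (\<lambda>(a, b). box a b :: 'a set))" for A
  proof (rule sigma_sets_induct_disjoint[of "range (\<lambda>(a, b). box a b :: 'a set)" UNIV A])
    show "Int_stable (range (\<lambda>(a, b). box a b :: 'a set))"
      by (auto simp: Int_stable_def box_Int_box)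
    show "A \<in> sigma_sets UNIV (range (\<lambda>(a, b). box a b :: 'a set))" by fact
    have sb: "sigma_sets UNIV (range (\<lambda>(a, b). box a b :: 'a set)) = sets borel"
      by (subst borel_eq_box) (simp add: sets_measure_of)
    show "(LINT x|lborel. indicator A x *\<^sub>R ?w x) = 0" if A: "A \<in> range (\<lambda>(a, b). box a b :: 'a set)" for A
    proof -
      obtain a b where A: "A = box a b" using A by auto
      obtain a' b' where ab: "cbox a b \<inter> cbox c d = cbox a' b'" using Int_interval by blast
      have "cbox a b - box a b \<in> null_sets lebesgue" using negligible_frontier_interval by (simp add: negligible_iff_null_sets)
      moreover have "cbox a b - box a b \<in> sets borel" by simp
      ultimately have "cbox a b - box a b \<in> null_sets lborel" by (simp add: null_sets_completion_iff[symmetric])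
      then have null: "AE x in lborel. x \<notin> cbox a b - box a b" by (rule AE_not_in)
      have "(LINT x|lborel. indicator A x *\<^sub>R ?w x) = (LINT x|lborel. indicator (cbox a' b') x *\<^sub>R w x)"
      proof (rule integral_cong_AE)
        show "AE x in lborel. indicator A x *\<^sub>R ?w x = indicator (cbox a' b') x *\<^sub>R w x"
          using null unfolding ab[symmetric] A
          by eventually_elim (use box_subset_cbox[of a b] in \<open>auto simp: indicator_def\<close>)
      qed (use A in simp_all)
      also have "\<dots> = 0"
        by (rule integral_box_zero[OF w orth]) (use ab B in auto)
      finally show ?thesis .
    qed
    show "(LINT x|lborel. indicator {} x *\<^sub>R ?w x) = 0" by simp
    show "(LINT x|lborel. indicator (UNIV - A) x *\<^sub>R ?w x) = 0"
      if A: "A \<in> sigma_sets UNIV (range (\<lambda>(a, b). box a b :: 'a set))" and IH: "(LINT x|lborel. indicator A x *\<^sub>R ?w x) = 0" for A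
    proof -
      have "(LINT x|lborel. ?w x) = 0" by (rule integral_box_zero[OF w orth B])
      moreover have "(LINT x|lborel. indicator (UNIV - A) x *\<^sub>R ?w x) = (LINT x|lborel. ?w x - indicator A x *\<^sub>R ?w x)"
        by (rule Bochner_Integration.integral_cong[OF refl]) (simp add: indicator_def)
      moreover have "(LINT x|lborel. ?w x - indicator A x *\<^sub>R ?w x) = (LINT x|lborel. ?w x) - (LINT x|lborel. indicator A x *\<^sub>R ?w x)"
        by (rule Bochner_Integration.integral_diff[OF wi wiA]) (use A sb in simp)
      ultimately show ?thesis using IH by simp
    qed
    show "(LINT x|lborel. indicator (\<Union>(range A)) x *\<^sub>R ?w x) = 0"
      if A: "disjoint_family A" "range A \<subseteq> sigma_sets UNIV (range (\<lambda>(a, b). box a b :: 'a set))"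
        and IH: "\<And>i. (LINT x|lborel. indicator (A i) x *\<^sub>R ?w x) = 0" for A :: "nat \<Rightarrow> 'a set"
    proof -
      have As: "A i \<in> sets lborel" for i using A(2) sb by auto
      have "\<Union>(range A) \<in> sets borel" using As by auto
      then have int: "set_integrable lborel (\<Union>(range A)) ?w"
        unfolding set_integrable_def by (rule wiA)
      have "set_lebesgue_integral lborel (\<Union>(range A)) ?w = (\<Sum>i. set_lebesgue_integral lborel (A i) ?w)"
        by (rule lebesgue_integral_countable_add[OF As _ int]) (use A(1) in \<open>auto simp: disjoint_family_on_def\<close>)
      then show ?thesis unfolding set_lebesgue_integral_def IH by simp
    qed
  qed auto
  have "AE x in lborel. ?w x = 0"
  proof (rule sigma_finite_measure.density_zero[OF lborel.sigma_finite_measure_axioms wi])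
    fix A :: "'a set" assume "A \<in> sets lborel"
    then have "A \<in> sigma_sets UNIV (range (\<lambda>(a, b). box a b :: 'a set))"
      by (simp add: borel_eq_box sets_measure_of)
    then show "set_lebesgue_integral lborel A ?w = 0" unfolding set_lebesgue_integral_def by (rule gen)
  qed
  then show ?thesis by eventually_elim (auto simp: indicator_def split: if_splits)
qed

text \<open>An open set is a countable union of closed boxes.\<close>

lemma AE_zero_on_dom:
  assumes w: "sqi lborel w" and orth: "\<And>v. test_fun \<Omega> v \<Longrightarrow> ip lborel w v = 0"
  shows "AE x in lborel. x \<in> \<Omega> \<longrightarrow> w x = 0"
proof -
  obtain \<D> where D: "countable \<D>" "\<D> \<subseteq> Pow \<Omega>" "\<And>X. X \<in> \<D> \<Longrightarrow> \<exists>a b. X = cbox a b" "\<Union>\<D> = \<Omega>"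
    using open_countable_Union_open_cbox[OF open_dom] by blast
  have "AE x in lborel. x \<in> X \<longrightarrow> w x = 0" if X: "X \<in> \<D>" for X
  proof -
    obtain a b where ab: "X = cbox a b" using D(3)[OF X] by blast
    have "cbox a b \<subseteq> \<Omega>" using D(2) X ab by blast
    from AE_zero_on_box[OF w _ this] orth show ?thesis unfolding ab by blast
  qed
  then have "AE x in lborel. \<forall>X\<in>\<D>. x \<in> X \<longrightarrow> w x = 0"
    by (subst AE_ball_countable[OF D(1)]) blast
  then show ?thesis by eventually_elim (use D(4) in blast)
qed

text \<open>The difference of \<open>u\<close> and the sum of its series is orthogonal to every
  \<open>\<phi> j\<close>, hence by \<open>test_expansion\<close> to every test function in
  \<Omega>, hence zero on \<Omega>; outside \<Omega> both functions vanish.\<close>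

lemma L2_expansion:
  assumes u: "sqi lborel u" and z: "AE x in lborel. x \<notin> \<Omega> \<longrightarrow> u x = 0"
  shows "sqlim lborel (\<lambda>N x. \<Sum>j<N. ip lborel u (\<phi> j) * \<phi> j x) u"
proof -
  have a: "ip lborel u (\<phi> j) = of_real 1 * ip lborel u (\<phi> j)" for j by simp
  obtain h where h: "sqlim lborel (\<lambda>N x. \<Sum>j<N. ip lborel u (\<phi> j) * \<phi> j x) h" and hj: "\<And>j. ip lborel h (\<phi> j) = ip lborel u (\<phi> j)"
    using orthogonal_expansion_converges[OF u phi_sqi zero_le_one phi_orth a] by blast
  have hs: "sqi lborel h" by (rule sqlimD(2)[OF h])
  have h0: "AE x in lborel. x \<notin> \<Omega> \<longrightarrow> h x = 0"
  proof (rule sqCauchy_limit_AE[OF h])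
    fix N
    have "AE x in lborel. \<forall>j. x \<notin> \<Omega> \<longrightarrow> \<phi> j x = 0" using phi_outside by (subst AE_all_countable) blast
    then show "AE x in lborel. x \<notin> \<Omega> \<longrightarrow> (\<Sum>j<N. ip lborel u (\<phi> j) * \<phi> j x) = 0" by eventually_elim simp
  qed
  have ds: "sqi lborel (\<lambda>x. u x - h x)" by (rule sqi_diff[OF u hs])
  have "ip lborel (\<lambda>x. u x - h x) v = 0" if v: "test_fun \<Omega> v" for v
  proof -
    have "ip lborel (\<lambda>x. u x - h x) (\<phi> j) = 0" for j
      by (simp add: ip_diff_left[OF u hs phi_sqi] hj)
    then have "ip lborel (\<lambda>x. u x - h x) (\<lambda>x. \<Sum>j<N. ip lborel v (\<phi> j) * \<phi> j x) = 0" for N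
      using ds phi_sqi by (simp add: ip_sum_right sqi_scale ip_scale_right)
    then show ?thesis
      using sqlim_ip[OF sqlim_const[OF ds] test_expansion[OF v]] by (simp add: LIMSEQ_const_iff)
  qed
  then have "AE x in lborel. x \<in> \<Omega> \<longrightarrow> u x - h x = 0" by (rule AE_zero_on_dom[OF ds])
  then have "AE x in lborel. h x = u x" using z h0 by eventually_elim auto
  then show ?thesis by (intro sqlim_cong_AE[OF h]) (use u in \<open>auto simp: sqi_def\<close>)
qed

lemma Parseval:
  assumes u: "sqi lborel u" and z: "AE x in lborel. x \<notin> \<Omega> \<longrightarrow> u x = 0"
  shows "(\<lambda>j. (norm (ip lborel u (\<phi> j)))\<^sup>2) sums nsq lborel u"
proof -
  have "nsq lborel (\<lambda>x. \<Sum>j<N. ip lborel u (\<phi> j) * \<phi> j x) = (\<Sum>j<N. (norm (ip lborel u (\<phi> j)))\<^sup>2)" for N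
    using nsq_orthogonal_sum[OF phi_sqi phi_orth finite_lessThan, of "\<lambda>j. ip lborel u (\<phi> j)" N] by simp
  then show ?thesis using sqlim_nsq[OF L2_expansion[OF u z]] by (simp add: sums_def)
qed

end

section \<open>Interpolation representation of the quadratic forms\<close>

text \<open>The weight is extended by 0 to the negative axis so that all integrals run over the
  whole line; there it also cancels the fractions \<open>l / (l + t)\<close>, whose sign is then
  uncontrolled.\<close>

definition wt :: "real \<Rightarrow> real \<Rightarrow> real" where
  "wt s t = (if t > 0 then t powr (s - 1) else 0)"

text \<open>The value is \<open>pi / sin (pi * s)\<close> for \<open>0 < s < 1\<close>; all that
  matters is that it is positive and finite, so that it can be cancelled.\<close>

definition Cs :: "real \<Rightarrow> ennreal" where
  "Cs s = (\<integral>\<^sup>+ t. ennreal (wt s t / (1 + t)) \<partial>lborel)"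

text \<open>For positive \<open>t\<close>, the quadratic form of A (A + t)^-1 with A the Laplacian
  -\<Delta> on the whole space, evaluated at the function with transform \<open>U\<close>.\<close>

definition KR :: "('a::euclidean_space \<Rightarrow> complex) \<Rightarrow> real \<Rightarrow> ennreal" where
  "KR U t = (\<integral>\<^sup>+ \<xi>. ennreal (hw \<xi> / (hw \<xi> + t) * (norm (U \<xi>))\<^sup>2) \<partial>lborel)"

lemma wt_measurable [measurable]: "wt s \<in> borel_measurable borel"
  unfolding wt_def[abs_def] by measurable

lemma wt_nonneg [simp]: "0 \<le> wt s t"
  by (simp add: wt_def)

lemma nn_integral_has_integral_on:
  fixes f :: "real \<Rightarrow> real"
  assumes [measurable]: "f \<in> borel_measurable borel" "S \<in> sets borel" and "\<And>x. 0 \<le> f x" "(f has_integral I) S"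
  shows "(\<integral>\<^sup>+ x. ennreal (if x \<in> S then f x else 0) \<partial>lborel) = ennreal I"
proof (rule nn_integral_has_integral_lborel)
  show "((\<lambda>x. if x \<in> S then f x else 0) has_integral I) UNIV"
    using assms(4) by (simp only: has_integral_restrict_UNIV)
qed (use assms in auto)

text \<open>The integrand is dominated by \<open>t powr (s - 1)\<close> near 0 and by
  \<open>t powr (s - 2)\<close> beyond 1; integrability uses \<open>0 < s\<close> at 0 and
  \<open>s < 1\<close> at infinity.\<close>

lemma Cs_finite:
  assumes s: "0 < s" "s < 1" shows "Cs s < \<infinity>"
proof -
  have a: "(\<integral>\<^sup>+ t. ennreal (if t \<in> {0..1} then t powr (s - 1) else 0) \<partial>lborel) = ennreal (1 powr (s - 1 + 1) / (s - 1 + 1))"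
    by (rule nn_integral_has_integral_on[OF _ _ _ has_integral_powr_from_0]) (use s in auto)
  have b: "(\<integral>\<^sup>+ t. ennreal (if t \<in> {1..} then t powr (s - 2) else 0) \<partial>lborel) = ennreal (- (1 powr (s - 2 + 1)) / (s - 2 + 1))"
    by (rule nn_integral_has_integral_on[OF _ _ _ has_integral_powr_to_inf]) (use s in auto)
  have le: "ennreal (wt s t / (1 + t)) \<le> ennreal (if t \<in> {0..1} then t powr (s - 1) else 0) + ennreal (if t \<in> {1..} then t powr (s - 2) else 0)" for t
  proof (cases "t \<le> 0 \<or> t \<le> 1")
    case True
    have "wt s t / (1 + t) \<le> (if t \<in> {0..1} then t powr (s - 1) else 0)"
      using True by (auto simp: wt_def divide_le_eq mult_le_cancel_left1)
    then have "ennreal (wt s t / (1 + t)) \<le> ennreal (if t \<in> {0..1} then t powr (s - 1) else 0)" by (rule ennreal_leI)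
    then show ?thesis by (rule order_trans) simp
  next
    case False
    then have t: "t > 1" by auto
    have "t powr (s - 1) = t powr (s - 2) * t" using t powr_add[of t "s - 2" 1] by simp
    then have "wt s t / (1 + t) \<le> t powr (s - 2)"
      using t by (simp add: wt_def divide_le_eq mult_left_mono)
    then have "ennreal (wt s t / (1 + t)) \<le> ennreal (if t \<in> {1..} then t powr (s - 2) else 0)" using t by (simp add: ennreal_leI)
    then show ?thesis by (rule order_trans) simp
  qed
  have "Cs s \<le> (\<integral>\<^sup>+ t. ennreal (if t \<in> {0..1} then t powr (s - 1) else 0) + ennreal (if t \<in> {1..} then t powr (s - 2) else 0) \<partial>lborel)"
    unfolding Cs_def by (rule nn_integral_mono) (rule le)
  also have "\<dots> = ennreal (1 powr (s - 1 + 1) / (s - 1 + 1)) + ennreal (- (1 powr (s - 2 + 1)) / (s - 2 + 1))"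
    unfolding a[symmetric] b[symmetric] by (rule nn_integral_add) measurable
  also have "\<dots> < \<infinity>" by simp
  finally show ?thesis .
qed

lemma Cs_pos:
  assumes s: "s < 1" shows "Cs s \<noteq> 0"
proof -
  have "ennreal (1 / 2) * emeasure lborel {0<..(1::real)} = (\<integral>\<^sup>+ t. ennreal (1 / 2) * indicator {0<..(1::real)} t \<partial>lborel)"
    by (rule nn_integral_cmult_indicator[symmetric]) simp
  also have "\<dots> \<le> Cs s"
    unfolding Cs_def
  proof (rule nn_integral_mono)
    fix t :: real
    show "ennreal (1 / 2) * indicator {0<..1} t \<le> ennreal (wt s t / (1 + t))"
    proof (cases "t \<in> {0<..1}")
      case True
      have "t powr 0 \<le> t powr (s - 1)" by (rule powr_mono') (use True s in auto)
      then have "1 \<le> t powr (s - 1)" using True by simp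
      then have "1 / 2 \<le> wt s t / (1 + t)" using True by (simp add: wt_def field_simps)
      then have "ennreal (1 / 2) \<le> ennreal (wt s t / (1 + t))" by (rule ennreal_leI)
      then show ?thesis using True by (simp only: indicator_simps mult_1_right)
    qed simp
  qed
  finally show ?thesis by auto
qed

text \<open>The substitution that multiplies \<open>t\<close> by \<open>l\<close> extracts the power
  \<open>l powr s\<close>.\<close>

lemma interpolation:
  assumes s: "0 < s" and l: "0 \<le> l"
  shows "(\<integral>\<^sup>+ t. ennreal (wt s t * (l / (l + t))) \<partial>lborel) = ennreal (l powr s) * Cs s"
proof (cases "l = 0")
  case True then show ?thesis by simp
next
  case False
  then have l: "l > 0" using l by simp
  have [measurable]: "(\<lambda>t. ennreal (wt s t * (l / (l + t)))) \<in> borel_measurable borel" by measurable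
  have "(\<integral>\<^sup>+ t. ennreal (wt s t * (l / (l + t))) \<partial>lborel) = \<bar>l\<bar> * (\<integral>\<^sup>+ t. ennreal (wt s (0 + l * t) * (l / (l + (0 + l * t)))) \<partial>lborel)"
    by (rule nn_integral_real_affine) (use l in auto)
  also have "\<dots> = (\<integral>\<^sup>+ t. ennreal l * ennreal (wt s (0 + l * t) * (l / (l + (0 + l * t)))) \<partial>lborel)"
    by (subst nn_integral_cmult) (use l in auto)
  also have "\<dots> = (\<integral>\<^sup>+ t. ennreal (l powr s) * ennreal (wt s t / (1 + t)) \<partial>lborel)"
  proof (rule nn_integral_cong)
    fix t :: real
    have "l * (wt s (0 + l * t) * (l / (l + (0 + l * t)))) = l powr s * (wt s t / (1 + t))"
    proof (cases "t > 0")
      case True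
      have "l / (l + (0 + l * t)) = 1 / (1 + t)"
      proof -
        have "l + (0 + l * t) = l * (1 + t)" by (simp add: distrib_left)
        then show ?thesis using l by simp
      qed
      moreover have "l * wt s (0 + l * t) = l powr s * wt s t"
      proof -
        have "wt s (0 + l * t) = l powr (s - 1) * t powr (s - 1)" using l True by (simp add: wt_def powr_mult)
        moreover have "l * l powr (s - 1) = l powr s" using l powr_add[of l 1 "s - 1"] by simp
        ultimately show ?thesis using True by (simp add: wt_def mult.assoc[symmetric])
      qed
      ultimately show ?thesis by (simp add: mult.assoc[symmetric])
    next
      case False
      then have "\<not> 0 < l * t" using l by (simp add: zero_less_mult_iff)
      then show ?thesis using False by (simp add: wt_def)
    qed
    moreover have "0 \<le> wt s t / (1 + t)" "0 \<le> wt s (0 + l * t) * (l / (l + (0 + l * t)))"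
    proof -
      show "0 \<le> wt s t / (1 + t)" by (cases "t > 0") (simp_all add: wt_def)
      show "0 \<le> wt s (0 + l * t) * (l / (l + (0 + l * t)))"
        by (cases "0 < l * t") (use l in \<open>simp_all add: wt_def\<close>)
    qed
    ultimately show "ennreal l * ennreal (wt s (0 + l * t) * (l / (l + (0 + l * t)))) = ennreal (l powr s) * ennreal (wt s t / (1 + t))"
      using l by (simp only: ennreal_mult[symmetric] less_imp_le powr_ge_zero)
  qed
  also have "\<dots> = ennreal (l powr s) * Cs s"
    unfolding Cs_def by (rule nn_integral_cmult) measurable
  finally show ?thesis .
qed

lemma hw_powr: "hw \<xi> powr s = norm \<xi> powr (2 * s)"
proof (cases "\<xi> = 0")
  case False
  then have "hw \<xi> = norm \<xi> powr 2" by (simp add: hw_def)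
  then show ?thesis by (simp only: powr_powr)
qed (simp add: hw_def)

lemma KR_measurable [measurable]:
  assumes [measurable]: "U \<in> borel_measurable borel" shows "KR U \<in> borel_measurable borel"
proof -
  have "(\<lambda>(t, \<xi>). ennreal (hw \<xi> / (hw \<xi> + t) * (norm (U \<xi>))\<^sup>2)) \<in> borel_measurable (borel \<Otimes>\<^sub>M lborel)" by measurable
  then show ?thesis unfolding KR_def[abs_def] by (rule lborel.borel_measurable_nn_integral)
qed

lemma KR_integral:
  fixes U :: "'a::euclidean_space \<Rightarrow> complex"
  assumes s: "0 < s" and U [measurable]: "U \<in> borel_measurable borel"
  shows "Cs s * (\<integral>\<^sup>+ \<xi>. ennreal (norm \<xi> powr (2 * s) * (norm (U \<xi>))\<^sup>2) \<partial>lborel) = (\<integral>\<^sup>+ t. ennreal (wt s t) * KR U t \<partial>lborel)"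
proof -
  have "(\<integral>\<^sup>+ t. ennreal (wt s t) * KR U t \<partial>lborel)
      = (\<integral>\<^sup>+ t. (\<integral>\<^sup>+ \<xi>. ennreal (wt s t) * ennreal (hw \<xi> / (hw \<xi> + t) * (norm (U \<xi>))\<^sup>2) \<partial>lborel) \<partial>lborel)"
    unfolding KR_def by (intro nn_integral_cong nn_integral_cmult[symmetric]) measurable
  also have "\<dots> = (\<integral>\<^sup>+ \<xi>. (\<integral>\<^sup>+ t. ennreal (wt s t) * ennreal (hw \<xi> / (hw \<xi> + t) * (norm (U \<xi>))\<^sup>2) \<partial>lborel) \<partial>lborel)"
    by (rule lborel_pair.Fubini') measurable
  also have "\<dots> = (\<integral>\<^sup>+ \<xi>. Cs s * ennreal (norm \<xi> powr (2 * s) * (norm (U \<xi>))\<^sup>2) \<partial>lborel)"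
  proof (rule nn_integral_cong)
    fix \<xi> :: 'a
    have "ennreal (wt s t) * ennreal (hw \<xi> / (hw \<xi> + t) * (norm (U \<xi>))\<^sup>2) = ennreal ((norm (U \<xi>))\<^sup>2) * ennreal (wt s t * (hw \<xi> / (hw \<xi> + t)))" for t
    proof (cases "t > 0")
      case True
      then show ?thesis by (simp only: ennreal_mult[symmetric] wt_nonneg zero_le_power2 mult_nonneg_nonneg divide_nonneg_nonneg hw_nonneg add_nonneg_nonneg less_imp_le mult_ac)
    next
      case False then show ?thesis by (simp add: wt_def)
    qed
    then have "(\<integral>\<^sup>+ t. ennreal (wt s t) * ennreal (hw \<xi> / (hw \<xi> + t) * (norm (U \<xi>))\<^sup>2) \<partial>lborel)
        = (\<integral>\<^sup>+ t. ennreal ((norm (U \<xi>))\<^sup>2) * ennreal (wt s t * (hw \<xi> / (hw \<xi> + t))) \<partial>lborel)" by simp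
    also have "\<dots> = ennreal ((norm (U \<xi>))\<^sup>2) * (\<integral>\<^sup>+ t. ennreal (wt s t * (hw \<xi> / (hw \<xi> + t))) \<partial>lborel)"
      by (rule nn_integral_cmult) measurable
    also have "\<dots> = ennreal ((norm (U \<xi>))\<^sup>2) * (ennreal (norm \<xi> powr (2 * s)) * Cs s)"
      unfolding interpolation[OF s hw_nonneg] hw_powr ..
    also have "\<dots> = Cs s * ennreal (norm \<xi> powr (2 * s) * (norm (U \<xi>))\<^sup>2)"
      by (simp add: ennreal_mult mult_ac)
    finally show "(\<integral>\<^sup>+ t. ennreal (wt s t) * ennreal (hw \<xi> / (hw \<xi> + t) * (norm (U \<xi>))\<^sup>2) \<partial>lborel)
        = Cs s * ennreal (norm \<xi> powr (2 * s) * (norm (U \<xi>))\<^sup>2)" .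
  qed
  also have "\<dots> = Cs s * (\<integral>\<^sup>+ \<xi>. ennreal (norm \<xi> powr (2 * s) * (norm (U \<xi>))\<^sup>2) \<partial>lborel)"
    by (rule nn_integral_cmult) measurable
  finally show ?thesis by simp
qed

text \<open>As a function of \<open>w\<close>, the left side is minimal at
  \<open>t / (q + t) * a\<close> with value \<open>q / (q + t) * a\<^sup>2\<close>. The exact excess
  is kept because it later measures the distance to the minimiser.\<close>

lemma complete_square_real:
  fixes a w q t :: real
  assumes "t > 0" "q \<ge> 0"
  shows "(a - w)\<^sup>2 + q / t * w\<^sup>2 = q / (q + t) * a\<^sup>2 + (1 + q / t) * (w - t / (q + t) * a)\<^sup>2"
proof -
  define r where "r = q + t"
  have r: "r > 0" "q = r - t" using assms by (auto simp: r_def)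
  have "(1 + q / t) * (w - t / r * a)\<^sup>2 = r / t * w\<^sup>2 - 2 * w * a + t / r * a\<^sup>2"
  proof -
    have "1 + q / t = r / t" using assms r by (simp add: field_simps)
    then have "(1 + q / t) * (w - t / r * a)\<^sup>2 = r / t * (w\<^sup>2 - 2 * w * (t / r * a) + (t / r * a)\<^sup>2)"
      by (simp add: power2_diff mult.assoc)
    also have "\<dots> = r / t * w\<^sup>2 - (r / t * (t / r)) * (2 * w * a) + (r / t * (t / r)) * (t / r) * a\<^sup>2"
      by (simp only: power2_eq_square right_diff_distrib distrib_left mult_ac)
    also have "r / t * (t / r) = 1" using assms r by simp
    finally show ?thesis by simp
  qed
  moreover have "q / t * w\<^sup>2 = r / t * w\<^sup>2 - w\<^sup>2"
    unfolding r(2) diff_divide_distrib using assms by (simp add: left_diff_distrib)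
  moreover have "q / r * a\<^sup>2 = a\<^sup>2 - t / r * a\<^sup>2"
    unfolding r(2) diff_divide_distrib using r(1) by (simp add: left_diff_distrib)
  ultimately show ?thesis unfolding r_def[symmetric] by (simp add: power2_diff)
qed

lemma complete_square:
  fixes a w :: complex and q t :: real
  assumes "t > 0" "q \<ge> 0"
  shows "(norm (a - w))\<^sup>2 + q / t * (norm w)\<^sup>2
    = q / (q + t) * (norm a)\<^sup>2 + (1 + q / t) * (norm (w - of_real (t / (q + t)) * a))\<^sup>2"
  using complete_square_real[OF assms, of "Re a" "Re w"] complete_square_real[OF assms, of "Im a" "Im w"]
  unfolding cmod_power2 by (simp add: distrib_left)

section \<open>The Navier resolvent form and its comparison with the Dirichlet one\<close>

context eigensystem
begin

definition KO :: "('a \<Rightarrow> complex) \<Rightarrow> real \<Rightarrow> ennreal" where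
  "KO u t = (\<Sum>j. ennreal (\<mu> j / (\<mu> j + t) * (norm (ip lborel u (\<phi> j)))\<^sup>2))"

lemma KO_measurable [measurable]: "KO u \<in> borel_measurable borel"
  unfolding KO_def[abs_def] by measurable

lemma KO_integral:
  assumes s: "0 < s" and u: "u \<in> borel_measurable lborel"
  shows "Cs s * Q_Navier s \<Omega> \<mu> \<phi> u = (\<integral>\<^sup>+ t. ennreal (wt s t) * KO u t \<partial>lborel)"
proof -
  let ?a = "\<lambda>j. (norm (ip lborel u (\<phi> j)))\<^sup>2"
  have pt: "ennreal (wt s t) * ennreal (\<mu> j / (\<mu> j + t) * ?a j) = ennreal (?a j) * ennreal (wt s t * (\<mu> j / (\<mu> j + t)))" for j t
  proof (cases "t > 0")
    case True
    then show ?thesis by (simp only: ennreal_mult[symmetric] wt_nonneg zero_le_power2 mult_nonneg_nonneg divide_nonneg_nonneg mu_nonneg add_nonneg_nonneg less_imp_le mult_ac)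
  next
    case False then show ?thesis by (simp add: wt_def)
  qed
  have "(\<integral>\<^sup>+ t. ennreal (wt s t) * KO u t \<partial>lborel) = (\<integral>\<^sup>+ t. (\<Sum>j. ennreal (?a j) * ennreal (wt s t * (\<mu> j / (\<mu> j + t)))) \<partial>lborel)"
    unfolding KO_def ennreal_suminf_cmult[symmetric] pt ..
  also have "\<dots> = (\<Sum>j. \<integral>\<^sup>+ t. ennreal (?a j) * ennreal (wt s t * (\<mu> j / (\<mu> j + t))) \<partial>lborel)"
    by (rule nn_integral_suminf) measurable
  also have "\<dots> = (\<Sum>j. Cs s * ennreal (\<mu> j powr s * ?a j))"
  proof (rule suminf_cong)
    fix j
    have "(\<integral>\<^sup>+ t. ennreal (?a j) * ennreal (wt s t * (\<mu> j / (\<mu> j + t))) \<partial>lborel) = ennreal (?a j) * (\<integral>\<^sup>+ t. ennreal (wt s t * (\<mu> j / (\<mu> j + t))) \<partial>lborel)"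
      by (rule nn_integral_cmult) measurable
    then show "(\<integral>\<^sup>+ t. ennreal (?a j) * ennreal (wt s t * (\<mu> j / (\<mu> j + t))) \<partial>lborel) = Cs s * ennreal (\<mu> j powr s * ?a j)"
      unfolding interpolation[OF s mu_nonneg] by (simp add: ennreal_mult mult_ac)
  qed
  also have "\<dots> = Cs s * Q_Navier s \<Omega> \<mu> \<phi> u"
    unfolding Q_Navier_def L2_inner_ip[OF u] ennreal_suminf_cmult ..
  finally show ?thesis by simp
qed

text \<open>\<open>W N\<close> is the truncated expansion of the Navier minimiser, used as a
  competitor in the whole-space problem, whose minimiser is \<open>T\<close>. The values
  \<open>J N\<close> tend to the Navier form, while \<open>J N\<close> minus the Dirichlet form
  controls the squared distance from \<open>W N\<close> to \<open>T\<close>. This gives the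
  inequality, and if the forms agree it forces \<open>W N\<close> to converge to
  \<open>T\<close>.\<close>

lemma K_comparison:
  assumes u: "test_limit u" and z: "AE x in lborel. x \<notin> \<Omega> \<longrightarrow> u x = 0" and t: "t > 0"
  shows "KR (fourier_L2 u) t \<le> KO u t"
    and "KO u t \<le> KR (fourier_L2 u) t \<Longrightarrow>
      sqlim lborel (\<lambda>N \<xi>. \<Sum>j<N. of_real (t / (\<mu> j + t)) * ip lborel u (\<phi> j) * e j \<xi>)
        (\<lambda>\<xi>. of_real (t / (hw \<xi> + t)) * fourier_L2 u \<xi>)"
proof -
  let ?U = "fourier_L2 u"
  note us = test_limit_sqi[OF u]
  have Us: "sqi lborel ?U" by (rule fourier_L2_sqi[OF us])
  have Um [measurable]: "?U \<in> borel_measurable borel" using Us by (simp add: sqi_def)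
  define a where "a j = ip lborel u (\<phi> j)" for j
  define b where "b j = of_real (t / (\<mu> j + t)) * a j" for j
  define W where "W N \<xi> = (\<Sum>j<N. b j * e j \<xi>)" for N \<xi>
  define T where "T \<xi> = of_real (t / (hw \<xi> + t)) * ?U \<xi>" for \<xi>
  define k where "k j = \<mu> j / (\<mu> j + t) * (norm (a j))\<^sup>2" for j
  have mt: "\<mu> j + t > 0" for j using mu_nonneg[of j] t by simp
  have ht: "hw \<xi> + t > 0" for \<xi> :: 'a using t by (simp add: add_nonneg_pos)
  have e0: "sqi lborel (e j)" and eh: "sqi (wl hw) (e j)" for j
    by (rule Hcl_sqi0[OF e_Hcl], rule Hcl_sqihw[OF e_Hcl])
  have W0: "sqi lborel (W N)" and Wh: "sqi (wl hw) (W N)" for N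
    unfolding W_def[abs_def] by (intro sqi_sum sqi_scale e0, intro sqi_sum sqi_scale eh)
  have Wm [measurable]: "W N \<in> borel_measurable borel" for N using W0[of N] by (simp add: sqi_def)
  have Tm [measurable]: "T \<in> borel_measurable borel" unfolding T_def[abs_def] by measurable
  have frac: "0 \<le> t / (q + t)" "t / (q + t) \<le> 1" "0 \<le> q / (q + t)" "q / (q + t) \<le> 1" if "q \<ge> 0" for q
    using that t by (auto simp: divide_le_eq_1)
  have Ts: "sqi lborel T"
  proof (rule sqi_bound[OF _ sqi_integrable[OF Us]])
    have "(norm (T \<xi>))\<^sup>2 \<le> (norm (?U \<xi>))\<^sup>2" for \<xi>
    proof (rule power_mono)
      have "norm (T \<xi>) = t / (hw \<xi> + t) * norm (?U \<xi>)"
        by (simp only: T_def norm_mult norm_of_real abs_of_nonneg[OF frac(1)[OF hw_nonneg]])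
      also have "\<dots> \<le> 1 * norm (?U \<xi>)" by (intro mult_right_mono frac) simp_all
      finally show "norm (T \<xi>) \<le> norm (?U \<xi>)" by simp
    qed simp
    then show "AE \<xi> in lborel. (norm (T \<xi>))\<^sup>2 \<le> (norm (?U \<xi>))\<^sup>2" by simp
  qed simp
  have aU: "ip lborel ?U (e j) = of_real 1 * a j" for j
    unfolding a_def by (simp add: Plancherel_ip[OF u phi_limit])
  have PU: "nsq lborel ?U = nsq lborel u" by (rule Plancherel[OF u])
  \<comment> \<open>The functional to be minimised, at \<open>W N\<close>. Expanded in
    eigenfunctions it is a sum of the \<open>k j\<close> plus the remainder in Parseval's identity,
    which tends to 0.\<close>
  define J where "J N = nsq lborel (\<lambda>\<xi>. ?U \<xi> - W N \<xi>) + nsq (wl hw) (W N) / t" for N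
  have J1: "J N = nsq lborel u - (\<Sum>j<N. (norm (a j))\<^sup>2) + (\<Sum>j<N. k j)" for N
  proof -
    have "nsq lborel (\<lambda>\<xi>. ?U \<xi> - W N \<xi>) = nsq lborel u - (\<Sum>j<N. 1 * (norm (a j))\<^sup>2) + (\<Sum>j<N. 1 * (norm (a j - b j))\<^sup>2)"
      unfolding W_def using nsq_diff_orthogonal_sum[OF Us e0 e_orth aU finite_lessThan, of b N] by (simp add: PU)
    moreover have "nsq (wl hw) (W N) = (\<Sum>j<N. \<mu> j * (norm (b j))\<^sup>2)"
      unfolding W_def[abs_def] by (rule nsq_orthogonal_sum[OF eh form_orth finite_lessThan])
    moreover have "1 * (norm (a j - b j))\<^sup>2 + \<mu> j * (norm (b j))\<^sup>2 / t = k j" for j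
    proof -
      have "(norm (a j - b j))\<^sup>2 + \<mu> j / t * (norm (b j))\<^sup>2 = \<mu> j / (\<mu> j + t) * (norm (a j))\<^sup>2"
        unfolding complete_square[OF t mu_nonneg] b_def by simp
      then show ?thesis by (simp add: k_def)
    qed
    then have "(\<Sum>j<N. 1 * (norm (a j - b j))\<^sup>2) + (\<Sum>j<N. \<mu> j * (norm (b j))\<^sup>2) / t = (\<Sum>j<N. k j)"
      unfolding sum_divide_distrib sum.distrib[symmetric] by (rule sum.cong[OF refl])
    ultimately show ?thesis unfolding J_def by simp
  qed
  define R where "R = (LINT \<xi>|lborel. hw \<xi> / (hw \<xi> + t) * (norm (?U \<xi>))\<^sup>2)"
  have Ri: "integrable lborel (\<lambda>\<xi>. hw \<xi> / (hw \<xi> + t) * (norm (?U \<xi>))\<^sup>2)"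
  proof (rule Bochner_Integration.integrable_bound[OF sqi_integrable[OF Us]])
    show "AE \<xi> in lborel. norm (hw \<xi> / (hw \<xi> + t) * (norm (?U \<xi>))\<^sup>2) \<le> norm ((norm (?U \<xi>))\<^sup>2)"
    proof (rule AE_I2)
      fix \<xi> :: 'a
      have "hw \<xi> / (hw \<xi> + t) * (norm (?U \<xi>))\<^sup>2 \<le> 1 * (norm (?U \<xi>))\<^sup>2"
        by (intro mult_right_mono frac) simp_all
      moreover have "0 \<le> hw \<xi> / (hw \<xi> + t) * (norm (?U \<xi>))\<^sup>2" by (intro mult_nonneg_nonneg frac) simp_all
      ultimately show "norm (hw \<xi> / (hw \<xi> + t) * (norm (?U \<xi>))\<^sup>2) \<le> norm ((norm (?U \<xi>))\<^sup>2)"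
        by (simp only: real_norm_def abs_of_nonneg zero_le_power2)
    qed
  qed measurable
  have KRe: "KR ?U t = ennreal R"
    unfolding KR_def R_def
    by (rule nn_integral_eq_integral[OF Ri]) (intro AE_I2 mult_nonneg_nonneg frac, simp_all)
  have R0: "0 \<le> R" unfolding R_def by (intro integral_nonneg_AE AE_I2 mult_nonneg_nonneg frac) simp_all
  have Whi: "integrable lborel (\<lambda>\<xi>. hw \<xi> * (norm (W N \<xi>))\<^sup>2)" for N
    using Wh[of N] by (subst (asm) sqi_wl) auto
  \<comment> \<open>The completed square at each frequency, with the factor
    \<open>1 + hw \<xi> / t\<close> of the excess bounded below by 1.\<close>
  have J2: "nsq lborel (\<lambda>\<xi>. W N \<xi> - T \<xi>) \<le> J N - R" for N
  proof -
    have "J N = (LINT \<xi>|lborel. (norm (?U \<xi> - W N \<xi>))\<^sup>2 + hw \<xi> * (norm (W N \<xi>))\<^sup>2 / t)"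
    proof -
      have "nsq (wl hw) (W N) = (LINT \<xi>|lborel. hw \<xi> * (norm (W N \<xi>))\<^sup>2)" by (rule nsq_wl) simp_all
      then show ?thesis unfolding J_def nsq_def[of lborel]
        using Bochner_Integration.integral_add[OF sqi_integrable[OF sqi_diff[OF Us W0[of N]]] integrable_divide_zero[of t lborel "\<lambda>\<xi>. hw \<xi> * (norm (W N \<xi>))\<^sup>2"]] Whi[of N]
        by simp
    qed
    moreover have "R + nsq lborel (\<lambda>\<xi>. W N \<xi> - T \<xi>) = (LINT \<xi>|lborel. hw \<xi> / (hw \<xi> + t) * (norm (?U \<xi>))\<^sup>2 + (norm (W N \<xi> - T \<xi>))\<^sup>2)"
      unfolding R_def nsq_def by (rule Bochner_Integration.integral_add[OF Ri sqi_integrable[OF sqi_diff[OF W0 Ts]], symmetric])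
    moreover have "(LINT \<xi>|lborel. hw \<xi> / (hw \<xi> + t) * (norm (?U \<xi>))\<^sup>2 + (norm (W N \<xi> - T \<xi>))\<^sup>2)
       \<le> (LINT \<xi>|lborel. (norm (?U \<xi> - W N \<xi>))\<^sup>2 + hw \<xi> * (norm (W N \<xi>))\<^sup>2 / t)"
    proof (rule integral_mono)
      show "integrable lborel (\<lambda>\<xi>. hw \<xi> / (hw \<xi> + t) * (norm (?U \<xi>))\<^sup>2 + (norm (W N \<xi> - T \<xi>))\<^sup>2)"
        by (intro Bochner_Integration.integrable_add Ri sqi_integrable sqi_diff W0 Ts)
      show "integrable lborel (\<lambda>\<xi>. (norm (?U \<xi> - W N \<xi>))\<^sup>2 + hw \<xi> * (norm (W N \<xi>))\<^sup>2 / t)"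
        by (intro Bochner_Integration.integrable_add integrable_divide_zero Whi sqi_integrable sqi_diff W0 Us)
      fix \<xi> :: 'a
      have "1 * (norm (W N \<xi> - T \<xi>))\<^sup>2 \<le> (1 + hw \<xi> / t) * (norm (W N \<xi> - T \<xi>))\<^sup>2"
        using t by (intro mult_right_mono) simp_all
      then show "hw \<xi> / (hw \<xi> + t) * (norm (?U \<xi>))\<^sup>2 + (norm (W N \<xi> - T \<xi>))\<^sup>2
          \<le> (norm (?U \<xi> - W N \<xi>))\<^sup>2 + hw \<xi> * (norm (W N \<xi>))\<^sup>2 / t"
        using complete_square[OF t hw_nonneg, of "?U \<xi>" "W N \<xi>" \<xi>] unfolding T_def by simp
    qed
    ultimately show ?thesis by linarith
  qed
  have P: "(\<lambda>j. (norm (a j))\<^sup>2) sums nsq lborel u" unfolding a_def by (rule Parseval[OF us z])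
  have k0: "0 \<le> k j" for j unfolding k_def by (intro mult_nonneg_nonneg frac mu_nonneg) simp
  have ka: "k j \<le> (norm (a j))\<^sup>2" for j
    unfolding k_def using mult_right_mono[OF frac(4)[OF mu_nonneg[of j]], of "(norm (a j))\<^sup>2"] by simp
  have ks: "summable k"
    by (rule summable_comparison_test'[OF sums_summable[OF P]]) (use k0 ka in simp)
  have KOe: "KO u t = ennreal (suminf k)"
    unfolding KO_def a_def[symmetric] k_def[symmetric] by (rule suminf_ennreal2[OF k0 ks])
  have "(\<lambda>N. nsq lborel u - (\<Sum>j<N. (norm (a j))\<^sup>2) + (\<Sum>j<N. k j)) \<longlonglongrightarrow> nsq lborel u - nsq lborel u + suminf k"
    by (intro tendsto_add tendsto_diff tendsto_const P[unfolded sums_def] summable_LIMSEQ[OF ks])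
  then have Jlim: "J \<longlonglongrightarrow> suminf k" unfolding J1[abs_def, symmetric] by simp
  have "R \<le> suminf k"
  proof (rule LIMSEQ_le_const[OF Jlim])
    show "\<exists>N. \<forall>n\<ge>N. R \<le> J n"
    proof (intro exI allI impI)
      fix n show "R \<le> J n" using J2[of n] nsq_nonneg[of lborel "\<lambda>\<xi>. W n \<xi> - T \<xi>"] by linarith
    qed
  qed
  then show "KR ?U t \<le> KO u t" unfolding KRe KOe by (rule ennreal_leI)
  assume "KO u t \<le> KR ?U t"
  then have "suminf k \<le> R" unfolding KRe KOe using R0 by (simp add: ennreal_le_iff)
  with \<open>R \<le> suminf k\<close> have eq: "suminf k = R" by simp
  have "(\<lambda>N. J N - R) \<longlonglongrightarrow> suminf k - R" by (intro tendsto_diff Jlim tendsto_const)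
  then have "(\<lambda>N. J N - R) \<longlonglongrightarrow> 0" by (simp add: eq)
  then have "(\<lambda>N. nsq lborel (\<lambda>\<xi>. W N \<xi> - T \<xi>)) \<longlonglongrightarrow> 0" by (rule null_sandwich[OF _ nsq_nonneg J2])
  then have "sqlim lborel W T" by (rule sqlimI[OF W0 Ts])
  then show "sqlim lborel (\<lambda>N \<xi>. \<Sum>j<N. of_real (t / (\<mu> j + t)) * ip lborel u (\<phi> j) * e j \<xi>)
        (\<lambda>\<xi>. of_real (t / (hw \<xi> + t)) * fourier_L2 u \<xi>)"
    unfolding W_def[abs_def] T_def[abs_def] b_def a_def .
qed

text \<open>Both forms are integrals over \<open>t\<close> of the resolvent forms with the weight
  \<open>wt s\<close>. If the integrals agree and are finite, the nonnegative difference of the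
  integrands has integral 0; the weight is positive for \<open>t > 0\<close> and drops out.\<close>

lemma Q_comparison:
  assumes s: "0 < s" "s < 1" and u: "test_limit u" and z: "AE x in lborel. x \<notin> \<Omega> \<longrightarrow> u x = 0"
  shows "Q_Dirichlet s u \<le> Q_Navier s \<Omega> \<mu> \<phi> u"
    and "Q_Dirichlet s u < \<infinity> \<Longrightarrow> Q_Navier s \<Omega> \<mu> \<phi> u \<le> Q_Dirichlet s u \<Longrightarrow>
      AE t in lborel. t > 0 \<longrightarrow> KO u t \<le> KR (fourier_L2 u) t"
proof -
  have Um [measurable]: "fourier_L2 u \<in> borel_measurable borel"
    using fourier_L2_sqi[OF test_limit_sqi[OF u]] by (simp add: sqi_def)
  have um: "u \<in> borel_measurable lborel" using test_limit_sqi[OF u] by (simp add: sqi_def)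
  note C = Cs_pos[OF s(2)] and Cf = Cs_finite[OF s]
  have N: "Cs s * Q_Navier s \<Omega> \<mu> \<phi> u = (\<integral>\<^sup>+ t. ennreal (wt s t) * KO u t \<partial>lborel)" by (rule KO_integral[OF s(1) um])
  have D: "Cs s * Q_Dirichlet s u = (\<integral>\<^sup>+ t. ennreal (wt s t) * KR (fourier_L2 u) t \<partial>lborel)"
    unfolding Q_Dirichlet_def by (rule KR_integral[OF s(1) Um])
  have le: "ennreal (wt s t) * KR (fourier_L2 u) t \<le> ennreal (wt s t) * KO u t" for t
  proof (cases "t > 0")
    case True then show ?thesis by (intro mult_left_mono K_comparison(1)[OF u z]) simp_all
  qed (simp add: wt_def)
  have "Cs s * Q_Dirichlet s u \<le> Cs s * Q_Navier s \<Omega> \<mu> \<phi> u"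
    unfolding N D by (rule nn_integral_mono) (rule le)
  then show "Q_Dirichlet s u \<le> Q_Navier s \<Omega> \<mu> \<phi> u" using C Cf by (simp add: ennreal_mult_le_mult_iff less_top)
  assume fin: "Q_Dirichlet s u < \<infinity>" and ge: "Q_Navier s \<Omega> \<mu> \<phi> u \<le> Q_Dirichlet s u"
  let ?f = "\<lambda>t. ennreal (wt s t) * KO u t" and ?g = "\<lambda>t. ennreal (wt s t) * KR (fourier_L2 u) t"
  have gf: "integral\<^sup>N lborel ?g \<noteq> \<infinity>"
    unfolding D[symmetric] using fin Cf by (simp add: ennreal_mult_eq_top_iff less_top)
  \<comment> \<open>The difference of two integrals in the extended reals is meaningful because the
    subtracted one is finite.\<close>
  have "(\<integral>\<^sup>+ t. ?f t - ?g t \<partial>lborel) = integral\<^sup>N lborel ?f - integral\<^sup>N lborel ?g"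
    by (rule nn_integral_diff[OF _ _ gf]) (use le in \<open>auto intro!: AE_I2\<close>)
  also have "\<dots> = 0"
  proof -
    have "integral\<^sup>N lborel ?f \<le> integral\<^sup>N lborel ?g"
      unfolding N[symmetric] D[symmetric] by (rule mult_left_mono[OF ge]) simp
    then show ?thesis using gf by (simp add: diff_eq_0_iff_ennreal less_top)
  qed
  finally have "AE t in lborel. ?f t - ?g t = 0" by (subst (asm) nn_integral_0_iff_AE) simp_all
  moreover have "AE t in lborel. ?g t \<noteq> \<infinity>" by (rule nn_integral_PInf_AE[OF _ gf]) simp
  ultimately show "AE t in lborel. t > 0 \<longrightarrow> KO u t \<le> KR (fourier_L2 u) t"
  proof eventually_elim
    case (elim t)
    show ?case
    proof
      assume t: "t > 0"
      have "?f t \<le> ?g t" using elim by (simp add: diff_eq_0_iff_ennreal less_top)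
      moreover have "ennreal (wt s t) \<noteq> 0" "ennreal (wt s t) \<noteq> top" using t by (auto simp: wt_def)
      ultimately show "KO u t \<le> KR (fourier_L2 u) t" by (simp add: ennreal_mult_le_mult_iff)
    qed
  qed
qed

end

section \<open>Strict comparison\<close>

text \<open>The unnormalised Fourier integral on the complex line through the real direction \<eta>;
  for compactly supported integrable \<open>g\<close> it is entire in \<open>z\<close>.\<close>

definition etrans :: "('a::euclidean_space \<Rightarrow> complex) \<Rightarrow> 'a \<Rightarrow> complex \<Rightarrow> complex" where
  "etrans g \<eta> z = (LINT x|lborel. exp (- (\<i> * z * of_real (\<eta> \<bullet> x))) * g x)"

lemma etrans_real: "etrans g \<eta> (of_real r) = (LINT x|lborel. exp (- (\<i> * of_real ((r *\<^sub>R \<eta>) \<bullet> x))) * g x)"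
  unfolding etrans_def by (simp add: mult.assoc)

lemma fourier_etrans:
  fixes g :: "'a::euclidean_space \<Rightarrow> complex"
  shows "fourier g (r *\<^sub>R \<eta>) = of_real (fconst TYPE('a)) * etrans g \<eta> (of_real r)"
  unfolding etrans_real fourier_eq ..

lemma etrans_holomorphic:
  fixes g :: "'a::euclidean_space \<Rightarrow> complex"
  assumes g: "integrable lborel g" and R: "\<And>x. norm x > R \<Longrightarrow> g x = 0"
  shows "etrans g \<eta> holomorphic_on ball 0 P"
proof (rule power_series_holomorphic)
  fix z :: complex
  let ?w = "\<lambda>x. - (\<i> * z * of_real (\<eta> \<bullet> x))"
  let ?c = "\<lambda>k x. (- (\<i> * complex_of_real (\<eta> \<bullet> x))) ^ k /\<^sub>R fact k * g x"
  let ?f = "\<lambda>k x. ?w x ^ k /\<^sub>R fact k * g x"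
  have gm [measurable]: "g \<in> borel_measurable borel" using borel_measurable_integrable[OF g] by simp
  define B where "B = norm z * (norm \<eta> * max R 0)"
  have nf: "norm (?f k x) \<le> (B ^ k /\<^sub>R fact k) * norm (g x)" for k x
  proof (cases "norm x > max R 0")
    case True then show ?thesis using R[of x] by simp
  next
    case False
    have "norm (?w x) = norm z * \<bar>\<eta> \<bullet> x\<bar>" by (simp add: norm_mult)
    also have "\<dots> \<le> norm z * (norm \<eta> * norm x)" by (intro mult_left_mono Cauchy_Schwarz_ineq2) simp
    also have "\<dots> \<le> B" unfolding B_def using False by (intro mult_left_mono) auto
    finally have "norm (?w x) ^ k \<le> B ^ k" by (rule power_mono) simp
    then have "norm (?w x ^ k) /\<^sub>R fact k \<le> B ^ k /\<^sub>R fact k" by (simp add: norm_power divide_right_mono field_simps)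
    then have "(norm (?w x ^ k) /\<^sub>R fact k) * norm (g x) \<le> (B ^ k /\<^sub>R fact k) * norm (g x)"
      by (rule mult_right_mono) simp
    then show ?thesis by (simp add: norm_mult)
  qed
  have Bs: "summable (\<lambda>k. B ^ k /\<^sub>R fact k)" by (rule summable_exp_generic)
  have fi: "integrable lborel (?f k)" for k
  proof (rule Bochner_Integration.integrable_bound)
    show "integrable lborel (\<lambda>x. (B ^ k /\<^sub>R fact k) * norm (g x))" using g by simp
    show "AE x in lborel. norm (?f k x) \<le> norm ((B ^ k /\<^sub>R fact k) * norm (g x))"
      by (rule AE_I2) (rule order_trans[OF nf abs_ge_self, folded real_norm_def])
  qed measurable
  have sm: "(\<lambda>k. LINT x|lborel. ?f k x) sums (LINT x|lborel. (\<Sum>k. ?f k x))"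
  proof (rule sums_integral[OF fi])
    show "AE x in lborel. summable (\<lambda>k. norm (?f k x))"
    proof (rule AE_I2)
      fix x
      show "summable (\<lambda>k. norm (?f k x))"
        by (rule summable_comparison_test'[OF summable_mult2[OF Bs, of "norm (g x)"], of 0]) (use nf in simp)
    qed
    show "summable (\<lambda>k. LINT x|lborel. norm (?f k x))"
    proof (rule summable_comparison_test'[OF summable_mult2[OF Bs, of "LINT x|lborel. norm (g x)"], of 0])
      fix k :: nat
      have "(LINT x|lborel. norm (?f k x)) \<le> (LINT x|lborel. (B ^ k /\<^sub>R fact k) * norm (g x))"
        by (rule integral_mono[OF integrable_norm[OF fi]]) (use g nf in simp_all)
      also have "\<dots> = B ^ k /\<^sub>R fact k * (LINT x|lborel. norm (g x))" by (rule integral_mult_right_zero)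
      finally show "norm (LINT x|lborel. norm (?f k x)) \<le> B ^ k /\<^sub>R fact k * (LINT x|lborel. norm (g x))" by simp
    qed
  qed
  have "(LINT x|lborel. (\<Sum>k. ?f k x)) = etrans g \<eta> z"
    unfolding etrans_def
  proof (rule Bochner_Integration.integral_cong[OF refl])
    fix x show "(\<Sum>k. ?f k x) = exp (?w x) * g x"
      by (rule sums_unique[symmetric]) (rule sums_mult2[OF exp_converges])
  qed
  moreover have "(LINT x|lborel. ?f k x) = (LINT x|lborel. ?c k x) * (z - 0) ^ k" for k
  proof -
    have "?f k x = z ^ k * ?c k x" for x
    proof -
      have "?w x = z * (- (\<i> * complex_of_real (\<eta> \<bullet> x)))" by simp
      then have "?w x ^ k = z ^ k * (- (\<i> * complex_of_real (\<eta> \<bullet> x))) ^ k" by (simp only: power_mult_distrib)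
      then show ?thesis by (simp only: scaleR_conv_of_real mult_ac)
    qed
    then have "(LINT x|lborel. ?f k x) = z ^ k * (LINT x|lborel. ?c k x)" by (simp only: integral_mult_right_zero)
    then show ?thesis by (simp only: diff_zero mult.commute)
  qed
  ultimately show "(\<lambda>k. (LINT x|lborel. ?c k x) * (z - 0) ^ k) sums etrans g \<eta> z" using sm by (simp only:)
qed

text \<open>On the line through the unit vector \<eta> the function \<open>hw\<close> is the
  polynomial \<open>z\<^sup>2\<close>, so the relation between the transforms extends from the real
  axis to a disc. At \<open>z = \<i> * sqrt t\<close> the factor \<open>z\<^sup>2 + t\<close>
  vanishes and only the term with \<open>u\<close> is left; \<open>t < 1\<close> keeps this point
  inside the disc of radius 2.\<close>

lemma etrans_vanishes:
  fixes u w :: "'a::euclidean_space \<Rightarrow> complex"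
  assumes u: "integrable lborel u" "\<And>x. norm x > R \<Longrightarrow> u x = 0"
    and w: "integrable lborel w" "\<And>x. norm x > R \<Longrightarrow> w x = 0"
    and eq: "\<And>\<xi>. of_real (hw \<xi> + t) * fourier w \<xi> = of_real t * fourier u \<xi>"
    and t: "0 < t" "t < 1" and \<eta>: "norm \<eta> = 1"
  shows "etrans u \<eta> (\<i> * of_real (sqrt t)) = 0"
proof -
  define D where "D z = (z\<^sup>2 + of_real t) * etrans w \<eta> z - of_real t * etrans u \<eta> z" for z
  have hol: "D holomorphic_on ball 0 2"
    unfolding D_def by (intro holomorphic_intros etrans_holomorphic u w)
  have real: "D (of_real r) = 0" for r
  proof -
    have "hw (r *\<^sub>R \<eta>) = r\<^sup>2" using \<eta> by (simp add: hw_def power_mult_distrib)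
    then have "of_real (fconst TYPE('a)) * (((of_real r)\<^sup>2 + of_real t) * etrans w \<eta> (of_real r) - of_real t * etrans u \<eta> (of_real r)) = (0::complex)"
      using eq[of "r *\<^sub>R \<eta>"] unfolding fourier_etrans by (simp add: algebra_simps)
    moreover have "complex_of_real (fconst TYPE('a)) \<noteq> 0" by simp
    ultimately show ?thesis unfolding D_def by (simp only: mult_eq_0_iff) simp
  qed
  have "D (\<i> * of_real (sqrt t)) = 0"
  proof (rule analytic_continuation[OF hol open_ball connected_ball])
    show "(of_real ` {-1<..<1::real} :: complex set) \<subseteq> ball 0 2" by auto
    show "(0::complex) \<in> ball 0 2" by simp
    show "(0::complex) islimpt (of_real ` {-1<..<1::real})"
      unfolding islimpt_approachable
    proof (intro allI impI)
      fix d :: real assume d: "d > 0"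
      define r where "r = min d 1 / 2"
      have "r > 0" "r < 1" "r < d" using d by (auto simp: r_def)
      then show "\<exists>x'\<in>complex_of_real ` {-1<..<1}. x' \<noteq> 0 \<and> dist x' 0 < d"
        by (intro bexI[of _ "of_real r"] conjI) (auto simp: dist_norm)
    qed
    show "D z = 0" if "z \<in> of_real ` {-1<..<1::real}" for z using that real by blast
    have "sqrt t < sqrt 4" using t by (intro real_sqrt_less_mono) simp
    then show "\<i> * of_real (sqrt t) \<in> ball 0 2" using t by (simp add: norm_mult)
  qed
  moreover have "(\<i> * complex_of_real (sqrt t))\<^sup>2 + of_real t = 0"
    using t by (simp add: power_mult_distrib of_real_power[symmetric])
  ultimately show ?thesis using t unfolding D_def by simp
qed

lemma AE_obtain_small:
  assumes "AE t in lborel. t > 0 \<longrightarrow> Q t" "(d::real) > 0"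
  obtains t where "0 < t" "t < d" "Q t"
proof (rule ccontr)
  assume "\<not> thesis"
  with that have n: "\<not> Q t" if "t \<in> {0<..<d}" for t using \<open>t \<in> {0<..<d}\<close> by auto
  have "AE t in lborel. t \<notin> {0<..<d}" using assms(1) by eventually_elim (use n in auto)
  then have "{0<..<d} \<in> null_sets lborel" by (subst AE_iff_null_sets) auto
  then have "emeasure lborel {0<..<d} = 0" by auto
  then show False using assms(2) by simp
qed

lemma fourier_continuous:
  fixes u :: "'a::euclidean_space \<Rightarrow> complex"
  assumes u: "integrable lborel u" and R: "\<And>x. norm x > R \<Longrightarrow> u x = 0"
  shows "continuous_on UNIV (fourier u)"
proof -
  define L where "L = fconst TYPE('a) * (LINT x|lborel. norm (u x)) * max R 0"
  have L0: "L \<ge> 0" unfolding L_def by simp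
  have "L-lipschitz_on UNIV (fourier u)"
  proof (rule lipschitz_onI[OF _ L0])
    fix \<xi> \<eta> :: 'a
    have "norm (fourier u \<xi> - fourier u \<eta>) \<le> fconst TYPE('a) * (LINT x|lborel. norm (u x)) * max R 0 * norm (\<xi> - \<eta>)"
      by (rule fourier_Lipschitz[OF u]) (use R in auto)
    then show "dist (fourier u \<xi>) (fourier u \<eta>) \<le> L * dist \<xi> \<eta>" by (simp only: dist_norm L_def)
  qed
  then show ?thesis by (rule lipschitz_on_continuous_on)
qed

lemma AE_eq_continuous:
  fixes f g :: "'a::euclidean_space \<Rightarrow> complex"
  assumes "continuous_on UNIV f" "continuous_on UNIV g" "AE x in lborel. f x = g x"
  shows "f x = g x"
proof (rule ccontr)
  assume ne: "f x \<noteq> g x"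
  let ?S = "{x. f x \<noteq> g x}"
  have op: "open ?S" by (rule open_Collect_neq[OF assms(1,2)])
  have "AE x in lborel. x \<notin> ?S" using assms(3) by eventually_elim simp
  then have "?S \<in> null_sets lborel" using op by (subst AE_iff_null_sets) auto
  then have "negligible ?S" by (simp add: negligible_iff_null_sets null_sets_completionI)
  moreover have "?S \<noteq> {}" using ne by blast
  ultimately show False using op open_not_negligible by blast
qed

section \<open>Agreement of the resolvent forms forces the function to vanish\<close>

context eigensystem
begin

lemma strict_core:
  assumes u: "test_limit u" and z: "AE x in lborel. x \<notin> \<Omega> \<longrightarrow> u x = 0"
    and K: "AE t in lborel. t > 0 \<longrightarrow> KO u t \<le> KR (fourier_L2 u) t"
  shows "nsq lborel u = 0"
proof -
  note us = test_limit_sqi[OF u]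
  obtain R where R: "\<forall>x\<in>\<Omega>. norm x \<le> R" using bounded_dom unfolding bounded_iff by blast
  have out: "x \<notin> \<Omega>" if "norm x > R" for x using R that by (auto simp: not_le[symmetric])
  have um [measurable]: "u \<in> borel_measurable borel" using us by (simp add: sqi_def)
  \<comment> \<open>A representative vanishing at every point off \<Omega>: it is integrable with
    bounded support, so its transform is an honest integral, continuous in the frequency and entire
    along complex lines.\<close>
  define u' where "u' x = (if x \<in> \<Omega> then u x else 0)" for x
  have u'm [measurable]: "u' \<in> borel_measurable borel" unfolding u'_def[abs_def] by measurable
  have uu': "AE x in lborel. u x = u' x" using z by eventually_elim (simp add: u'_def)
  have u's: "sqi lborel u'" by (rule sqi_cong_AE[OF us _ uu']) simp
  have u'i: "integrable lborel u'"
    by (rule sqi_bounded_support_integrable(1)[OF u's bounded_dom dom_borel]) (simp add: u'_def)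
  have u'R: "norm x > R \<Longrightarrow> u' x = 0" for x using out by (simp add: u'_def)
  have FU: "AE \<xi> in lborel. fourier_L2 u \<xi> = fourier u' \<xi>"
  proof -
    have "sqlim lborel (\<lambda>k. u') u" 
      by (rule sqlim_cong_AE[OF sqlim_const[OF u's]]) (use uu' in \<open>auto\<close>)
    from fourier_L2_sqlim[OF u'i this] show ?thesis
      by (rule sqlim_unique) (rule sqlim_const[OF Bessel_fourier(1)[OF u'i u's]])
  qed
  have van: "etrans u' \<eta> (\<i> * of_real (sqrt t)) = 0"
    if t: "0 < t" "t < 1" and le: "KO u t \<le> KR (fourier_L2 u) t" and \<eta>: "norm \<eta> = 1" for t \<eta>
  proof -
    let ?b = "\<lambda>j. of_real (t / (\<mu> j + t)) * ip lborel u (\<phi> j)"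
    let ?T = "\<lambda>\<xi>. of_real (t / (hw \<xi> + t)) * fourier_L2 u \<xi>"
    let ?W = "\<lambda>N \<xi>. \<Sum>j<N. ?b j * e j \<xi>"
    have lim: "sqlim lborel ?W ?T" by (rule K_comparison(2)[OF u z t(1) le])
    \<comment> \<open>The same partial sums on the space side, cut off to \<Omega>. Plancherel shows
      that they converge, so the whole-space minimiser \<open>?T\<close> is the transform of a
      function vanishing outside \<Omega>; this is where equality of the forms becomes a support
      property.\<close>
    define w where "w N x = (if x \<in> \<Omega> then \<Sum>j<N. ?b j * \<phi> j x else 0)" for N x
    have pm [measurable]: "\<phi> j \<in> borel_measurable borel" for j using phi_sqi[of j] by (simp add: sqi_def)
    have wm [measurable]: "w N \<in> borel_measurable borel" for N unfolding w_def[abs_def] by measurable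
    have ws0: "test_limit (\<lambda>x. \<Sum>j<N. ?b j * \<phi> j x)" for N by (intro test_limit_sum phi_limit finite_lessThan)
    have wAE: "AE x in lborel. (\<Sum>j<N. ?b j * \<phi> j x) = w N x" for N
    proof -
      have "AE x in lborel. \<forall>j. x \<notin> \<Omega> \<longrightarrow> \<phi> j x = 0" using phi_outside by (subst AE_all_countable) blast
      then show ?thesis by eventually_elim (simp add: w_def)
    qed
    have ws: "sqi lborel (w N)" for N
      by (rule sqi_cong_AE[OF test_limit_sqi[OF ws0] _ wAE]) simp
    have wi: "integrable lborel (w N)" for N
      by (rule sqi_bounded_support_integrable(1)[OF ws bounded_dom dom_borel]) (simp add: w_def)
    have Fw: "AE \<xi> in lborel. fourier (w N) \<xi> = ?W N \<xi>" for N
    proof -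
      have "sqlim lborel (\<lambda>k. w N) (\<lambda>x. \<Sum>j<N. ?b j * \<phi> j x)"
        by (rule sqlim_cong_AE[OF sqlim_const[OF ws]]) (use wAE[of N] in \<open>auto elim: eventually_mono\<close>)
      from fourier_L2_sqlim[OF wi this]
      have "AE \<xi> in lborel. fourier_L2 (\<lambda>x. \<Sum>j<N. ?b j * \<phi> j x) \<xi> = fourier (w N) \<xi>"
        by (rule sqlim_unique) (rule sqlim_const[OF Bessel_fourier(1)[OF wi ws]])
      moreover have "AE \<xi> in lborel. fourier_L2 (\<lambda>x. \<Sum>j<N. ?b j * \<phi> j x) \<xi> = ?W N \<xi>"
        by (rule fourier_L2_sum) (simp_all add: phi_sqi)
      ultimately show ?thesis by eventually_elim simp
    qed
    have "nsq lborel (\<lambda>x. w i x - w j x) = nsq lborel (\<lambda>\<xi>. ?W i \<xi> - ?W j \<xi>)" for i j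
    proof -
      have "nsq lborel (\<lambda>x. w i x - w j x) = nsq lborel (\<lambda>x. (\<Sum>k<i. ?b k * \<phi> k x) - (\<Sum>k<j. ?b k * \<phi> k x))"
        using wAE[of i] wAE[of j] by (intro nsq_cong_AE) (auto elim: eventually_elim2)
      also have "\<dots> = nsq lborel (fourier_L2 (\<lambda>x. (\<Sum>k<i. ?b k * \<phi> k x) - (\<Sum>k<j. ?b k * \<phi> k x)))"
        by (rule Plancherel[OF test_limit_diff[OF ws0 ws0], symmetric])
      also have "\<dots> = nsq lborel (\<lambda>\<xi>. ?W i \<xi> - ?W j \<xi>)"
      proof (rule nsq_cong_AE)
        show "fourier_L2 (\<lambda>x. (\<Sum>k<i. ?b k * \<phi> k x) - (\<Sum>k<j. ?b k * \<phi> k x)) \<in> borel_measurable lborel"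
          by (rule sqi_measurable[OF fourier_L2_sqi[OF test_limit_sqi[OF test_limit_diff[OF ws0 ws0]]]])
        show "(\<lambda>\<xi>. ?W i \<xi> - ?W j \<xi>) \<in> borel_measurable lborel"
          by (rule sqi_measurable[OF sqi_diff[OF sqlimD(1)[OF lim] sqlimD(1)[OF lim]]])
        have s: "AE \<xi> in lborel. fourier_L2 (\<lambda>x. \<Sum>j<N. ?b j * \<phi> j x) \<xi> = ?W N \<xi>" for N
          by (rule fourier_L2_sum) (simp_all add: phi_sqi)
        show "AE \<xi> in lborel. fourier_L2 (\<lambda>x. (\<Sum>k<i. ?b k * \<phi> k x) - (\<Sum>k<j. ?b k * \<phi> k x)) \<xi> = ?W i \<xi> - ?W j \<xi>"
          using fourier_L2_diff[OF test_limit_sqi[OF ws0] test_limit_sqi[OF ws0], of i j] s[of i] s[of j]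
          by eventually_elim simp
      qed
      finally show ?thesis .
    qed
    then have "sqCauchy lborel w"
      using sqlim_imp_Cauchy[OF lim] ws unfolding sqCauchy_def by simp
    then obtain v where v: "sqlim lborel w v" by (rule sqCauchy_converges)
    have v0: "AE x in lborel. x \<notin> \<Omega> \<longrightarrow> v x = 0"
      by (rule sqCauchy_limit_AE[OF v]) (simp add: w_def)
    have vm [measurable]: "v \<in> borel_measurable borel" using sqlimD(2)[OF v] by (simp add: sqi_def)
    define v' where "v' x = (if x \<in> \<Omega> then v x else 0)" for x
    have v'm: "v' \<in> borel_measurable borel" unfolding v'_def[abs_def] by measurable
    have v': "sqlim lborel w v'"
      by (rule sqlim_cong_AE[OF v]) (use v0 v'm in \<open>auto simp: v'_def elim: eventually_mono\<close>)
    note v's = sqlimD(2)[OF v']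
    have v'i: "integrable lborel v'"
      by (rule sqi_bounded_support_integrable(1)[OF v's bounded_dom dom_borel]) (simp add: v'_def)
    have v'R: "norm x > R \<Longrightarrow> v' x = 0" for x using out by (simp add: v'_def)
    have "sqlim lborel (\<lambda>N. fourier (w N)) (fourier_L2 v')" by (rule fourier_L2_sqlim[OF wi v'])
    moreover have "sqlim lborel (\<lambda>N. fourier (w N)) ?T"
    proof (rule sqlimI)
      show "sqi lborel (fourier (w N))" for N by (rule Bessel_fourier(1)[OF wi ws])
      show "sqi lborel ?T" by (rule sqlimD(2)[OF lim])
      have "nsq lborel (\<lambda>\<xi>. fourier (w N) \<xi> - ?T \<xi>) = nsq lborel (\<lambda>\<xi>. ?W N \<xi> - ?T \<xi>)" for N
      proof (rule nsq_cong_AE)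
        show "(\<lambda>\<xi>. fourier (w N) \<xi> - ?T \<xi>) \<in> borel_measurable lborel"
          by (rule sqi_measurable[OF sqi_diff[OF Bessel_fourier(1)[OF wi ws] sqlimD(2)[OF lim]]])
        show "(\<lambda>\<xi>. ?W N \<xi> - ?T \<xi>) \<in> borel_measurable lborel"
          by (rule sqi_measurable[OF sqi_diff[OF sqlimD(1)[OF lim] sqlimD(2)[OF lim]]])
        show "AE \<xi> in lborel. fourier (w N) \<xi> - ?T \<xi> = ?W N \<xi> - ?T \<xi>" using Fw[of N] by eventually_elim simp
      qed
      then show "(\<lambda>N. nsq lborel (\<lambda>\<xi>. fourier (w N) \<xi> - ?T \<xi>)) \<longlonglongrightarrow> 0" using sqlimD(3)[OF lim] by (simp only:)
    qed
    ultimately have "AE \<xi> in lborel. fourier_L2 v' \<xi> = ?T \<xi>" by (rule sqlim_unique)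
    then have AE: "AE \<xi> in lborel. of_real (hw \<xi> + t) * fourier v' \<xi> = of_real t * fourier u' \<xi>"
      using fourier_L2_integrable[OF v'i v's] FU
    proof eventually_elim
      case (elim \<xi>)
      have "complex_of_real (hw \<xi> + t) \<noteq> 0" unfolding of_real_eq_0_iff using hw_nonneg[of \<xi>] t(1) by linarith
      then have "complex_of_real (hw \<xi> + t) * (of_real (t / (hw \<xi> + t)) * y) = of_real t * y" for y
        unfolding of_real_divide by (simp del: of_real_add)
      then show ?case using elim by simp
    qed
    \<comment> \<open>Both sides are continuous, because both functions have bounded support, so the
      identity holds at every frequency and in particular along each line.\<close>
    have eq: "of_real (hw \<xi> + t) * fourier v' \<xi> = of_real t * fourier u' \<xi>" for \<xi>
      by (rule AE_eq_continuous[OF _ _ AE])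
         (auto simp: hw_def intro!: continuous_intros fourier_continuous[OF v'i v'R] fourier_continuous[OF u'i u'R])
    show ?thesis by (rule etrans_vanishes[OF u'i u'R v'i v'R eq t \<eta>])
  qed
  \<comment> \<open>The admissible \<open>t\<close> have full measure, so some lie arbitrarily close
    to 0; the zeros \<open>\<i> * sqrt t\<close> accumulate at 0 and the identity theorem applies on
    any disc containing \<open>z\<close>.\<close>
  have zero: "etrans u' \<eta> z = 0" if \<eta>: "norm \<eta> = 1" for \<eta> z
  proof -
    define P where "P = norm z + 2"
    define S where "S = {\<i> * complex_of_real (sqrt t) |t. 0 < t \<and> t < 1 \<and> KO u t \<le> KR (fourier_L2 u) t}"
    show ?thesis
    proof (rule analytic_continuation[OF etrans_holomorphic[OF u'i u'R] open_ball connected_ball])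
      show "S \<subseteq> ball 0 P"
      proof
        fix y assume "y \<in> S"
        then obtain t where t: "y = \<i> * complex_of_real (sqrt t)" "0 < t" "t < 1" unfolding S_def by blast
        have "sqrt t < sqrt 1" using t by (intro real_sqrt_less_mono)
        then have "norm y < 1" using t by (simp add: norm_mult)
        moreover have "1 < P" unfolding P_def using norm_ge_zero[of z] by linarith
        ultimately show "y \<in> ball 0 P" by simp
      qed
      have "0 < P" unfolding P_def using norm_ge_zero[of z] by linarith
      then show "0 \<in> ball 0 P" by simp
      show "0 islimpt S"
        unfolding islimpt_approachable
      proof (intro allI impI)
        fix d :: real assume d: "d > 0"
        have "min (d\<^sup>2) 1 > 0" using d by simp
        with K obtain t where t: "0 < t" "t < min (d\<^sup>2) 1" "KO u t \<le> KR (fourier_L2 u) t" by (rule AE_obtain_small)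
        have "sqrt t < sqrt (d\<^sup>2)" using t by (intro real_sqrt_less_mono) simp
        then have "sqrt t < d" using d by simp
        moreover have "\<i> * complex_of_real (sqrt t) \<in> S" unfolding S_def using t by auto
        ultimately show "\<exists>x'\<in>S. x' \<noteq> 0 \<and> dist x' 0 < d"
          using t(1) by (intro bexI[of _ "\<i> * complex_of_real (sqrt t)"]) (simp_all add: norm_mult)
      qed
      show "etrans u' \<eta> y = 0" if "y \<in> S" for y using that van[OF _ _ _ \<eta>] unfolding S_def by blast
      show "z \<in> ball 0 P" by (simp add: P_def)
    qed
  qed
  \<comment> \<open>Every real frequency lies on a line through the origin spanned by a unit
    vector.\<close>
  have F0: "fourier u' \<xi> = 0" for \<xi>
  proof -
    obtain \<eta> r where "norm \<eta> = 1" "\<xi> = r *\<^sub>R \<eta>"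
    proof (cases "\<xi> = 0")
      case True
      obtain b :: 'a where "b \<in> Basis" using nonempty_Basis by blast
      then show ?thesis using that[of b 0] True by simp
    next
      case False
      then show ?thesis using that[of "\<xi> /\<^sub>R norm \<xi>" "norm \<xi>"] by simp
    qed
    then show ?thesis using fourier_etrans[of u' r \<eta>] zero by simp
  qed
  have "AE \<xi> in lborel. fourier_L2 u \<xi> = 0" using FU by eventually_elim (simp add: F0)
  then have "nsq lborel (fourier_L2 u) = 0" using nsq_eq_0_iff[OF fourier_L2_sqi[OF us]] by simp
  then show ?thesis by (simp only: Plancherel[OF u])
qed

end

section \<open>Domains with Lipschitz boundary\<close>

text \<open>Near each of its points the frontier is contained in the graph of a Lipschitz function
  over a hyperplane, that is, in a Lipschitz image of a null set. Compactness of the frontier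
  reduces to finitely many such pieces.\<close>

lemma frontier_negligible:
  fixes \<Omega> :: "'a::euclidean_space set"
  assumes \<Omega>: "bounded_lipschitz_domain \<Omega>"
  shows "negligible (frontier \<Omega>)"
proof -
  have op: "open \<Omega>" and bd: "bounded \<Omega>" and lip: "lipschitz_boundary \<Omega>"
    using \<Omega> by (auto simp: bounded_lipschitz_domain_def)
  have loc: "\<exists>r>0. negligible (frontier \<Omega> \<inter> ball p r)" if p: "p \<in> frontier \<Omega>" for p
  proof -
    obtain e r L g where e: "norm e = 1" and r: "r > 0" and g: "L-lipschitz_on {y. y \<bullet> e = 0} g"
      and gr: "\<forall>x\<in>ball p r. x \<in> \<Omega> \<longleftrightarrow> g (x - (x \<bullet> e) *\<^sub>R e) < x \<bullet> e"
      using lip p unfolding lipschitz_boundary_def by blast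
    let ?H = "{y. y \<bullet> e = 0}"
    let ?F = "\<lambda>y. y + g y *\<^sub>R e"
    have ee: "e \<bullet> e = 1" using e by (simp add: dot_square_norm)
    have proj: "x - (x \<bullet> e) *\<^sub>R e \<in> ?H" for x by (simp add: inner_diff_left ee)
    have gc: "continuous_on UNIV (\<lambda>x. g (x - (x \<bullet> e) *\<^sub>R e))"
      by (rule continuous_on_compose2[OF lipschitz_on_continuous_on[OF g]])
         (use proj in \<open>auto intro!: continuous_intros\<close>)
    have "negligible (?F ` ?H)"
    proof (rule negligible_locally_Lipschitz_image)
      show "DIM('a) \<le> DIM('a)" by simp
      have "negligible {y. e \<bullet> y = 0}" by (rule negligible_hyperplane) (use e in auto)
      then show "negligible ?H" by (simp add: inner_commute)
      fix x assume x: "x \<in> ?H"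
      have "norm (?F y - ?F x) \<le> (1 + L) * norm (y - x)" if y: "y \<in> ?H" for y
      proof -
        have "?F y - ?F x = (y - x) + (g y - g x) *\<^sub>R e" by (simp add: algebra_simps)
        also have "norm \<dots> \<le> norm (y - x) + \<bar>g y - g x\<bar> * norm e"
          using norm_triangle_ineq[of "y - x" "(g y - g x) *\<^sub>R e"] by simp
        finally have "norm (?F y - ?F x) \<le> norm (y - x) + \<bar>g y - g x\<bar> * norm e" .
        moreover have "\<bar>g y - g x\<bar> \<le> L * norm (y - x)"
          using lipschitz_onD[OF g y x] by (simp add: dist_norm)
        ultimately show ?thesis using e by (simp add: distrib_right)
      qed
      then show "\<exists>T B. open T \<and> x \<in> T \<and> (\<forall>y\<in>?H \<inter> T. norm (?F y - ?F x) \<le> B * norm (y - x))"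
        by (intro exI[of _ UNIV] exI[of _ "1 + L"]) auto
    qed
    moreover have "frontier \<Omega> \<inter> ball p r \<subseteq> ?F ` ?H"
    proof
      fix x assume x: "x \<in> frontier \<Omega> \<inter> ball p r"
      then have xn: "x \<notin> \<Omega>" and xc: "x \<in> closure \<Omega>" and xb: "x \<in> ball p r"
        using op by (auto simp: frontier_def interior_open)
      let ?y = "x - (x \<bullet> e) *\<^sub>R e"
      have ge: "x \<bullet> e \<le> g ?y" using gr xn xb by (meson not_less)
      \<comment> \<open>Points strictly below the graph form an open set disjoint from \<Omega>,
        hence disjoint from its closure. Points on the frontier are also not strictly above the
        graph, so they lie on it.\<close>
      have "\<not> x \<bullet> e < g ?y"
      proof
        assume lt: "x \<bullet> e < g ?y"
        let ?U = "ball p r \<inter> {z. z \<bullet> e < g (z - (z \<bullet> e) *\<^sub>R e)}"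
        have "open ?U" by (intro open_Int open_ball open_Collect_less gc continuous_intros)
        moreover have "?U \<inter> \<Omega> = {}" using gr by fastforce
        ultimately have "?U \<inter> closure \<Omega> = {}" using open_Int_closure_eq_empty by blast
        then show False using xb xc lt by blast
      qed
      with ge have "x = ?F ?y" by simp
      then show "x \<in> ?F ` ?H" using proj by blast
    qed
    ultimately have "negligible (frontier \<Omega> \<inter> ball p r)" by (rule negligible_subset)
    with r show ?thesis by blast
  qed
  have "\<forall>p\<in>frontier \<Omega>. \<exists>r. r > 0 \<and> negligible (frontier \<Omega> \<inter> ball p r)" using loc by blast
  then have "\<exists>r. \<forall>p\<in>frontier \<Omega>. r p > 0 \<and> negligible (frontier \<Omega> \<inter> ball p (r p))" by (rule bchoice)
  then obtain r where r: "\<forall>p\<in>frontier \<Omega>. r p > 0 \<and> negligible (frontier \<Omega> \<inter> ball p (r p))" by (rule exE)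
  have "compact (frontier \<Omega>)" by (rule compact_frontier_bounded[OF bd])
  moreover have "frontier \<Omega> \<subseteq> (\<Union>p\<in>frontier \<Omega>. ball p (r p))" using r by fastforce
  ultimately obtain C where C: "C \<subseteq> frontier \<Omega>" "finite C" "frontier \<Omega> \<subseteq> (\<Union>p\<in>C. ball p (r p))"
    by (rule compactE_image[OF _ open_ball])
  have "negligible (\<Union>p\<in>C. frontier \<Omega> \<inter> ball p (r p))"
    by (rule negligible_Union) (use C r in auto)
  then show ?thesis by (rule negligible_subset) (use C(3) in blast)
qed

text \<open>The complement of the essential support is a union of possibly uncountably many open
  sets; Lindelof's theorem makes it countable, so \<open>u\<close> vanishes almost everywhere there.
  The gap between the closure and \<Omega> is the frontier, a null set.\<close>

lemma Hs_tilde_outside: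
  fixes \<Omega> :: "'a::euclidean_space set"
  assumes \<Omega>: "bounded_lipschitz_domain \<Omega>" and u: "u \<in> Hs_tilde s \<Omega>"
  shows "AE x in lborel. x \<notin> \<Omega> \<longrightarrow> u x = 0"
proof -
  let ?U = "{U. open U \<and> (AE x in lborel. x \<in> U \<longrightarrow> u x = 0)}"
  obtain D where D: "D \<subseteq> ?U" "countable D" "\<Union>D = \<Union>?U"
    by (rule Lindelof[of ?U]) auto
  have "AE x in lborel. \<forall>U\<in>D. x \<in> U \<longrightarrow> u x = 0"
    using AE_ball_countable[OF D(2), of "\<lambda>x U. x \<in> U \<longrightarrow> u x = 0" lborel] D(1) by auto
  moreover have "AE x in lborel. x \<notin> frontier \<Omega>"
  proof (rule AE_not_in)
    have "frontier \<Omega> \<in> null_sets (completion lborel)"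
      using frontier_negligible[OF \<Omega>] by (simp add: negligible_iff_null_sets)
    moreover have "frontier \<Omega> \<in> sets lborel" using borel_closed[OF frontier_closed[of \<Omega>]] by simp
    ultimately show "frontier \<Omega> \<in> null_sets lborel" by (simp add: null_sets_completion_iff)
  qed
  ultimately show ?thesis
  proof eventually_elim
    case (elim x)
    show ?case
    proof
      assume "x \<notin> \<Omega>"
      with elim have "x \<notin> closure \<Omega>" unfolding closure_Un_frontier by blast
      then have "x \<notin> ess_support u" using u unfolding Hs_tilde_def by blast
      then have "x \<in> \<Union>D" unfolding D(3) ess_support_def by blast
      with elim show "u x = 0" by blast
    qed
  qed
qed

section \<open>The Dirichlet form\<close>

definition fw :: "real \<Rightarrow> 'a::euclidean_space \<Rightarrow> real" where
  "fw s \<xi> = norm \<xi> powr (2 * s)"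

lemma fw_measurable [measurable, simp]: "fw s \<in> borel_measurable borel"
  unfolding fw_def[abs_def] by measurable

lemma fw_nonneg [simp]: "0 \<le> fw s \<xi>"
  by (simp add: fw_def)

lemma fw_le_sw: "0 \<le> s \<Longrightarrow> fw s \<xi> \<le> sw s \<xi>"
  unfolding fw_def hw_powr[symmetric] sw_def hw_def[symmetric] by (rule powr_mono2) simp_all

lemma Q_Dirichlet_nsq:
  fixes U :: "'a::euclidean_space \<Rightarrow> complex"
  assumes U: "sqi (wl (fw s)) U"
  shows "(\<integral>\<^sup>+ \<xi>. ennreal (norm \<xi> powr (2 * s) * (norm (U \<xi>))\<^sup>2) \<partial>lborel) = ennreal (nsq (wl (fw s)) U)"
proof -
  have "U \<in> borel_measurable borel" "integrable lborel (\<lambda>\<xi>. fw s \<xi> * (norm (U \<xi>))\<^sup>2)"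
    using U by (simp_all add: sqi_wl)
  then show ?thesis unfolding nsq_wl[OF fw_measurable fw_nonneg \<open>U \<in> borel_measurable borel\<close>]
    by (subst nn_integral_eq_integral[symmetric]) (simp_all add: fw_def)
qed

lemma Hs_approximation:
  assumes u: "u \<in> Hs s" and s: "0 < s" "s < 1"
  obtains f where "\<forall>k::nat. test_fun UNIV (f k)" "sqlim lborel f u"
    "sqlim (wl (fw s)) (\<lambda>k. fourier (f k)) (fourier_L2 u)"
proof -
  obtain f where f: "\<forall>k::nat. test_fun UNIV (f k)" "sqlim lborel f u"
      "sqlim (wl (sw s)) (\<lambda>k. fourier (f k)) (fourier_L2 u)"
    using u[unfolded Hs_def] less_imp_le[OF s(1)] less_imp_le[OF s(2)] by (rule Hs_completionE)
  have "sqlim (wl (fw s)) (\<lambda>k. fourier (f k)) (fourier_L2 u)"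
    by (rule sqlim_wl_mono[OF f(3)]) (use s in \<open>simp_all add: fw_le_sw\<close>)
  with f(1,2) show thesis by (rule that)
qed

lemma Q_Dirichlet_Hs:
  assumes u: "u \<in> Hs s" and s: "0 < s" "s < 1"
  shows "Q_Dirichlet s u = ennreal (nsq (wl (fw s)) (fourier_L2 u))"
proof -
  obtain f where "\<forall>k::nat. test_fun UNIV (f k)" "sqlim lborel f u"
      "sqlim (wl (fw s)) (\<lambda>k. fourier (f k)) (fourier_L2 u)" using u s by (rule Hs_approximation)
  then show ?thesis unfolding Q_Dirichlet_def by (intro Q_Dirichlet_nsq sqlimD(2))
qed

lemma Q_Dirichlet_test:
  assumes f: "test_fun UNIV f" and s: "0 < s" "s < 1"
  shows "Q_Dirichlet s f = ennreal (nsq (wl (fw s)) (fourier f))"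
    "Q_Dirichlet s f = (\<integral>\<^sup>+ \<xi>. ennreal (norm \<xi> powr (2 * s) * (norm (fourier f \<xi>))\<^sup>2) \<partial>lborel)"
proof -
  have "sqi (wl (fw s)) (fourier f)"
    by (rule sqi_wl_mono(1)[OF fourier_test_sqi_sw[OF f less_imp_le[OF s(2)]]]) (use s in \<open>simp_all add: fw_le_sw\<close>)
  note e = Q_Dirichlet_nsq[OF this]
  show "Q_Dirichlet s f = (\<integral>\<^sup>+ \<xi>. ennreal (norm \<xi> powr (2 * s) * (norm (fourier f \<xi>))\<^sup>2) \<partial>lborel)"
    unfolding Q_Dirichlet_def
    by (rule nn_integral_cong_AE)
       (use fourier_L2_integrable[OF test_fun_integrable[OF f] test_fun_sqi[OF f]] in eventually_elim, simp)
  then show "Q_Dirichlet s f = ennreal (nsq (wl (fw s)) (fourier f))" unfolding e .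
qed

lemma test_fun_Hs_completion:
  assumes f: "test_fun \<Omega> f" shows "f \<in> Hs_completion s \<Omega>"
  unfolding Hs_completion_def
proof (intro CollectI conjI exI[of _ "\<lambda>_. f"] allI impI)
  have "fourier (\<lambda>x::'a. 0) = (\<lambda>\<xi>. 0)" by (rule ext) (simp add: fourier_def)
  then show "\<exists>N. \<forall>i\<ge>N. \<forall>j\<ge>N. Hs_norm_sq s (\<lambda>x. f x - f x) < e" if "e > 0" for e :: ennreal
    using that unfolding Hs_norm_sq_def by simp
  show "L2_tendsto (\<lambda>_. f) f" by (simp add: L2_tendsto_def)
qed (fact test_fun_L2[OF f] f)+

section \<open>The resolvent kernel\<close>

text \<open>The heat kernel at time \<tau>, weighted by the exponential probability density with
  rate \<open>t\<close>. Integrated over \<tau> it gives \<open>G t\<close>, the kernel of t (t -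
  \<Delta>)^-1 on the whole space.\<close>

definition rk :: "real \<Rightarrow> real \<Rightarrow> 'a::euclidean_space \<Rightarrow> real" where
  "rk t \<tau> y = (if \<tau> > 0 then t * exp (- t * \<tau>) * heat \<tau> y else 0)"

definition G :: "real \<Rightarrow> 'a::euclidean_space \<Rightarrow> real" where
  "G t y = (LINT \<tau>|lborel. rk t \<tau> y)"

lemma rk_measurable [measurable]:
  "(\<lambda>(\<tau>, y). rk t \<tau> (y::'a::euclidean_space)) \<in> borel_measurable (lborel \<Otimes>\<^sub>M lborel)"
  unfolding rk_def heat_def by measurable

lemma rk_measurable1 [measurable]: "rk t \<tau> \<in> borel_measurable borel"
  unfolding rk_def[abs_def] by measurable

lemma rk_nonneg: "t > 0 \<Longrightarrow> 0 \<le> rk t \<tau> y"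
  unfolding rk_def by simp

lemma integral_exp_decay:
  fixes a :: real
  assumes a: "a > 0"
  shows "(\<integral>\<^sup>+ \<tau>. ennreal (if \<tau> > 0 then exp (- a * \<tau>) else 0) \<partial>lborel) = ennreal (1 / a)"
    "integrable lborel (\<lambda>\<tau>. if \<tau> > 0 then exp (- a * \<tau>) else 0)"
    "(LINT \<tau>|lborel. (if \<tau> > 0 then exp (- a * \<tau>) else 0)) = 1 / a"
proof -
  have "(\<integral>\<^sup>+ \<tau>. ennreal (if \<tau> \<in> {0..} then exp (- a * \<tau>) else 0) \<partial>lborel) = ennreal (exp (- a * 0) / a)"
    by (rule nn_integral_has_integral_on[OF _ _ _ has_integral_exp_minus_to_infinity[OF a]]) simp_all
  moreover have "(\<integral>\<^sup>+ \<tau>. ennreal (if \<tau> > 0 then exp (- a * \<tau>) else 0) \<partial>lborel) = (\<integral>\<^sup>+ \<tau>. ennreal (if \<tau> \<in> {0..} then exp (- a * \<tau>) else 0) \<partial>lborel)"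
    by (rule nn_integral_cong_AE) (use AE_lborel_singleton[of "0::real"] in eventually_elim, auto)
  ultimately show n: "(\<integral>\<^sup>+ \<tau>. ennreal (if \<tau> > 0 then exp (- a * \<tau>) else 0) \<partial>lborel) = ennreal (1 / a)" by simp
  show i: "integrable lborel (\<lambda>\<tau>. if \<tau> > 0 then exp (- a * \<tau>) else 0)"
    by (rule integrableI_nonneg) (use n in auto)
  show "(LINT \<tau>|lborel. (if \<tau> > 0 then exp (- a * \<tau>) else 0)) = 1 / a"
    by (subst integral_eq_nn_integral) (use n a in auto)
qed

text \<open>The heat kernel has mass 1 in \<open>y\<close> and the exponential density has mass 1 in
  \<tau>. The unimodular factor covers both the constant 1 and the Fourier exponentials.\<close>

lemma rk_integrable:
  fixes f :: "'a::euclidean_space \<Rightarrow> complex"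
  assumes t: "t > 0" and f [measurable]: "f \<in> borel_measurable borel" and f1: "\<And>y. norm (f y) = 1"
  shows "integrable (lborel \<Otimes>\<^sub>M lborel) (\<lambda>(\<tau>, y). f y * of_real (rk t \<tau> y))"
proof (rule integrableI_bounded)
  show "(\<lambda>(\<tau>, y). f y * complex_of_real (rk t \<tau> y)) \<in> borel_measurable (lborel \<Otimes>\<^sub>M lborel)"
    using rk_measurable[of t, where 'a='a] by measurable
  have "(\<integral>\<^sup>+ x. ennreal (norm (case x of (\<tau>, y) \<Rightarrow> f y * complex_of_real (rk t \<tau> y))) \<partial>(lborel \<Otimes>\<^sub>M lborel))
      = (\<integral>\<^sup>+ x. (case x of (\<tau>, y) \<Rightarrow> ennreal (rk t \<tau> (y::'a))) \<partial>(lborel \<Otimes>\<^sub>M lborel))"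
    by (intro nn_integral_cong) (auto simp: norm_mult f1 rk_nonneg[OF t])
  also have "\<dots> = (\<integral>\<^sup>+ \<tau>. (\<integral>\<^sup>+ y. ennreal (rk t \<tau> (y::'a)) \<partial>lborel) \<partial>lborel)"
    by (subst lborel.nn_integral_fst[symmetric]) (use rk_measurable[of t, where 'a='a] in \<open>simp_all add: case_prod_beta\<close>)
  also have "\<dots> = (\<integral>\<^sup>+ \<tau>. ennreal t * ennreal (if \<tau> > 0 then exp (- t * \<tau>) else 0) \<partial>lborel)"
  proof (rule nn_integral_cong)
    fix \<tau> :: real
    show "(\<integral>\<^sup>+ y. ennreal (rk t \<tau> (y::'a)) \<partial>lborel) = ennreal t * ennreal (if \<tau> > 0 then exp (- t * \<tau>) else 0)"
    proof (cases "\<tau> > 0")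
      case True
      have "(\<integral>\<^sup>+ y. ennreal (rk t \<tau> (y::'a)) \<partial>lborel) = (\<integral>\<^sup>+ y. ennreal (t * exp (- t * \<tau>)) * ennreal (heat \<tau> (y::'a)) \<partial>lborel)"
        using True t by (intro nn_integral_cong) (simp add: rk_def ennreal_mult)
      also have "\<dots> = ennreal (t * exp (- t * \<tau>)) * (\<integral>\<^sup>+ y. ennreal (heat \<tau> (y::'a)) \<partial>lborel)"
        by (rule nn_integral_cmult) measurable
      also have "\<dots> = ennreal t * ennreal (exp (- t * \<tau>))" using heat_integral(3)[OF True, where 'a='a] t by (simp add: ennreal_mult)
      finally show ?thesis using True by simp
    qed (simp add: rk_def)
  qed
  also have "\<dots> = ennreal t * ennreal (1 / t)" by (subst nn_integral_cmult) (simp_all add: integral_exp_decay(1)[OF t])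
  also have "\<dots> < \<infinity>" by (simp add: ennreal_mult_less_top)
  finally show "(\<integral>\<^sup>+ x. ennreal (norm (case x of (\<tau>, y) \<Rightarrow> f y * complex_of_real (rk t \<tau> y))) \<partial>(lborel \<Otimes>\<^sub>M lborel)) < \<infinity>" .
qed

text \<open>Under the Fourier integral the heat kernel becomes
  \<open>exp (- \<tau> * hw \<xi>)\<close>, and the remaining integral over \<tau> is a Laplace
  transform.\<close>

lemma resolvent_kernel:
  assumes t: "t > 0"
  shows "integrable lborel (\<lambda>y. complex_of_real (G t (y::'a::euclidean_space)))"
    and "(LINT y|lborel. exp (- (\<i> * of_real (\<xi> \<bullet> y))) * complex_of_real (G t (y::'a))) = of_real (t / (hw \<xi> + t))"
proof -
  let ?e = "\<lambda>y::'a. exp (- (\<i> * complex_of_real (\<xi> \<bullet> y)))"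
  have i1: "integrable (lborel \<Otimes>\<^sub>M lborel) (\<lambda>(\<tau>, y). (1::complex) * of_real (rk t \<tau> (y::'a)))"
    by (rule rk_integrable[OF t]) simp_all
  have ie: "integrable (lborel \<Otimes>\<^sub>M lborel) (\<lambda>(\<tau>, y). ?e y * of_real (rk t \<tau> (y::'a)))"
    by (rule rk_integrable[OF t]) (simp_all add: norm_ee)
  have Gc: "(LINT \<tau>|lborel. c * complex_of_real (rk t \<tau> y)) = c * of_real (G t y)" for c and y :: 'a
    unfolding G_def by simp
  show "integrable lborel (\<lambda>y. complex_of_real (G t (y::'a)))"
    using lborel_pair.integrable_snd[OF i1] unfolding Gc by simp
  have "(LINT y|lborel. ?e y * complex_of_real (G t y)) = (LINT y|lborel. LINT \<tau>|lborel. ?e y * of_real (rk t \<tau> y))"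
    unfolding Gc ..
  also have "\<dots> = (LINT \<tau>|lborel. LINT y|lborel. ?e y * of_real (rk t \<tau> y))"
    by (rule lborel_pair.Fubini_integral[OF ie])
  also have "\<dots> = (LINT \<tau>|lborel. complex_of_real (t * (if \<tau> > 0 then exp (- (hw \<xi> + t) * \<tau>) else 0)))"
  proof (rule Bochner_Integration.integral_cong[OF refl])
    fix \<tau> :: real
    show "(LINT y|lborel. ?e y * of_real (rk t \<tau> y)) = complex_of_real (t * (if \<tau> > 0 then exp (- (hw \<xi> + t) * \<tau>) else 0))"
    proof (cases "\<tau> > 0")
      case True
      have "(LINT y|lborel. ?e y * of_real (rk t \<tau> y)) = (LINT y|lborel. of_real (t * exp (- t * \<tau>)) * (?e y * of_real (heat \<tau> y)))"
        using True by (intro Bochner_Integration.integral_cong[OF refl]) (simp add: rk_def mult_ac)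
      also have "\<dots> = of_real (t * exp (- t * \<tau>)) * of_real (exp (- \<tau> * (norm \<xi>)\<^sup>2))"
        unfolding heat_fourier(2)[OF True, symmetric] by simp
      also have "\<dots> = of_real (t * (exp (- t * \<tau>) * exp (- \<tau> * (norm \<xi>)\<^sup>2)))" by simp
      also have "exp (- t * \<tau>) * exp (- \<tau> * (norm \<xi>)\<^sup>2) = exp (- (hw \<xi> + t) * \<tau>)"
        unfolding exp_add[symmetric] hw_def by (simp add: algebra_simps)
      finally show ?thesis using True by simp
    qed (simp add: rk_def)
  qed
  also have "\<dots> = complex_of_real (t * (LINT \<tau>|lborel. (if \<tau> > 0 then exp (- (hw \<xi> + t) * \<tau>) else 0)))"
    unfolding integral_complex_of_real by simp
  also have "\<dots> = of_real (t / (hw \<xi> + t))"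
    using integral_exp_decay(3)[of "hw \<xi> + t"] t hw_nonneg[of \<xi>] by (simp add: add_nonneg_pos)
  finally show "(LINT y|lborel. ?e y * complex_of_real (G t y)) = of_real (t / (hw \<xi> + t))" .
qed

text \<open>The minimiser of \<open>w \<mapsto> \<parallel>v - w\<parallel>\<^sup>2 + \<parallel>\<nabla>w\<parallel>\<^sup>2 / t\<close> is the convolution of \<open>v\<close> with the resolvent
  kernel; truncating the kernel makes it a test function.\<close>

lemma KR_test_approximation:
  fixes v :: "'a::euclidean_space \<Rightarrow> complex"
  assumes v: "test_fun UNIV v" and t: "t > 0" and d: "d > 0"
  obtains w where "test_fun UNIV w"
    "ennreal (nsq lborel (\<lambda>x. v x - w x) + nsq (wl hw) (fourier w) / t) \<le> KR (fourier v) t + ennreal d"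
proof -
  let ?V = "fourier v"
  let ?G = "\<lambda>y::'a. complex_of_real (G t y)"
  let ?h = "\<lambda>R::nat. \<lambda>y. indicator (cball 0 (real R)) y *\<^sub>R ?G y"
  let ?e = "\<lambda>\<xi> y::'a. exp (- (\<i> * complex_of_real (\<xi> \<bullet> y)))"
  note Gi = resolvent_kernel(1)[OF t, where 'a='a]
  have Gm [measurable]: "?G \<in> borel_measurable borel" using Gi by (simp add: borel_measurable_integrable)
  then have Gr [measurable]: "G t \<in> borel_measurable (borel :: 'a measure)" by (simp add: borel_measurable_complex_iff)
  have hi: "integrable lborel (?h R)" for R
    by (rule integrable_mult_indicator[OF _ Gi]) simp
  \<comment> \<open>The multiplier of convolution with the truncated kernel; it is bounded by
    \<open>M\<close> uniformly in \<open>R\<close> and tends to that of the full resolvent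
    kernel.\<close>
  define k where "k R \<xi> = (LINT y|lborel. ?e \<xi> y * ?h R y)" for R \<xi>
  define M where "M = (LINT y|lborel. norm (?G y))"
  have M0: "0 \<le> M" unfolding M_def by simp
  obtain K where K: "compact K" "\<forall>x. x \<notin> K \<longrightarrow> v x = 0" using v by (rule test_fun_compactE)
  have wt: "test_fun UNIV (conv (?h R) v)" for R
    by (rule conv_test_fun[OF hi v compact_cball[of "0::'a" "real R"] _ K(1)]) (use K(2) in \<open>simp_all add: indicator_def\<close>)
  have Fw: "fourier (conv (?h R) v) \<xi> = k R \<xi> * ?V \<xi>" for R \<xi>
    unfolding k_def by (rule fourier_conv[OF hi v])
  have kb: "norm (k R \<xi>) \<le> M" for R \<xi>
  proof -
    have "norm (k R \<xi>) \<le> (LINT y|lborel. norm (?e \<xi> y * ?h R y))" unfolding k_def by (rule integral_norm_bound)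
    also have "\<dots> \<le> M" unfolding M_def
    proof (rule integral_mono')
      show "integrable lborel (\<lambda>y. norm (?G y))" by (rule integrable_norm[OF Gi])
      show "norm (?e \<xi> y * ?h R y) \<le> norm (?G y)" for y by (simp add: norm_mult norm_ee indicator_def)
    qed simp
    finally show ?thesis .
  qed
  have kl: "(\<lambda>R. k R \<xi>) \<longlonglongrightarrow> of_real (t / (hw \<xi> + t))" for \<xi>
    unfolding k_def resolvent_kernel(2)[OF t, symmetric]
  proof (rule integral_dominated_convergence)
    show "integrable lborel (\<lambda>y. norm (?G y))" by (rule integrable_norm[OF Gi])
    show "AE y in lborel. norm (?e \<xi> y * ?h R y) \<le> norm (?G y)" for R
      by (rule AE_I2) (simp add: norm_mult norm_ee indicator_def)
    show "AE y in lborel. (\<lambda>R. ?e \<xi> y * ?h R y) \<longlonglongrightarrow> ?e \<xi> y * ?G y"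
    proof (rule AE_I2)
      fix y :: 'a
      obtain N :: nat where N: "norm y \<le> real N" using real_arch_simple by blast
      have "\<forall>\<^sub>F R in sequentially. ?e \<xi> y * ?h R y = ?e \<xi> y * ?G y"
        using eventually_ge_at_top[of N]
      proof eventually_elim
        case (elim R)
        then have "norm y \<le> real R" using N by (meson of_nat_mono order_trans)
        then show ?case by simp
      qed
      then show "(\<lambda>R. ?e \<xi> y * ?h R y) \<longlonglongrightarrow> ?e \<xi> y * ?G y" by (rule tendsto_eventually)
    qed
    show "(\<lambda>y. ?e \<xi> y * ?G y) \<in> borel_measurable lborel" "(\<lambda>y. ?e \<xi> y * ?h R y) \<in> borel_measurable lborel" for R
      by (rule borel_measurable_integrable[OF integrable_ee_mult] Gi hi)+
  qed
  have Vm [measurable]: "?V \<in> borel_measurable borel" using fourier_test_sqi[OF v] by (simp add: sqi_def)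
  have Fm [measurable]: "fourier (conv (?h R) v) \<in> borel_measurable borel" for R
    using fourier_test_sqi[OF wt[of R]] by (simp add: sqi_def)
  let ?q = "\<lambda>\<xi>. hw \<xi> / (hw \<xi> + t) * (norm (?V \<xi>))\<^sup>2"
  let ?J = "\<lambda>R \<xi>. (norm (?V \<xi> - fourier (conv (?h R) v) \<xi>))\<^sup>2 + hw \<xi> / t * (norm (fourier (conv (?h R) v) \<xi>))\<^sup>2"
  have Vi: "integrable lborel (\<lambda>\<xi>. (norm (?V \<xi>))\<^sup>2)" by (rule sqi_integrable[OF fourier_test_sqi[OF v]])
  have Vh: "integrable lborel (\<lambda>\<xi>. hw \<xi> * (norm (?V \<xi>))\<^sup>2)"
    using fourier_test_sqi_hw[OF v] by (simp add: sqi_wl)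
  have lim: "(\<lambda>R. LINT \<xi>|lborel. ?J R \<xi>) \<longlonglongrightarrow> (LINT \<xi>|lborel. ?q \<xi>)"
  proof (rule integral_dominated_convergence)
    show "integrable lborel (\<lambda>\<xi>. (1 + M)\<^sup>2 * (norm (?V \<xi>))\<^sup>2 + M\<^sup>2 / t * (hw \<xi> * (norm (?V \<xi>))\<^sup>2))"
      using Vi Vh by (intro Bochner_Integration.integrable_add integrable_mult_right) 
    show "AE \<xi> in lborel. norm (?J R \<xi>) \<le> (1 + M)\<^sup>2 * (norm (?V \<xi>))\<^sup>2 + M\<^sup>2 / t * (hw \<xi> * (norm (?V \<xi>))\<^sup>2)" for R
    proof (rule AE_I2)
      fix \<xi> :: 'a
      have "norm (?V \<xi> - k R \<xi> * ?V \<xi>) \<le> norm (?V \<xi>) + norm (k R \<xi>) * norm (?V \<xi>)"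
        using norm_triangle_ineq4[of "?V \<xi>" "k R \<xi> * ?V \<xi>"] by (simp add: norm_mult)
      also have "\<dots> \<le> (1 + M) * norm (?V \<xi>)"
        using mult_right_mono[OF kb[of R \<xi>] norm_ge_zero[of "?V \<xi>"]] by (simp add: distrib_right)
      finally have a: "(norm (?V \<xi> - k R \<xi> * ?V \<xi>))\<^sup>2 \<le> (1 + M)\<^sup>2 * (norm (?V \<xi>))\<^sup>2"
        unfolding power_mult_distrib[symmetric] by (rule power_mono) simp
      have "norm (k R \<xi> * ?V \<xi>) \<le> M * norm (?V \<xi>)"
        unfolding norm_mult by (rule mult_right_mono[OF kb]) simp
      then have "(norm (k R \<xi> * ?V \<xi>))\<^sup>2 \<le> (M * norm (?V \<xi>))\<^sup>2" by (rule power_mono) simp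
      then have b: "hw \<xi> / t * (norm (k R \<xi> * ?V \<xi>))\<^sup>2 \<le> hw \<xi> / t * (M\<^sup>2 * (norm (?V \<xi>))\<^sup>2)"
        unfolding power_mult_distrib using t by (intro mult_left_mono) simp_all
      have "0 \<le> ?J R \<xi>" using t by simp
      then have "norm (?J R \<xi>) = ?J R \<xi>" by simp
      also have "\<dots> \<le> (1 + M)\<^sup>2 * (norm (?V \<xi>))\<^sup>2 + hw \<xi> / t * (M\<^sup>2 * (norm (?V \<xi>))\<^sup>2)"
        unfolding Fw by (rule add_mono[OF a b])
      finally show "norm (?J R \<xi>) \<le> (1 + M)\<^sup>2 * (norm (?V \<xi>))\<^sup>2 + M\<^sup>2 / t * (hw \<xi> * (norm (?V \<xi>))\<^sup>2)"
        by (simp add: mult_ac)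
    qed
    show "AE \<xi> in lborel. (\<lambda>R. ?J R \<xi>) \<longlonglongrightarrow> ?q \<xi>"
    proof (rule AE_I2)
      fix \<xi> :: 'a
      let ?T = "of_real (t / (hw \<xi> + t)) * ?V \<xi>"
      have "(\<lambda>R. ?J R \<xi>) \<longlonglongrightarrow> (norm (?V \<xi> - ?T))\<^sup>2 + hw \<xi> / t * (norm ?T)\<^sup>2"
        unfolding Fw by (intro tendsto_intros kl)
      \<comment> \<open>\<open>?T\<close> is the exact minimiser at this frequency, so the excess in
        the completed square is 0.\<close>
      also have "(norm (?V \<xi> - ?T))\<^sup>2 + hw \<xi> / t * (norm ?T)\<^sup>2 = ?q \<xi>"
        unfolding complete_square[OF t hw_nonneg] by simp
      finally show "(\<lambda>R. ?J R \<xi>) \<longlonglongrightarrow> ?q \<xi>" .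
    qed
  qed measurable
  have q0: "0 \<le> ?q \<xi>" for \<xi> using t by simp
  have qi: "integrable lborel ?q"
  proof (rule Bochner_Integration.integrable_bound[OF Vi])
    show "AE \<xi> in lborel. norm (?q \<xi>) \<le> norm ((norm (?V \<xi>))\<^sup>2)"
    proof (rule AE_I2)
      fix \<xi> :: 'a
      have "hw \<xi> + t > 0" using t hw_nonneg[of \<xi>] by linarith
      then have f: "hw \<xi> / (hw \<xi> + t) \<le> 1" using t by (simp add: pos_divide_le_eq)
      have "?q \<xi> \<le> 1 * (norm (?V \<xi>))\<^sup>2" by (rule mult_right_mono[OF f]) simp
      then show "norm (?q \<xi>) \<le> norm ((norm (?V \<xi>))\<^sup>2)" using q0[of \<xi>] by (simp only: real_norm_def abs_of_nonneg zero_le_power2 mult_1)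
    qed
  qed measurable
  have KRq: "KR ?V t = ennreal (LINT \<xi>|lborel. ?q \<xi>)"
    unfolding KR_def by (rule nn_integral_eq_integral[OF qi]) (use q0 in simp)
  obtain R where R: "(LINT \<xi>|lborel. ?J R \<xi>) < (LINT \<xi>|lborel. ?q \<xi>) + d"
    using order_tendstoD(2)[OF lim, of "(LINT \<xi>|lborel. ?q \<xi>) + d"] d unfolding eventually_sequentially by auto
  let ?w = "conv (?h R) v"
  have "nsq lborel (\<lambda>x. v x - ?w x) = nsq lborel (fourier (\<lambda>x. v x - ?w x))"
    by (rule Plancherel_test_fun[OF test_fun_diff[OF v wt], symmetric])
  also have "fourier (\<lambda>x. v x - ?w x) = (\<lambda>\<xi>. ?V \<xi> - fourier ?w \<xi>)"
    by (rule ext) (rule fourier_diff[OF test_fun_integrable[OF v] test_fun_integrable[OF wt]])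
  finally have n1: "nsq lborel (\<lambda>x. v x - ?w x) = (LINT \<xi>|lborel. (norm (?V \<xi> - fourier ?w \<xi>))\<^sup>2)"
    by (simp only: nsq_def)
  have n2: "nsq (wl hw) (fourier ?w) / t = (LINT \<xi>|lborel. hw \<xi> / t * (norm (fourier ?w \<xi>))\<^sup>2)"
    unfolding nsq_wl[OF hw_measurable hw_nonneg Fm] by simp
  have i1: "integrable lborel (\<lambda>\<xi>. (norm (?V \<xi> - fourier ?w \<xi>))\<^sup>2)"
    by (rule sqi_integrable[OF sqi_diff[OF fourier_test_sqi[OF v] fourier_test_sqi[OF wt]]])
  have i2: "integrable lborel (\<lambda>\<xi>. hw \<xi> / t * (norm (fourier ?w \<xi>))\<^sup>2)"
    using fourier_test_sqi_hw[OF wt[of R]] by (simp add: sqi_wl)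
  have "nsq lborel (\<lambda>x. v x - ?w x) + nsq (wl hw) (fourier ?w) / t = (LINT \<xi>|lborel. ?J R \<xi>)"
    unfolding n1 n2 by (rule Bochner_Integration.integral_add[OF i1 i2, symmetric])
  also have "\<dots> \<le> (LINT \<xi>|lborel. ?q \<xi>) + d" using R by simp
  finally have "ennreal (nsq lborel (\<lambda>x. v x - ?w x) + nsq (wl hw) (fourier ?w) / t) \<le> ennreal ((LINT \<xi>|lborel. ?q \<xi>) + d)"
    by (rule ennreal_leI)
  also have "\<dots> = KR ?V t + ennreal d" unfolding KRq
    by (rule ennreal_plus) (use d q0 in \<open>auto intro!: integral_nonneg_AE\<close>)
  finally show thesis by (rule that[OF wt])
qed

section \<open>Concentration\<close>

text \<open>No amplitude factor is included: the quotient is homogeneous, and the powers of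
  \<epsilon> from the form and from the norm cancel at the critical exponent.\<close>

definition scl :: "real \<Rightarrow> 'a::euclidean_space \<Rightarrow> ('a \<Rightarrow> complex) \<Rightarrow> 'a \<Rightarrow> complex" where
  "scl \<epsilon> p f x = f ((1 / \<epsilon>) *\<^sub>R (x - p))"

lemma scl_measurable [measurable]:
  assumes [measurable]: "f \<in> borel_measurable borel" shows "scl \<epsilon> p f \<in> borel_measurable borel"
  unfolding scl_def[abs_def] by measurable

lemma scl_test:
  assumes f: "test_fun UNIV f" and \<epsilon>: "\<epsilon> > 0" and R: "\<And>x. norm x > R \<Longrightarrow> f x = 0" and sub: "cball p (\<epsilon> * R) \<subseteq> \<Omega>"
  shows "test_fun \<Omega> (scl \<epsilon> p f)"
proof (rule test_funI[OF _ compact_cball sub])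
  have "scl \<epsilon> p f = (\<lambda>x. f (- ((1 / \<epsilon>) *\<^sub>R p) + (1 / \<epsilon>) *\<^sub>R x))"
    by (rule ext) (simp add: scl_def scaleR_diff_right)
  then show "Ck k (scl \<epsilon> p f)" for k
    using test_fun_Ck[OF test_fun_affine[OF f, of "1 / \<epsilon>" "- ((1 / \<epsilon>) *\<^sub>R p)"]] \<epsilon> by simp
  fix x assume "x \<notin> cball p (\<epsilon> * R)"
  then have "\<epsilon> * R < norm (x - p)" by (simp add: dist_norm norm_minus_commute)
  then have "R < norm ((1 / \<epsilon>) *\<^sub>R (x - p))" using \<epsilon> by (simp add: pos_less_divide_eq mult.commute)
  then show "scl \<epsilon> p f x = 0" unfolding scl_def by (rule R)
qed

lemma scl_integral:
  fixes f :: "'a::euclidean_space \<Rightarrow> complex" and g :: "complex \<Rightarrow> real"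
  assumes \<epsilon>: "\<epsilon> > 0" and [measurable]: "f \<in> borel_measurable borel" "g \<in> borel_measurable borel"
  shows "(LINT x|lborel. g (scl \<epsilon> p f x)) = \<epsilon> ^ DIM('a) * (LINT x|lborel. g (f x))"
proof -
  have e: "scl \<epsilon> p f (p + \<epsilon> *\<^sub>R x) = f x" for x using \<epsilon> by (simp add: scl_def)
  have "(LINT x|lborel. g (scl \<epsilon> p f x)) = \<bar>\<epsilon>\<bar> ^ DIM('a) *\<^sub>R (LINT x|lborel. g (scl \<epsilon> p f (p + \<epsilon> *\<^sub>R x)))"
    by (rule lborel_integral_affine) (use \<epsilon> in auto)
  then show ?thesis unfolding e using \<epsilon> by simp
qed

lemma nsq_scl:
  fixes f :: "'a::euclidean_space \<Rightarrow> complex"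
  assumes "\<epsilon> > 0" "f \<in> borel_measurable borel"
  shows "nsq lborel (scl \<epsilon> p f) = \<epsilon> ^ DIM('a) * nsq lborel f"
  unfolding nsq_def by (rule scl_integral[OF assms, of "\<lambda>z. (norm z)\<^sup>2"]) measurable

text \<open>The energy scales with the power DIM - 2 of \<epsilon>; the factor
  \<open>\<epsilon>\<^sup>2\<close> on the left avoids a negative exponent in dimension 1.\<close>

lemma nsq_hw_scl:
  fixes f :: "'a::euclidean_space \<Rightarrow> complex"
  assumes f: "test_fun UNIV f" and \<epsilon>: "\<epsilon> > 0"
  shows "\<epsilon>\<^sup>2 * nsq (wl hw) (fourier (scl \<epsilon> p f)) = \<epsilon> ^ DIM('a) * nsq (wl hw) (fourier f)"
proof -
  have fm: "f \<in> borel_measurable borel" by (rule test_fun_measurable[OF f])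
  have Fm [measurable]: "fourier f \<in> borel_measurable borel" using fourier_test_sqi[OF f] by (simp add: sqi_def)
  have E: "fourier (scl \<epsilon> p f) = (\<lambda>\<xi>. of_real (\<epsilon> ^ DIM('a)) * exp (- (\<i> * of_real (\<xi> \<bullet> p))) * fourier f (\<epsilon> *\<^sub>R \<xi>))"
    unfolding scl_def[abs_def] by (rule ext) (rule fourier_affine[OF \<epsilon> fm])
  have Sm: "fourier (scl \<epsilon> p f) \<in> borel_measurable borel" unfolding E by measurable
  define I where "I = (LINT \<xi>|lborel. hw \<xi> * (norm (fourier f (\<epsilon> *\<^sub>R \<xi>)))\<^sup>2)"
  have "nsq (wl hw) (fourier (scl \<epsilon> p f)) = (LINT \<xi>|lborel. (\<epsilon> ^ DIM('a))\<^sup>2 * (hw \<xi> * (norm (fourier f (\<epsilon> *\<^sub>R \<xi>)))\<^sup>2))"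
    unfolding nsq_wl[OF hw_measurable hw_nonneg Sm]
  proof (rule Bochner_Integration.integral_cong[OF refl])
    fix \<xi> :: 'a
    have "norm (fourier (scl \<epsilon> p f) \<xi>) = \<epsilon> ^ DIM('a) * norm (fourier f (\<epsilon> *\<^sub>R \<xi>))"
      unfolding E using \<epsilon> by (simp add: norm_mult norm_ee norm_power)
    then show "hw \<xi> * (norm (fourier (scl \<epsilon> p f) \<xi>))\<^sup>2 = (\<epsilon> ^ DIM('a))\<^sup>2 * (hw \<xi> * (norm (fourier f (\<epsilon> *\<^sub>R \<xi>)))\<^sup>2)"
      by (simp only: power_mult_distrib mult_ac)
  qed
  then have 1: "nsq (wl hw) (fourier (scl \<epsilon> p f)) = (\<epsilon> ^ DIM('a))\<^sup>2 * I" unfolding I_def by simp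
  have "nsq (wl hw) (fourier f) = (LINT \<xi>|lborel. hw \<xi> * (norm (fourier f \<xi>))\<^sup>2)"
    by (rule nsq_wl[OF hw_measurable hw_nonneg Fm])
  also have "\<dots> = \<bar>\<epsilon>\<bar> ^ DIM('a) *\<^sub>R (LINT \<xi>|lborel. hw (0 + \<epsilon> *\<^sub>R \<xi>) * (norm (fourier f (0 + \<epsilon> *\<^sub>R \<xi>)))\<^sup>2)"
    by (rule lborel_integral_affine) (use \<epsilon> in auto)
  also have "(LINT \<xi>|lborel. hw (0 + \<epsilon> *\<^sub>R \<xi>) * (norm (fourier f (0 + \<epsilon> *\<^sub>R \<xi>)))\<^sup>2) = \<epsilon>\<^sup>2 * I"
    unfolding I_def by (simp add: hw_def power_mult_distrib mult.assoc)
  finally have 2: "nsq (wl hw) (fourier f) = \<epsilon> ^ DIM('a) * (\<epsilon>\<^sup>2 * I)" using \<epsilon> by simp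
  show ?thesis unfolding 1 2 by (simp only: power2_eq_square mult_ac)
qed

section \<open>Quotients of extended nonnegative reals\<close>

lemma ennreal_le_divide_imp:
  assumes "a \<le> b / ennreal c" shows "a * ennreal c \<le> b"
proof (cases "ennreal c = 0")
  case False
  have "a * ennreal c \<le> b / ennreal c * ennreal c" using assms by (rule mult_right_mono) simp
  also have "\<dots> = b * ennreal c / ennreal c" by (simp add: ennreal_times_divide mult.commute)
  also have "\<dots> = b" by (rule ennreal_mult_divide_eq[OF False]) simp
  finally show ?thesis .
qed simp

text \<open>Division by 0 gives infinity for a nonzero numerator but 0 for the numerator 0; the
  second premise excludes the latter.\<close>

lemma ennreal_le_divideI:
  assumes "a * ennreal c \<le> b" "b \<noteq> 0" shows "a \<le> b / ennreal c"
proof (cases "ennreal c = 0")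
  case True
  then have "b / ennreal c = top" using assms(2) by (simp add: divide_ennreal_def ennreal_mult_eq_top_iff)
  then show ?thesis by simp
next
  case False
  have "a = a * ennreal c / ennreal c" by (rule ennreal_mult_divide_eq[OF False, symmetric]) simp
  also have "\<dots> \<le> b / ennreal c" by (rule divide_right_mono_ennreal[OF assms(1)])
  finally show ?thesis .
qed

lemma ennreal_divide_le:
  assumes "a \<le> ennreal c * b" "c > 0" shows "a / ennreal c \<le> b"
proof -
  have "a / ennreal c \<le> b * ennreal c / ennreal c"
    by (rule divide_right_mono_ennreal) (use assms in \<open>simp add: mult.commute\<close>)
  also have "\<dots> = b" by (rule ennreal_mult_divide_eq) (use assms in auto)
  finally show ?thesis .
qed

text \<open>The second identity is scale invariance: the squared norm with the critical exponent
  scales under dilation like the fractional form.\<close>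

lemma crit_exp_props:
  assumes s: "0 < s" and n: "real n > 2 * s"
  shows "crit_exp n s > 0" "real n * (2 / crit_exp n s) = real n - 2 * s"
  using assms by (auto simp: crit_exp_def)

lemma Lp_norm_sq: "(Lp_norm p UNIV u)\<^sup>2 = (LINT x|lborel. norm (u x) powr p) powr (2 / p)"
  unfolding Lp_norm_def set_lebesgue_integral_def by (simp add: power2_eq_square powr_add[symmetric])

lemma Lp_norm_supported:
  assumes z: "AE x in lborel. x \<notin> \<Omega> \<longrightarrow> u x = 0" and u [measurable]: "u \<in> borel_measurable borel"
    and O [measurable]: "\<Omega> \<in> sets borel"
  shows "Lp_norm p \<Omega> u = Lp_norm p UNIV u"
proof -
  have "(LINT x:\<Omega>|lborel. norm (u x) powr p) = (LINT x:UNIV|lborel. norm (u x) powr p)"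
    unfolding set_lebesgue_integral_def
    by (rule integral_cong_AE) (measurable, use z in eventually_elim, auto simp: indicator_def)
  then show ?thesis by (simp only: Lp_norm_def)
qed

section \<open>Upper bounds for the Navier resolvent form of scaled functions\<close>

context eigensystem
begin

text \<open>The other half of the variational principle: \<open>w\<close> is a competitor in
  \<Omega>. In each eigenmode the minimum is at most the value at the coefficient of
  \<open>w\<close>, and Bessel's inequality, once for Lebesgue measure and once for the energy,
  bounds the sums over the modes.\<close>

lemma KO_le_test:
  assumes v: "sqi lborel v" and w: "test_fun \<Omega> w" and t: "t > 0"
  shows "KO v t \<le> ennreal (nsq lborel (\<lambda>x. v x - w x) + nsq (wl hw) (fourier w) / t)"
proof -
  let ?a = "\<lambda>j. ip lborel v (\<phi> j)" and ?b = "\<lambda>j. ip lborel w (\<phi> j)"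
  have ws: "sqi lborel w" by (rule test_fun_sqi[OF w])
  have fb: "ip lborel (fourier w) (e j) = ?b j" for j
    using ip_fourier_test[OF phi_limit[of j] w] ip_commute[of lborel w "\<phi> j"] ip_commute[of lborel "fourier w" "e j"] by simp
  have o1: "ip lborel (\<phi> i) (\<phi> j) = (if i = j then of_real ((\<lambda>_. 1) i) else 0)" for i j by (simp add: phi_orth)
  have d1: "ip lborel (\<lambda>x. v x - w x) (\<phi> j) = of_real ((\<lambda>_. 1) j) * (?a j - ?b j)" for j
    by (simp add: ip_diff_left[OF v ws phi_sqi])
  have B1: "(\<Sum>j<N. 1 * (norm (?a j - ?b j))\<^sup>2) \<le> nsq lborel (\<lambda>x. v x - w x)" for N
    by (rule Bessel[OF sqi_diff[OF v ws] phi_sqi o1 d1 finite_lessThan])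
  have d2: "ip (wl hw) (fourier w) (e j) = of_real (\<mu> j) * ?b j" for j
    unfolding form_e[OF Hcl_test[OF w]] fb ..
  have B2: "(\<Sum>j<N. \<mu> j * (norm (?b j))\<^sup>2) \<le> nsq (wl hw) (fourier w)" for N
    by (rule Bessel[OF fourier_test_sqi_hw[OF w] Hcl_sqihw[OF e_Hcl] form_orth d2 finite_lessThan])
  have pt: "\<mu> j / (\<mu> j + t) * (norm (?a j))\<^sup>2 \<le> 1 * (norm (?a j - ?b j))\<^sup>2 + \<mu> j * (norm (?b j))\<^sup>2 / t" for j
  proof -
    have "0 \<le> (1 + \<mu> j / t) * (norm (?b j - of_real (t / (\<mu> j + t)) * ?a j))\<^sup>2"
      using t mu_nonneg[of j] by (intro mult_nonneg_nonneg) simp_all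
    then show ?thesis using complete_square[OF t mu_nonneg, of "?a j" "?b j" j] by simp
  qed
  have k0: "0 \<le> \<mu> j / (\<mu> j + t) * (norm (?a j))\<^sup>2" for j
    using t mu_nonneg[of j] by simp
  show ?thesis unfolding KO_def
  proof (rule suminf_le_const[OF summableI])
    fix N
    have "(\<Sum>j<N. \<mu> j / (\<mu> j + t) * (norm (?a j))\<^sup>2) \<le> (\<Sum>j<N. 1 * (norm (?a j - ?b j))\<^sup>2 + \<mu> j * (norm (?b j))\<^sup>2 / t)"
      by (rule sum_mono) (rule pt)
    also have "\<dots> = (\<Sum>j<N. 1 * (norm (?a j - ?b j))\<^sup>2) + (\<Sum>j<N. \<mu> j * (norm (?b j))\<^sup>2) / t"
      unfolding sum.distrib sum_divide_distrib ..
    also have "\<dots> \<le> nsq lborel (\<lambda>x. v x - w x) + nsq (wl hw) (fourier w) / t"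
      using t by (intro add_mono B1 divide_right_mono B2) simp
    finally show "(\<Sum>j<N. ennreal (\<mu> j / (\<mu> j + t) * (norm (?a j))\<^sup>2)) \<le> ennreal (nsq lborel (\<lambda>x. v x - w x) + nsq (wl hw) (fourier w) / t)"
      unfolding sum_ennreal[OF k0] by (rule ennreal_leI)
  qed
qed

text \<open>Dilation by \<epsilon> divides the spectral parameter by
  \<open>\<epsilon>\<^sup>2\<close>, and after division by the volume factor the bound no longer
  depends on \<epsilon>. The inclusion in \<Omega> is required for the competitor \<open>w\<close>
  alone.\<close>

lemma KO_scl_le:
  assumes v: "test_fun UNIV v" and w: "test_fun UNIV w" "\<And>x. norm x > R \<Longrightarrow> w x = 0"
    and \<epsilon>: "\<epsilon> > 0" and sub: "cball p (\<epsilon> * R) \<subseteq> \<Omega>" and \<tau>: "\<tau> > 0"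
  shows "KO (scl \<epsilon> p v) (1 / \<epsilon>\<^sup>2 * \<tau>) / ennreal (\<epsilon> ^ DIM('a)) \<le> ennreal (nsq lborel (\<lambda>x. v x - w x) + nsq (wl hw) (fourier w) / \<tau>)"
proof (rule ennreal_divide_le)
  obtain Rv where Rv: "\<forall>x. norm x > Rv \<longrightarrow> v x = 0"
  proof -
    obtain K where K: "compact K" "\<forall>x. x \<notin> K \<longrightarrow> v x = 0" using v by (rule test_fun_compactE)
    obtain B where "\<forall>x\<in>K. norm x \<le> B" using compact_imp_bounded[OF K(1)] unfolding bounded_iff by blast
    then show thesis using K(2) that[of B] by (meson not_less)
  qed
  have "test_fun UNIV (scl \<epsilon> p v)" by (rule scl_test[OF v \<epsilon>, of Rv]) (use Rv in auto)
  then have vs: "sqi lborel (scl \<epsilon> p v)" by (rule test_fun_sqi)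
  have t: "1 / \<epsilon>\<^sup>2 * \<tau> > 0" using \<epsilon> \<tau> by simp
  have m: "(\<lambda>x. v x - w x) \<in> borel_measurable borel" by (rule test_fun_measurable[OF test_fun_diff[OF v w(1)]])
  have "nsq lborel (\<lambda>x. scl \<epsilon> p v x - scl \<epsilon> p w x) = nsq lborel (scl \<epsilon> p (\<lambda>x. v x - w x))"
    by (simp add: scl_def[abs_def])
  then have 1: "nsq lborel (\<lambda>x. scl \<epsilon> p v x - scl \<epsilon> p w x) = \<epsilon> ^ DIM('a) * nsq lborel (\<lambda>x. v x - w x)"
    unfolding nsq_scl[OF \<epsilon> m] .
  have "nsq (wl hw) (fourier (scl \<epsilon> p w)) / (1 / \<epsilon>\<^sup>2 * \<tau>) = (\<epsilon>\<^sup>2 * nsq (wl hw) (fourier (scl \<epsilon> p w))) / \<tau>" by simp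
  then have 2: "nsq (wl hw) (fourier (scl \<epsilon> p w)) / (1 / \<epsilon>\<^sup>2 * \<tau>) = \<epsilon> ^ DIM('a) * (nsq (wl hw) (fourier w) / \<tau>)"
    unfolding nsq_hw_scl[OF w(1) \<epsilon>] by simp
  have "KO (scl \<epsilon> p v) (1 / \<epsilon>\<^sup>2 * \<tau>) \<le> ennreal (nsq lborel (\<lambda>x. scl \<epsilon> p v x - scl \<epsilon> p w x) + nsq (wl hw) (fourier (scl \<epsilon> p w)) / (1 / \<epsilon>\<^sup>2 * \<tau>))"
    by (rule KO_le_test[OF vs scl_test[OF w(1) \<epsilon> w(2) sub] t])
  also have "\<dots> = ennreal (\<epsilon> ^ DIM('a) * (nsq lborel (\<lambda>x. v x - w x) + nsq (wl hw) (fourier w) / \<tau>))"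
    unfolding 1 2 distrib_left ..
  also have "\<dots> = ennreal (\<epsilon> ^ DIM('a)) * ennreal (nsq lborel (\<lambda>x. v x - w x) + nsq (wl hw) (fourier w) / \<tau>)"
    by (rule ennreal_mult) (use \<epsilon> \<tau> in simp_all)
  finally show "KO (scl \<epsilon> p v) (1 / \<epsilon>\<^sup>2 * \<tau>) \<le> ennreal (\<epsilon> ^ DIM('a)) * ennreal (nsq lborel (\<lambda>x. v x - w x) + nsq (wl hw) (fourier w) / \<tau>)" .
  show "0 < \<epsilon> ^ DIM('a)" using \<epsilon> by simp
qed

text \<open>The substitution \<open>t = \<tau> / \<epsilon>\<^sup>2\<close> in the integral over
  \<open>t\<close>. The measure and the weight contribute \<open>\<epsilon> powr (- 2 * s)\<close>,
  and the volume factor contributes the power DIM.\<close>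

lemma Q_Navier_scaled:
  assumes s: "0 < s" and \<epsilon>: "\<epsilon> > 0" and v: "v \<in> borel_measurable borel"
  shows "Cs s * Q_Navier s \<Omega> \<mu> \<phi> v
    = ennreal (\<epsilon> powr (real DIM('a) - 2 * s)) * (\<integral>\<^sup>+ \<tau>. ennreal (wt s \<tau>) * (KO v (1 / \<epsilon>\<^sup>2 * \<tau>) / ennreal (\<epsilon> ^ DIM('a))) \<partial>lborel)"
proof -
  let ?d = "1 / \<epsilon>\<^sup>2" and ?E = "\<epsilon> ^ DIM('a)"
  let ?A = "\<lambda>\<tau>. KO v (?d * \<tau>) / ennreal ?E"
  have d: "?d > 0" using \<epsilon> by simp
  have E: "?E > 0" using \<epsilon> by simp
  have dp: "?d powr a = \<epsilon> powr (- 2 * a)" for a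
  proof -
    have "?d = \<epsilon> powr (- 2)" using \<epsilon> by (simp add: powr_minus_divide)
    then show ?thesis by (simp only: powr_powr)
  qed
  have Ep: "?E = \<epsilon> powr (real DIM('a))" using \<epsilon> by (simp add: powr_realpow)
  have pt: "ennreal (wt s (0 + ?d * \<tau>)) * KO v (0 + ?d * \<tau>) = ennreal (?d powr (s - 1) * ?E) * (ennreal (wt s \<tau>) * ?A \<tau>)" for \<tau>
  proof -
    have w: "wt s (?d * \<tau>) = ?d powr (s - 1) * wt s \<tau>"
    proof (cases "\<tau> > 0")
      case True
      then have "?d * \<tau> > 0" using d by (rule mult_pos_pos[rotated])
      then show ?thesis unfolding wt_def using True by (simp only: powr_mult if_True)
    next
      case False
      then have "\<not> ?d * \<tau> > 0" using d by (simp add: zero_less_divide_iff)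
      then show ?thesis unfolding wt_def using False by simp
    qed
    define B where "B = ?A \<tau>"
    have "ennreal ?E * B = ennreal ?E * KO v (?d * \<tau>) / ennreal ?E" unfolding B_def by (rule ennreal_times_divide)
    also have "\<dots> = KO v (?d * \<tau>) * ennreal ?E / ennreal ?E" by (simp only: mult.commute)
    also have "\<dots> = KO v (?d * \<tau>)"
      by (rule ennreal_mult_divide_eq[OF _ ennreal_neq_top]) (use E in \<open>simp only: ennreal_eq_0_iff not_le\<close>)
    finally have k: "KO v (?d * \<tau>) = ennreal ?E * B" by (rule sym)
    show ?thesis
      unfolding B_def[symmetric]
      unfolding add_0 w k ennreal_mult[OF powr_ge_zero less_imp_le[OF E]] ennreal_mult[OF powr_ge_zero wt_nonneg]
      by (simp only: mult_ac)
  qed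
  have "Cs s * Q_Navier s \<Omega> \<mu> \<phi> v = (\<integral>\<^sup>+ t. ennreal (wt s t) * KO v t \<partial>lborel)"
    by (rule KO_integral[OF s]) (use v in simp)
  also have "\<dots> = ennreal \<bar>?d\<bar> * (\<integral>\<^sup>+ \<tau>. ennreal (wt s (0 + ?d * \<tau>)) * KO v (0 + ?d * \<tau>) \<partial>lborel)"
    by (rule nn_integral_real_affine) (use d in auto)
  also have "\<dots> = ennreal ?d * (ennreal (?d powr (s - 1) * ?E) * (\<integral>\<^sup>+ \<tau>. ennreal (wt s \<tau>) * ?A \<tau> \<partial>lborel))"
    unfolding pt using d by (subst nn_integral_cmult) simp_all
  also have "\<dots> = ennreal (?d * (?d powr (s - 1) * ?E)) * (\<integral>\<^sup>+ \<tau>. ennreal (wt s \<tau>) * ?A \<tau> \<partial>lborel)"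
    unfolding mult.assoc[symmetric] using d E by (subst ennreal_mult[symmetric]) (simp_all add: ennreal_mult mult_ac)
  also have "?d * (?d powr (s - 1) * ?E) = ?d powr 1 * ?d powr (s - 1) * ?E" using d by simp
  also have "\<dots> = ?d powr s * ?E" unfolding powr_add[symmetric] by simp
  also have "\<dots> = \<epsilon> powr (real DIM('a) - 2 * s)" unfolding dp Ep powr_add[symmetric] by simp
  finally show ?thesis .
qed

end

section \<open>The Sobolev constants\<close>

text \<open>Test functions approximate \<open>u\<close> in the norm of \<open>Hs s\<close>, so their
  forms converge, while Fatou's lemma along an almost everywhere convergent subsequence bounds the
  norm of \<open>u\<close>.\<close>

lemma Sobolev_quotient_limit:
  fixes S :: ennreal and u :: "'a::euclidean_space \<Rightarrow> complex"
  assumes s: "0 < s" "s < 1" and p: "p > 0"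
    and T: "\<And>f :: 'a \<Rightarrow> complex. test_fun UNIV f \<Longrightarrow> S * ennreal ((Lp_norm p UNIV f)\<^sup>2) \<le> Q_Dirichlet s f"
    and u: "u \<in> Hs s"
  shows "S * ennreal ((Lp_norm p UNIV u)\<^sup>2) \<le> Q_Dirichlet s u"
proof -
  let ?I = "\<lambda>g :: 'a \<Rightarrow> complex. LINT x|lborel. norm (g x) powr p"
  obtain f where f: "\<forall>k::nat. test_fun UNIV (f k)" "sqlim lborel f u"
      "sqlim (wl (fw s)) (\<lambda>k. fourier (f k)) (fourier_L2 u)" using u s by (rule Hs_approximation)
  note ft = f(1)[rule_format]
  define q where "q k = nsq (wl (fw s)) (fourier (f k))" for k
  define q' where "q' = nsq (wl (fw s)) (fourier_L2 u)"
  have ql: "q \<longlonglongrightarrow> q'" unfolding q_def[abs_def] q'_def by (rule sqlim_nsq[OF f(3)])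
  have q0: "0 \<le> q k" "0 \<le> q'" for k by (simp_all add: q_def q'_def)
  have I0: "0 \<le> ?I g" for g by simp
  have um [measurable]: "u \<in> borel_measurable borel" using sqlimD(2)[OF f(2)] by (simp add: sqi_def)
  have fm [measurable]: "f k \<in> borel_measurable borel" for k by (rule test_fun_measurable[OF ft])
  \<comment> \<open>\<open>S\<close> may be infinite, so real lower bounds \<open>m\<close> are used
    in its place. If the power of \<open>u\<close> is not integrable, its integral is 0 by
    convention and the inequality is trivial.\<close>
  have main: "m * ?I u powr (2 / p) \<le> q'" if m: "m > 0" "ennreal m \<le> S" for m
  proof (cases "integrable lborel (\<lambda>x. norm (u x) powr p)")
    case False
    then have "?I u = 0" by (rule not_integrable_integral_eq)
    then show ?thesis using q0(2) by simp
  next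
    case True
    have fk: "?I (f k) \<le> (q k / m) powr (p / 2)" for k
    proof -
      have "ennreal m * ennreal (?I (f k) powr (2 / p)) \<le> S * ennreal ((Lp_norm p UNIV (f k))\<^sup>2)"
        unfolding Lp_norm_sq by (rule mult_right_mono[OF m(2)]) simp
      also have "\<dots> \<le> ennreal (q k)"
        using T[OF ft[of k]] unfolding Q_Dirichlet_test(1)[OF ft s] q_def .
      finally have "ennreal (m * ?I (f k) powr (2 / p)) \<le> ennreal (q k)"
        using m(1) by (simp add: ennreal_mult)
      then have "m * ?I (f k) powr (2 / p) \<le> q k" by (simp only: ennreal_le_iff[OF q0(1)])
      then have "?I (f k) powr (2 / p) \<le> q k / m" using m(1) by (simp add: pos_le_divide_eq mult.commute)
      then have "(?I (f k) powr (2 / p)) powr (p / 2) \<le> (q k / m) powr (p / 2)"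
        by (rule powr_mono2[rotated 2]) (use p in simp_all)
      moreover have "(?I (f k) powr (2 / p)) powr (p / 2) = ?I (f k)"
        unfolding powr_powr using p I0[of "f k"] by simp
      ultimately show ?thesis by (simp only:)
    qed
    obtain r where r: "strict_mono r" "AE x in lborel. (\<lambda>i. f (r i) x) \<longlonglongrightarrow> u x"
      using f(2) by (rule sqlim_AE_subseq)
    have "ennreal (?I u) = (\<integral>\<^sup>+ x. ennreal (norm (u x) powr p) \<partial>lborel)"
      by (rule nn_integral_eq_integral[OF True, symmetric]) simp
    also have "\<dots> = (\<integral>\<^sup>+ x. liminf (\<lambda>i. ennreal (norm (f (r i) x) powr p)) \<partial>lborel)"
    proof (rule nn_integral_cong_AE)
      show "AE x in lborel. ennreal (norm (u x) powr p) = liminf (\<lambda>i. ennreal (norm (f (r i) x) powr p))"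
        using r(2)
      proof eventually_elim
        case (elim x)
        have "(\<lambda>i. norm (f (r i) x) powr p) \<longlonglongrightarrow> norm (u x) powr p"
          by (rule tendsto_powr2[OF tendsto_norm[OF elim] tendsto_const _ p]) simp
        then have "(\<lambda>i. ennreal (norm (f (r i) x) powr p)) \<longlonglongrightarrow> ennreal (norm (u x) powr p)"
          by (rule tendsto_ennrealI)
        then show ?case by (rule lim_imp_Liminf[OF sequentially_bot, symmetric])
      qed
    qed
    also have "\<dots> \<le> liminf (\<lambda>i. \<integral>\<^sup>+ x. ennreal (norm (f (r i) x) powr p) \<partial>lborel)"
      by (rule nn_integral_liminf) measurable
    also have "\<dots> \<le> liminf (\<lambda>i. ennreal ((q (r i) / m) powr (p / 2)))"
    proof (rule Liminf_mono[OF always_eventually], intro allI)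
      fix i
      have "(\<integral>\<^sup>+ x. ennreal (norm (f (r i) x) powr p) \<partial>lborel) = ennreal (?I (f (r i)))"
        by (rule nn_integral_eq_integral[OF test_fun_norm_powr_integrable[OF ft p]]) simp
      also have "\<dots> \<le> ennreal ((q (r i) / m) powr (p / 2))" by (rule ennreal_leI[OF fk])
      finally show "(\<integral>\<^sup>+ x. ennreal (norm (f (r i) x) powr p) \<partial>lborel) \<le> ennreal ((q (r i) / m) powr (p / 2))" .
    qed
    also have "\<dots> = ennreal ((q' / m) powr (p / 2))"
    proof (rule lim_imp_Liminf[OF sequentially_bot tendsto_ennrealI])
      have "(\<lambda>i. q (r i) / m) \<longlonglongrightarrow> q' / m"
        using LIMSEQ_subseq_LIMSEQ[OF ql r(1)] m(1) by (intro tendsto_divide tendsto_const) (simp_all add: o_def)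
      then show "(\<lambda>i. (q (r i) / m) powr (p / 2)) \<longlonglongrightarrow> (q' / m) powr (p / 2)"
        by (rule tendsto_powr2[OF _ tendsto_const]) (use q0 m(1) p in simp_all)
    qed
    finally have "?I u \<le> (q' / m) powr (p / 2)" by (simp only: ennreal_le_iff[OF powr_ge_zero])
    then have "?I u powr (2 / p) \<le> ((q' / m) powr (p / 2)) powr (2 / p)"
      by (rule powr_mono2[rotated 2]) (use p I0 in simp_all)
    also have "\<dots> = q' / m" unfolding powr_powr using p q0(2) m(1) by simp
    finally show ?thesis using m(1) by (simp add: pos_le_divide_eq mult.commute)
  qed
  define c where "c = ?I u powr (2 / p)"
  have c0: "0 \<le> c" by (simp add: c_def)
  have "S * ennreal c \<le> ennreal q'"
  proof (cases S)
    case (real m)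
    show ?thesis
    proof (cases "m > 0")
      case True
      then have "m * c \<le> q'" using main[of m] real unfolding c_def by simp
      then show ?thesis using real c0 by (simp add: ennreal_mult[symmetric] ennreal_leI)
    next
      case False then show ?thesis using real by simp
    qed
  next
    case top
    have "c = 0"
    proof (rule ccontr)
      assume "c \<noteq> 0"
      then have c: "c > 0" using c0 by simp
      \<comment> \<open>When \<open>S\<close> is infinite every positive \<open>m\<close> is
        allowed; this one would give \<open>q' + 1 \<le> q'\<close>.\<close>
      then have "(q' + 1) / c * c \<le> q'" using main[of "(q' + 1) / c"] q0(2) top unfolding c_def[symmetric] by simp
      then show False using c by simp
    qed
    then show ?thesis by simp
  qed
  then show ?thesis unfolding Q_Dirichlet_Hs[OF u s] Lp_norm_sq c_def q'_def .
qed

text \<open>The weight is positive off the origin, so a vanishing form means a vanishing transform.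
  The fact rules out the quotient 0 / 0, whose value 0 would spoil the infimum should the norm in
  the denominator be 0 by convention.\<close>

lemma Q_Dirichlet_pos:
  assumes u: "u \<in> Hs s" and s: "0 < s" "s < 1" and nz: "\<not> ae_zero u"
  shows "Q_Dirichlet s u \<noteq> 0"
proof
  assume Q: "Q_Dirichlet s u = 0"
  have tl: "test_limit u"
    by (rule Hs_completion_test_limit[OF u[unfolded Hs_def] less_imp_le[OF s(1)] less_imp_le[OF s(2)]])
  have Us: "sqi lborel (fourier_L2 u)" by (rule fourier_L2_sqi[OF test_limit_sqi[OF tl]])
  then have [measurable]: "fourier_L2 u \<in> borel_measurable borel" by (simp add: sqi_def)
  have "AE \<xi> in lborel. ennreal (norm \<xi> powr (2 * s) * (norm (fourier_L2 u \<xi>))\<^sup>2) = 0"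
    using Q unfolding Q_Dirichlet_def by (subst (asm) nn_integral_0_iff_AE) simp_all
  then have "AE \<xi> in lborel. fourier_L2 u \<xi> = 0"
    using AE_lborel_singleton[of "0::'a"]
  proof eventually_elim
    case (elim \<xi>)
    then have "norm \<xi> powr (2 * s) * (norm (fourier_L2 u \<xi>))\<^sup>2 \<le> 0" by (simp only: ennreal_eq_0_iff)
    moreover have "norm \<xi> powr (2 * s) > 0" using elim by simp
    ultimately have "(norm (fourier_L2 u \<xi>))\<^sup>2 \<le> 0" by (simp add: mult_le_0_iff)
    then show ?case by simp
  qed
  then have "nsq lborel u = 0" using nsq_eq_0_iff[OF Us] Plancherel[OF tl] by simp
  then show False using nz nsq_eq_0_iff[OF test_limit_sqi[OF tl]] by (simp add: ae_zero_def)
qed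

context eigensystem
begin

lemma test_fun_Hs_tilde:
  assumes f: "test_fun \<Omega> f" shows "f \<in> Hs_tilde s \<Omega>"
proof -
  have "f \<in> Hs s" unfolding Hs_def by (rule test_fun_Hs_completion[OF test_fun_UNIV[OF f]])
  moreover have "x \<in> closure \<Omega>" if x: "x \<in> ess_support f" for x
  proof (rule ccontr)
    assume n: "x \<notin> closure \<Omega>"
    have "f y = 0" if "y \<in> - closure \<Omega>" for y
      by (rule test_fun_outside[OF f]) (use that closure_subset in blast)
    then have "- closure \<Omega> \<in> {U. open U \<and> (AE x in lborel. x \<in> U \<longrightarrow> f x = 0)}"
      by (auto simp: open_closed)
    with n x show False unfolding ess_support_def by blast
  qed
  ultimately show ?thesis unfolding Hs_tilde_def by blast
qed

text \<open>A test function on the whole space is shrunk into the domain; in the limit the domain looks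
  like the whole space.\<close>

lemma S_Navier_le_test:
  fixes v :: "'a \<Rightarrow> complex"
  assumes s: "0 < s" "s < 1" and n: "real DIM('a) > 2 * s" and ne: "\<Omega> \<noteq> {}" and v: "test_fun UNIV v"
  shows "S_Navier s \<Omega> \<mu> \<phi> * ennreal ((Lp_norm (crit_exp DIM('a) s) UNIV v)\<^sup>2) \<le> Q_Dirichlet s v"
proof (cases "ae_zero v")
  case True
  then have "AE x in lborel. norm (v x) powr crit_exp DIM('a) s = 0" unfolding ae_zero_def by eventually_elim simp
  then have "(LINT x|lborel. norm (v x) powr crit_exp DIM('a) s) = 0" by (rule integral_eq_zero_AE)
  then show ?thesis unfolding Lp_norm_sq by simp
next
  case nz: False
  define p where "p = crit_exp DIM('a) s"
  have p: "p > 0" "real DIM('a) * (2 / p) = real DIM('a) - 2 * s"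
    unfolding p_def by (rule crit_exp_props[OF s(1) n])+
  have vm [measurable]: "v \<in> borel_measurable borel" by (rule test_fun_measurable[OF v])
  note vs = test_fun_sqi[OF v]
  have bnd: "\<exists>R>0. \<forall>x. norm x > R \<longrightarrow> w x = 0" if w: "test_fun UNIV w" for w :: "'a \<Rightarrow> complex"
  proof -
    obtain K where K: "compact K" "\<forall>x. x \<notin> K \<longrightarrow> w x = 0" using w by (rule test_fun_compactE)
    obtain B where "B > 0" "\<forall>x\<in>K. norm x \<le> B" using compact_imp_bounded[OF K(1)] unfolding bounded_pos by blast
    then show ?thesis using K(2) by (meson not_less)
  qed
  obtain x0 where "x0 \<in> \<Omega>" using ne by blast
  then obtain \<rho> where \<rho>: "\<rho> > 0" "cball x0 \<rho> \<subseteq> \<Omega>" using open_dom open_contains_cball by blast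
  obtain R where R: "R > 0" "\<forall>x. norm x > R \<longrightarrow> v x = 0" using bnd[OF v] by blast
  \<comment> \<open>With this start every scaled copy of \<open>v\<close> already fits into the ball
    of radius \<rho> inside \<Omega>.\<close>
  define \<epsilon> where "\<epsilon> k = \<rho> / R / real (Suc k)" for k
  have \<epsilon>0: "\<epsilon> k > 0" for k using \<rho> R unfolding \<epsilon>_def by simp
  have \<epsilon>l: "\<epsilon> \<longlonglongrightarrow> 0"
    unfolding \<epsilon>_def[abs_def] by (rule real_tendsto_divide_at_top[OF tendsto_const filterlim_compose[OF filterlim_real_sequentially filterlim_Suc]])
  have \<epsilon>R: "cball x0 (\<epsilon> k * R) \<subseteq> \<Omega>" for k
  proof -
    have "\<epsilon> k * R = \<rho> / real (Suc k)" using R by (simp add: \<epsilon>_def)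
    also have "\<dots> \<le> \<rho>" using \<rho> by (simp add: divide_le_eq)
    finally show ?thesis using \<rho>(2) subset_cball[of "\<epsilon> k * R" \<rho> x0] by blast
  qed
  let ?v = "\<lambda>k. scl (\<epsilon> k) x0 v"
  define A where "A k \<tau> = KO (?v k) (1 / (\<epsilon> k)\<^sup>2 * \<tau>) / ennreal (\<epsilon> k ^ DIM('a))" for k \<tau>
  define S where "S = S_Navier s \<Omega> \<mu> \<phi>"
  define L where "L = (Lp_norm p UNIV v)\<^sup>2"
  define a where "a = nsq lborel v"
  define D where "D = nsq (wl hw) (fourier v)"
  have aD: "0 \<le> a" "0 \<le> D" by (simp_all add: a_def D_def)
  have Am [measurable]: "A k \<in> borel_measurable borel" for k unfolding A_def[abs_def] by measurable
  have vt: "test_fun \<Omega> (?v k)" for k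
    by (rule scl_test[OF v \<epsilon>0 _ \<epsilon>R]) (use R(2) in blast)
  \<comment> \<open>The scaled function is admissible for the Navier constant. The form and the
    squared norm carry the same power of \<open>\<epsilon> k\<close>, which cancels, so the left
    side is independent of \<open>k\<close>.\<close>
  have step: "Cs s * (S * ennreal L) \<le> (\<integral>\<^sup>+ \<tau>. ennreal (wt s \<tau>) * A k \<tau> \<partial>lborel)" for k
  proof -
    let ?\<kappa> = "\<epsilon> k powr (real DIM('a) - 2 * s)"
    have \<kappa>: "?\<kappa> > 0" using \<epsilon>0[of k] by simp
    have wm: "?v k \<in> borel_measurable borel" by measurable
    have "nsq lborel v \<noteq> 0" using nz nsq_eq_0_iff[OF vs] by (simp add: ae_zero_def)
    then have "nsq lborel (?v k) \<noteq> 0" unfolding nsq_scl[OF \<epsilon>0 vm] using \<epsilon>0[of k] by simp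
    then have nzk: "\<not> ae_zero (?v k)" using nsq_eq_0_iff[OF test_fun_sqi[OF vt]] by (simp add: ae_zero_def)
    have "Lp_norm p \<Omega> (?v k) = Lp_norm p UNIV (?v k)"
      by (rule Lp_norm_supported[OF _ wm dom_borel]) (use test_fun_outside[OF vt] in auto)
    then have "(Lp_norm p \<Omega> (?v k))\<^sup>2 = (Lp_norm p UNIV (?v k))\<^sup>2" by simp
    also have "\<dots> = (\<epsilon> k ^ DIM('a) * (LINT x|lborel. norm (v x) powr p)) powr (2 / p)"
      unfolding Lp_norm_sq using scl_integral[OF \<epsilon>0 vm, of "\<lambda>z. norm z powr p" k x0] by simp
    also have "\<dots> = (\<epsilon> k powr real DIM('a)) powr (2 / p) * L"
      unfolding powr_mult L_def Lp_norm_sq using \<epsilon>0[of k] by (simp add: powr_realpow)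
    also have "(\<epsilon> k powr real DIM('a)) powr (2 / p) = ?\<kappa>" unfolding powr_powr p(2) ..
    finally have Lk: "(Lp_norm p \<Omega> (?v k))\<^sup>2 = ?\<kappa> * L" .
    have "S \<le> Q_Navier s \<Omega> \<mu> \<phi> (?v k) / ennreal (?\<kappa> * L)"
      unfolding S_def S_Navier_def Lk[symmetric] p_def
      by (rule INF_lower) (use test_fun_Hs_tilde[OF vt] nzk in blast)
    then have "S * ennreal (?\<kappa> * L) \<le> Q_Navier s \<Omega> \<mu> \<phi> (?v k)" by (rule ennreal_le_divide_imp)
    then have "Cs s * (S * ennreal (?\<kappa> * L)) \<le> Cs s * Q_Navier s \<Omega> \<mu> \<phi> (?v k)" by (rule mult_left_mono) simp
    also have "\<dots> = ennreal ?\<kappa> * (\<integral>\<^sup>+ \<tau>. ennreal (wt s \<tau>) * A k \<tau> \<partial>lborel)"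
      unfolding A_def by (rule Q_Navier_scaled[OF s(1) \<epsilon>0 wm])
    also have "Cs s * (S * ennreal (?\<kappa> * L)) = ennreal ?\<kappa> * (Cs s * (S * ennreal L))"
      using \<kappa> by (simp add: ennreal_mult L_def mult_ac)
    finally show ?thesis using \<kappa> by (simp only: ennreal_mult_le_mult_iff ennreal_eq_0_iff not_le ennreal_neq_top not_False_eq_True)
  qed
  \<comment> \<open>The competitor 0, which fits into a ball of radius 0.\<close>
  have A1: "A k \<tau> \<le> ennreal a" if "\<tau> > 0" for k \<tau>
  proof -
    have "fourier (\<lambda>x::'a. 0) = (\<lambda>\<xi>. 0)" by (rule ext) (simp add: fourier_def)
    then show ?thesis
      using KO_scl_le[OF v test_fun_zero, of 0 "\<epsilon> k" x0 \<tau>] \<epsilon>0[of k] \<rho> \<open>x0 \<in> \<Omega>\<close> that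
      by (simp add: A_def a_def)
  qed
  \<comment> \<open>The competitor \<open>v\<close> itself.\<close>
  have A2: "A k \<tau> \<le> ennreal (D / \<tau>)" if "\<tau> > 0" for k \<tau>
    using KO_scl_le[OF v v _ \<epsilon>0 \<epsilon>R that] R(2) by (simp add: A_def D_def)
  \<comment> \<open>The smaller of \<open>a\<close> and \<open>D / \<tau>\<close> is at most
    \<open>(a + D) / (1 + \<tau>)\<close>. This is a majorant uniform in \<open>k\<close>, whose
    integral against the weight is a multiple of \<open>Cs s\<close>; it is what the reverse Fatou
    lemma requires.\<close>
  have A3: "ennreal (wt s \<tau>) * A k \<tau> \<le> ennreal (a + D) * ennreal (wt s \<tau> / (1 + \<tau>))" for k \<tau>
  proof (cases "\<tau> > 0")
    case True
    have "A k \<tau> \<le> ennreal ((a + D) / (1 + \<tau>))"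
    proof (cases "a * \<tau> \<le> D")
      case le: True
      have "a \<le> (a + D) / (1 + \<tau>)" using le True by (simp add: pos_le_divide_eq distrib_left)
      then show ?thesis using A1[OF True, of k] by (meson ennreal_leI order_trans)
    next
      case False
      have "D / \<tau> * (1 + \<tau>) = D / \<tau> + D" using True by (simp add: distrib_left)
      moreover have "D / \<tau> \<le> a" using False True by (simp add: pos_divide_le_eq)
      ultimately have "D / \<tau> \<le> (a + D) / (1 + \<tau>)" using True by (simp add: pos_le_divide_eq)
      then show ?thesis using A2[OF True, of k] by (meson ennreal_leI order_trans)
    qed
    then have "ennreal (wt s \<tau>) * A k \<tau> \<le> ennreal (wt s \<tau>) * ennreal ((a + D) / (1 + \<tau>))"
      by (rule mult_left_mono) simp
    also have "\<dots> = ennreal (wt s \<tau> * ((a + D) / (1 + \<tau>)))"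
      by (rule ennreal_mult[symmetric]) (use aD True in simp_all)
    also have "wt s \<tau> * ((a + D) / (1 + \<tau>)) = (a + D) * (wt s \<tau> / (1 + \<tau>))" by simp
    also have "ennreal \<dots> = ennreal (a + D) * ennreal (wt s \<tau> / (1 + \<tau>))"
      by (rule ennreal_mult) (use aD True in simp_all)
    finally show ?thesis .
  qed (simp add: wt_def)
  \<comment> \<open>A nearly optimal competitor \<open>w\<close> for the whole space has compact
    support, so its scaled copies lie in \<Omega> for all large \<open>k\<close>. The tolerance
    \<open>d / c\<close> becomes \<open>d\<close> after multiplication by the weight
    \<open>c\<close>.\<close>
  have lim: "limsup (\<lambda>k. ennreal (wt s \<tau>) * A k \<tau>) \<le> ennreal (wt s \<tau>) * KR (fourier v) \<tau>" for \<tau>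
  proof (cases "\<tau> > 0")
    case True
    define c where "c = wt s \<tau>"
    have c: "c > 0" using True by (simp add: c_def wt_def)
    show ?thesis unfolding c_def[symmetric]
    proof (rule ennreal_le_epsilon)
      fix d :: real assume d: "0 < d"
      obtain w where w: "test_fun UNIV w"
          "ennreal (nsq lborel (\<lambda>x. v x - w x) + nsq (wl hw) (fourier w) / \<tau>) \<le> KR (fourier v) \<tau> + ennreal (d / c)"
        using v True divide_pos_pos[OF d c] by (rule KR_test_approximation)
      obtain Rw where Rw: "Rw > 0" "\<forall>x. norm x > Rw \<longrightarrow> w x = 0" using bnd[OF w(1)] by blast
      have "\<forall>\<^sub>F k in sequentially. \<epsilon> k < \<rho> / Rw"
        by (rule order_tendstoD(2)[OF \<epsilon>l]) (use \<rho> Rw in simp)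
      then have "\<forall>\<^sub>F k in sequentially. ennreal c * A k \<tau> \<le> ennreal c * KR (fourier v) \<tau> + ennreal d"
      proof eventually_elim
        case (elim k)
        then have "\<epsilon> k * Rw \<le> \<rho>" using Rw(1) by (simp add: pos_less_divide_eq)
        then have sub: "cball x0 (\<epsilon> k * Rw) \<subseteq> \<Omega>" using \<rho>(2) subset_cball[of "\<epsilon> k * Rw" \<rho> x0] by blast
        have "A k \<tau> \<le> ennreal (nsq lborel (\<lambda>x. v x - w x) + nsq (wl hw) (fourier w) / \<tau>)"
          unfolding A_def by (rule KO_scl_le[OF v w(1) _ \<epsilon>0 sub True]) (use Rw(2) in blast)
        then have "A k \<tau> \<le> KR (fourier v) \<tau> + ennreal (d / c)" using w(2) by (rule order_trans)
        then have "ennreal c * A k \<tau> \<le> ennreal c * (KR (fourier v) \<tau> + ennreal (d / c))" by (rule mult_left_mono) simp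
        also have "\<dots> = ennreal c * KR (fourier v) \<tau> + ennreal (c * (d / c))"
          unfolding distrib_left using c d by (subst ennreal_mult[symmetric]) simp_all
        also have "c * (d / c) = d" using c by simp
        finally show ?case .
      qed
      then show "limsup (\<lambda>k. ennreal c * A k \<tau>) \<le> ennreal c * KR (fourier v) \<tau> + ennreal d" by (rule Limsup_bounded)
    qed
  next
    case False
    then show ?thesis by (simp add: wt_def Limsup_const)
  qed
  have Vm [measurable]: "fourier v \<in> borel_measurable borel" using fourier_test_sqi[OF v] by (simp add: sqi_def)
  have "Cs s * (S * ennreal L) \<le> limsup (\<lambda>k. \<integral>\<^sup>+ \<tau>. ennreal (wt s \<tau>) * A k \<tau> \<partial>lborel)"
    by (rule le_Limsup[OF sequentially_bot always_eventually]) (use step in blast)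
  also have "\<dots> \<le> (\<integral>\<^sup>+ \<tau>. limsup (\<lambda>k. ennreal (wt s \<tau>) * A k \<tau>) \<partial>lborel)"
  proof (rule nn_integral_limsup)
    show "AE \<tau> in lborel. ennreal (wt s \<tau>) * A k \<tau> \<le> ennreal (a + D) * ennreal (wt s \<tau> / (1 + \<tau>))" for k
      by (rule AE_I2) (rule A3)
    have "(\<integral>\<^sup>+ \<tau>. ennreal (a + D) * ennreal (wt s \<tau> / (1 + \<tau>)) \<partial>lborel) = ennreal (a + D) * Cs s"
      unfolding Cs_def by (rule nn_integral_cmult) measurable
    also have "\<dots> < \<infinity>" using Cs_finite[OF s] by (simp add: ennreal_mult_less_top)
    finally show "(\<integral>\<^sup>+ \<tau>. ennreal (a + D) * ennreal (wt s \<tau> / (1 + \<tau>)) \<partial>lborel) < \<infinity>" .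
  qed measurable
  also have "\<dots> \<le> (\<integral>\<^sup>+ \<tau>. ennreal (wt s \<tau>) * KR (fourier v) \<tau> \<partial>lborel)" by (rule nn_integral_mono) (rule lim)
  also have "\<dots> = Cs s * Q_Dirichlet s v"
    unfolding Q_Dirichlet_test(2)[OF v s] by (rule KR_integral[OF s(1) Vm, symmetric])
  finally have "Cs s * (S * ennreal L) \<le> Cs s * Q_Dirichlet s v" .
  then have "S * ennreal L \<le> Q_Dirichlet s v"
    using ennreal_mult_le_mult_iff[OF Cs_pos[OF s(2)], of "S * ennreal L" "Q_Dirichlet s v"] Cs_finite[OF s] by auto
  then show ?thesis unfolding S_def L_def p_def .
qed

end

theorem theorem4:
  fixes \<Omega> :: "'a::euclidean_space set"
    and s :: real
    and \<mu> :: "nat \<Rightarrow> real"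
    and \<phi> :: "nat \<Rightarrow> 'a \<Rightarrow> complex"
  assumes "0 < s" and "s < 1" and "real DIM('a) > 2 * s"
    and "bounded_lipschitz_domain \<Omega>"
    and "dirichlet_eigensystem \<Omega> \<mu> \<phi>"
  shows "S_Navier s \<Omega> \<mu> \<phi> = S_Dirichlet TYPE('a) s \<and>
    \<not> (\<exists>u\<in>Hs_tilde s \<Omega>. \<not> ae_zero u \<and>
         Q_Navier s \<Omega> \<mu> \<phi> u =
           S_Navier s \<Omega> \<mu> \<phi> * ennreal ((Lp_norm (crit_exp DIM('a) s) \<Omega> u)\<^sup>2))"
proof -
  note s = assms(1,2) and n = assms(3) and dom = assms(4)
  have O: "open \<Omega>" "bounded \<Omega>" "\<Omega> \<noteq> {}" using dom by (auto simp: bounded_lipschitz_domain_def)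
  interpret eigensystem \<Omega> \<mu> \<phi> by unfold_locales (use O assms(5) in auto)
  define p where "p = crit_exp DIM('a) s"
  have p: "p > 0" unfolding p_def by (rule crit_exp_props(1)[OF s(1) n])
  let ?SN = "S_Navier s \<Omega> \<mu> \<phi>" and ?SD = "S_Dirichlet TYPE('a) s"
  have tilde: "u \<in> Hs s" "test_limit u" "AE x in lborel. x \<notin> \<Omega> \<longrightarrow> u x = 0"
      "Q_Dirichlet s u \<le> Q_Navier s \<Omega> \<mu> \<phi> u" "Lp_norm p \<Omega> u = Lp_norm p UNIV u" if u: "u \<in> Hs_tilde s \<Omega>" for u
  proof -
    show h: "u \<in> Hs s" using u by (simp add: Hs_tilde_def)
    show tl: "test_limit u"
      by (rule Hs_completion_test_limit[OF h[unfolded Hs_def] less_imp_le[OF s(1)] less_imp_le[OF s(2)]])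
    show z: "AE x in lborel. x \<notin> \<Omega> \<longrightarrow> u x = 0" by (rule Hs_tilde_outside[OF dom u])
    show "Q_Dirichlet s u \<le> Q_Navier s \<Omega> \<mu> \<phi> u" by (rule Q_comparison(1)[OF s tl z])
    have "u \<in> borel_measurable borel" using test_limit_sqi[OF tl] by (simp add: sqi_def)
    then show "Lp_norm p \<Omega> u = Lp_norm p UNIV u" by (rule Lp_norm_supported[OF z _ dom_borel])
  qed
  have SD: "?SD * ennreal ((Lp_norm p UNIV u)\<^sup>2) \<le> Q_Dirichlet s u" if u: "u \<in> Hs s" "\<not> ae_zero u" for u :: "'a \<Rightarrow> complex"
    by (rule ennreal_le_divide_imp) (unfold S_Dirichlet_def p_def, rule INF_lower, use u in blast)
  have "?SN \<le> ?SD" unfolding S_Dirichlet_def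
  proof (rule INF_greatest)
    fix u :: "'a \<Rightarrow> complex" assume "u \<in> {u. u \<in> Hs s \<and> \<not> ae_zero u}"
    then have u: "u \<in> Hs s" "\<not> ae_zero u" by auto
    show "?SN \<le> Q_Dirichlet s u / ennreal ((Lp_norm (crit_exp DIM('a) s) UNIV u)\<^sup>2)"
    \<comment> \<open>The product form of the inequality is proved, since the denominator may be 0
      by convention; then the quotient is infinite, as the form is nonzero.\<close>
    proof (rule ennreal_le_divideI)
      show "?SN * ennreal ((Lp_norm (crit_exp DIM('a) s) UNIV u)\<^sup>2) \<le> Q_Dirichlet s u"
        unfolding p_def[symmetric]
        by (rule Sobolev_quotient_limit[OF s p _ u(1)]) (unfold p_def, rule S_Navier_le_test[OF s n O(3)])
      show "Q_Dirichlet s u \<noteq> 0" by (rule Q_Dirichlet_pos[OF u(1) s u(2)])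
    qed
  qed
  moreover have "?SD \<le> ?SN" unfolding S_Navier_def
  proof (rule INF_greatest)
    fix u :: "'a \<Rightarrow> complex" assume "u \<in> {u \<in> Hs_tilde s \<Omega>. \<not> ae_zero u}"
    then have u: "u \<in> Hs_tilde s \<Omega>" "\<not> ae_zero u" by auto
    have "?SD \<le> Q_Dirichlet s u / ennreal ((Lp_norm p UNIV u)\<^sup>2)"
      unfolding S_Dirichlet_def p_def by (rule INF_lower) (use tilde(1)[OF u(1)] u(2) in blast)
    also have "\<dots> \<le> Q_Navier s \<Omega> \<mu> \<phi> u / ennreal ((Lp_norm p UNIV u)\<^sup>2)"
      by (rule divide_right_mono_ennreal[OF tilde(4)[OF u(1)]])
    finally show "?SD \<le> Q_Navier s \<Omega> \<mu> \<phi> u / ennreal ((Lp_norm (crit_exp DIM('a) s) \<Omega> u)\<^sup>2)"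
      unfolding p_def[symmetric] tilde(5)[OF u(1)] .
  qed
  ultimately have eq: "?SN = ?SD" by (rule antisym)
  moreover have False if u: "u \<in> Hs_tilde s \<Omega>" "\<not> ae_zero u"
    and att: "Q_Navier s \<Omega> \<mu> \<phi> u = ?SN * ennreal ((Lp_norm (crit_exp DIM('a) s) \<Omega> u)\<^sup>2)" for u
  proof -
    \<comment> \<open>At a minimiser the Navier form equals the common constant times the squared
      norm, and the Dirichlet form is at least that. Together with the general inequality both forms
      agree.\<close>
    have "Q_Navier s \<Omega> \<mu> \<phi> u \<le> Q_Dirichlet s u"
      using SD[OF tilde(1)[OF u(1)] u(2)] unfolding att eq p_def[symmetric] tilde(5)[OF u(1)] .
    moreover have "Q_Dirichlet s u < \<infinity>" unfolding Q_Dirichlet_Hs[OF tilde(1)[OF u(1)] s] by simp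
    ultimately have "AE t in lborel. t > 0 \<longrightarrow> KO u t \<le> KR (fourier_L2 u) t"
      by (intro Q_comparison(2)[OF s tilde(2,3)[OF u(1)]])
    then have "nsq lborel u = 0" by (rule strict_core[OF tilde(2,3)[OF u(1)]])
    then show False using u(2) nsq_eq_0_iff[OF test_limit_sqi[OF tilde(2)[OF u(1)]]] by (simp add: ae_zero_def)
  qed
  ultimately show ?thesis by blast
qed

end
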